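(* Let $K$ be a unital commutative $\mathbb Q$-algebra. For any nonempty $W\subseteq\mathbb N^+$ there exists a unique homomorphism $\mathcal T_W:\mathcal N Sym\to\mathcal H_{GL}^W$ of graded $K$-Hopf algebras such that $\mathcal T_W^{\times5}(\Pi)=\Omega_{\mathbb T}^W$ (where $\mathcal T_W$ is extended coefficientwise to $\mathcal N Sym[[t]]\to\mathcal H_{GL}^W[[t]]$). In particular, for all $m\ge1$, $$\mathcal T_W(\Lambda_m)=\sum_{T\in\bar{\mathbb S}^W_m}(-1)^{o(T)+|T|}\mathcal V_T,\qquad \mathcal T_W(S_m)=\sum_{T\in\bar{\mathbb T}^W_m}\mathcal V_T,\qquad \mathcal T_W(\Psi_m)=\sum_{T\in\bar{\mathbb H}^W_m}\beta_T\mathcal V_T,$$ $$\mathcal T_W(\Phi_m)=m\sum_{T\in\bar{\mathbb P}^W_m}\theta_T\mathcal V_T,\qquad \mathcal T_W(\Xi_m)=\sum_{T\in\bar{\mathbb P}^W_m}\gamma_T\mathcal V_T.$$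
   Context: **Noncommutative symmetric functions.** $\mathcal N Sym$ is the free associative $K$-algebra on $\Lambda_1,\Lambda_2,\dots$, with $\Lambda_0=1$, graded by giving $\Lambda_m$ weight $m$. Put $\lambda(t)=\sum_{m\ge0}t^m\Lambda_m$. There are unique $\sigma(t),\Phi(t),\psi(t),\xi(t)\in\mathcal N Sym[[t]]$ (with $\Phi(0)=0$) such that $\lambda(-t)\sigma(t)=\sigma(t)\lambda(-t)=1$, $e^{\Phi(t)}=\sigma(t)$, $\sigma'(t)=\sigma(t)\psi(t)$, $\sigma'(t)=\xi(t)\sigma(t)$. Write $\sigma(t)=\sum_{m\ge0}t^mS_m$, $\Phi(t)=\sum_{m\ge1}t^m\Phi_m/m$, $\psi(t)=\sum_{m\ge1}t^{m-1}\Psi_m$, $\xi(t)=\sum_{m\ge1}t^{m-1}\Xi_m$. Set $\Pi=(\lambda(t),\sigma(t),\Phi(t),\psi(t),\xi(t))$. $\mathcal N Sym$ is freely generated by the $\Psi_m$ and is a graded Hopf algebra with $\Psi_m$ primitive, $\epsilon(\Psi_m)=0$, antipode $\Psi_m\mapsto-\Psi_m$. **Trees.** All rooted trees are finite, considered up to isomorphism (preserving root and labels). $\mathbb T^W$ is the set of rooted trees with every vertex labeled by an element of $W$ (its weight); $\mathbb F^W$ is the set of finite disjoint unions of such trees (forests, including the empty one). $B_+(T_1,\dots,T_m)$ is the rooted tree obtained by joining the roots of $T_1,\dots,T_m$ to a new root labeled $0$; $B_+(\emptyset)=\circ$ is the single vertex labeled $0$. $\bar{\mathbb T}^W:=\{B_+(F):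 F\in\mathbb F^W\}$. For $T\in\bar{\mathbb T}^W$: $|T|$ is the sum of the labels of the vertices (root counted $0$), $o(T)$ is the number of children of the root, $v(T)$ the number of vertices, $\alpha(T)$ the number of (root- and label-preserving) automorphisms, $\mathcal V_T:=T/\alpha(T)$. $\bar{\mathbb S}^W$ is the set of $T\in\bar{\mathbb T}^W$ of height at most $1$ (all non-root vertices are children of the root; $\circ$ is included). $\bar{\mathbb H}^W$ is the set of chains $T\in\bar{\mathbb T}^W$, $T\ne\circ$ (trees with a single leaf). $\bar{\mathbb P}^W$ is the set of primitive $T\in\bar{\mathbb T}^W$, i.e. those whose root has exactly one child. A subscript $m$ (as in $\bar{\mathbb S}^W_m$) restricts to trees with $|T|=m$. For $T\in\bar{\mathbb H}^W$, $\beta_T$ is the label of the unique leaf; for $T\in\bar{\mathbb P}^W$, $\gamma_T$ is the label of the unique child of the root. **Grossman-Larson Hopf algebra.** $\mathcal H_{GL}^W$ is the free $K$-module with basis $\bar{\mathbb T}^W$, graded by $|T|$. For $T=B_+(T_1,\dots,T_m)$ and $S$ in $\bar{\mathbb T}^W$, the product $T\cdot S$ is the sum of the $v(S)^m$ rooted trees obtained by joining the root of each $T_i$ by an edge to some vertex of $S$, in all possible ways; the unit is $\circ=1$. The coproduct is $\Delta(T)=\sum_{I\sqcup J=\{1,\dots,m\}}B_+(T_I)\otimes B_+(T_J)$, where $B_+(T_I)$ is $B_+$ applied to the $T_i$, $i\in I$; the counit sends $\circ$ to $1$ and all other trees to $0$. This is a connected graded Hopf algebra. **Constants $\theta_T$.**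 For an unlabeled rooted tree $T$ and an edge $e$, cutting $e$ splits $T$ into $R_e(T)$ (containing the root) and a tree $P_e(T)$. For distinct edges write $e\succ e'$ if $e'$ is an edge of $R_e(T)$; $e_1\succ\dots\succ e_{m-1}$ means $e_i\succ e_j$ for all $i<j$. For such a sequence set $S_0=T$, $T_{\vec e,i}=B_+(P_{e_i}(S_{i-1}))$, $S_i=R_{e_i}(S_{i-1})$ for $1\le i\le m-1$, and $T_{\vec e,m}=S_{m-1}$ ($B_+$ here adds an unlabeled new root; these auxiliary trees $S_i$ are unrelated to the functions $S_m$). Define $\theta_T\in\mathbb Q$ by: $\theta_T=0$ if $T$ is the single vertex or if the root of $T$ has more than one child; $\theta_{B_+(\circ)}=1$ (the two-vertex tree); and if the root of $T$ has exactly one child and $v(T)\ge 3$, $$\theta_T=1-\sum_{m\ge2}\frac1{m!}\sum_{\substack{(e_1,\dots,e_{m-1})\in E(T)^{m-1}\\ e_1\succ\cdots\succ e_{m-1}}}\theta_{T_{\vec e,1}}\cdots\theta_{T_{\vec e,m}}.$$ For labeled $T$, $\theta_T$ is that of the underlying unlabeled rooted tree. **The tuple $\Omega_{\mathbb T}^W$.** $\Omega_{\mathbb T}^W=(\tilde f(t),\tilde g(t),\tilde d(t),\tilde h(t),\tilde m(t))$ with $\tilde f(t)=\sum_{T\in\bar{\mathbb S}^W}(-1)^{o(T)+|T|}t^{|T|}\mathcal V_T$, $\tilde g(t)=\sum_{T\in\bar{\mathbb T}^W}t^{|T|}\mathcal V_T$, $\tilde d(t)=\sum_{T\in\bar{\mathbb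 P}^W}t^{|T|}\theta_T\mathcal V_T$, $\tilde h(t)=\sum_{T\in\bar{\mathbb H}^W}t^{|T|-1}\beta_T\mathcal V_T$, $\tilde m(t)=\sum_{T\in\bar{\mathbb P}^W}t^{|T|-1}\gamma_T\mathcal V_T$. *)

theory Defs
  imports
    "HOL-Library.Multiset"
    "HOL-Library.FuncSet"
    "HOL-Library.Poly_Mapping"
    "HOL-Library.Product_Plus"
    "HOL-Computational_Algebra.Formal_Power_Series"
begin

section \<open>The base ring and free modules\<close>

text \<open>A (nonzero) unital commutative \<open>\<rat>\<close>-algebra: a commutative ring with a unital ring
  homomorphism from the rationals.\<close>

class rat_algebra = comm_ring_1 +
  fixes rat_emb :: "rat \<Rightarrow> 'a"
  assumes rat_emb_1: "rat_emb 1 = 1"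
    and rat_emb_add: "rat_emb (p + q) = rat_emb p + rat_emb q"
    and rat_emb_mult: "rat_emb (p * q) = rat_emb p * rat_emb q"

instantiation rat :: rat_algebra
begin
definition rat_emb_rat :: "rat \<Rightarrow> rat" where "rat_emb_rat q = q"
instance by standard (simp_all add: rat_emb_rat_def)
end

text \<open>The free \<open>'k\<close>-module with basis \<open>'b\<close> is \<open>'b \<Rightarrow>\<^sub>0 'k\<close>; the tensor product of the free
  modules with bases \<open>'b\<close> and \<open>'c\<close> is the free module with basis \<open>'b \<times> 'c\<close>.\<close>

definition smult :: "'k \<Rightarrow> ('b \<Rightarrow>\<^sub>0 'k) \<Rightarrow> ('b \<Rightarrow>\<^sub>0 'k::comm_ring_1)" where
  "smult c x = Poly_Mapping.map ((*) c) x"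

abbreviation basis :: "'b \<Rightarrow> ('b \<Rightarrow>\<^sub>0 'k::comm_ring_1)" where
  "basis b \<equiv> Poly_Mapping.single b 1"

definition tensor ::
  "('b \<Rightarrow>\<^sub>0 'k) \<Rightarrow> ('c \<Rightarrow>\<^sub>0 'k) \<Rightarrow> ('b \<times> 'c \<Rightarrow>\<^sub>0 'k::comm_ring_1)" where
  "tensor x y = (\<Sum>u\<in>Poly_Mapping.keys x. \<Sum>v\<in>Poly_Mapping.keys y.
     Poly_Mapping.single (u, v) (Poly_Mapping.lookup x u * Poly_Mapping.lookup y v))"

definition tensor_map ::
  "(('b \<Rightarrow>\<^sub>0 'k) \<Rightarrow> ('d \<Rightarrow>\<^sub>0 'k)) \<Rightarrow> (('c \<Rightarrow>\<^sub>0 'k) \<Rightarrow> ('e \<Rightarrow>\<^sub>0 'k)) \<Rightarrow>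
   ('b \<times> 'c \<Rightarrow>\<^sub>0 'k) \<Rightarrow> ('d \<times> 'e \<Rightarrow>\<^sub>0 'k::comm_ring_1)" where
  "tensor_map f g z =
    (\<Sum>(u, v)\<in>Poly_Mapping.keys z.
      smult (Poly_Mapping.lookup z (u, v)) (tensor (f (basis u)) (g (basis v))))"

definition coeffwise :: "('a \<Rightarrow> 'b) \<Rightarrow> 'a fps \<Rightarrow> 'b fps" where
  "coeffwise f F = Abs_fps (\<lambda>n. f (fps_nth F n))"


section \<open>Noncommutative symmetric functions\<close>

text \<open>Words under concatenation, written additively so that the convolution product of
  \<^theory>\<open>HOL-Library.Poly_Mapping\<close> makes \<open>'a fword \<Rightarrow>\<^sub>0 'k\<close> the free associative algebra on the
  alphabet \<open>'a\<close>, and makes \<open>'a fword \<times> 'a fword \<Rightarrow>\<^sub>0 'k\<close> its tensor square as an algebra.\<close>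

datatype 'a fword = FWord "'a list"

instantiation fword :: (type) monoid_add
begin
definition zero_fword :: "'a fword" where "zero_fword = FWord []"
fun plus_fword :: "'a fword \<Rightarrow> 'a fword \<Rightarrow> 'a fword" where
  "plus_fword (FWord u) (FWord v) = FWord (u @ v)"
instance
proof
  fix a b c :: "'a fword"
  show "a + b + c = a + (b + c)" by (cases a; cases b; cases c) simp
  show "0 + a = a" by (cases a) (simp add: zero_fword_def)
  show "a + 0 = a" by (cases a) (simp add: zero_fword_def)
qed
end

text \<open>The letter \<open>n\<close> stands for the generator \<open>\<Lambda>\<^bsub>n+1\<^esub>\<close>, so that letters range over all of
  \<^typ>\<open>nat\<close>.\<close>

type_synonym 'k nsym = "nat fword \<Rightarrow>\<^sub>0 'k"
type_synonym 'k nsym2 = "nat fword \<times> nat fword \<Rightarrow>\<^sub>0 'k"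

fun word_weight :: "nat fword \<Rightarrow> nat" where
  "word_weight (FWord w) = (\<Sum>n\<leftarrow>w. Suc n)"

definition nsym_grade :: "nat \<Rightarrow> 'k::rat_algebra nsym set" where
  "nsym_grade n = {x. \<forall>w\<in>Poly_Mapping.keys x. word_weight w = n}"

definition Lam :: "nat \<Rightarrow> 'k::rat_algebra nsym" where
  "Lam m = (if m = 0 then 1 else basis (FWord [m - 1]))"

definition lam_ser :: "'k::rat_algebra nsym fps" where
  "lam_ser = Abs_fps Lam"

text \<open>\<open>\<lambda>(-t)\<close>.\<close>
definition lam_neg_ser :: "'k::rat_algebra nsym fps" where
  "lam_neg_ser = Abs_fps (\<lambda>m. (-1) ^ m * fps_nth lam_ser m)"

text \<open>\<open>e\<^bsup>F(t)\<^esup>\<close>, for \<open>F(0) = 0\<close>.\<close>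
definition exp_ser :: "'k::rat_algebra nsym fps \<Rightarrow> 'k nsym fps" where
  "exp_ser F = fps_compose (Abs_fps (\<lambda>n. smult (rat_emb (1 / fact n)) 1)) F"

definition sigma_ser :: "'k::rat_algebra nsym fps" where
  "sigma_ser = (THE s. lam_neg_ser * s = 1 \<and> s * lam_neg_ser = 1)"

definition Phi_ser :: "'k::rat_algebra nsym fps" where
  "Phi_ser = (THE F. fps_nth F 0 = 0 \<and> exp_ser F = sigma_ser)"

definition psi_ser :: "'k::rat_algebra nsym fps" where
  "psi_ser = (THE p. fps_deriv sigma_ser = sigma_ser * p)"

definition xi_ser :: "'k::rat_algebra nsym fps" where
  "xi_ser = (THE p. fps_deriv sigma_ser = p * sigma_ser)"

text \<open>The normalisations are \<open>\<Phi>(t) = \<Sum> t\<^sup>m \<Phi>\<^sub>m / m\<close>, \<open>\<psi>(t) = \<Sum> t\<^bsup>m-1\<^esup> \<Psi>\<^sub>m\<close> and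
  \<open>\<xi>(t) = \<Sum> t\<^bsup>m-1\<^esup> \<Xi>\<^sub>m\<close>; \<open>Phi\<close>, \<open>Psi\<close>, \<open>Xi\<close> are meant for \<open>m \<ge> 1\<close>.\<close>

definition Sfun :: "nat \<Rightarrow> 'k::rat_algebra nsym" where
  "Sfun m = fps_nth sigma_ser m"

definition Phi :: "nat \<Rightarrow> 'k::rat_algebra nsym" where
  "Phi m = of_nat m * fps_nth Phi_ser m"

definition Psi :: "nat \<Rightarrow> 'k::rat_algebra nsym" where
  "Psi m = fps_nth psi_ser (m - 1)"

definition Xi :: "nat \<Rightarrow> 'k::rat_algebra nsym" where
  "Xi m = fps_nth xi_ser (m - 1)"

type_synonym 'a series5 = "'a fps \<times> 'a fps \<times> 'a fps \<times> 'a fps \<times> 'a fps"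

definition Pi_sys :: "'k::rat_algebra nsym series5" where
  "Pi_sys = (lam_ser, sigma_ser, Phi_ser, psi_ser, xi_ser)"

definition coeffwise5 :: "('a \<Rightarrow> 'b) \<Rightarrow> 'a series5 \<Rightarrow> 'b series5" where
  "coeffwise5 f = (\<lambda>(a, b, c, d, e).
     (coeffwise f a, coeffwise f b, coeffwise f c, coeffwise f d, coeffwise f e))"

text \<open>The Hopf structure is prescribed on the free generators \<open>\<Psi>\<^sub>m\<close>.\<close>

definition nsym_comult :: "'k::rat_algebra nsym \<Rightarrow> 'k nsym2" where
  "nsym_comult = (THE D.
     (\<forall>x y. D (x + y) = D x + D y) \<and> (\<forall>c x. D (smult c x) = smult c (D x)) \<and>
     D 1 = 1 \<and> (\<forall>x y. D (x * y) = D x * D y) \<and>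
     (\<forall>m\<ge>1. D (Psi m) = tensor (Psi m) 1 + tensor 1 (Psi m)))"

definition nsym_counit :: "'k::rat_algebra nsym \<Rightarrow> 'k" where
  "nsym_counit = (THE E.
     (\<forall>x y. E (x + y) = E x + E y) \<and> (\<forall>c x. E (smult c x) = c * E x) \<and>
     E 1 = 1 \<and> (\<forall>x y. E (x * y) = E x * E y) \<and>
     (\<forall>m\<ge>1. E (Psi m) = 0))"

definition nsym_antipode :: "'k::rat_algebra nsym \<Rightarrow> 'k nsym" where
  "nsym_antipode = (THE S.
     (\<forall>x y. S (x + y) = S x + S y) \<and> (\<forall>c x. S (smult c x) = smult c (S x)) \<and>
     S 1 = 1 \<and> (\<forall>x y. S (x * y) = S y * S x) \<and>
     (\<forall>m\<ge>1. S (Psi m) = - Psi m))"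


section \<open>Rooted trees\<close>

text \<open>Since the branches at a vertex form a multiset, the elements of this type are exactly the
  isomorphism classes of finite rooted trees with vertices labeled in \<open>'a\<close>.\<close>

datatype 'a rtree = Node (root_label: 'a) (branches: "'a rtree multiset")

text \<open>A concrete rooted tree is a finite prefix-closed set \<open>V\<close> of paths containing \<open>[]\<close>, with a
  labeling of \<open>V\<close>: the root is \<open>[]\<close> and the parent of a vertex \<open>p \<noteq> []\<close> is \<open>butlast p\<close>. An edge is
  identified with its endpoint further from the root.

  \<open>verts T\<close> with \<open>label_at T\<close> is a concrete tree in the class \<open>T\<close>: a step \<open>(t, i)\<close> of a path leads
  to the root of the \<open>i\<close>-th of the \<open>count M t\<close> copies of the branch \<open>t\<close>.\<close>

type_synonym 'a tpath = "('a rtree \<times> nat) list"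

fun is_vertex :: "'a rtree \<Rightarrow> 'a tpath \<Rightarrow> bool" where
  "is_vertex T [] = True"
| "is_vertex T ((t, i) # p) = (i < count (branches T) t \<and> is_vertex t p)"

definition verts :: "'a rtree \<Rightarrow> 'a tpath set" where
  "verts T = {p. is_vertex T p}"

fun label_at :: "'a rtree \<Rightarrow> 'a tpath \<Rightarrow> 'a" where
  "label_at T [] = root_label T"
| "label_at T ((t, i) # p) = label_at t p"

definition tree_isos ::
  "'x list set \<Rightarrow> ('x list \<Rightarrow> 'a) \<Rightarrow> 'y list set \<Rightarrow> ('y list \<Rightarrow> 'a) \<Rightarrow> ('x list \<Rightarrow> 'y list) set" where
  "tree_isos V lab V' lab' = {\<phi> \<in> extensional V.
     bij_betw \<phi> V V' \<and> \<phi> [] = [] \<and>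
     (\<forall>p\<in>V. p \<noteq> [] \<longrightarrow> \<phi> (butlast p) = butlast (\<phi> p)) \<and>
     (\<forall>p\<in>V. lab' (\<phi> p) = lab p)}"

text \<open>The isomorphism class of a concrete tree.\<close>
definition tree_class :: "'x list set \<Rightarrow> ('x list \<Rightarrow> 'a) \<Rightarrow> 'a rtree" where
  "tree_class V lab = (THE T. tree_isos V lab (verts T) (label_at T) \<noteq> {})"

definition num_verts :: "'a rtree \<Rightarrow> nat" where
  "num_verts T = card (verts T)"

definition num_auts :: "'a rtree \<Rightarrow> nat" where
  "num_auts T = card (tree_isos (verts T) (label_at T) (verts T) (label_at T))"

definition root_children :: "'a rtree \<Rightarrow> ('a rtree \<times> nat) set" where
  "root_children T = {c. [c] \<in> verts T}"

definition root_degree :: "'a rtree \<Rightarrow> nat" where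
  "root_degree T = card (root_children T)"

definition leaves :: "'a rtree \<Rightarrow> 'a tpath set" where
  "leaves T = {p \<in> verts T. \<forall>c. p @ [c] \<notin> verts T}"

definition weight :: "nat rtree \<Rightarrow> nat" where
  "weight T = (\<Sum>p\<in>verts T. label_at T p)"

definition Bplus :: "nat rtree multiset \<Rightarrow> nat rtree" where
  "Bplus F = Node 0 F"

definition TW :: "nat set \<Rightarrow> nat rtree set" where
  "TW W = {T. set_rtree T \<subseteq> W}"

definition FW :: "nat set \<Rightarrow> nat rtree multiset set" where
  "FW W = {F. set_mset F \<subseteq> TW W}"

definition Tbar :: "nat set \<Rightarrow> nat rtree set" where
  "Tbar W = Bplus ` FW W"

definition Sbar :: "nat set \<Rightarrow> nat rtree set" where
  "Sbar W = {T \<in> Tbar W. \<forall>p\<in>verts T. length p \<le> 1}"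

definition Hbar :: "nat set \<Rightarrow> nat rtree set" where
  "Hbar W = {T \<in> Tbar W. T \<noteq> Bplus {#} \<and> card (leaves T) = 1}"

definition Pbar :: "nat set \<Rightarrow> nat rtree set" where
  "Pbar W = {T \<in> Tbar W. root_degree T = 1}"

text \<open>\<open>\<beta>\<^sub>T\<close> for chains and \<open>\<gamma>\<^sub>T\<close> for primitive trees.\<close>

definition leaf_label :: "nat rtree \<Rightarrow> nat" where
  "leaf_label T = label_at T (the_elem (leaves T))"

definition child_label :: "nat rtree \<Rightarrow> nat" where
  "child_label T = label_at T [the_elem (root_children T)]"


section \<open>The constants \<open>\<theta>\<^sub>T\<close>\<close>

text \<open>Cutting the edge \<open>e\<close> of the concrete unlabeled tree \<open>V\<close>: \<open>cut_R V e\<close> keeps the names of the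
  vertices, so its edges are edges of \<open>V\<close>; in \<open>cut_P V e\<close> the vertex \<open>e\<close> becomes the root.\<close>

definition tree_edges :: "'x list set \<Rightarrow> 'x list set" where
  "tree_edges V = V - {[]}"

definition cut_R :: "'x list set \<Rightarrow> 'x list \<Rightarrow> 'x list set" where
  "cut_R V e = {p \<in> V. \<nexists>q. p = e @ q}"

definition cut_P :: "'x list set \<Rightarrow> 'x list \<Rightarrow> 'x list set" where
  "cut_P V e = {q. e @ q \<in> V}"

text \<open>The sequences \<open>e\<^sub>1 \<succ> \<dots> \<succ> e\<^sub>n\<close> of edges; \<^const>\<open>sorted_wrt\<close> demands the relation for all
  pairs \<open>i < j\<close>, as \<open>\<succ>\<close> is not transitive.\<close>
definition cut_seqs :: "'x list set \<Rightarrow> nat \<Rightarrow> 'x list list set" where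
  "cut_seqs V n = {es. length es = n \<and> set es \<subseteq> tree_edges V \<and>
     sorted_wrt (\<lambda>e e'. e' \<in> tree_edges (cut_R V e)) es}"

text \<open>The list \<open>T\<^bsub>e,1\<^esub>, \<dots>, T\<^bsub>e,m\<^esub>\<close>.\<close>
fun cut_pieces :: "'x list set \<Rightarrow> 'x list list \<Rightarrow> unit rtree list" where
  "cut_pieces S [] = [tree_class S (\<lambda>_. ())]"
| "cut_pieces S (e # es) =
     Node () {# tree_class (cut_P S e) (\<lambda>_. ()) #} # cut_pieces (cut_R S e) es"

text \<open>The sum over \<open>m \<ge> 2\<close> stops at \<open>v(T)\<close>, as the \<open>m - 1\<close> edges of a sequence are distinct. The
  recursion does not descend literally: for the one-term sequence consisting of the root edge, the
  first piece is \<open>T\<close> itself, but the second one is the single vertex and the product is \<open>0\<close>. Hence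
  \<open>\<theta>\<close> is introduced as the only function satisfying the equations.\<close>
definition theta_eqs :: "(unit rtree \<Rightarrow> rat) \<Rightarrow> bool" where
  "theta_eqs \<theta> \<longleftrightarrow> (\<forall>T. \<theta> T =
     (if root_degree T \<noteq> 1 then 0
      else if num_verts T = 2 then 1
      else 1 - (\<Sum>m = 2..num_verts T. 1 / fact m *
             (\<Sum>es\<in>cut_seqs (verts T) (m - 1). \<Prod>U\<leftarrow>cut_pieces (verts T) es. \<theta> U))))"

definition theta_unlabeled :: "unit rtree \<Rightarrow> rat" where
  "theta_unlabeled = (THE \<theta>. theta_eqs \<theta>)"

definition theta :: "'a rtree \<Rightarrow> rat" where
  "theta T = theta_unlabeled (map_rtree (\<lambda>_. ()) T)"


section \<open>The Grossman--Larson Hopf algebra\<close>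

text \<open>The Hopf algebra attached to \<open>W\<close> has carrier \<open>gl_carrier W\<close>; its operations do not depend on
  \<open>W\<close>, except for the antipode, which is determined on the carrier only.\<close>

type_synonym 'k gl = "nat rtree \<Rightarrow>\<^sub>0 'k"
type_synonym 'k gl2 = "nat rtree \<times> nat rtree \<Rightarrow>\<^sub>0 'k"

definition gl_carrier :: "nat set \<Rightarrow> 'k::rat_algebra gl set" where
  "gl_carrier W = {x. Poly_Mapping.keys x \<subseteq> Tbar W}"

definition gl_grade :: "nat set \<Rightarrow> nat \<Rightarrow> 'k::rat_algebra gl set" where
  "gl_grade W n = {x \<in> gl_carrier W. \<forall>T\<in>Poly_Mapping.keys x. weight T = n}"

definition gl_one :: "'k::rat_algebra gl" where
  "gl_one = basis (Bplus {#})"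

text \<open>The tree obtained from \<open>S\<close> by joining, for each child \<open>c\<close> of the root of \<open>T\<close>, the branch of
  \<open>T\<close> at \<open>c\<close> to the vertex \<open>f c\<close> of \<open>S\<close>. Steps within \<open>S\<close> are tagged \<open>Inl\<close> and steps within \<open>T\<close> are
  tagged \<open>Inr\<close>; a nonroot vertex \<open>p\<close> of \<open>T\<close> lies in the branch at \<open>hd p\<close>.\<close>
definition graft ::
  "nat rtree \<Rightarrow> nat rtree \<Rightarrow> (nat rtree \<times> nat \<Rightarrow> nat tpath) \<Rightarrow> nat rtree" where
  "graft T S f = tree_class
     (map Inl ` verts S \<union> (\<lambda>p. map Inl (f (hd p)) @ map Inr p) ` (verts T - {[]}))
     (\<lambda>p. if list_all isl p then label_at S (map projl p)
          else label_at T (map projr (dropWhile isl p)))"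

definition gl_prod_basis :: "nat rtree \<Rightarrow> nat rtree \<Rightarrow> 'k::rat_algebra gl" where
  "gl_prod_basis T S = (\<Sum>f \<in> root_children T \<rightarrow>\<^sub>E verts S. basis (graft T S f))"

definition gl_mult :: "'k::rat_algebra gl \<Rightarrow> 'k gl \<Rightarrow> 'k gl" where
  "gl_mult x y = (\<Sum>T\<in>Poly_Mapping.keys x. \<Sum>S\<in>Poly_Mapping.keys y.
     smult (Poly_Mapping.lookup x T * Poly_Mapping.lookup y S) (gl_prod_basis T S))"

definition gl_comult_basis :: "nat rtree \<Rightarrow> 'k::rat_algebra gl2" where
  "gl_comult_basis T = (\<Sum>I \<in> Pow (root_children T).
     basis (Bplus (image_mset fst (mset_set I)),
            Bplus (image_mset fst (mset_set (root_children T - I)))))"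

definition gl_comult :: "'k::rat_algebra gl \<Rightarrow> 'k gl2" where
  "gl_comult x = (\<Sum>T\<in>Poly_Mapping.keys x. smult (Poly_Mapping.lookup x T) (gl_comult_basis T))"

definition gl_counit :: "'k::rat_algebra gl \<Rightarrow> 'k" where
  "gl_counit x = Poly_Mapping.lookup x (Bplus {#})"

definition gl_convolution ::
  "('k::rat_algebra gl \<Rightarrow> 'k gl) \<Rightarrow> ('k gl \<Rightarrow> 'k gl) \<Rightarrow> 'k gl \<Rightarrow> 'k gl" where
  "gl_convolution f g x = (\<Sum>(T, S)\<in>Poly_Mapping.keys (gl_comult x).
     smult (Poly_Mapping.lookup (gl_comult x) (T, S)) (gl_mult (f (basis T)) (g (basis S))))"

text \<open>The antipode, i.e.\ the convolution inverse of the identity; only its values on the carrier,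
  which are uniquely determined, matter.\<close>
definition gl_antipode :: "nat set \<Rightarrow> 'k::rat_algebra gl \<Rightarrow> 'k gl" where
  "gl_antipode W = (SOME A.
     (\<forall>x\<in>gl_carrier W. A x \<in> gl_carrier W) \<and>
     (\<forall>x\<in>gl_carrier W. \<forall>y\<in>gl_carrier W. A (x + y) = A x + A y) \<and>
     (\<forall>c. \<forall>x\<in>gl_carrier W. A (smult c x) = smult c (A x)) \<and>
     (\<forall>x\<in>gl_carrier W.
        gl_convolution A id x = smult (gl_counit x) gl_one \<and>
        gl_convolution id A x = smult (gl_counit x) gl_one))"

definition graded_hopf_hom :: "nat set \<Rightarrow> ('k::rat_algebra nsym \<Rightarrow> 'k gl) \<Rightarrow> bool" where
  "graded_hopf_hom W f \<longleftrightarrow>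
     (\<forall>x. f x \<in> gl_carrier W) \<and>
     (\<forall>x y. f (x + y) = f x + f y) \<and>
     (\<forall>c x. f (smult c x) = smult c (f x)) \<and>
     f 1 = gl_one \<and>
     (\<forall>x y. f (x * y) = gl_mult (f x) (f y)) \<and>
     (\<forall>x. gl_comult (f x) = tensor_map f f (nsym_comult x)) \<and>
     (\<forall>x. gl_counit (f x) = nsym_counit x) \<and>
     (\<forall>x. f (nsym_antipode x) = gl_antipode W (f x)) \<and>
     (\<forall>n. \<forall>x\<in>nsym_grade n. f x \<in> gl_grade W n)"


section \<open>The tuple \<open>\<Omega>\<close>\<close>

text \<open>\<open>\<V>\<^sub>T = T / \<alpha>(T)\<close>.\<close>
definition VT :: "nat rtree \<Rightarrow> 'k::rat_algebra gl" where
  "VT T = smult (rat_emb (1 / of_nat (num_auts T))) (basis T)"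

text \<open>\<open>\<Sum>\<^bsub>T\<in>A\<^esub> t\<^bsup>d(T)\<^esup> c(T) \<V>\<^sub>T\<close>. Below, the sum for each coefficient is finite because all labels
  in \<open>W\<close> are positive.\<close>
definition tree_series ::
  "nat rtree set \<Rightarrow> (nat rtree \<Rightarrow> nat) \<Rightarrow> (nat rtree \<Rightarrow> 'k) \<Rightarrow> 'k::rat_algebra gl fps" where
  "tree_series A d c = Abs_fps (\<lambda>n. \<Sum>T | T \<in> A \<and> d T = n. smult (c T) (VT T))"

definition Omega :: "nat set \<Rightarrow> 'k::rat_algebra gl series5" where
  "Omega W =
    (tree_series (Sbar W) weight (\<lambda>T. (-1) ^ (root_degree T + weight T)),
     tree_series (Tbar W) weight (\<lambda>T. 1),
     tree_series (Pbar W) weight (\<lambda>T. rat_emb (theta T)),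
     tree_series (Hbar W) (\<lambda>T. weight T - 1) (\<lambda>T. of_nat (leaf_label T)),
     tree_series (Pbar W) (\<lambda>T. weight T - 1) (\<lambda>T. of_nat (child_label T)))"

end

theory Submission
  imports Defs
begin

text \<open>Expand the elements of \<open>\<H>\<^bsub>GL\<^esub>\<close> in the basis \<open>\<V>\<^sub>T\<close> and identify \<open>B\<^sub>+(F)\<close> with the forest \<open>F\<close>.
  Counting isomorphisms in two ways shows that grafting is adjoint to cutting, so that the product
  becomes the convolution \<open>(c * d)(F) = \<Sum> c(P) d(R)\<close> of functions on forests, the sum ranging over the
  admissible cuts of \<open>F\<close> into a pruned forest \<open>P\<close> and a trunk \<open>R\<close>; the coproduct becomes
  \<open>c \<mapsto> ((F, G) \<mapsto> c(F + G))\<close>. The identities between the five series then are identities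
  between functions on forests that are multiplicative (such as the constant \<open>1\<close>, which represents
  \<open>g(t)\<close>) or primitive, and they reduce to the case of a single tree: \<open>g' = g h\<close> and \<open>g' = m g\<close>
  because both sides add up the labels of the forest, \<open>f(-t) g = 1\<close> by cancellation over subsets of the
  leaves, and \<open>exp d = g\<close> because the exponential of a primitive function is multiplicative, while
  on a single tree the equation is the recursion for \<open>\<theta>\<close>.

  As \<open>\<N>Sym\<close> is free on the \<open>\<Psi>\<^sub>m\<close>, these may be sent to the coefficients of \<open>h\<close>; uniqueness of the
  solution of \<open>\<sigma>' = \<sigma>\<psi>\<close>, of inverses and of logarithms identifies the other images, and the
  compatibilities with the Hopf structure need only be checked on the primitive elements \<open>\<Psi>\<^sub>m\<close>.\<close>

section \<open>Coalgebras with multiset-valued comultiplication\<close>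

text \<open>The detour through functions on forests has a practical reason: a homomorphism out of a
  free algebra is easiest to construct into a ring, and associativity of grafting is hard to see
  directly, whereas coassociativity of cuts follows from a short recursion. The division by
  \<alpha>(T) makes both dual operations free of denominators. The recursion for \<theta> becomes
  transparent once a sequence of m - 1 edge cuts is read as one term of an m-fold convolution power
  of a function living on single trees: the equation then states that the powers divided by m! add
  up to 1 on a tree, the term m = 1 being \<theta> itself. The antipode of the tree algebra is given
  only as a choice on the carrier. Its existence comes from a geometric series. Compatibility with
  it is deduced from the convolution identity by induction on words in the \<Psi>'s.\<close>

definition mconv :: "'a::comm_monoid_add multiset \<Rightarrow> 'a multiset \<Rightarrow> 'a multiset" where
  "mconv A B = (\<Sum>a\<in>#A. image_mset ((+) a) B)"

lemma sum_mset_UNION: "(\<Sum>x\<in>#(\<Sum>a\<in>#A. f a). g x) = (\<Sum>a\<in>#A. \<Sum>x\<in>#f a. g x)"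
  by (induction A) auto

lemma sum_mset_image: "(\<Sum>x\<in>#image_mset f A. g x) = (\<Sum>x\<in>#A. g (f x))"
  by (simp add: image_mset.compositionality o_def)

lemma sum_mset_single [simp]: "(\<Sum>x\<in>#A. {#f x#}) = image_mset f A"
  by (induction A) auto

lemma sum_mset_cong: "(\<And>x. x \<in># A \<Longrightarrow> f x = g x) \<Longrightarrow> (\<Sum>x\<in>#A. f x) = (\<Sum>x\<in>#A. g x)"
  by (rule arg_cong[where f = sum_mset]) (rule image_mset_cong)

lemma set_mset_sum_mset: "set_mset (\<Sum>a\<in>#A. f a) = (\<Union>a\<in>set_mset A. set_mset (f a))"
  by (induction A) auto

text \<open>Testing against singletons suffices. The use of the criterion is that an equation of
  multisets becomes an equation of iterated sums, where reindexing and exchange of summation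
  apply.\<close>

lemma mset_eqI_sum:
  assumes "\<And>\<phi> :: 'a \<Rightarrow> 'a multiset. (\<Sum>x\<in>#A. \<phi> x) = (\<Sum>x\<in>#B. \<phi> x)"
  shows "A = B"
  using assms[of "\<lambda>x. {#x#}"] by simp

lemma sum_mconv: "(\<Sum>x\<in>#mconv A B. \<phi> x) = (\<Sum>a\<in>#A. \<Sum>b\<in>#B. \<phi> (a + b))"
  by (simp add: mconv_def sum_mset_UNION sum_mset_image)

lemma set_mconv: "set_mset (mconv A B) = {a + b | a b. a \<in># A \<and> b \<in># B}"
  by (auto simp: mconv_def set_mset_sum_mset)

text \<open>Commutativity is what lets \<open>mprod\<close> be indexed by a multiset of factors,
  such as the unordered branches of a vertex.\<close>

global_interpretation mconv: comm_monoid_mset mconv "{#0#}"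
  defines mprod = mconv.F
proof
  fix A B C :: "'a::comm_monoid_add multiset"
  show "mconv (mconv A B) C = mconv A (mconv B C)"
    by (rule mset_eqI_sum) (simp add: sum_mconv add.assoc)
  show "mconv A B = mconv B A"
    by (rule mset_eqI_sum, simp only: sum_mconv, subst sum_mset.swap) (simp add: add.commute)
  show "mconv A {#0#} = A"
    by (rule mset_eqI_sum) (simp add: sum_mconv)
qed

text \<open>Structure constants are natural numbers, hence multisets of pairs; the counit takes only
  the values 0 and 1, hence a predicate. A class axiom cannot quantify over a further type, so the
  laws are equations of multisets; pairing them with functions into any commutative monoid yields
  the usable forms \<open>coassoc\<close>, \<open>counit_left\<close> and
  \<open>counit_right\<close>.\<close>

class coalg =
  fixes cop :: "'a \<Rightarrow> ('a \<times> 'a) multiset"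
    and eps :: "'a \<Rightarrow> bool"
  assumes coassoc_mset: "(\<Sum>p\<in>#cop a. image_mset (\<lambda>q. (fst q, snd q, snd p)) (cop (fst p))) =
      (\<Sum>p\<in>#cop a. image_mset (\<lambda>q. (fst p, fst q, snd q)) (cop (snd p)))"
    and counit_left_mset: "image_mset snd (filter_mset (\<lambda>p. eps (fst p)) (cop a)) = {#a#}"
    and counit_right_mset: "image_mset fst (filter_mset (\<lambda>p. eps (snd p)) (cop a)) = {#a#}"

lemma coassoc:
  fixes a :: "'a::coalg"
  shows "(\<Sum>p\<in>#cop a. \<Sum>q\<in>#cop (fst p). \<phi> (fst q) (snd q) (snd p)) =
    (\<Sum>p\<in>#cop a. \<Sum>q\<in>#cop (snd p). \<phi> (fst p) (fst q) (snd q))"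
  using arg_cong[OF coassoc_mset[of a], of "\<lambda>M. \<Sum>x\<in>#M. \<phi> (fst x) (fst (snd x)) (snd (snd x))"]
  by (simp add: sum_mset_UNION sum_mset_image)

lemma sum_mset_filter: "(\<Sum>x\<in>#filter_mset P A. g x) = (\<Sum>x\<in>#A. if P x then g x else 0)"
  by (induction A) auto

lemma counit_left:
  fixes a :: "'a::coalg"
  shows "(\<Sum>p\<in>#cop a. if eps (fst p) then g (snd p) else 0) = g a"
  using arg_cong[OF counit_left_mset[of a], of "\<lambda>M. \<Sum>x\<in>#M. g x"]
  by (simp add: sum_mset_image sum_mset_filter)

lemma counit_right:
  fixes a :: "'a::coalg"
  shows "(\<Sum>p\<in>#cop a. if eps (snd p) then g (fst p) else 0) = g a"
  using arg_cong[OF counit_right_mset[of a], of "\<lambda>M. \<Sum>x\<in>#M. g x"]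
  by (simp add: sum_mset_image sum_mset_filter)

text \<open>Needed for 0 \<noteq> 1 in the convolution ring; otherwise the counit law would equate
  an empty multiset with a singleton.\<close>

lemma ex_eps: "\<exists>a::'a::coalg. eps a"
proof -
  have "filter_mset (\<lambda>p. eps (fst p)) (cop (undefined :: 'a)) \<noteq> {#}"
    using counit_left_mset[of "undefined :: 'a"] by (metis image_mset_empty multi_self_add_other_not_self)
  then obtain p where "p \<in># filter_mset (\<lambda>p. eps (fst p)) (cop (undefined :: 'a))"
    by (meson multiset_nonemptyE)
  then show ?thesis by auto
qed

lemma sum_mset_swap4:
  "(\<Sum>p\<in>#A. \<Sum>q\<in>#B. \<Sum>r\<in>#C p. \<Sum>s\<in>#D q. \<psi> p q r s) =
    (\<Sum>q\<in>#B. \<Sum>s\<in>#D q. \<Sum>p\<in>#A. \<Sum>r\<in>#C p. \<psi> p q r s)"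
proof -
  have "(\<Sum>p\<in>#A. \<Sum>q\<in>#B. \<Sum>r\<in>#C p. \<Sum>s\<in>#D q. \<psi> p q r s) =
      (\<Sum>q\<in>#B. \<Sum>p\<in>#A. \<Sum>r\<in>#C p. \<Sum>s\<in>#D q. \<psi> p q r s)"
    by (rule sum_mset.swap)
  also have "\<dots> = (\<Sum>q\<in>#B. \<Sum>p\<in>#A. \<Sum>s\<in>#D q. \<Sum>r\<in>#C p. \<psi> p q r s)"
    by (rule sum_mset_cong, rule sum_mset_cong, rule sum_mset.swap)
  also have "\<dots> = (\<Sum>q\<in>#B. \<Sum>s\<in>#D q. \<Sum>p\<in>#A. \<Sum>r\<in>#C p. \<psi> p q r s)"
    by (rule sum_mset_cong, rule sum_mset.swap)
  finally show ?thesis .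
qed

text \<open>Coassociativity passes to products by exchanging the sums of the two factors. The
  factors are bare multisets and not elements of a coalgebra, because the lemma also serves inside
  instance proofs, where the laws are known only from an induction hypothesis.\<close>

lemma sum_mset_coassoc_product:
  fixes \<psi> :: "'a \<Rightarrow> 'a \<Rightarrow> 'a \<Rightarrow> 'b \<Rightarrow> 'b \<Rightarrow> 'b \<Rightarrow> 'e::comm_monoid_add"
  assumes A: "\<And>\<phi> :: 'a \<Rightarrow> 'a \<Rightarrow> 'a \<Rightarrow> 'e. (\<Sum>p\<in>#A. \<Sum>r\<in>#C p. \<phi> (fst r) (snd r) (snd p)) =
      (\<Sum>p\<in>#A. \<Sum>r\<in>#C' p. \<phi> (fst p) (fst r) (snd r))"
    and B: "\<And>\<phi> :: 'b \<Rightarrow> 'b \<Rightarrow> 'b \<Rightarrow> 'e. (\<Sum>q\<in>#B. \<Sum>s\<in>#D q. \<phi> (fst s) (snd s) (snd q)) =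
      (\<Sum>q\<in>#B. \<Sum>s\<in>#D' q. \<phi> (fst q) (fst s) (snd s))"
  shows "(\<Sum>p\<in>#A. \<Sum>q\<in>#B. \<Sum>r\<in>#C p. \<Sum>s\<in>#D q.
        \<psi> (fst r) (snd r) (snd p) (fst s) (snd s) (snd q)) =
      (\<Sum>p\<in>#A. \<Sum>q\<in>#B. \<Sum>r\<in>#C' p. \<Sum>s\<in>#D' q.
        \<psi> (fst p) (fst r) (snd r) (fst q) (fst s) (snd s))"
proof -
  have "(\<Sum>p\<in>#A. \<Sum>q\<in>#B. \<Sum>r\<in>#C p. \<Sum>s\<in>#D q.
        \<psi> (fst r) (snd r) (snd p) (fst s) (snd s) (snd q)) =
      (\<Sum>q\<in>#B. \<Sum>s\<in>#D q. \<Sum>p\<in>#A. \<Sum>r\<in>#C p.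
        \<psi> (fst r) (snd r) (snd p) (fst s) (snd s) (snd q))"
    by (rule sum_mset_swap4)
  also have "\<dots> = (\<Sum>q\<in>#B. \<Sum>s\<in>#D q. \<Sum>p\<in>#A. \<Sum>r\<in>#C' p.
        \<psi> (fst p) (fst r) (snd r) (fst s) (snd s) (snd q))"
    by (rule sum_mset_cong, rule sum_mset_cong, rule A[where \<phi> = "\<lambda>a b c. \<psi> a b c _ _ _"])
  also have "\<dots> = (\<Sum>p\<in>#A. \<Sum>q\<in>#B. \<Sum>r\<in>#C' p. \<Sum>s\<in>#D q.
        \<psi> (fst p) (fst r) (snd r) (fst s) (snd s) (snd q))"
    by (rule sum_mset_swap4[symmetric])
  also have "\<dots> = (\<Sum>p\<in>#A. \<Sum>r\<in>#C' p. \<Sum>q\<in>#B. \<Sum>s\<in>#D q.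
        \<psi> (fst p) (fst r) (snd r) (fst s) (snd s) (snd q))"
    by (rule sum_mset_cong, rule sum_mset.swap)
  also have "\<dots> = (\<Sum>p\<in>#A. \<Sum>r\<in>#C' p. \<Sum>q\<in>#B. \<Sum>s\<in>#D' q.
        \<psi> (fst p) (fst r) (snd r) (fst q) (fst s) (snd s))"
    by (rule sum_mset_cong, rule sum_mset_cong, rule B[where \<phi> = "\<lambda>a b c. \<psi> _ _ _ a b c"])
  also have "\<dots> = (\<Sum>p\<in>#A. \<Sum>q\<in>#B. \<Sum>r\<in>#C' p. \<Sum>s\<in>#D' q.
        \<psi> (fst p) (fst r) (snd r) (fst q) (fst s) (snd s))"
    by (rule sum_mset_cong, rule sum_mset.swap)
  finally show ?thesis .
qed

lemma sum_mset_counit_product: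
  fixes \<phi> :: "'a \<Rightarrow> 'b \<Rightarrow> 'e::comm_monoid_add"
  assumes A: "\<And>\<phi> :: 'a \<Rightarrow> 'e. (\<Sum>p\<in>#A. if P p then \<phi> (f p) else 0) = \<phi> a"
    and B: "\<And>\<phi> :: 'b \<Rightarrow> 'e. (\<Sum>q\<in>#B. if Q q then \<phi> (g q) else 0) = \<phi> b"
  shows "(\<Sum>p\<in>#A. \<Sum>q\<in>#B. if P p \<and> Q q then \<phi> (f p) (g q) else 0) = \<phi> a b"
proof -
  have "(\<Sum>p\<in>#A. \<Sum>q\<in>#B. if P p \<and> Q q then \<phi> (f p) (g q) else 0) =
      (\<Sum>p\<in>#A. if P p then (\<Sum>q\<in>#B. if Q q then \<phi> (f p) (g q) else 0) else 0)"
    by (rule sum_mset_cong) simp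
  also have "\<dots> = (\<Sum>p\<in>#A. if P p then \<phi> (f p) b else 0)"
    by (simp only: B)
  also have "\<dots> = \<phi> a b" by (rule A)
  finally show ?thesis .
qed

text \<open>The convolution ring of this tensor product consists of functions of two arguments; for
  pairs of forests it receives the images of coproducts.\<close>

instantiation prod :: (coalg, coalg) coalg
begin
definition cop_prod :: "'a \<times> 'b \<Rightarrow> (('a \<times> 'b) \<times> ('a \<times> 'b)) multiset" where
  "cop_prod x = (\<Sum>p\<in>#cop (fst x). image_mset (\<lambda>q. ((fst p, fst q), (snd p, snd q))) (cop (snd x)))"
definition eps_prod :: "'a \<times> 'b \<Rightarrow> bool" where
  "eps_prod x \<longleftrightarrow> eps (fst x) \<and> eps (snd x)"

lemma sum_cop_prod:
  "(\<Sum>r\<in>#cop (x :: 'a \<times> 'b). \<phi> r) =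
    (\<Sum>p\<in>#cop (fst x). \<Sum>q\<in>#cop (snd x). \<phi> ((fst p, fst q), (snd p, snd q)))"
  by (simp add: cop_prod_def sum_mset_UNION sum_mset_image)

instance
proof
  fix x :: "'a \<times> 'b"
  show "(\<Sum>p\<in>#cop x. image_mset (\<lambda>q. (fst q, snd q, snd p)) (cop (fst p))) =
      (\<Sum>p\<in>#cop x. image_mset (\<lambda>q. (fst p, fst q, snd q)) (cop (snd p)))"
  proof (rule mset_eqI_sum)
    fix \<phi> :: "('a \<times> 'b) \<times> ('a \<times> 'b) \<times> ('a \<times> 'b) \<Rightarrow> (('a \<times> 'b) \<times> ('a \<times> 'b) \<times> ('a \<times> 'b)) multiset"
    show "(\<Sum>y\<in>#(\<Sum>p\<in>#cop x. image_mset (\<lambda>q. (fst q, snd q, snd p)) (cop (fst p))). \<phi> y) =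
        (\<Sum>y\<in>#(\<Sum>p\<in>#cop x. image_mset (\<lambda>q. (fst p, fst q, snd q)) (cop (snd p))). \<phi> y)"
      unfolding sum_mset_UNION sum_mset_image sum_cop_prod fst_conv snd_conv
      by (rule sum_mset_coassoc_product[where \<psi> = "\<lambda>a b c a' b' c'. \<phi> ((a, a'), (b, b'), (c, c'))"])
        (rule coassoc)+
  qed
  show "image_mset snd (filter_mset (\<lambda>p. eps (fst p)) (cop x)) = {#x#}"
  proof (rule mset_eqI_sum)
    fix \<phi> :: "'a \<times> 'b \<Rightarrow> ('a \<times> 'b) multiset"
    show "(\<Sum>y\<in>#image_mset snd (filter_mset (\<lambda>p. eps (fst p)) (cop x)). \<phi> y) = (\<Sum>y\<in>#{#x#}. \<phi> y)"
      using sum_mset_counit_product[where f = snd and g = snd and a = "fst x" and b = "snd x" and \<phi> = "\<lambda>a b. \<phi> (a, b)", OF counit_left counit_left]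
      unfolding sum_mset_image sum_mset_filter sum_cop_prod eps_prod_def fst_conv snd_conv by simp
  qed
  show "image_mset fst (filter_mset (\<lambda>p. eps (snd p)) (cop x)) = {#x#}"
  proof (rule mset_eqI_sum)
    fix \<phi> :: "'a \<times> 'b \<Rightarrow> ('a \<times> 'b) multiset"
    show "(\<Sum>y\<in>#image_mset fst (filter_mset (\<lambda>p. eps (snd p)) (cop x)). \<phi> y) = (\<Sum>y\<in>#{#x#}. \<phi> y)"
      using sum_mset_counit_product[where f = fst and g = fst and a = "fst x" and b = "snd x" and \<phi> = "\<lambda>a b. \<phi> (a, b)", OF counit_right counit_right]
      unfolding sum_mset_image sum_mset_filter sum_cop_prod eps_prod_def fst_conv snd_conv by simp
  qed
qed
end

section \<open>Convolution algebras\<close>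

datatype ('c, 'k) conv = Conv (coef: "'c \<Rightarrow> 'k")

lemma conv_eqI: "(\<And>x. coef c x = coef d x) \<Longrightarrow> c = d"
  by (cases c; cases d) auto

instantiation conv :: (coalg, ring_1) ring_1
begin
definition zero_conv :: "('a, 'b) conv" where "0 = Conv (\<lambda>_. 0)"
definition one_conv :: "('a, 'b) conv" where "1 = Conv (\<lambda>x. if eps x then 1 else 0)"
definition plus_conv :: "('a, 'b) conv \<Rightarrow> ('a, 'b) conv \<Rightarrow> ('a, 'b) conv" where
  "c + d = Conv (\<lambda>x. coef c x + coef d x)"
definition minus_conv :: "('a, 'b) conv \<Rightarrow> ('a, 'b) conv \<Rightarrow> ('a, 'b) conv" where
  "c - d = Conv (\<lambda>x. coef c x - coef d x)"
definition uminus_conv :: "('a, 'b) conv \<Rightarrow> ('a, 'b) conv" where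
  "- c = Conv (\<lambda>x. - coef c x)"
definition times_conv :: "('a, 'b) conv \<Rightarrow> ('a, 'b) conv \<Rightarrow> ('a, 'b) conv" where
  "c * d = Conv (\<lambda>x. \<Sum>p\<in>#cop x. coef c (fst p) * coef d (snd p))"

lemma coef_simps [simp]:
  "coef (0 :: ('a, 'b) conv) x = 0"
  "coef (1 :: ('a, 'b) conv) x = (if eps x then 1 else 0)"
  "coef (c + d) x = coef c x + coef d x"
  "coef (c - d) x = coef c x - coef d x"
  "coef (- c) x = - coef c x"
  by (simp_all add: zero_conv_def one_conv_def plus_conv_def minus_conv_def uminus_conv_def)

lemma coef_times: "coef (c * d) x = (\<Sum>p\<in>#cop x. coef c (fst p) * coef d (snd p))"
  by (simp add: times_conv_def)

instance
proof
  fix a b c :: "('a, 'b) conv"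
  show "a * b * c = a * (b * c)"
  proof (rule conv_eqI)
    fix x
    show "coef (a * b * c) x = coef (a * (b * c)) x"
      using coassoc[where a = x and \<phi> = "\<lambda>u v w. coef a u * coef b v * coef c w"]
      by (simp add: coef_times sum_mset_distrib_left sum_mset_distrib_right mult.assoc)
  qed
  show "1 * a = a"
  proof (rule conv_eqI)
    fix x
    show "coef (1 * a) x = coef a x"
      using counit_left[where a = x and g = "coef a"]
      by (simp add: coef_times if_distrib[where f = "\<lambda>z. z * _"] cong: if_cong)
  qed
  show "a * 1 = a"
  proof (rule conv_eqI)
    fix x
    show "coef (a * 1) x = coef a x"
      using counit_right[where a = x and g = "coef a"]
      by (simp add: coef_times if_distrib[where f = "\<lambda>z. _ * z"] cong: if_cong)
  qed
  obtain x :: 'a where "eps x" using ex_eps by blast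
  then have "coef (0 :: ('a, 'b) conv) x \<noteq> coef 1 x" by simp
  then show "(0 :: ('a, 'b) conv) \<noteq> 1" by metis
qed (rule conv_eqI, simp add: coef_times algebra_simps sum_mset.distrib)+
end

definition scal :: "'k \<Rightarrow> ('c::coalg, 'k::comm_ring_1) conv" where
  "scal a = Conv (\<lambda>x. if eps x then a else 0)"

lemma coef_scal: "coef (scal a) x = (if eps x then a else 0)"
  by (simp add: scal_def)

lemma coef_scal_times [simp]: "coef (scal a * c) x = a * coef c x"
  using counit_left[where a = x and g = "\<lambda>y. a * coef c y"]
  by (simp add: coef_times coef_scal if_distrib[where f = "\<lambda>z. z * _"] cong: if_cong)

lemma coef_times_scal [simp]: "coef (c * scal a) x = coef c x * a"
  using counit_right[where a = x and g = "\<lambda>y. coef c y * a"]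
  by (simp add: coef_times coef_scal if_distrib[where f = "\<lambda>z. _ * z"] cong: if_cong)

lemma coef_sum [simp]: "coef (\<Sum>i\<in>I. f i) x = (\<Sum>i\<in>I. coef (f i) x)"
  by (induction I rule: infinite_finite_induct) auto

section \<open>The coalgebra of admissible cuts\<close>

text \<open>A cut of a forest with (multi)set of trees \<open>M\<close> is recorded as the pair consisting of the pruned
  forest and of the remaining trunk, which contains the roots that are not cut off.\<close>

text \<open>A class, since \<open>rtree multiset\<close> can be made an instance of \<^class>\<open>coalg\<close> only uniformly over a
  class of element types.\<close>

class cuttable =
  fixes bcuts :: "'a \<Rightarrow> ('a multiset \<times> 'a multiset) multiset"
  assumes bcuts_coassoc:
      "(\<Sum>p\<in>#bcuts t. image_mset (\<lambda>q. (fst q, snd q, snd p)) (mprod (image_mset bcuts (fst p)))) =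
       (\<Sum>p\<in>#bcuts t. image_mset (\<lambda>q. (fst p, fst q, snd q)) (mprod (image_mset bcuts (snd p))))"
    and bcuts_counit_left: "image_mset snd (filter_mset (\<lambda>p. fst p = {#}) (bcuts t)) = {#{#t#}#}"
    and bcuts_counit_right: "image_mset fst (filter_mset (\<lambda>p. snd p = {#}) (bcuts t)) = {#{#t#}#}"

instantiation multiset :: (cuttable) coalg
begin
definition cop_multiset :: "'a multiset \<Rightarrow> ('a multiset \<times> 'a multiset) multiset" where
  "cop_multiset M = mprod (image_mset bcuts M)"
definition eps_multiset :: "'a multiset \<Rightarrow> bool" where
  "eps_multiset M \<longleftrightarrow> M = {#}"

lemma cop_empty [simp]: "cop ({#} :: 'a multiset) = {#({#}, {#})#}"
  by (simp add: cop_multiset_def zero_prod_def)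

lemma cop_singleton: "cop {#t :: 'a#} = bcuts t"
  by (simp add: cop_multiset_def)

lemma sum_cop_union:
  "(\<Sum>x\<in>#cop (M + N :: 'a multiset). \<phi> x) = (\<Sum>p\<in>#cop M. \<Sum>q\<in>#cop N. \<phi> (fst p + fst q, snd p + snd q))"
  by (simp add: cop_multiset_def sum_mconv plus_prod_def)

lemma eps_multiset_simps [simp]: "eps (M :: 'a multiset) \<longleftrightarrow> M = {#}"
  by (simp add: eps_multiset_def)

instance
proof
  fix M :: "'a multiset"
  have "(\<Sum>p\<in>#cop M. \<Sum>q\<in>#cop (fst p). \<phi> (fst q) (snd q) (snd p)) =
      (\<Sum>p\<in>#cop M. \<Sum>q\<in>#cop (snd p). \<phi> (fst p) (fst q) (snd q))"
    for \<phi> :: "_ \<Rightarrow> _ \<Rightarrow> _ \<Rightarrow> ('a multiset \<times> 'a multiset \<times> 'a multiset) multiset"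
  proof (induction M arbitrary: \<phi>)
    case (add t M)
    have t: "(\<Sum>p\<in>#cop {#t#}. \<Sum>q\<in>#cop (fst p). \<phi> (fst q) (snd q) (snd p)) =
        (\<Sum>p\<in>#cop {#t#}. \<Sum>q\<in>#cop (snd p). \<phi> (fst p) (fst q) (snd q))"
      for \<phi> :: "_ \<Rightarrow> _ \<Rightarrow> _ \<Rightarrow> ('a multiset \<times> 'a multiset \<times> 'a multiset) multiset"
      using arg_cong[OF bcuts_coassoc[of t], of "\<lambda>M. \<Sum>x\<in>#M. \<phi> (fst x) (fst (snd x)) (snd (snd x))"]
      by (simp add: sum_mset_UNION sum_mset_image cop_multiset_def)
    have e: "add_mset t M = {#t#} + M" by simp
    show ?case
      unfolding e sum_cop_union fst_conv snd_conv
      by (rule sum_mset_coassoc_product[where \<psi> = "\<lambda>a b c a' b' c'. \<phi> (a + a') (b + b') (c + c')"])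
        (rule t add.IH)+
  qed simp
  note coassoc = this
  show "(\<Sum>p\<in>#cop M. image_mset (\<lambda>q. (fst q, snd q, snd p)) (cop (fst p))) =
      (\<Sum>p\<in>#cop M. image_mset (\<lambda>q. (fst p, fst q, snd q)) (cop (snd p)))"
  proof (rule mset_eqI_sum)
    fix \<phi> :: "'a multiset \<times> 'a multiset \<times> 'a multiset \<Rightarrow> ('a multiset \<times> 'a multiset \<times> 'a multiset) multiset"
    show "(\<Sum>y\<in>#(\<Sum>p\<in>#cop M. image_mset (\<lambda>q. (fst q, snd q, snd p)) (cop (fst p))). \<phi> y) =
        (\<Sum>y\<in>#(\<Sum>p\<in>#cop M. image_mset (\<lambda>q. (fst p, fst q, snd q)) (cop (snd p))). \<phi> y)"
      using coassoc[where \<phi> = "\<lambda>a b c. \<phi> (a, b, c)"] by (simp add: sum_mset_UNION sum_mset_image)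
  qed
  have "(\<Sum>p\<in>#cop M. if fst p = {#} then \<phi> (snd p) else 0) = \<phi> M"
    for \<phi> :: "'a multiset \<Rightarrow> 'a multiset multiset"
  proof (induction M arbitrary: \<phi>)
    case (add t M)
    have single: "(\<Sum>p\<in>#cop {#t#}. if fst p = {#} then \<phi> (snd p) else 0) = \<phi> {#t#}"
      for \<phi> :: "'a multiset \<Rightarrow> 'a multiset multiset"
      using arg_cong[OF bcuts_counit_left[of t], of "\<lambda>M. \<Sum>x\<in>#M. \<phi> x"]
      by (simp add: sum_mset_filter sum_mset_image cop_singleton)
    have e: "add_mset t M = {#t#} + M" by simp
    show ?case
        unfolding e sum_cop_union fst_conv snd_conv union_eq_empty
        by (rule sum_mset_counit_product[where f = snd and g = snd and \<phi> = "\<lambda>a b. \<phi> (a + b)"]) (rule single add.IH)+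
  qed simp
  then show "image_mset snd (filter_mset (\<lambda>p. eps (fst p)) (cop M)) = {#M#}"
    by - (rule mset_eqI_sum, simp add: sum_mset_image sum_mset_filter)
  have "(\<Sum>p\<in>#cop M. if snd p = {#} then \<phi> (fst p) else 0) = \<phi> M"
    for \<phi> :: "'a multiset \<Rightarrow> 'a multiset multiset"
  proof (induction M arbitrary: \<phi>)
    case (add t M)
    have single: "(\<Sum>p\<in>#cop {#t#}. if snd p = {#} then \<phi> (fst p) else 0) = \<phi> {#t#}"
      for \<phi> :: "'a multiset \<Rightarrow> 'a multiset multiset"
      using arg_cong[OF bcuts_counit_right[of t], of "\<lambda>M. \<Sum>x\<in>#M. \<phi> x"]
      by (simp add: sum_mset_filter sum_mset_image cop_singleton)
    have e: "add_mset t M = {#t#} + M" by simp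
    show ?case
        unfolding e sum_cop_union fst_conv snd_conv union_eq_empty
        by (rule sum_mset_counit_product[where f = fst and g = fst and \<phi> = "\<lambda>a b. \<phi> (a + b)"]) (rule single add.IH)+
  qed simp
  then show "image_mset fst (filter_mset (\<lambda>p. eps (snd p)) (cop M)) = {#M#}"
    by - (rule mset_eqI_sum, simp add: sum_mset_image sum_mset_filter)
qed
end

instantiation rtree :: (type) cuttable
begin
text \<open>Either the whole tree is pruned, or its root stays and the branches are cut. This is the
  cocycle equation \<open>\<Delta> B = B \<otimes> 1 + (id \<otimes> B) \<Delta>\<close> of the
  Connes-Kreimer coproduct, with \<open>B\<close> the operator that adds a root labelled
  \<open>a\<close>; coassociativity follows from it by induction on the tree.\<close>

primrec bcuts_rtree :: "'a rtree \<Rightarrow> ('a rtree multiset \<times> 'a rtree multiset) multiset" where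
  "bcuts_rtree (Node a M) = add_mset ({#Node a M#}, {#})
     (image_mset (\<lambda>p. (fst p, {#Node a (snd p)#})) (mprod (image_mset bcuts_rtree M)))"

lemma sum_bcuts_rtree:
  "(\<Sum>p\<in>#bcuts (Node a M). \<phi> p) =
    \<phi> ({#Node a M#}, {#}) + (\<Sum>p\<in>#mprod (image_mset bcuts M). \<phi> (fst p, {#Node a (snd p)#}))"
  by (simp add: sum_mset_image)

declare bcuts_rtree.simps [simp del]

instance
proof
  fix t :: "'a rtree"
  \<comment> \<open>\<open>c\<close> is the future \<open>cop\<close> on forests, written out
    because that notation becomes available only with the instance under proof.\<close>
  define c where "c = (\<lambda>M :: 'a rtree multiset. mprod (image_mset bcuts M))"
  have c_add: "(\<Sum>x\<in>#c (M + N). \<phi> x) = (\<Sum>p\<in>#c M. \<Sum>q\<in>#c N. \<phi> (fst p + fst q, snd p + snd q))"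
    for M N and \<phi> :: "_ \<Rightarrow> 'e::comm_monoid_add"
    by (simp add: c_def sum_mconv plus_prod_def)
  have c_empty [simp]: "c {#} = {#({#}, {#})#}" by (simp add: c_def zero_prod_def)
  have c_single [simp]: "c {#s#} = bcuts s" for s by (simp add: c_def)
  have b: "(\<Sum>p\<in>#bcuts (Node a M). \<phi> p) =
      \<phi> ({#Node a M#}, {#}) + (\<Sum>p\<in>#c M. \<phi> (fst p, {#Node a (snd p)#}))"
    for a M and \<phi> :: "_ \<Rightarrow> 'e::comm_monoid_add"
    unfolding c_def by (rule sum_bcuts_rtree)
  have co: "(\<Sum>p\<in>#bcuts t. \<Sum>q\<in>#c (fst p). \<phi> (fst q) (snd q) (snd p)) =
      (\<Sum>p\<in>#bcuts t. \<Sum>q\<in>#c (snd p). \<phi> (fst p) (fst q) (snd q))"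
    for \<phi> :: "_ \<Rightarrow> _ \<Rightarrow> _ \<Rightarrow> ('a rtree multiset \<times> 'a rtree multiset \<times> 'a rtree multiset) multiset"
  proof (induction t arbitrary: \<phi>)
    case (Node a M)
    \<comment> \<open>The induction hypothesis speaks of members of \<open>M\<close> only, so the
      passage from trees to forests runs over submultisets of \<open>M\<close>.\<close>
    have M: "(\<Sum>p\<in>#c N. \<Sum>q\<in>#c (fst p). \<phi> (fst q) (snd q) (snd p)) =
        (\<Sum>p\<in>#c N. \<Sum>q\<in>#c (snd p). \<phi> (fst p) (fst q) (snd q))" if "N \<subseteq># M"
      for N and \<phi> :: "_ \<Rightarrow> _ \<Rightarrow> _ \<Rightarrow> ('a rtree multiset \<times> 'a rtree multiset \<times> 'a rtree multiset) multiset"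
      using that
    proof (induction N arbitrary: \<phi>)
      case (add s N)
      have s: "s \<in># M" and N: "N \<subseteq># M"
        using mset_subset_eq_insertD[OF add.prems] by (simp_all add: subset_mset.less_imp_le)
      have e: "add_mset s N = {#s#} + N" by simp
      show ?case
        unfolding e c_add c_single fst_conv snd_conv
        by (rule sum_mset_coassoc_product[where \<psi> = "\<lambda>a b c a' b' c'. \<phi> (a + a') (b + b') (c + c')"])
          (rule Node.IH[OF s, folded c_def] add.IH[OF N])+
    qed simp
    have "(\<Sum>p\<in>#c M. \<Sum>q\<in>#c (fst p). \<phi> (fst q) (snd q) {#Node a (snd p)#}) =
        (\<Sum>p\<in>#c M. \<Sum>q\<in>#c (snd p). \<phi> (fst p) (fst q) {#Node a (snd q)#})"
      using M[of M "\<lambda>u v w. \<phi> u v {#Node a w#}"] by simp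
    then show ?case
      by (simp only: b fst_conv snd_conv c_single) (simp add: b sum_mset.distrib add_ac)
  qed
  have "(\<Sum>p\<in>#bcuts t. image_mset (\<lambda>q. (fst q, snd q, snd p)) (c (fst p))) =
      (\<Sum>p\<in>#bcuts t. image_mset (\<lambda>q. (fst p, fst q, snd q)) (c (snd p)))"
    using co[of "\<lambda>u v w. {#(u, v, w)#}"]
    by simp
  then show "(\<Sum>p\<in>#bcuts t. image_mset (\<lambda>q. (fst q, snd q, snd p)) (mprod (image_mset bcuts (fst p)))) =
      (\<Sum>p\<in>#bcuts t. image_mset (\<lambda>q. (fst p, fst q, snd q)) (mprod (image_mset bcuts (snd p))))"
    by (simp add: c_def)
  have snd_empty: "(\<Sum>p\<in>#c M. if snd p = {#} then \<phi> (fst p) else 0) = \<phi> M"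
    for M and \<phi> :: "'a rtree multiset \<Rightarrow> 'a rtree multiset multiset"
  proof (induction M arbitrary: \<phi>)
    case (add s M)
    have single: "(\<Sum>p\<in>#bcuts s. if snd p = {#} then \<phi> (fst p) else 0) = \<phi> {#s#}"
      for \<phi> :: "'a rtree multiset \<Rightarrow> 'a rtree multiset multiset"
      by (cases s) (simp only: b, simp)
    have e: "add_mset s M = {#s#} + M" by simp
    show ?case
        unfolding e c_add c_single fst_conv snd_conv union_eq_empty
        by (rule sum_mset_counit_product[where f = fst and g = fst and \<phi> = "\<lambda>a b. \<phi> (a + b)"]) (rule single add.IH)+
  qed simp
  from this[of _ "{#t#}"] show "image_mset fst (filter_mset (\<lambda>p. snd p = {#}) (bcuts t)) = {#{#t#}#}"
    by - (rule mset_eqI_sum, simp add: sum_mset_image sum_mset_filter)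
  have t: "(\<Sum>p\<in>#bcuts t. if fst p = {#} then \<phi> (snd p) else 0) = \<phi> {#t#}"
    for \<phi> :: "'a rtree multiset \<Rightarrow> 'a rtree multiset multiset"
  proof (induction t arbitrary: \<phi>)
    case (Node a M)
    have "(\<Sum>p\<in>#c N. if fst p = {#} then \<phi> (snd p) else 0) = \<phi> N" if "N \<subseteq># M"
      for N and \<phi> :: "'a rtree multiset \<Rightarrow> 'a rtree multiset multiset"
      using that
    proof (induction N arbitrary: \<phi>)
      case (add s N)
      have s: "s \<in># M" and N: "N \<subseteq># M"
        using mset_subset_eq_insertD[OF add.prems] by (simp_all add: subset_mset.less_imp_le)
      have e: "add_mset s N = {#s#} + N" by simp
      show ?case
        unfolding e c_add c_single fst_conv snd_conv union_eq_empty
        by (rule sum_mset_counit_product[where f = snd and g = snd and \<phi> = "\<lambda>a b. \<phi> (a + b)"]) (rule Node.IH[OF s, folded c_def] add.IH[OF N])+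
    qed simp
    from this[of M "\<lambda>w. \<phi> {#Node a w#}"] show ?case
      by (simp only: b fst_conv snd_conv, simp)
  qed
  then show "image_mset snd (filter_mset (\<lambda>p. fst p = {#}) (bcuts t)) = {#{#t#}#}"
    by - (rule mset_eqI_sum, simp add: sum_mset_image sum_mset_filter)
qed
end

lemma bcuts_Node: "bcuts (Node a M) = add_mset ({#Node a M#}, {#})
    (image_mset (\<lambda>p. (fst p, {#Node a (snd p)#})) (cop M))"
  by (simp add: cop_multiset_def bcuts_rtree.simps)

lemma sum_cop_Node:
  "(\<Sum>p\<in>#cop {#Node a M#}. \<phi> p) =
    \<phi> ({#Node a M#}, {#}) + (\<Sum>p\<in>#cop M. \<phi> (fst p, {#Node a (snd p)#}))"
  by (simp add: cop_singleton bcuts_Node sum_mset_image)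

section \<open>Concrete and abstract trees\<close>

definition ctree :: "'x list set \<Rightarrow> bool" where
  "ctree V \<longleftrightarrow> finite V \<and> [] \<in> V \<and> (\<forall>p q. p @ q \<in> V \<longrightarrow> p \<in> V)"

lemma ctree_finite [simp]: "ctree V \<Longrightarrow> finite V"
  and ctree_Nil [simp]: "ctree V \<Longrightarrow> [] \<in> V"
  and ctree_prefix: "ctree V \<Longrightarrow> p @ q \<in> V \<Longrightarrow> p \<in> V"
  by (auto simp: ctree_def)

lemma ctree_hd: "ctree V \<Longrightarrow> c # q \<in> V \<Longrightarrow> [c] \<in> V"
  using ctree_prefix[of V "[c]" q] by simp

lemma in_cut_P [simp]: "q \<in> cut_P V e \<longleftrightarrow> e @ q \<in> V"
  by (simp add: cut_P_def)

lemma finite_cut_P [simp]: "finite V \<Longrightarrow> finite (cut_P V e)"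
  by (rule finite_imageD[where f = "(@) e"]) (auto intro: finite_subset[of _ V] inj_onI)

lemma card_cut_P_less:
  assumes "finite V" "[] \<in> V"
  shows "card (cut_P V [c]) < card V"
proof -
  have "card (cut_P V [c]) = card ((#) c ` cut_P V [c])"
    by (simp add: card_image)
  also have "\<dots> < card V"
    using assms by (intro psubset_card_mono) auto
  finally show ?thesis .
qed

lemma ctree_cut_P: "ctree V \<Longrightarrow> e \<in> V \<Longrightarrow> ctree (cut_P V e)"
  unfolding ctree_def by (auto simp flip: append_assoc)

lemma ctree_cut_R: "ctree V \<Longrightarrow> e \<noteq> [] \<Longrightarrow> ctree (cut_R V e)"
  unfolding ctree_def cut_R_def by auto

lemma card_cut_R_less: "finite V \<Longrightarrow> e \<in> V \<Longrightarrow> card (cut_R V e) < card V"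
  by (intro psubset_card_mono) (auto simp: cut_R_def)

lemma finite_kids [simp]: "finite V \<Longrightarrow> finite {c. [c] \<in> V}"
  by (rule finite_imageD[where f = "\<lambda>c. [c]"]) (auto intro: finite_subset[of _ V] inj_onI)

context
  notes image_mset_cong [fundef_cong]
begin
text \<open>A recursively computed value for \<open>tree_class\<close>. The test in the body secures
  termination: passing to the branch at a child lowers the cardinality for a finite set containing
  \<open>[]\<close>.\<close>

function abs_tree :: "'x list set \<Rightarrow> ('x list \<Rightarrow> 'a) \<Rightarrow> 'a rtree" where
  "abs_tree V lab = (if finite V \<and> [] \<in> V
     then Node (lab []) (image_mset (\<lambda>c. abs_tree (cut_P V [c]) (\<lambda>q. lab (c # q))) (mset_set {c. [c] \<in> V}))
     else Node (lab []) {#})"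
  by auto
termination
  by (relation "measure (\<lambda>p. card (fst p))") (auto intro: card_cut_P_less)
end

declare abs_tree.simps [simp del]

lemma abs_tree_ctree:
  "ctree V \<Longrightarrow> abs_tree V lab =
    Node (lab []) (image_mset (\<lambda>c. abs_tree (cut_P V [c]) (\<lambda>q. lab (c # q))) (mset_set {c. [c] \<in> V}))"
  by (subst abs_tree.simps) simp

lemma root_label_abs_tree [simp]: "root_label (abs_tree V lab) = lab []"
  by (subst abs_tree.simps) simp

text \<open>Peels off one child of the root, chosen at will. Later inductions over concrete trees
  split \<open>V\<close> in this way, both parts having smaller cardinality.\<close>

lemma branches_abs_tree_remove:
  assumes V: "ctree V" and c: "[c] \<in> V"
  shows "branches (abs_tree V lab) =
    add_mset (abs_tree (cut_P V [c]) (\<lambda>q. lab (c # q))) (branches (abs_tree (cut_R V [c]) lab))"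
proof -
  have R: "ctree (cut_R V [c])" using V by (simp add: ctree_cut_R)
  have K: "{d. [d] \<in> cut_R V [c]} = {d. [d] \<in> V} - {c}"
    by (auto simp: cut_R_def)
  have e: "cut_P (cut_R V [c]) [d] = cut_P V [d]" if "d \<noteq> c" for d
    using that by (auto simp: cut_R_def cut_P_def)
  have m: "mset_set {d. [d] \<in> V} = add_mset c (mset_set ({d. [d] \<in> V} - {c}))"
    using V c by (simp add: mset_set.remove)
  have "image_mset (\<lambda>d. abs_tree (cut_P V [d]) (\<lambda>q. lab (d # q))) (mset_set ({d. [d] \<in> V} - {c})) =
      image_mset (\<lambda>d. abs_tree (cut_P (cut_R V [c]) [d]) (\<lambda>q. lab (d # q))) (mset_set ({d. [d] \<in> V} - {c}))"
    using V by (intro image_mset_cong) (simp add: e)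
  then show ?thesis
    by (simp add: abs_tree_ctree[OF V] abs_tree_ctree[OF R] K m)
qed

lemma branches_abs_tree_leaf: "ctree V \<Longrightarrow> V = {[]} \<Longrightarrow> branches (abs_tree V lab) = {#}"
  by (simp add: abs_tree_ctree)

lemma ctree_eq_single: "ctree V \<Longrightarrow> (\<And>c. [c] \<notin> V) \<Longrightarrow> V = {[]}"
proof -
  assume V: "ctree V" and n: "\<And>c. [c] \<notin> V"
  have "p = []" if "p \<in> V" for p
    using that n ctree_hd[OF V] by (cases p) auto
  then show ?thesis using V by auto
qed

subsection \<open>Isomorphisms\<close>

text \<open>An isomorphism fixes the root, is injective and commutes with taking parents, so it
  carries descendants to descendants at the same relative depth.\<close>

lemma tree_iso_append:
  assumes V: "ctree V" and f: "f \<in> tree_isos V lab V' lab'" and pq: "p @ q \<in> V"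
  shows "\<exists>r. f (p @ q) = f p @ r \<and> length r = length q"
  using pq
proof (induction q rule: rev_induct)
  case (snoc x q)
  have inV: "p @ q \<in> V" using snoc.prems ctree_prefix[OF V, of "p @ q" "[x]"] by simp
  then obtain r where r: "f (p @ q) = f p @ r" "length r = length q" using snoc.IH by blast
  have inj: "inj_on f V" and f0: "f [] = []"
    and b: "\<And>p. p \<in> V \<Longrightarrow> p \<noteq> [] \<Longrightarrow> f (butlast p) = butlast (f p)"
    using f by (auto simp: tree_isos_def bij_betw_def)
  have "f (p @ q @ [x]) \<noteq> []"
    using inj_onD[OF inj, of "p @ q @ [x]" "[]"] f0 snoc.prems V by auto
  moreover have "butlast (f (p @ q @ [x])) = f p @ r"
    using b[OF snoc.prems] r by (simp add: butlast_append)
  ultimately have "f (p @ q @ [x]) = f p @ (r @ [last (f (p @ q @ [x]))])"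
    by (metis append.assoc append_butlast_last_id)
  then show ?case using r(2) by (metis length_append_singleton)
qed simp

lemma tree_iso_Cons:
  assumes V: "ctree V" and f: "f \<in> tree_isos V lab V' lab'" and c: "[c] \<in> V"
  obtains c' where "f [c] = [c']" "[c'] \<in> V'"
proof -
  obtain r where "f [c] = f [] @ r" "length r = 1"
    using tree_iso_append[OF V f, of "[]" "[c]"] c by auto
  moreover have "f [] = []" "f [c] \<in> V'" using f c by (auto simp: tree_isos_def bij_betw_def)
  ultimately show thesis using that by (cases r) auto
qed

definition glue :: "'x list set \<Rightarrow> 'x \<Rightarrow> 'y \<times> ('x list \<Rightarrow> 'y list) \<times> ('x list \<Rightarrow> 'y list) \<Rightarrow> 'x list \<Rightarrow> 'y list" where
  "glue V c = (\<lambda>(c', g, h). restrict (\<lambda>p. if p \<noteq> [] \<and> hd p = c then c' # g (tl p) else h p) V)"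

definition unglue :: "'x list set \<Rightarrow> 'x \<Rightarrow> ('x list \<Rightarrow> 'y list) \<Rightarrow> 'y \<times> ('x list \<Rightarrow> 'y list) \<times> ('x list \<Rightarrow> 'y list)" where
  "unglue V c f = (hd (f [c]), restrict (\<lambda>q. tl (f (c # q))) (cut_P V [c]), restrict f (cut_R V [c]))"

lemma in_cut_R_single: "p \<in> cut_R V [c] \<longleftrightarrow> p \<in> V \<and> \<not> (p \<noteq> [] \<and> hd p = c)"
  by (cases p) (auto simp: cut_R_def)

lemma split_at_child: "V = cut_R V [c] \<union> (#) c ` cut_P V [c]"
proof (intro equalityI subsetI)
  fix p assume "p \<in> V"
  then show "p \<in> cut_R V [c] \<union> (#) c ` cut_P V [c]"
    by (cases p) (auto simp: in_cut_R_single)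
qed (auto simp: in_cut_R_single)

text \<open>An isomorphism amounts to the image \<open>c'\<close> of one chosen child, an
  isomorphism between the branches at \<open>c\<close> and \<open>c'\<close>, and one between the
  trees that remain after removing them. This gives a recursion for the number of
  isomorphisms.\<close>

lemma bij_betw_glue:
  assumes V: "ctree V" and V': "ctree V'" and c: "[c] \<in> V"
  shows "bij_betw (glue V c)
     (SIGMA c':{c'. [c'] \<in> V'}.
        tree_isos (cut_P V [c]) (\<lambda>q. lab (c # q)) (cut_P V' [c']) (\<lambda>q. lab' (c' # q)) \<times>
        tree_isos (cut_R V [c]) lab (cut_R V' [c']) lab')
     (tree_isos V lab V' lab')"
    (is "bij_betw _ ?S ?I")
proof (rule bij_betwI[where g = "unglue V c"])
  show "glue V c \<in> ?S \<rightarrow> ?I"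
  proof (safe)
    fix c' g h
    assume c': "[c'] \<in> V'"
      and g: "g \<in> tree_isos (cut_P V [c]) (\<lambda>q. lab (c # q)) (cut_P V' [c']) (\<lambda>q. lab' (c' # q))"
      and h: "h \<in> tree_isos (cut_R V [c]) lab (cut_R V' [c']) lab'"
    define f where "f = glue V c (c', g, h)"
    have f1: "f (c # q) = c' # g q" if "c # q \<in> V" for q using that by (simp add: f_def glue_def)
    have f2: "f p = h p" if "p \<in> cut_R V [c]" for p
      using that unfolding in_cut_R_single by (auto simp: f_def glue_def)
    have gb: "bij_betw g (cut_P V [c]) (cut_P V' [c'])" and g0: "g [] = []"
      and gp: "\<And>p. c # p \<in> V \<Longrightarrow> p \<noteq> [] \<Longrightarrow> g (butlast p) = butlast (g p)"
      and gl: "\<And>p. c # p \<in> V \<Longrightarrow> lab' (c' # g p) = lab (c # p)"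
      using g by (auto simp: tree_isos_def)
    have hb: "bij_betw h (cut_R V [c]) (cut_R V' [c'])" and h0: "h [] = []"
      and hp: "\<And>p. p \<in> cut_R V [c] \<Longrightarrow> p \<noteq> [] \<Longrightarrow> h (butlast p) = butlast (h p)"
      and hl: "\<And>p. p \<in> cut_R V [c] \<Longrightarrow> lab' (h p) = lab p"
      using h by (auto simp: tree_isos_def)
    have Vsplit: "V = cut_R V [c] \<union> (#) c ` cut_P V [c]"
      by (rule split_at_child)
    have V'split: "V' = cut_R V' [c'] \<union> (#) c' ` cut_P V' [c']" "cut_R V' [c'] \<inter> (#) c' ` cut_P V' [c'] = {}"
      by (rule split_at_child) (auto simp: in_cut_R_single)
    have b1: "bij_betw f (cut_R V [c]) (cut_R V' [c'])"
      using hb f2 by (simp cong: bij_betw_cong)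
    have b2: "bij_betw f ((#) c ` cut_P V [c]) ((#) c' ` cut_P V' [c'])"
    proof -
      have "bij_betw ((#) c' \<circ> g \<circ> tl) ((#) c ` cut_P V [c]) ((#) c' ` cut_P V' [c'])"
      proof (rule bij_betw_trans[where B = "cut_P V [c]"])
        show "bij_betw tl ((#) c ` cut_P V [c]) (cut_P V [c])"
          by (auto simp: bij_betw_def inj_on_def image_image)
        show "bij_betw ((#) c' \<circ> g) (cut_P V [c]) ((#) c' ` cut_P V' [c'])"
          by (rule bij_betw_trans[OF gb]) (simp add: bij_betw_def)
      qed
      then show ?thesis
        by (rule iffD1[OF bij_betw_cong, rotated]) (auto simp: f1)
    qed
    have fb: "bij_betw f V V'"
      using bij_betw_combine[OF b1 b2 V'split(2)] Vsplit V'split(1) by simp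
    have R0: "[] \<in> cut_R V [c]" using V by (simp add: in_cut_R_single)
    have "f (butlast p) = butlast (f p)" if p: "p \<in> V" "p \<noteq> []" for p
    proof (cases "hd p = c")
      case True
      then obtain q where q: "p = c # q" using p(2) by (cases p) auto
      show ?thesis
      proof (cases "q = []")
        case True
        then show ?thesis using q p f1 f2[OF R0] h0 g0 by simp
      next
        case False
        have "c # butlast q \<in> V" using ctree_prefix[OF V, of "butlast p" "[last p]"] p q False by simp
        moreover have "g q \<noteq> []"
          using bij_betw_imp_inj_on[OF gb, THEN inj_onD, of q "[]"] False q p c g0 by auto
        ultimately show ?thesis using False q p f1 gp by simp
      qed
    next
      case False
      then have pR: "p \<in> cut_R V [c]" using p by (simp add: in_cut_R_single)
      have "butlast p \<in> cut_R V [c]"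
        using ctree_prefix[OF ctree_cut_R[OF V, of "[c]"], of "butlast p" "[last p]"] p pR by simp
      then show ?thesis using f2 hp pR p by simp
    qed
    moreover have "lab' (f p) = lab p" if p: "p \<in> V" for p
    proof (cases "p \<noteq> [] \<and> hd p = c")
      case True
      then obtain q where q: "p = c # q" by (cases p) auto
      then show ?thesis using p f1 gl by simp
    next
      case False
      then have pR: "p \<in> cut_R V [c]" using p unfolding in_cut_R_single by simp
      then show ?thesis using f2 hl by simp
    qed
    moreover have "f [] = []" using f2[OF R0] h0 by simp
    moreover have "f \<in> extensional V" by (simp add: f_def glue_def)
    ultimately show "glue V c (c', g, h) \<in> ?I"
      using fb unfolding f_def[symmetric] tree_isos_def by simp
  qed
next
  have R: "ctree (cut_R V [c])" using V by (simp add: ctree_cut_R)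
  show "unglue V c \<in> ?I \<rightarrow> ?S"
  proof (safe)
    fix f assume f: "f \<in> ?I"
    obtain c' where c': "f [c] = [c']" "[c'] \<in> V'" using tree_iso_Cons[OF V f c] .
    have fb: "bij_betw f V V'" and f0: "f [] = []"
      and fp: "\<And>p. p \<in> V \<Longrightarrow> p \<noteq> [] \<Longrightarrow> f (butlast p) = butlast (f p)"
      and fl: "\<And>p. p \<in> V \<Longrightarrow> lab' (f p) = lab p"
      using f by (auto simp: tree_isos_def)
    have inj: "inj_on f V" using fb by (simp add: bij_betw_def)
    define g where "g = restrict (\<lambda>q. tl (f (c # q))) (cut_P V [c])"
    have fc: "f (c # q) = c' # g q" if "c # q \<in> V" for q
      using tree_iso_append[OF V f, of "[c]" q] that c' by (auto simp: g_def)
    have fR: "f p \<in> cut_R V' [c']" if p: "p \<in> cut_R V [c]" for p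
    proof (cases p)
      case Nil
      then show ?thesis using f0 V' by (simp add: in_cut_R_single)
    next
      case (Cons d q)
      then have pV: "d # q \<in> V" and d: "d \<noteq> c" using p by (auto simp: in_cut_R_single)
      have dV: "[d] \<in> V" using ctree_hd[OF V pV] .
      obtain d' where d': "f [d] = [d']" using tree_iso_Cons[OF V f dV] by metis
      have "d' \<noteq> c'" using inj_onD[OF inj, of "[d]" "[c]"] c' d' d dV c by auto
      moreover obtain r where "f p = d' # r"
        using tree_iso_append[OF V f, of "[d]" q] pV Cons d' by auto
      moreover have "f p \<in> V'" using fb pV Cons by (auto simp: bij_betw_def)
      ultimately show ?thesis by (simp add: in_cut_R_single)
    qed
    have gb: "bij_betw g (cut_P V [c]) (cut_P V' [c'])"
    proof (rule bij_betw_imageI)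
      show "inj_on g (cut_P V [c])"
        using inj fc by (auto simp: inj_on_def) (metis list.inject)
      show "g ` cut_P V [c] = cut_P V' [c']"
      proof safe
        fix q assume "q \<in> cut_P V [c]"
        then have q: "c # q \<in> V" by simp
        with bij_betwE[OF fb] have "f (c # q) \<in> V'" by blast
        then show "g q \<in> cut_P V' [c']" using fc[OF q] by simp
      next
        fix q assume "q \<in> cut_P V' [c']"
        then have "c' # q \<in> f ` V" using fb by (simp add: bij_betw_def)
        then obtain p where p: "p \<in> V" "f p = c' # q" by auto
        have "p \<notin> cut_R V [c]" using fR[of p] p by (auto simp: in_cut_R_single)
        then obtain r where r: "p = c # r" using p by (cases p) (auto simp: in_cut_R_single)
        then show "q \<in> g ` cut_P V [c]" using fc[of r] p by auto
      qed
    qed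
    have hb: "bij_betw f (cut_R V [c]) (cut_R V' [c'])"
    proof (rule bij_betw_imageI)
      show "inj_on f (cut_R V [c])" using inj by (rule inj_on_subset) (auto simp: in_cut_R_single)
      show "f ` cut_R V [c] = cut_R V' [c']"
      proof safe
        fix p assume "p \<in> cut_R V [c]" then show "f p \<in> cut_R V' [c']" by (rule fR)
      next
        fix p assume p: "p \<in> cut_R V' [c']"
        then have "p \<in> f ` V" using fb by (simp add: bij_betw_def in_cut_R_single)
        then obtain q where q: "q \<in> V" "f q = p" by auto
        have "q \<in> cut_R V [c]"
        proof (rule ccontr)
          assume "q \<notin> cut_R V [c]"
          then obtain r where r: "q = c # r" using q by (cases q) (auto simp: in_cut_R_single)
          then have "p = c' # g r" using fc[of r] q by simp
          then show False using p by (simp add: in_cut_R_single)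
        qed
        then show "p \<in> f ` cut_R V [c]" using q by auto
      qed
    qed
    have "g \<in> tree_isos (cut_P V [c]) (\<lambda>q. lab (c # q)) (cut_P V' [c']) (\<lambda>q. lab' (c' # q))"
      unfolding tree_isos_def
    proof (safe)
      show "g \<in> extensional (cut_P V [c])" by (simp add: g_def)
      show "bij_betw g (cut_P V [c]) (cut_P V' [c'])" by (rule gb)
      show "g [] = []" using fc[of "[]"] c c' by simp
    next
      fix p assume p: "p \<in> cut_P V [c]" "p \<noteq> []"
      have "c # butlast p \<in> V" using ctree_prefix[OF V, of "c # butlast p" "[last p]"] p by simp
      then show "g (butlast p) = butlast (g p)"
        using fc[of p] fc[of "butlast p"] fp[of "c # p"] p
          inj_onD[OF inj, of "c # p" "[c]"] c c' by (auto split: if_splits)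
    next
      fix p assume p: "p \<in> cut_P V [c]"
      then show "lab' (c' # g p) = lab (c # p)" using fc[of p] fl[of "c # p"] by simp
    qed
    moreover have "restrict f (cut_R V [c]) \<in> tree_isos (cut_R V [c]) lab (cut_R V' [c']) lab'"
      unfolding tree_isos_def
    proof (safe)
      show "bij_betw (restrict f (cut_R V [c])) (cut_R V [c]) (cut_R V' [c'])"
        using hb by (simp cong: bij_betw_cong)
      show "restrict f (cut_R V [c]) [] = []" using f0 R by simp
    next
      fix p assume p: "p \<in> cut_R V [c]" "p \<noteq> []"
      have "butlast p \<in> cut_R V [c]" using ctree_prefix[OF R, of "butlast p" "[last p]"] p by simp
      then show "restrict f (cut_R V [c]) (butlast p) = butlast (restrict f (cut_R V [c]) p)"
        using p fp[of p] by (simp add: in_cut_R_single)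
    next
      fix p assume p: "p \<in> cut_R V [c]"
      then show "lab' (restrict f (cut_R V [c]) p) = lab p" using fl[of p] by (simp add: in_cut_R_single)
    qed simp
    ultimately show "unglue V c f \<in> ?S"
      unfolding unglue_def g_def[symmetric] using c' by simp
  qed
next
  fix x assume x: "x \<in> ?S"
  obtain c' g h where xe: "x = (c', g, h)" by (cases x)
  have g: "g \<in> extensional (cut_P V [c])" "g [] = []" and h: "h \<in> extensional (cut_R V [c])"
    using x xe by (auto simp: tree_isos_def)
  have "restrict (\<lambda>q. tl (glue V c x (c # q))) (cut_P V [c]) = g"
    using g by (intro extensionalityI[OF restrict_extensional]) (auto simp: xe glue_def)
  moreover have "restrict (glue V c x) (cut_R V [c]) = h"
    using h by (intro extensionalityI[OF restrict_extensional h]) (auto simp: xe glue_def in_cut_R_single)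
  ultimately show "unglue V c (glue V c x) = x"
    using c by (simp add: unglue_def xe glue_def)
next
  fix f assume f: "f \<in> ?I"
  obtain c' where c': "f [c] = [c']" "[c'] \<in> V'" using tree_iso_Cons[OF V f c] .
  have e: "f \<in> extensional V" using f by (simp add: tree_isos_def)
  show "glue V c (unglue V c f) = f"
  proof (rule extensionalityI[OF _ e])
    show "glue V c (unglue V c f) \<in> extensional V" by (simp add: glue_def unglue_def)
    fix p assume p: "p \<in> V"
    show "glue V c (unglue V c f) p = f p"
    proof (cases "p \<noteq> [] \<and> hd p = c")
      case True
      then obtain q where q: "p = c # q" by (cases p) auto
      then obtain r where "f p = c' # r" using tree_iso_append[OF V f, of "[c]" q] p c' by auto
      then show ?thesis using q p c' by (simp add: glue_def unglue_def)
    next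
      case False
      then show ?thesis using p by (auto simp: glue_def unglue_def in_cut_R_single)
    qed
  qed
qed

section \<open>Symmetry factors and the number of isomorphisms\<close>

primrec sym_factor :: "'a rtree \<Rightarrow> nat" where
  "sym_factor (Node a M) = prod_mset (image_mset sym_factor M) * (\<Prod>t\<in>set_mset M. fact (count M t))"

text \<open>The order of the automorphism group of the forest: equal trees may be permuted, and each
  tree may undergo an automorphism of its own.\<close>

definition forest_sym :: "'a rtree multiset \<Rightarrow> nat" where
  "forest_sym M = prod_mset (image_mset sym_factor M) * (\<Prod>t\<in>set_mset M. fact (count M t))"

lemma sym_factor_branches: "sym_factor t = forest_sym (branches t)"
  by (cases t) (simp add: forest_sym_def)

lemma sym_factor_Node [simp]: "sym_factor (Node a M) = forest_sym M"
  by (simp add: forest_sym_def)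

declare sym_factor.simps [simp del]

lemma forest_sym_empty [simp]: "forest_sym {#} = 1"
  by (simp add: forest_sym_def)

text \<open>A distinguished copy of \<open>t\<close> can go to any of the equal copies, in
  \<open>sym_factor t\<close> ways each, and the remaining trees are mapped independently. In this
  form the formula matches the recursion for isomorphisms.\<close>

lemma forest_sym_add:
  "forest_sym (add_mset t M) = count (add_mset t M) t * sym_factor t * forest_sym M"
proof (cases "t \<in># M")
  case True
  have "(\<Prod>s\<in>set_mset M. fact (count (add_mset t M) s) :: nat) =
      fact (count (add_mset t M) t) * (\<Prod>s\<in>set_mset M - {t}. fact (count M s))"
  proof -
    have "(\<Prod>s\<in>set_mset M - {t}. fact (count (add_mset t M) s)) = (\<Prod>s\<in>set_mset M - {t}. fact (count M s) :: nat)"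
      by (intro prod.cong) auto
    then show ?thesis
      by (simp only: prod.remove[OF finite_set_mset True, of "\<lambda>s. fact (count (add_mset t M) s) :: nat"])
  qed
  moreover have "(\<Prod>s\<in>set_mset M. fact (count M s) :: nat) =
      fact (count M t) * (\<Prod>s\<in>set_mset M - {t}. fact (count M s))" (is "?A = _")
    by (rule prod.remove[OF finite_set_mset True])
  ultimately have "(\<Prod>s\<in>set_mset M. fact (count (add_mset t M) s) :: nat) = Suc (count M t) * ?A"
    by (simp only: count_add_mset if_True simp_thms fact_Suc of_nat_id mult.assoc)
  then show ?thesis using True by (simp add: forest_sym_def insert_absorb algebra_simps)
next
  case False
  have "(\<Prod>s\<in>set_mset M. fact (count (add_mset t M) s)) = (\<Prod>s\<in>set_mset M. fact (count M s) :: nat)"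
    using False by (intro prod.cong) auto
  then show ?thesis using False by (simp add: forest_sym_def not_in_iff algebra_simps)
qed

lemma sym_factor_pos [simp]: "sym_factor t > 0"
proof (induction t)
  case (Node a M)
  have "forest_sym N > 0" if "N \<subseteq># M" for N
    using that
  proof (induction N)
    case (add t N)
    then show ?case
      using Node.IH[of t] mset_subset_eq_insertD[OF add.prems]
      by (simp add: forest_sym_add subset_mset.less_imp_le)
  qed simp
  then show ?case by simp
qed

lemma forest_sym_pos [simp]: "forest_sym M > 0"
  using sym_factor_pos[of "Node undefined M"] by (simp del: sym_factor_pos)

text \<open>Fix a child \<open>c\<close> of the root: its image must be a child with an equal
  branch, and there are \<open>count N t\<close> of those. The single formula shows both that
  \<open>abs_tree\<close> decides isomorphism and that \<alpha>(T) is the symmetry factor.\<close>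

lemma card_tree_isos:
  fixes V :: "'x list set" and V' :: "'y list set"
  assumes "ctree V" "ctree V'"
  shows "finite (tree_isos V lab V' lab') \<and> card (tree_isos V lab V' lab') =
    (if abs_tree V lab = abs_tree V' lab' then sym_factor (abs_tree V lab) else 0)"
  using assms
proof (induction "card V" arbitrary: V V' lab lab' rule: less_induct)
  case less
  note V = \<open>ctree V\<close> and V' = \<open>ctree V'\<close>
  show ?case
  proof (cases "\<exists>c. [c] \<in> V")
    case False
    then have V0: "V = {[]}" using ctree_eq_single[OF V] by auto
    have T: "abs_tree V lab = Node (lab []) {#}"
      using branches_abs_tree_leaf[OF V V0] by (metis root_label_abs_tree rtree.collapse)
    have eq: "abs_tree V lab = abs_tree V' lab' \<longleftrightarrow> V' = {[]} \<and> lab [] = lab' []"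
    proof
      assume A: "abs_tree V lab = abs_tree V' lab'"
      have "branches (abs_tree V' lab') = {#}" using A T by (metis rtree.sel(2))
      then have "[c] \<notin> V'" for c
        using branches_abs_tree_remove[OF V', of c lab'] by auto
      then have "V' = {[]}" by (rule ctree_eq_single[OF V'])
      then show "V' = {[]} \<and> lab [] = lab' []" using A by (metis root_label_abs_tree)
    next
      assume "V' = {[]} \<and> lab [] = lab' []"
      then show "abs_tree V lab = abs_tree V' lab'"
        using T branches_abs_tree_leaf[OF V'] by (metis root_label_abs_tree rtree.collapse)
    qed
    show ?thesis
    proof (cases "V' = {[]} \<and> lab [] = lab' []")
      case True
      then have "tree_isos V lab V' lab' = {restrict (\<lambda>_. []) {[]}}"
        unfolding tree_isos_def V0
        by (auto simp: bij_betw_def intro!: extensionalityI[of _ "{[]}"])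
      then show ?thesis
        using True eq by (simp only: T sym_factor_Node if_True) simp
    next
      case False
      then have "tree_isos V lab V' lab' = {}"
        unfolding tree_isos_def V0 by (auto simp: bij_betw_def)
      then show ?thesis using False eq by auto
    qed
  next
    case True
    then obtain c where c: "[c] \<in> V" by auto
    define t where "t = abs_tree (cut_P V [c]) (\<lambda>q. lab (c # q))"
    define M where "M = branches (abs_tree (cut_R V [c]) lab)"
    define t' where "t' = (\<lambda>c'. abs_tree (cut_P V' [c']) (\<lambda>q. lab' (c' # q)))"
    define N where "N = branches (abs_tree V' lab')"
    have T: "abs_tree V lab = Node (lab []) (add_mset t M)"
      using branches_abs_tree_remove[OF V c] unfolding t_def M_def
      by (metis root_label_abs_tree rtree.collapse)
    have T': "abs_tree V' lab' = Node (lab' []) N"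
      unfolding N_def by (metis root_label_abs_tree rtree.collapse)
    have N: "N = add_mset (t' c') (branches (abs_tree (cut_R V' [c']) lab'))" if "[c'] \<in> V'" for c'
      using branches_abs_tree_remove[OF V' that] by (simp add: N_def t'_def)
    have R: "abs_tree (cut_R V [c]) lab = Node (lab []) M"
      unfolding M_def by (metis root_label_abs_tree rtree.collapse)
    have R': "abs_tree (cut_R V' [c']) lab' = Node (lab' []) (N - {#t' c'#})" if "[c'] \<in> V'" for c'
      using N[OF that] by (metis add_mset_remove_trivial root_label_abs_tree rtree.collapse)
    define I where "I = (\<lambda>c'. tree_isos (cut_P V [c]) (\<lambda>q. lab (c # q)) (cut_P V' [c']) (\<lambda>q. lab' (c' # q)) \<times>
        tree_isos (cut_R V [c]) lab (cut_R V' [c']) lab')"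
    have I: "finite (I c') \<and> card (I c') = (if t = t' c' then sym_factor t else 0) *
        (if lab [] = lab' [] \<and> M = N - {#t' c'#} then forest_sym M else 0)" if c': "[c'] \<in> V'" for c'
    proof -
      have 1: "finite (tree_isos (cut_P V [c]) (\<lambda>q. lab (c # q)) (cut_P V' [c']) (\<lambda>q. lab' (c' # q))) \<and>
          card (tree_isos (cut_P V [c]) (\<lambda>q. lab (c # q)) (cut_P V' [c']) (\<lambda>q. lab' (c' # q))) =
          (if t = t' c' then sym_factor t else 0)"
        unfolding t_def t'_def
        using V V' c c' by (intro less.hyps) (auto intro: card_cut_P_less ctree_cut_P)
      have 2: "finite (tree_isos (cut_R V [c]) lab (cut_R V' [c']) lab') \<and>
          card (tree_isos (cut_R V [c]) lab (cut_R V' [c']) lab') =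
          (if abs_tree (cut_R V [c]) lab = abs_tree (cut_R V' [c']) lab'
           then sym_factor (abs_tree (cut_R V [c]) lab) else 0)"
        using V V' c c' by (intro less.hyps) (auto intro: card_cut_R_less ctree_cut_R)
      show ?thesis
        unfolding I_def using 1 2 R R'[OF c'] by (simp add: card_cartesian_product)
    qed
    have bij: "bij_betw (glue V c) (SIGMA c':{c'. [c'] \<in> V'}. I c') (tree_isos V lab V' lab')"
      unfolding I_def by (rule bij_betw_glue[OF V V' c])
    have fin: "finite (tree_isos V lab V' lab')"
      using bij I V' by (intro iffD1[OF bij_betw_finite[OF bij]] finite_SigmaI) auto
    have "card (tree_isos V lab V' lab') = (\<Sum>c'\<in>{c'. [c'] \<in> V'}. card (I c'))"
      using bij_betw_same_card[OF bij] I V' by (simp add: card_SigmaI)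
    also have "\<dots> = (\<Sum>c'\<in>{c'. [c'] \<in> V'}. (if t = t' c' then sym_factor t else 0) *
        (if lab [] = lab' [] \<and> M = N - {#t' c'#} then forest_sym M else 0))"
      using I by (intro sum.cong) auto
    also have "\<dots> = (\<Sum>s\<in>#N. (if t = s then sym_factor t else 0) *
        (if lab [] = lab' [] \<and> M = N - {#s#} then forest_sym M else 0))"
      unfolding N_def abs_tree_ctree[OF V'] t'_def rtree.sel
      by (simp add: sum_unfold_sum_mset image_mset.compositionality o_def)
    also have "\<dots> = (\<Sum>s\<in>#N. if s = t then sym_factor t *
        (if lab [] = lab' [] \<and> M = N - {#t#} then forest_sym M else 0) else 0)"
      by (rule sum_mset_cong) auto
    also have "\<dots> = count N t * (sym_factor t *
        (if lab [] = lab' [] \<and> M = N - {#t#} then forest_sym M else 0))"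
      by (simp add: sum_mset_delta)
    also have "\<dots> = (if abs_tree V lab = abs_tree V' lab' then sym_factor (abs_tree V lab) else 0)"
    proof (cases "lab [] = lab' [] \<and> N = add_mset t M")
      case True
      then show ?thesis by (simp add: T T' forest_sym_add algebra_simps)
    next
      case False
      then have ne: "abs_tree V lab \<noteq> abs_tree V' lab'" by (auto simp: T T')
      have "count N t = 0 \<or> \<not> (lab [] = lab' [] \<and> M = N - {#t#})"
        using False by (metis insert_DiffM not_in_iff)
      then show ?thesis by (elim disjE) (simp_all only: ne if_False mult_0 mult_0_right)
    qed
    finally show ?thesis using fin by simp
  qed
qed

subsection \<open>The standard concrete representative\<close>

lemma verts_Node:
  "verts (Node a M) = insert [] (\<Union>c\<in>{(t, i). i < count M t}. (#) c ` verts (fst c))"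
proof (intro equalityI subsetI)
  fix p assume "p \<in> verts (Node a M)"
  then show "p \<in> insert [] (\<Union>c\<in>{(t, i). i < count M t}. (#) c ` verts (fst c))"
    by (cases p) (auto simp: verts_def image_iff)
qed (auto simp: verts_def)

lemma Cons_in_verts: "c # q \<in> verts T \<longleftrightarrow> snd c < count (branches T) (fst c) \<and> q \<in> verts (fst c)"
  by (cases c) (simp add: verts_def)

lemma Nil_in_verts [simp]: "[] \<in> verts T"
  by (simp add: verts_def)

lemma root_children_eq: "root_children T = {(t, i). i < count (branches T) t}"
  by (auto simp: root_children_def Cons_in_verts)

lemma finite_count_pairs [simp]: "finite {(t, i). i < count M t}"
proof -
  have "{(t, i). i < count M t} = (SIGMA t:set_mset M. {..<count M t})"
    by (auto simp: intro: count_inI)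
  then show ?thesis by simp
qed

lemma finite_root_children [simp]: "finite (root_children T)"
  by (simp add: root_children_eq)

lemma image_mset_count_pairs: "image_mset fst (mset_set {(t, i). i < count M t}) = M"
proof (rule multiset_eqI)
  fix x
  have "{c. c \<in> {(t, i). i < count M t} \<and> x = fst c} = Pair x ` {..<count M x}"
    by auto
  then show "count (image_mset fst (mset_set {(t, i). i < count M t})) x = count M x"
    by (simp add: count_image_mset' sum.reindex inj_on_def)
qed

lemma image_mset_root_children: "image_mset fst (mset_set (root_children T)) = branches T"
  by (simp add: root_children_eq image_mset_count_pairs)

lemma root_children_in_branches: "c \<in> root_children T \<Longrightarrow> fst c \<in># branches T"
  by (auto simp: root_children_eq) (metis count_greater_zero_iff less_nat_zero_code neq0_conv)

lemma ctree_verts [simp]: "ctree (verts T)"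
proof (induction T)
  case (Node a M)
  have fin: "finite (verts (Node a M))"
    unfolding verts_Node using Node.IH root_children_in_branches[of _ "Node a M"]
    by (auto simp: root_children_eq)
  have "p \<in> verts (Node a M)" if "p @ q \<in> verts (Node a M)" for p q
  proof (cases p)
    case (Cons c r)
    then have "r @ q \<in> verts (fst c)" "snd c < count M (fst c)"
      using that by (auto simp: Cons_in_verts)
    moreover from this have "fst c \<in># M" by (metis count_inI less_nat_zero_code)
    ultimately show ?thesis using Node.IH[of "fst c"] Cons by (auto simp: Cons_in_verts ctree_def)
  qed simp
  with fin show ?case unfolding ctree_def by auto
qed

lemma cut_P_verts: "c \<in> root_children T \<Longrightarrow> cut_P (verts T) [c] = verts (fst c)"
  by (auto simp: root_children_def Cons_in_verts)

lemma abs_tree_verts [simp]: "abs_tree (verts T) (label_at T) = T"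
proof (induction T)
  case (Node a M)
  have l: "(\<lambda>q. label_at (Node a M) (c # q)) = label_at (fst c)" for c
    by (cases c) auto
  have "{c. [c] \<in> verts (Node a M)} = root_children (Node a M)"
    by (simp add: root_children_def)
  then have "abs_tree (verts (Node a M)) (label_at (Node a M)) = Node a
      (image_mset (\<lambda>c. abs_tree (cut_P (verts (Node a M)) [c]) (label_at (fst c)))
        (mset_set (root_children (Node a M))))"
    by (simp add: abs_tree_ctree l)
  also have "image_mset (\<lambda>c. abs_tree (cut_P (verts (Node a M)) [c]) (label_at (fst c)))
        (mset_set (root_children (Node a M))) = image_mset fst (mset_set (root_children (Node a M)))"
    using Node.IH root_children_in_branches[of _ "Node a M"]
    by (intro image_mset_cong) (auto simp: cut_P_verts)
  finally show ?case by (simp add: image_mset_root_children)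
qed

text \<open>Symmetry factors are positive, so isomorphisms exist exactly when the abstract trees
  agree; hence the definite description denotes.\<close>

lemma tree_class_eq:
  assumes "ctree V"
  shows "tree_class V lab = abs_tree V lab"
proof -
  have "tree_isos V lab (verts T) (label_at T) \<noteq> {} \<longleftrightarrow> T = abs_tree V lab" for T
    using card_tree_isos[OF assms ctree_verts, of lab T "label_at T"]
    by (metis abs_tree_verts card_eq_0_iff less_irrefl sym_factor_pos)
  then show ?thesis by (simp add: tree_class_def)
qed

lemma num_auts_eq: "num_auts T = sym_factor T"
  using card_tree_isos[OF ctree_verts ctree_verts, of T "label_at T" T "label_at T"]
  by (simp add: num_auts_def)

section \<open>Grafting is adjoint to cutting\<close>

text \<open>\<open>fpair\<close> and \<open>tpair\<close> count the isomorphisms between two forests or trees.\<close>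

definition fpair :: "'a rtree multiset \<Rightarrow> 'a rtree multiset \<Rightarrow> nat" where
  "fpair M N = (if M = N then forest_sym M else 0)"

definition tpair :: "'a rtree \<Rightarrow> 'a rtree \<Rightarrow> nat" where
  "tpair t u = (if t = u then sym_factor t else 0)"

lemma tpair_fpair: "tpair t u = (if root_label t = root_label u then fpair (branches t) (branches u) else 0)"
  by (auto simp: tpair_def fpair_def sym_factor_branches rtree.expand)

lemma fpair_empty: "fpair {#} N = (if N = {#} then 1 else 0)"
  by (auto simp: fpair_def)

text \<open>An isomorphism sends the distinguished tree to one of the trees of \<open>N\<close>; the
  sum over the multiset runs through equal copies separately.\<close>

lemma fpair_add: "fpair (add_mset t M) N = (\<Sum>n\<in>#N. tpair t n * fpair M (N - {#n#}))"
proof -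
  have "(\<Sum>n\<in>#N. tpair t n * fpair M (N - {#n#})) =
      (\<Sum>n\<in>#N. if n = t then sym_factor t * fpair M (N - {#t#}) else 0)"
    by (rule sum_mset_cong) (auto simp: tpair_def)
  also have "\<dots> = count N t * (sym_factor t * fpair M (N - {#t#}))"
    by (simp add: sum_mset_delta)
  also have "\<dots> = fpair (add_mset t M) N"
  proof (cases "N = add_mset t M")
    case False
    then have "count N t = 0 \<or> fpair M (N - {#t#}) = 0"
      by (metis fpair_def insert_DiffM not_in_iff)
    moreover have "fpair (add_mset t M) N = 0" using False by (simp add: fpair_def)
    ultimately show ?thesis by auto
  qed (simp add: fpair_def forest_sym_add algebra_simps)
  finally show ?thesis by simp
qed

lemma sum_sum_mset_swap: "(\<Sum>i\<in>A. \<Sum>n\<in>#P. g i n) = (\<Sum>n\<in>#P. \<Sum>i\<in>A. g i n)"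
  by (induction P) (simp_all add: sum.distrib)

lemma sum_mset_product_sum:
  fixes f g :: "'i \<Rightarrow> 'p \<Rightarrow> 'e::comm_semiring_0"
  shows "(\<Sum>i\<in>A. (\<Sum>p\<in>#P. f i p * b p) * (\<Sum>q\<in>#Q. g i q * d q)) =
    (\<Sum>p\<in>#P. \<Sum>q\<in>#Q. (\<Sum>i\<in>A. f i p * g i q) * (b p * d q))"
proof -
  have "(\<Sum>i\<in>A. (\<Sum>p\<in>#P. f i p * b p) * (\<Sum>q\<in>#Q. g i q * d q)) =
      (\<Sum>i\<in>A. \<Sum>p\<in>#P. \<Sum>q\<in>#Q. f i p * b p * (g i q * d q))"
    by (simp only: sum_mset_distrib_right, simp only: sum_mset_distrib_left)
  also have "\<dots> = (\<Sum>p\<in>#P. \<Sum>q\<in>#Q. \<Sum>i\<in>A. f i p * b p * (g i q * d q))"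
    by (simp only: sum_sum_mset_swap)
  also have "\<dots> = (\<Sum>p\<in>#P. \<Sum>q\<in>#Q. (\<Sum>i\<in>A. f i p * g i q) * (b p * d q))"
    unfolding sum_distrib_right by (intro sum_mset_cong sum.cong refl) (simp add: mult_ac)
  finally show ?thesis .
qed

text \<open>An isomorphism onto a disjoint union is a choice of the trees that go to the first
  summand, with an isomorphism on each side. Union is thereby adjoint to the coproduct that
  distributes branches; the same identity also distributes the branches to be grafted.\<close>

lemma fpair_sum_subsets:
  assumes "finite C"
  shows "(\<Sum>I\<in>Pow C. fpair (image_mset b (mset_set I)) P * fpair (image_mset b (mset_set (C - I))) Q) =
    fpair (image_mset b (mset_set C)) (P + Q)"
  using assms
proof (induction C arbitrary: P Q rule: finite_induct)
  case empty
  show ?case by (simp add: fpair_empty)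
next
  case (insert c C)
  let ?b = "\<lambda>I. image_mset b (mset_set I)"
  have fin: "finite I" if "I \<in> Pow C" for I using that insert.hyps(1) by (auto intro: finite_subset)
  have "(\<Sum>I\<in>Pow (insert c C). fpair (?b I) P * fpair (?b (insert c C - I)) Q) =
      (\<Sum>I\<in>Pow C. fpair (?b I) P * fpair (?b (insert c C - I)) Q) +
      (\<Sum>I\<in>insert c ` Pow C. fpair (?b I) P * fpair (?b (insert c C - I)) Q)"
    unfolding Pow_insert using insert.hyps by (intro sum.union_disjoint) auto
  also have "(\<Sum>I\<in>insert c ` Pow C. fpair (?b I) P * fpair (?b (insert c C - I)) Q) =
      (\<Sum>I\<in>Pow C. fpair (?b (insert c I)) P * fpair (?b (insert c C - insert c I)) Q)"
  proof (rule sum.reindex[unfolded o_def], rule inj_onI)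
    fix I J assume "I \<in> Pow C" "J \<in> Pow C" "insert c I = insert c J"
    then show "I = J" using insert.hyps(2) insert_ident[of c I J] by auto
  qed
  also have "\<dots> = (\<Sum>I\<in>Pow C. (\<Sum>n\<in>#P. tpair (b c) n * fpair (?b I) (P - {#n#})) * fpair (?b (C - I)) Q)"
  proof (rule sum.cong)
    fix I assume I: "I \<in> Pow C"
    then have "c \<notin> I" "insert c C - insert c I = C - I" using insert.hyps by auto
    then show "fpair (?b (insert c I)) P * fpair (?b (insert c C - insert c I)) Q =
        (\<Sum>n\<in>#P. tpair (b c) n * fpair (?b I) (P - {#n#})) * fpair (?b (C - I)) Q"
      using fin[OF I] by (simp add: fpair_add)
  qed simp
  also have "\<dots> = (\<Sum>n\<in>#P. tpair (b c) n * (\<Sum>I\<in>Pow C. fpair (?b I) (P - {#n#}) * fpair (?b (C - I)) Q))"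
    by (simp add: sum_mset_distrib_right sum_sum_mset_swap sum_distrib_left mult.assoc)
  also have "\<dots> = (\<Sum>n\<in>#P. tpair (b c) n * fpair (?b C) (P + Q - {#n#}))"
    by (rule sum_mset_cong) (auto simp: insert.IH dest!: multi_member_split)
  also have "(\<Sum>I\<in>Pow C. fpair (?b I) P * fpair (?b (insert c C - I)) Q) =
      (\<Sum>I\<in>Pow C. fpair (?b I) P * (\<Sum>n\<in>#Q. tpair (b c) n * fpair (?b (C - I)) (Q - {#n#})))"
  proof (rule sum.cong)
    fix I assume I: "I \<in> Pow C"
    then have "insert c C - I = insert c (C - I)" "c \<notin> C - I" using insert.hyps by auto
    then show "fpair (?b I) P * fpair (?b (insert c C - I)) Q =
        fpair (?b I) P * (\<Sum>n\<in>#Q. tpair (b c) n * fpair (?b (C - I)) (Q - {#n#}))"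
      using insert.hyps by (simp add: fpair_add)
  qed simp
  also have "\<dots> = (\<Sum>n\<in>#Q. tpair (b c) n * (\<Sum>I\<in>Pow C. fpair (?b I) P * fpair (?b (C - I)) (Q - {#n#})))"
    by (simp add: sum_mset_distrib_left sum_sum_mset_swap sum_distrib_left mult.left_commute)
  also have "\<dots> = (\<Sum>n\<in>#Q. tpair (b c) n * fpair (?b C) (P + Q - {#n#}))"
    by (rule sum_mset_cong) (auto simp: insert.IH dest!: multi_member_split)
  finally show ?case
    using insert.hyps by (simp add: fpair_add add.commute)
qed

text \<open>Each tree of a trunk is what is left of one tree \<open>n\<close> of the forest whose
  root is kept; the cut then consists of a cut of the branches of \<open>n\<close> and a cut of the
  other trees.\<close>

lemma sum_cop_pick:
  fixes N :: "'a rtree multiset" and \<phi> :: "_ \<Rightarrow> _ \<Rightarrow> _ \<Rightarrow> 'e::comm_monoid_add"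
  shows "(\<Sum>p\<in>#cop N. \<Sum>r\<in>#snd p. \<phi> (fst p) r (snd p - {#r#})) =
    (\<Sum>n\<in>#N. \<Sum>p\<in>#cop (branches n). \<Sum>q\<in>#cop (N - {#n#}).
      \<phi> (fst p + fst q) (Node (root_label n) (snd p)) (snd q))"
proof (induction N arbitrary: \<phi>)
  case (add t N)
  obtain a M where t: "t = Node a M" by (cases t)
  have e: "add_mset t N = {#t#} + N" by simp
  have "(\<Sum>p\<in>#cop (add_mset t N). \<Sum>r\<in>#snd p. \<phi> (fst p) r (snd p - {#r#})) =
      (\<Sum>p\<in>#cop {#t#}. \<Sum>q\<in>#cop N. \<Sum>r\<in>#snd p + snd q. \<phi> (fst p + fst q) r (snd p + snd q - {#r#}))"
    unfolding e sum_cop_union by simp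
  also have "\<dots> = (\<Sum>p\<in>#cop {#t#}. \<Sum>q\<in>#cop N. \<Sum>r\<in>#snd p. \<phi> (fst p + fst q) r (snd p - {#r#} + snd q)) +
      (\<Sum>p\<in>#cop {#t#}. \<Sum>q\<in>#cop N. \<Sum>r\<in>#snd q. \<phi> (fst p + fst q) r (snd p + (snd q - {#r#})))"
    unfolding sum_mset.distrib[symmetric] image_mset_union sum_mset.union
    by (intro sum_mset_cong arg_cong2[where f = plus]) (auto dest!: multi_member_split)
  also have "(\<Sum>p\<in>#cop {#t#}. \<Sum>q\<in>#cop N. \<Sum>r\<in>#snd p. \<phi> (fst p + fst q) r (snd p - {#r#} + snd q)) =
      (\<Sum>p\<in>#cop (branches t). \<Sum>q\<in>#cop N. \<phi> (fst p + fst q) (Node (root_label t) (snd p)) (snd q))"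
    unfolding t sum_cop_Node by simp
  also have "(\<Sum>p\<in>#cop {#t#}. \<Sum>q\<in>#cop N. \<Sum>r\<in>#snd q. \<phi> (fst p + fst q) r (snd p + (snd q - {#r#}))) =
      (\<Sum>q\<in>#cop N. \<Sum>p\<in>#cop {#t#}. \<Sum>r\<in>#snd q. \<phi> (fst p + fst q) r (snd p + (snd q - {#r#})))"
    by (rule sum_mset.swap)
  also have "\<dots> = (\<Sum>q\<in>#cop N. \<Sum>r\<in>#snd q. \<Sum>p\<in>#cop {#t#}. \<phi> (fst p + fst q) r (snd p + (snd q - {#r#})))"
    by (intro sum_mset_cong sum_mset.swap)
  also have "\<dots> = (\<Sum>n\<in>#N. \<Sum>p\<in>#cop (branches n). \<Sum>q\<in>#cop (N - {#n#}). \<Sum>s\<in>#cop {#t#}.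
      \<phi> (fst s + (fst p + fst q)) (Node (root_label n) (snd p)) (snd s + snd q))"
    by (rule add.IH[where \<phi> = "\<lambda>A r B. \<Sum>p\<in>#cop {#t#}. \<phi> (fst p + A) r (snd p + B)"])
  also have "\<dots> = (\<Sum>n\<in>#N. \<Sum>p\<in>#cop (branches n). \<Sum>q\<in>#cop (add_mset t N - {#n#}).
      \<phi> (fst p + fst q) (Node (root_label n) (snd p)) (snd q))"
  proof (intro sum_mset_cong)
    fix n p assume "n \<in># N"
    then have e: "add_mset t N - {#n#} = {#t#} + (N - {#n#})" by (auto dest!: multi_member_split)
    show "(\<Sum>q\<in>#cop (N - {#n#}). \<Sum>s\<in>#cop {#t#}.
          \<phi> (fst s + (fst p + fst q)) (Node (root_label n) (snd p)) (snd s + snd q)) =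
        (\<Sum>q\<in>#cop (add_mset t N - {#n#}). \<phi> (fst p + fst q) (Node (root_label n) (snd p)) (snd q))"
      unfolding e sum_cop_union by (subst sum_mset.swap) (simp add: add.left_commute)
  qed
  finally show ?case by simp
qed simp

section \<open>Grafting on concrete trees and its recursion\<close>

definition graft_set ::
  "('a rtree \<times> nat) set \<Rightarrow> 'a rtree \<Rightarrow> ('a rtree \<times> nat \<Rightarrow> 'a tpath) \<Rightarrow>
    (('a rtree \<times> nat) + ('a rtree \<times> nat)) list set" where
  "graft_set C S f = map Inl ` verts S \<union>
    {map Inl (f c) @ Inr c # map Inr q | c q. c \<in> C \<and> q \<in> verts (fst c)}"

lemma graft_setI1: "v \<in> verts S \<Longrightarrow> p = map Inl v \<Longrightarrow> p \<in> graft_set C S f"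
  unfolding graft_set_def by blast

lemma graft_setI2:
  "c \<in> C \<Longrightarrow> q \<in> verts (fst c) \<Longrightarrow> p = map Inl (f c) @ Inr c # map Inr q \<Longrightarrow> p \<in> graft_set C S f"
  unfolding graft_set_def by blast

definition graft_label :: "'a rtree \<Rightarrow> 'a rtree \<Rightarrow> (('a rtree \<times> nat) + ('a rtree \<times> nat)) list \<Rightarrow> 'a" where
  "graft_label T S p = (if list_all isl p then label_at S (map projl p)
     else label_at T (map projr (dropWhile isl p)))"

text \<open>In contrast to \<open>graft\<close>, the grafted branches form an arbitrary set
  \<open>C\<close>, since the recursion into a branch of \<open>S\<close> keeps only those that are
  sent there. \<open>T\<close> enters through the label function.\<close>

definition graft_tree ::
  "'a rtree \<Rightarrow> ('a rtree \<times> nat) set \<Rightarrow> 'a rtree \<Rightarrow> ('a rtree \<times> nat \<Rightarrow> 'a tpath) \<Rightarrow> 'a rtree" where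
  "graft_tree T C S f = abs_tree (graft_set C S f) (graft_label T S)"

lemma ctree_take: "ctree V \<Longrightarrow> p \<in> V \<Longrightarrow> take n p \<in> V"
  by (metis append_take_drop_id ctree_prefix)

lemma ctreeI_take: "finite V \<Longrightarrow> [] \<in> V \<Longrightarrow> (\<And>p n. p \<in> V \<Longrightarrow> take n p \<in> V) \<Longrightarrow> ctree V"
  unfolding ctree_def by (metis append_eq_conv_conj)

lemma ctree_graft_set:
  assumes C: "finite C" and f: "\<And>c. c \<in> C \<Longrightarrow> f c \<in> verts S"
  shows "ctree (graft_set C S f)"
proof (rule ctreeI_take)
  have "graft_set C S f = map Inl ` verts S \<union>
      (\<Union>c\<in>C. (\<lambda>q. map Inl (f c) @ Inr c # map Inr q) ` verts (fst c))"
    by (auto simp: graft_set_def)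
  then show "finite (graft_set C S f)" using C by simp
  show "[] \<in> graft_set C S f" by (auto simp: graft_set_def)
  fix p n assume "p \<in> graft_set C S f"
  then consider v where "v \<in> verts S" "p = map Inl v"
    | c q where "c \<in> C" "q \<in> verts (fst c)" "p = map Inl (f c) @ Inr c # map Inr q"
    by (auto simp: graft_set_def)
  then show "take n p \<in> graft_set C S f"
  proof cases
    case 1
    then show ?thesis using ctree_take[OF ctree_verts] by (auto simp: graft_set_def take_map)
  next
    case (2 c q)
    show ?thesis
    proof (cases "n \<le> length (f c)")
      case True
      then have "take n p = map Inl (take n (f c))" using 2 by (simp add: take_map)
      moreover have "take n (f c) \<in> verts S" using ctree_take[OF ctree_verts f[OF \<open>c \<in> C\<close>]] .
      ultimately show ?thesis by (auto simp: graft_set_def)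
    next
      case False
      then obtain k where "n - length (f c) = Suc k" by (metis Suc_diff_Suc not_le)
      then have "take n p = map Inl (f c) @ Inr c # map Inr (take k q)"
        using False 2 by (simp add: take_map)
      moreover have "take k q \<in> verts (fst c)" using 2 ctree_take[OF ctree_verts] by auto
      ultimately show ?thesis unfolding graft_set_def using 2(1) by blast
    qed
  qed
qed

lemma abs_tree_map:
  assumes g: "inj g" and V: "ctree V"
  shows "abs_tree (map g ` V) lab = abs_tree V (lab \<circ> map g)"
proof -
  have V': "ctree (map g ` V)"
    using V by (intro ctreeI_take) (auto simp: take_map ctree_take)
  have "restrict (map g) V \<in> tree_isos V (lab \<circ> map g) (map g ` V) lab"
  proof -
    have "butlast p \<in> V" if "p \<in> V" for p using ctree_take[OF V that] by (simp add: butlast_conv_take)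
    moreover have "bij_betw (restrict (map g) V) V (map g ` V)"
      using g by (auto simp: bij_betw_def inj_on_def inj_map_eq_map)
    ultimately show ?thesis using V by (auto simp: tree_isos_def map_butlast)
  qed
  then show ?thesis
    using card_tree_isos[OF V V', of "lab \<circ> map g" lab] by (metis card_eq_0_iff empty_iff)
qed

lemma graft_tree_cong:
  "(\<And>c. c \<in> C \<Longrightarrow> f c = g c) \<Longrightarrow> graft_tree T C S f = graft_tree T C S g"
  unfolding graft_tree_def graft_set_def by (rule arg_cong2[where f = abs_tree]) force+

lemma root_label_graft_tree [simp]: "root_label (graft_tree T C S f) = root_label S"
  by (simp add: graft_tree_def graft_label_def)

text \<open>The new root has as children the branches grafted at \<open>[]\<close> and the old
  children \<open>d\<close>, each of which has absorbed the branches whose target starts with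
  \<open>d\<close>. This is the recursion over \<open>S\<close> behind the adjunction.\<close>

lemma branches_graft_tree:
  assumes C: "finite C" and f: "\<And>c. c \<in> C \<Longrightarrow> f c \<in> verts S"
  shows "branches (graft_tree T C S f) = image_mset fst (mset_set {c \<in> C. f c = []}) +
    image_mset (\<lambda>d. graft_tree T {c \<in> C. f c \<noteq> [] \<and> hd (f c) = d} (fst d) (tl \<circ> f)) (mset_set (root_children S))"
proof -
  let ?G = "graft_set C S f"
  let ?sub = "\<lambda>x. abs_tree (cut_P ?G [x]) (\<lambda>q. graft_label T S (x # q))"
  have G: "ctree ?G" by (rule ctree_graft_set[OF C f])
  have kids: "{x. [x] \<in> ?G} = Inr ` {c \<in> C. f c = []} \<union> Inl ` root_children S" (is "?L = ?R")
  proof (intro equalityI subsetI)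
    fix x assume "x \<in> ?L"
    then consider v where "v \<in> verts S" "[x] = map Inl v"
      | c q where "c \<in> C" "q \<in> verts (fst c)" "[x] = map Inl (f c) @ Inr c # map Inr q"
      by (auto simp: graft_set_def)
    then show "x \<in> ?R"
    proof cases
      case 1
      then show ?thesis by (auto simp: root_children_def)
    next
      case (2 c q)
      then have "f c = []" "x = Inr c" by (cases "f c"; auto)+
      then show ?thesis using 2 by auto
    qed
  next
    fix x assume "x \<in> ?R"
    then show "x \<in> ?L"
    proof
      assume "x \<in> Inr ` {c \<in> C. f c = []}"
      then obtain c where "c \<in> C" "f c = []" "x = Inr c" by auto
      then show ?thesis by (auto intro: graft_setI2[of c _ "[]"])
    next
      assume "x \<in> Inl ` root_children S"
      then obtain d where "[d] \<in> verts S" "x = Inl d" by (auto simp: root_children_def)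
      then show ?thesis by (auto intro: graft_setI1[of "[d]"])
    qed
  qed
  have Inr: "?sub (Inr c) = fst c" if c: "c \<in> C" "f c = []" for c
  proof -
    have "cut_P ?G [Inr c] = map Inr ` verts (fst c)"
    proof (intro equalityI subsetI)
      fix p assume "p \<in> cut_P ?G [Inr c]"
      then obtain c' q where "c' \<in> C" "q \<in> verts (fst c')" "Inr c # p = map Inl (f c') @ Inr c' # map Inr q"
        by (auto simp: graft_set_def)
      then show "p \<in> map Inr ` verts (fst c)" by (cases "f c'") auto
    next
      fix p :: "('a rtree \<times> nat + 'a rtree \<times> nat) list" assume "p \<in> map Inr ` verts (fst c)"
      then show "p \<in> cut_P ?G [Inr c]" using c by (auto intro: graft_setI2[of c])
    qed
    moreover have "(\<lambda>q. graft_label T S (Inr c # q)) \<circ> map Inr = label_at (fst c)"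
      by (cases c) (auto simp: graft_label_def fun_eq_iff o_def)
    ultimately show ?thesis by (simp add: abs_tree_map)
  qed
  have Inl: "?sub (Inl d) = graft_tree T {c \<in> C. f c \<noteq> [] \<and> hd (f c) = d} (fst d) (tl \<circ> f)"
    if d: "d \<in> root_children S" for d
  proof -
    have "cut_P ?G [Inl d] = graft_set {c \<in> C. f c \<noteq> [] \<and> hd (f c) = d} (fst d) (tl \<circ> f)"
    proof (intro equalityI subsetI)
      fix p assume "p \<in> cut_P ?G [Inl d]"
      then consider v where "v \<in> verts S" "Inl d # p = map Inl v"
        | c q where "c \<in> C" "q \<in> verts (fst c)" "Inl d # p = map Inl (f c) @ Inr c # map Inr q"
        by (auto simp: graft_set_def)
      then show "p \<in> graft_set {c \<in> C. f c \<noteq> [] \<and> hd (f c) = d} (fst d) (tl \<circ> f)"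
      proof cases
        case 1
        then show ?thesis by (cases v) (auto intro: graft_setI1 simp: Cons_in_verts)
      next
        case (2 c q)
        then have "f c \<noteq> []" "hd (f c) = d" "p = map Inl (tl (f c)) @ Inr c # map Inr q"
          by (cases "f c"; auto)+
        then show ?thesis using 2 by (intro graft_setI2[of c _ q]) auto
      qed
    next
      fix p assume "p \<in> graft_set {c \<in> C. f c \<noteq> [] \<and> hd (f c) = d} (fst d) (tl \<circ> f)"
      then consider v where "v \<in> verts (fst d)" "p = map Inl v"
        | c q where "c \<in> C" "f c \<noteq> []" "hd (f c) = d" "q \<in> verts (fst c)"
          "p = map Inl (tl (f c)) @ Inr c # map Inr q"
        by (auto simp: graft_set_def)
      then show "p \<in> cut_P ?G [Inl d]"
      proof cases
        case 1
        then have "d # v \<in> verts S" using d by (auto simp: root_children_eq Cons_in_verts)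
        then show ?thesis using 1 by (auto intro: graft_setI1[of "d # v"])
      next
        case (2 c q)
        then have "Inl d # p = map Inl (f c) @ Inr c # map Inr q" by (cases "f c") auto
        then show ?thesis using 2 by (auto intro: graft_setI2[of c _ q])
      qed
    qed
    moreover have "(\<lambda>q. graft_label T S (Inl d # q)) = graft_label T (fst d)"
      by (cases d) (auto simp: graft_label_def fun_eq_iff)
    ultimately show ?thesis by (simp add: graft_tree_def)
  qed
  have "branches (graft_tree T C S f) = image_mset ?sub (mset_set {x. [x] \<in> ?G})"
    unfolding graft_tree_def abs_tree_ctree[OF G] by simp
  also have "mset_set {x. [x] \<in> ?G} = image_mset Inr (mset_set {c \<in> C. f c = []}) + image_mset Inl (mset_set (root_children S))"
    unfolding kids using C by (subst mset_set_Union) (auto simp: image_mset_mset_set)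
  finally show ?thesis
    using C by (auto simp: image_mset.compositionality o_def Inr Inl intro!: arg_cong2[where f = plus] image_mset_cong)
qed

definition graft_forest ::
  "'a rtree \<Rightarrow> ('a rtree \<times> nat) set \<Rightarrow> ('a rtree \<times> nat) set \<Rightarrow> ('a rtree \<times> nat \<Rightarrow> 'a tpath) \<Rightarrow> 'a rtree multiset" where
  "graft_forest T C D f = image_mset fst (mset_set {c \<in> C. f c = []}) +
    image_mset (\<lambda>d. graft_tree T {c \<in> C. f c \<noteq> [] \<and> hd (f c) = d} (fst d) (tl \<circ> f)) (mset_set D)"

definition forest_verts :: "('a rtree \<times> nat) set \<Rightarrow> 'a tpath set" where
  "forest_verts D = insert [] (\<Union>d\<in>D. (#) d ` verts (fst d))"

text \<open>A function into the disjoint union amounts to the set \<open>I\<close> of arguments sent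
  to the second part, a function on \<open>I\<close> and one on the complement. For a child
  \<open>d\<close> of the root, this sorts graftings by what lands in the branch at
  \<open>d\<close>.\<close>

lemma sum_split_functions:
  fixes G :: "('c \<Rightarrow> 'd list) \<Rightarrow> 'e::comm_monoid_add"
  assumes C: "finite C" and A: "finite A" and B: "finite B"
    and d: "\<And>p. p \<in> B \<Longrightarrow> p \<noteq> [] \<Longrightarrow> hd p \<noteq> d"
  shows "(\<Sum>f\<in>C \<rightarrow>\<^sub>E B \<union> (#) d ` A. G f) = (\<Sum>I\<in>Pow C. \<Sum>g\<in>I \<rightarrow>\<^sub>E A. \<Sum>h\<in>(C - I) \<rightarrow>\<^sub>E B.
    G (restrict (\<lambda>c. if c \<in> I then d # g c else h c) C))"
proof -
  let ?S = "SIGMA I:Pow C. (I \<rightarrow>\<^sub>E A) \<times> ((C - I) \<rightarrow>\<^sub>E B)"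
  let ?i = "\<lambda>(I, g, h). restrict (\<lambda>c. if c \<in> I then d # g c else h c) C"
  let ?I = "\<lambda>f :: 'c \<Rightarrow> 'd list. {c \<in> C. f c \<noteq> [] \<and> hd (f c) = d}"
  have finI: "finite I" if "I \<in> Pow C" for I using that C by (auto intro: finite_subset)
  have "(\<Sum>f\<in>C \<rightarrow>\<^sub>E B \<union> (#) d ` A. G f) = (\<Sum>x\<in>?S. G (?i x))"
  proof (rule sum.reindex_bij_witness[where i = ?i and
        j = "\<lambda>f. (?I f, restrict (\<lambda>c. tl (f c)) (?I f), restrict f (C - ?I f))"])
    fix f assume f: "f \<in> C \<rightarrow>\<^sub>E B \<union> (#) d ` A"
    have m: "f c \<in> B \<union> (#) d ` A" if "c \<in> C" for c using f that by auto
    show ij: "?i (?I f, restrict (\<lambda>c. tl (f c)) (?I f), restrict f (C - ?I f)) = f"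
      using f by (intro extensionalityI[where A = C]) (auto simp: PiE_def)
    show "G (?i (?I f, restrict (\<lambda>c. tl (f c)) (?I f), restrict f (C - ?I f))) = G f"
      by (simp only: ij)
    have "tl (f c) \<in> A" if c: "c \<in> ?I f" for c
    proof -
      have "f c \<notin> B" using c d[of "f c"] by auto
      then obtain q where "f c = d # q" "q \<in> A" using m[of c] c by auto
      then show ?thesis by simp
    qed
    moreover have "f c \<in> B" if "c \<in> C - ?I f" for c using m[of c] that by auto
    ultimately show "(?I f, restrict (\<lambda>c. tl (f c)) (?I f), restrict f (C - ?I f)) \<in> ?S" by auto
  next
    fix x assume x: "x \<in> ?S"
    then obtain I g h where xe: "x = (I, g, h)" and I: "I \<subseteq> C" and g: "g \<in> I \<rightarrow>\<^sub>E A" and h: "h \<in> (C - I) \<rightarrow>\<^sub>E B"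
      by auto
    have hB: "h c \<in> B" if "c \<in> C" "c \<notin> I" for c using h that by auto
    have gA: "g c \<in> A" if "c \<in> I" for c using g that by auto
    show "?i x \<in> C \<rightarrow>\<^sub>E B \<union> (#) d ` A" using hB gA by (auto simp: xe)
    have Ie: "?I (?i x) = I" using I d hB by (auto simp: xe)
    show "(?I (?i x), restrict (\<lambda>c. tl (?i x c)) (?I (?i x)), restrict (?i x) (C - ?I (?i x))) = x"
    proof -
      have "restrict (\<lambda>c. tl (?i x c)) I = g"
        using g I by (intro extensionalityI[where A = I]) (auto simp: PiE_def xe)
      moreover have "restrict (?i x) (C - I) = h"
        using h by (intro extensionalityI[where A = "C - I"]) (auto simp: PiE_def xe)
      ultimately show ?thesis unfolding Ie by (simp only: xe)
    qed
  qed
  also have "\<dots> = (\<Sum>I\<in>Pow C. \<Sum>y\<in>(I \<rightarrow>\<^sub>E A) \<times> ((C - I) \<rightarrow>\<^sub>E B). G (?i (I, y)))"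
  proof -
    have "(\<Sum>x\<in>?S. G (?i x)) = (\<Sum>(I, y)\<in>?S. G (?i (I, y)))"
      by (rule sum.cong) auto
    also have "\<dots> = (\<Sum>I\<in>Pow C. \<Sum>y\<in>(I \<rightarrow>\<^sub>E A) \<times> ((C - I) \<rightarrow>\<^sub>E B). G (?i (I, y)))"
      using C A B finI by (intro sum.Sigma[symmetric]) (auto intro!: finite_cartesian_product finite_PiE)
    finally show ?thesis .
  qed
  also have "\<dots> = (\<Sum>I\<in>Pow C. \<Sum>g\<in>I \<rightarrow>\<^sub>E A. \<Sum>h\<in>(C - I) \<rightarrow>\<^sub>E B. G (?i (I, g, h)))"
    by (rule sum.cong[OF refl], subst sum.cartesian_product, rule sum.cong[OF refl]) auto
  finally show ?thesis by simp
qed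

text \<open>The value at \<open>N\<close> of the convolution of two isomorphism counts, from
  \<open>A\<close> to the pruned forest and from \<open>B\<close> to the trunk.\<close>

definition cut_pairing :: "'a rtree multiset \<Rightarrow> 'a rtree multiset \<Rightarrow> 'a rtree multiset \<Rightarrow> nat" where
  "cut_pairing A B N = (\<Sum>p\<in>#cop N. fpair A (fst p) * fpair B (snd p))"

text \<open>Induction over the trees \<open>d\<close> of the trunk: the grafted branches are
  distributed between \<open>d\<close> and the rest, and \<open>sum_cop_pick\<close> recognises the
  result as a cut of \<open>N\<close> with the image of \<open>d\<close> singled out. Without any
  tree all branches land at the virtual root \<open>[]\<close>, and the claim is the counit
  law.\<close>

lemma sum_graft_forest:
  assumes "finite D" "finite C"
    and "\<And>d C u. d \<in> D \<Longrightarrow> finite C \<Longrightarrow> (\<Sum>f\<in>C \<rightarrow>\<^sub>E verts (fst d). tpair (graft_tree T C (fst d) f) u) =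
      (if root_label (fst d) = root_label u
       then cut_pairing (image_mset fst (mset_set C)) (branches (fst d)) (branches u) else 0)"
  shows "(\<Sum>f\<in>C \<rightarrow>\<^sub>E forest_verts D. fpair (graft_forest T C D f) N) =
    cut_pairing (image_mset fst (mset_set C)) (image_mset fst (mset_set D)) N"
  using assms
proof (induction D arbitrary: C N rule: finite_induct)
  case empty
  have "(\<Sum>f\<in>C \<rightarrow>\<^sub>E forest_verts {}. fpair (graft_forest T C {} f) N) = fpair (image_mset fst (mset_set C)) N"
    by (simp add: forest_verts_def PiE_singleton graft_forest_def)
  then show ?case
    using counit_right[of "fpair (image_mset fst (mset_set C))" N]
    by (simp add: cut_pairing_def fpair_empty if_distrib[where f = "\<lambda>z. _ * z"] cong: if_cong)
next
  case (insert d D)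
  let ?b = "\<lambda>C. image_mset fst (mset_set C)"
  let ?h = "\<lambda>I g h. restrict (\<lambda>c. if c \<in> I then d # g c else h c) C"
  have fv: "forest_verts (insert d D) = forest_verts D \<union> (#) d ` verts (fst d)"
    by (auto simp: forest_verts_def)
  have fin: "finite (forest_verts D)" using insert.hyps(1) by (simp add: forest_verts_def)
  have hdD: "hd p \<noteq> d" if "p \<in> forest_verts D" "p \<noteq> []" for p
    using that insert.hyps(2) by (auto simp: forest_verts_def)
  have gf: "graft_forest T C (insert d D) (?h I g h) = add_mset (graft_tree T I (fst d) g) (graft_forest T (C - I) D h)"
    if I: "I \<in> Pow C" and g: "g \<in> I \<rightarrow>\<^sub>E verts (fst d)" and h: "h \<in> (C - I) \<rightarrow>\<^sub>E forest_verts D" for I g h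
  proof -
    have hfv: "h c \<in> forest_verts D" if "c \<in> C" "c \<notin> I" for c using h that by auto
    have 0: "{c \<in> C. ?h I g h c = []} = {c \<in> C - I. h c = []}" using I by auto
    have 1: "{c \<in> C. ?h I g h c \<noteq> [] \<and> hd (?h I g h c) = d} = I" using I hdD hfv by auto
    have 2: "{c \<in> C. ?h I g h c \<noteq> [] \<and> hd (?h I g h c) = d'} = {c \<in> C - I. h c \<noteq> [] \<and> hd (h c) = d'}"
      if "d' \<in> D" for d' using I that insert.hyps(2) by auto
    have 3: "graft_tree T I (fst d) (tl \<circ> ?h I g h) = graft_tree T I (fst d) g"
      using I by (intro graft_tree_cong) auto
    have 4: "graft_tree T {c \<in> C - I. h c \<noteq> [] \<and> hd (h c) = d'} (fst d') (tl \<circ> ?h I g h) =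
        graft_tree T {c \<in> C - I. h c \<noteq> [] \<and> hd (h c) = d'} (fst d') (tl \<circ> h)" for d'
      using I by (intro graft_tree_cong) auto
    have E: "image_mset (\<lambda>d'. graft_tree T {c \<in> C. ?h I g h c \<noteq> [] \<and> hd (?h I g h c) = d'} (fst d') (tl \<circ> ?h I g h)) (mset_set D) =
        image_mset (\<lambda>d'. graft_tree T {c \<in> C - I. h c \<noteq> [] \<and> hd (h c) = d'} (fst d') (tl \<circ> h)) (mset_set D)"
      using insert.hyps(1) by (intro image_mset_cong) (simp only: 2 4 finite_set_mset_mset_set)
    show ?thesis
      unfolding graft_forest_def mset_set.insert[OF insert.hyps] image_mset_add_mset 0 1 3 E by simp
  qed
  have finI: "finite I" if "I \<in> Pow C" for I using that insert.prems(1) by (auto intro: finite_subset)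
  have "(\<Sum>f\<in>C \<rightarrow>\<^sub>E forest_verts (insert d D). fpair (graft_forest T C (insert d D) f) N) =
      (\<Sum>I\<in>Pow C. \<Sum>g\<in>I \<rightarrow>\<^sub>E verts (fst d). \<Sum>h\<in>(C - I) \<rightarrow>\<^sub>E forest_verts D.
        fpair (graft_forest T C (insert d D) (?h I g h)) N)"
    unfolding fv using insert.prems(1) fin hdD by (intro sum_split_functions) auto
  also have "\<dots> = (\<Sum>I\<in>Pow C. \<Sum>g\<in>I \<rightarrow>\<^sub>E verts (fst d). \<Sum>h\<in>(C - I) \<rightarrow>\<^sub>E forest_verts D.
        \<Sum>n\<in>#N. tpair (graft_tree T I (fst d) g) n * fpair (graft_forest T (C - I) D h) (N - {#n#}))"
    by (intro sum.cong refl) (simp add: gf fpair_add)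
  also have "\<dots> = (\<Sum>n\<in>#N. \<Sum>I\<in>Pow C. (\<Sum>g\<in>I \<rightarrow>\<^sub>E verts (fst d). tpair (graft_tree T I (fst d) g) n) *
        (\<Sum>h\<in>(C - I) \<rightarrow>\<^sub>E forest_verts D. fpair (graft_forest T (C - I) D h) (N - {#n#})))"
    by (simp add: sum_sum_mset_swap sum_product)
  also have "\<dots> = (\<Sum>n\<in>#N. \<Sum>I\<in>Pow C.
        (if root_label (fst d) = root_label n then cut_pairing (?b I) (branches (fst d)) (branches n) else 0) *
        cut_pairing (?b (C - I)) (?b D) (N - {#n#}))"
  proof (intro sum_mset_cong sum.cong refl)
    fix n I assume I: "I \<in> Pow C"
    have "(\<Sum>g\<in>I \<rightarrow>\<^sub>E verts (fst d). tpair (graft_tree T I (fst d) g) n) =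
        (if root_label (fst d) = root_label n then cut_pairing (?b I) (branches (fst d)) (branches n) else 0)"
      using insert.prems(2)[OF insertI1 finI[OF I]] .
    moreover have "(\<Sum>h\<in>(C - I) \<rightarrow>\<^sub>E forest_verts D. fpair (graft_forest T (C - I) D h) (N - {#n#})) =
        cut_pairing (?b (C - I)) (?b D) (N - {#n#})"
      using insert.prems by (intro insert.IH) auto
    ultimately show "(\<Sum>g\<in>I \<rightarrow>\<^sub>E verts (fst d). tpair (graft_tree T I (fst d) g) n) *
        (\<Sum>h\<in>(C - I) \<rightarrow>\<^sub>E forest_verts D. fpair (graft_forest T (C - I) D h) (N - {#n#})) =
        (if root_label (fst d) = root_label n then cut_pairing (?b I) (branches (fst d)) (branches n) else 0) *
        cut_pairing (?b (C - I)) (?b D) (N - {#n#})" by simp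
  qed
  also have "\<dots> = (\<Sum>n\<in>#N. \<Sum>p\<in>#cop (branches n). \<Sum>q\<in>#cop (N - {#n#}).
      fpair (?b C) (fst p + fst q) * (tpair (fst d) (Node (root_label n) (snd p)) * fpair (?b D) (snd q)))"
  proof (intro sum_mset_cong)
    fix n
    show "(\<Sum>I\<in>Pow C. (if root_label (fst d) = root_label n then cut_pairing (?b I) (branches (fst d)) (branches n) else 0) *
        cut_pairing (?b (C - I)) (?b D) (N - {#n#})) =
      (\<Sum>p\<in>#cop (branches n). \<Sum>q\<in>#cop (N - {#n#}).
        fpair (?b C) (fst p + fst q) * (tpair (fst d) (Node (root_label n) (snd p)) * fpair (?b D) (snd q)))"
      unfolding fpair_sum_subsets[OF insert.prems(1), symmetric]
      by (cases "root_label (fst d) = root_label n")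
        (simp_all add: cut_pairing_def tpair_fpair sum_mset_product_sum)
  qed
  also have "\<dots> = (\<Sum>p\<in>#cop N. \<Sum>r\<in>#snd p. fpair (?b C) (fst p) * (tpair (fst d) r * fpair (?b D) (snd p - {#r#})))"
    by (rule sum_cop_pick[symmetric, where \<phi> = "\<lambda>A r B. fpair (?b C) A * (tpair (fst d) r * fpair (?b D) B)"])
  also have "\<dots> = cut_pairing (?b C) (?b (insert d D)) N"
    using insert.hyps by (simp add: cut_pairing_def fpair_add sum_mset_distrib_left)
  finally show ?case .
qed

lemma verts_eq_forest_verts: "verts S = forest_verts (root_children S)"
  by (cases S) (simp add: verts_Node forest_verts_def root_children_eq)

text \<open>The adjunction itself: an isomorphism from a graft to \<open>u\<close> carries the
  grafted branches to the pruned part, and \<open>S\<close> to the trunk, of a cut of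
  \<open>u\<close>. The root is never pruned, so it is compared separately by its label.\<close>

lemma sum_graft_tree:
  assumes "finite C"
  shows "(\<Sum>f\<in>C \<rightarrow>\<^sub>E verts S. tpair (graft_tree T C S f) u) =
    (if root_label S = root_label u
     then cut_pairing (image_mset fst (mset_set C)) (branches S) (branches u) else 0)"
  using assms
proof (induction S arbitrary: C u)
  case (Node a M)
  let ?S = "Node a M"
  have IH: "(\<Sum>f\<in>C \<rightarrow>\<^sub>E verts (fst d). tpair (graft_tree T C (fst d) f) u) =
      (if root_label (fst d) = root_label u
       then cut_pairing (image_mset fst (mset_set C)) (branches (fst d)) (branches u) else 0)"
    if "d \<in> root_children ?S" "finite C" for d C u
    using Node.IH[of "fst d" C u] root_children_in_branches[OF that(1)] that(2) by simp
  have "(\<Sum>f\<in>C \<rightarrow>\<^sub>E verts ?S. tpair (graft_tree T C ?S f) u) =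
      (\<Sum>f\<in>C \<rightarrow>\<^sub>E verts ?S. if a = root_label u then fpair (graft_forest T C (root_children ?S) f) (branches u) else 0)"
  proof (intro sum.cong refl)
    fix f assume f: "f \<in> C \<rightarrow>\<^sub>E verts ?S"
    have "branches (graft_tree T C ?S f) = graft_forest T C (root_children ?S) f"
      unfolding graft_forest_def using f Node.prems by (intro branches_graft_tree) auto
    then show "tpair (graft_tree T C ?S f) u =
        (if a = root_label u then fpair (graft_forest T C (root_children ?S) f) (branches u) else 0)"
      by (simp only: tpair_fpair root_label_graft_tree rtree.sel)
  qed
  also have "\<dots> = (if a = root_label u then \<Sum>f\<in>C \<rightarrow>\<^sub>E forest_verts (root_children ?S).
      fpair (graft_forest T C (root_children ?S) f) (branches u) else 0)"
    unfolding verts_eq_forest_verts by simp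
  also have "\<dots> = (if a = root_label u then cut_pairing (image_mset fst (mset_set C))
      (image_mset fst (mset_set (root_children ?S))) (branches u) else 0)"
    using sum_graft_forest[OF finite_root_children Node.prems IH] by simp
  finally show ?case by (simp add: image_mset_root_children)
qed

lemma graft_eq:
  assumes "f \<in> root_children T \<rightarrow>\<^sub>E verts S"
  shows "graft T S f = graft_tree T (root_children T) S f"
proof -
  have "map Inl ` verts S \<union> (\<lambda>p. map Inl (f (hd p)) @ map Inr p) ` (verts T - {[]}) =
      graft_set (root_children T) S f" (is "?L = _")
  proof (intro equalityI subsetI)
    fix x assume "x \<in> ?L"
    then show "x \<in> graft_set (root_children T) S f"
    proof
      assume "x \<in> (\<lambda>p. map Inl (f (hd p)) @ map Inr p) ` (verts T - {[]})"
      then obtain p where p: "p \<in> verts T" "p \<noteq> []" "x = map Inl (f (hd p)) @ map Inr p" by auto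
      then obtain c q where "p = c # q" by (cases p) auto
      then show ?thesis
        using p by (intro graft_setI2[of c _ q]) (auto simp: root_children_eq Cons_in_verts)
    qed (auto simp: graft_set_def)
  next
    fix x assume "x \<in> graft_set (root_children T) S f"
    then consider "x \<in> map Inl ` verts S"
      | c q where "c \<in> root_children T" "q \<in> verts (fst c)" "x = map Inl (f c) @ Inr c # map Inr q"
      by (auto simp: graft_set_def)
    then show "x \<in> ?L"
    proof cases
      case (2 c q)
      then have "c # q \<in> verts T - {[]}" by (auto simp: root_children_eq Cons_in_verts)
      then show ?thesis using 2 by (auto intro!: image_eqI[of _ _ "c # q"])
    qed simp
  qed
  moreover have "ctree (graft_set (root_children T) S f)"
    using assms by (intro ctree_graft_set) auto
  ultimately show ?thesis
    by (simp add: graft_def graft_tree_def tree_class_eq graft_label_def[abs_def])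
qed

section \<open>Scalars\<close>

lemma rat_emb_0 [simp]: "rat_emb 0 = (0 :: 'k::rat_algebra)"
  using rat_emb_add[of 0 0, where 'a = 'k] by simp

lemma rat_emb_of_nat [simp]: "rat_emb (of_nat n) = (of_nat n :: 'k::rat_algebra)"
  by (induction n) (simp_all add: rat_emb_add rat_emb_1)

lemma rat_emb_sum: "rat_emb (sum f A) = (\<Sum>x\<in>A. rat_emb (f x) :: 'k::rat_algebra)"
  by (induction A rule: infinite_finite_induct) (simp_all add: rat_emb_add)

lemma rat_emb_sum_mset: "rat_emb (\<Sum>x\<in>#A. f x) = (\<Sum>x\<in>#A. rat_emb (f x) :: 'k::rat_algebra)"
  by (induction A) (simp_all add: rat_emb_add)

lemma of_nat_inverse:
  assumes "n > 0"
  shows "of_nat n * rat_emb (1 / of_nat n) = (1 :: 'k::rat_algebra)"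
proof -
  have "of_nat n * rat_emb (1 / of_nat n) = (rat_emb (of_nat n) * rat_emb (1 / of_nat n) :: 'k)"
    by simp
  also have "\<dots> = rat_emb (of_nat n * (1 / of_nat n))"
    by (rule rat_emb_mult[symmetric])
  finally show ?thesis using assms by (simp add: rat_emb_1)
qed

text \<open>The base ring may have zero divisors, but positive integers are units in a
  \<rat>-algebra, which is enough to cancel symmetry factors.\<close>

lemma of_nat_cancel:
  assumes "n > 0" "of_nat n * x = (of_nat n * y :: 'k::rat_algebra)"
  shows "x = y"
proof -
  have "rat_emb (1 / of_nat n) * (of_nat n * x) = rat_emb (1 / of_nat n) * (of_nat n * y)"
    using assms(2) by simp
  then show ?thesis
    using of_nat_inverse[OF assms(1), where 'k = 'k]
    by (simp add: mult.commute[of "rat_emb _" "of_nat n"] mult.assoc[symmetric])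
qed

lemma lookup_smult [simp]: "Poly_Mapping.lookup (smult c x) k = c * Poly_Mapping.lookup x k"
  by (simp add: smult_def Poly_Mapping.map.rep_eq when_def)

lemma keys_smult: "Poly_Mapping.keys (smult c x) \<subseteq> Poly_Mapping.keys x"
  by (auto simp: in_keys_iff)

text \<open>A nonempty forest consists of the root of one tree, the branches below it and the other
  trees, so one induction replaces a nested one over trees and multisets. Proving the claim for
  \<open>branches t\<close> lets the induction over trees supply it below every branch.\<close>

lemma forest_induct [case_names empty add]:
  assumes "P {#}" and step: "\<And>a M N. P M \<Longrightarrow> P N \<Longrightarrow> P (add_mset (Node a M) N)"
  shows "P (N :: 'a rtree multiset)"
proof -
  have "P (branches t)" for t :: "'a rtree"
  proof (induction t)
    case (Node a M)
    have "P N" if "N \<subseteq># M" for N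
      using that
    proof (induction N)
      case (add t N)
      have "P (branches t)" "P N"
        using add.IH Node.IH[of t] mset_subset_eq_insertD[OF add.prems] by (auto simp: subset_mset.less_imp_le)
      then have "P (add_mset (Node (root_label t) (branches t)) N)" by (rule step)
      then show ?case by simp
    qed (rule assms(1))
    then show ?case by simp
  qed
  from this[of "Node undefined N"] show ?thesis by simp
qed

section \<open>Numerical invariants of trees\<close>

text \<open>One invariant from which weight, number of vertices and set of labels are all read off,
  and which is additive over cuts.\<close>

primrec tree_labels :: "'a rtree \<Rightarrow> 'a multiset" where
  "tree_labels (Node a M) = add_mset a (\<Sum>\<^sub># (image_mset tree_labels M))"

definition labels :: "'a rtree multiset \<Rightarrow> 'a multiset" where
  "labels M = (\<Sum>t\<in>#M. tree_labels t)"

lemma labels_simps [simp]: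
  "labels {#} = {#}"
  "labels (add_mset t M) = tree_labels t + labels M"
  "labels (M + N) = labels M + labels N"
  by (simp_all add: labels_def)

lemma tree_labels_Node [simp]: "tree_labels (Node a M) = add_mset a (labels M)"
  by (simp add: labels_def)

declare tree_labels.simps [simp del]

lemma labels_eq_empty [simp]: "labels M = {#} \<longleftrightarrow> M = {#}"
proof (cases M)
  case (add t N)
  then show ?thesis by (cases t) simp
qed simp

lemma labels_cop: "p \<in># cop N \<Longrightarrow> labels (fst p) + labels (snd p) = labels N"
proof (induction N arbitrary: p rule: forest_induct)
  case (add a M N)
  have "set_mset (cop (add_mset (Node a M) N)) =
      {(fst p + fst q, snd p + snd q) | p q. p \<in># cop {#Node a M#} \<and> q \<in># cop N}"
  proof -
    have "cop (add_mset (Node a M) N) = mconv (cop {#Node a M#}) (cop N)"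
      by (simp add: cop_multiset_def)
    then show ?thesis by (auto simp: set_mconv plus_prod_def) 
  qed
  then obtain r q where p: "p = (fst r + fst q, snd r + snd q)"
    and r: "r \<in># cop {#Node a M#}" and q: "q \<in># cop N"
    using add.prems by auto
  have "labels (fst r) + labels (snd r) = labels {#Node a M#}"
    using r add.IH(1) by (auto simp: cop_singleton bcuts_Node)
  then show ?case using add.IH(2)[OF q] by (simp add: p ac_simps)
qed simp

text \<open>Induction on the number of vertices: a nonempty forest is given by a root label and two
  forests with fewer vertices.\<close>

lemma finite_forests:
  assumes "finite L"
  shows "finite {M :: 'a rtree multiset. size (labels M) \<le> n \<and> set_mset (labels M) \<subseteq> L}"
proof (induction n)
  case 0
  have "{M :: 'a rtree multiset. size (labels M) \<le> 0 \<and> set_mset (labels M) \<subseteq> L} \<subseteq> {{#}}" by auto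
  then show ?case by (rule finite_subset) simp
next
  case (Suc n)
  let ?F = "\<lambda>n. {M :: 'a rtree multiset. size (labels M) \<le> n \<and> set_mset (labels M) \<subseteq> L}"
  have "?F (Suc n) \<subseteq> insert {#} ((\<lambda>(a, M, N). add_mset (Node a M) N) ` (L \<times> ?F n \<times> ?F n))"
  proof
    fix M assume M: "M \<in> ?F (Suc n)"
    show "M \<in> insert {#} ((\<lambda>(a, M, N). add_mset (Node a M) N) ` (L \<times> ?F n \<times> ?F n))"
    proof (cases M)
      case (add t N)
      then show ?thesis
        using M by (cases t) (auto intro!: image_eqI[of _ _ "(root_label t, branches t, N)"])
    qed simp
  qed
  then show ?case using Suc assms by (elim finite_subset) auto
qed

lemma sum_root_children: "(\<Sum>c\<in>root_children T. g (fst c)) = (\<Sum>t\<in>#branches T. g t)"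
  by (simp add: sum_unfold_sum_mset image_mset.compositionality o_def flip: image_mset_root_children)

lemma sum_verts: "(\<Sum>p\<in>verts T. g p) = g [] + (\<Sum>c\<in>root_children T. \<Sum>q\<in>verts (fst c). g (c # q))"
proof -
  have "(\<Sum>p\<in>verts T. g p) = g [] + (\<Sum>p\<in>(\<Union>c\<in>root_children T. (#) c ` verts (fst c)). g p)"
    unfolding verts_eq_forest_verts[of T] forest_verts_def by (subst sum.insert) auto
  also have "(\<Sum>p\<in>(\<Union>c\<in>root_children T. (#) c ` verts (fst c)). g p) =
      (\<Sum>c\<in>root_children T. \<Sum>p\<in>(#) c ` verts (fst c). g p)"
    by (rule sum.UNION_disjoint) auto
  also have "\<dots> = (\<Sum>c\<in>root_children T. \<Sum>q\<in>verts (fst c). g (c # q))"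
    by (simp add: sum.reindex)
  finally show ?thesis .
qed

lemma weight_eq: "weight T = \<Sum>\<^sub># (tree_labels T)"
proof (induction T)
  case (Node a M)
  have "weight (Node a M) = a + (\<Sum>c\<in>root_children (Node a M). weight (fst c))"
    unfolding weight_def sum_verts[of _ "Node a M"] by (auto intro!: sum.cong simp: split_paired_all)
  also have "\<dots> = a + (\<Sum>t\<in>#M. \<Sum>\<^sub># (tree_labels t))"
    unfolding sum_root_children rtree.sel by (intro arg_cong2[where f = plus] refl sum_mset_cong Node.IH)
  also have "\<dots> = \<Sum>\<^sub># (tree_labels (Node a M))"
    by (simp add: labels_def sum_mset_UNION[where g = "\<lambda>x. x", simplified])
  finally show ?case .
qed

lemma num_verts_eq: "num_verts T = size (tree_labels T)"
proof (induction T)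
  case (Node a M)
  have "num_verts (Node a M) = 1 + (\<Sum>c\<in>root_children (Node a M). num_verts (fst c))"
    unfolding num_verts_def card_eq_sum sum_verts[of _ "Node a M"] by simp
  also have "\<dots> = 1 + (\<Sum>t\<in>#M. size (tree_labels t))"
    unfolding sum_root_children rtree.sel by (intro arg_cong2[where f = plus] refl sum_mset_cong Node.IH)
  also have "(\<Sum>t\<in>#M. size (tree_labels t)) = size (labels M)"
    by (induction M) auto
  finally show ?case by simp
qed

lemma root_degree_eq: "root_degree T = size (branches T)"
proof -
  have "root_degree T = size (image_mset fst (mset_set (root_children T)))"
    by (simp add: root_degree_def)
  then show ?thesis by (simp only: image_mset_root_children)
qed

lemma set_rtree_eq: "set_rtree T = set_mset (tree_labels T)"
proof (induction T)
  case (Node a M)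
  then show ?case by (simp add: labels_def set_mset_sum_mset)
qed

lemma Tbar_eq: "Tbar W = {T. root_label T = 0 \<and> set_mset (labels (branches T)) \<subseteq> W}"
proof -
  have "F \<in> FW W \<longleftrightarrow> set_mset (labels F) \<subseteq> W" for F
    by (auto simp: FW_def TW_def set_rtree_eq labels_def set_mset_sum_mset)
  then have "Tbar W = Node 0 ` {F. set_mset (labels F) \<subseteq> W}"
    by (auto simp: Tbar_def Bplus_def)
  then show ?thesis by (auto simp: image_iff) (metis rtree.collapse)
qed

lemma Node_in_Tbar [simp]: "Node a M \<in> Tbar W \<longleftrightarrow> a = 0 \<and> set_mset (labels M) \<subseteq> W"
  by (simp add: Tbar_eq)

lemma weight_Node [simp]: "weight (Node a M) = a + \<Sum>\<^sub># (labels M)"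
  by (simp add: weight_eq)

lemma size_le_sum_mset: "0 \<notin># (A :: nat multiset) \<Longrightarrow> size A \<le> \<Sum>\<^sub># A"
  by (induction A) auto

lemma member_le_sum_mset: "(x :: nat) \<in># A \<Longrightarrow> x \<le> \<Sum>\<^sub># A"
  by (auto dest!: multi_member_split)

text \<open>With positive labels the weight bounds both the number of vertices and every label, so
  finiteness holds even for infinite \<open>W\<close>.\<close>

lemma finite_forests_weight:
  fixes n :: nat
  assumes "0 \<notin> W"
  shows "finite {M. set_mset (labels M) \<subseteq> W \<and> \<Sum>\<^sub># (labels M) \<le> n}"
proof (rule finite_subset)
  show "{M. set_mset (labels M) \<subseteq> W \<and> \<Sum>\<^sub># (labels M) \<le> n} \<subseteq>
      {M. size (labels M) \<le> n \<and> set_mset (labels M) \<subseteq> {..n}}"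
  proof safe
    fix M assume M: "set_mset (labels M) \<subseteq> W" "\<Sum>\<^sub># (labels M) \<le> n"
    have "0 \<notin># labels M" using M(1) assms by blast
    then show "size (labels M) \<le> n" using M(2) size_le_sum_mset by fastforce
    fix x assume "x \<in># labels M"
    then show "x \<le> n" using M(2) member_le_sum_mset[of x "labels M"] by simp
  qed
  show "finite {M :: nat rtree multiset. size (labels M) \<le> n \<and> set_mset (labels M) \<subseteq> {..n}}"
    by (rule finite_forests) simp
qed

lemma finite_Tbar_weight:
  assumes "0 \<notin> W"
  shows "finite {T \<in> Tbar W. weight T \<le> n}"
proof (rule finite_subset)
  show "{T \<in> Tbar W. weight T \<le> n} \<subseteq> Node 0 ` {M. set_mset (labels M) \<subseteq> W \<and> \<Sum>\<^sub># (labels M) \<le> n}"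
  proof
    fix T assume "T \<in> {T \<in> Tbar W. weight T \<le> n}"
    then show "T \<in> Node 0 ` {M. set_mset (labels M) \<subseteq> W \<and> \<Sum>\<^sub># (labels M) \<le> n}"
      by (cases T) auto
  qed
qed (use finite_forests_weight[OF assms] in auto)

section \<open>Leaves, chains, and the labels of the leaf and of the child of the root\<close>

lemma leaves_Node:
  "leaves (Node a M) = (if M = {#} then {[]} else (\<Union>c\<in>root_children (Node a M). (#) c ` leaves (fst c)))"
proof (cases "M = {#}")
  case True
  then have "verts (Node a M) = {[]}" by (simp add: verts_Node)
  then show ?thesis using True by (auto simp: leaves_def)
next
  case False
  then obtain t where t: "t \<in># M" by auto
  then have "[(t, 0)] \<in> verts (Node a M)" by (simp add: Cons_in_verts)
  then have "[] \<notin> leaves (Node a M)" by (force simp: leaves_def)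
  moreover have "c # q \<in> leaves (Node a M) \<longleftrightarrow> c \<in> root_children (Node a M) \<and> q \<in> leaves (fst c)" for c q
    by (cases c) (auto simp: leaves_def Cons_in_verts root_children_eq)
  ultimately have "p \<in> leaves (Node a M) \<longleftrightarrow> p \<in> (\<Union>c\<in>root_children (Node a M). (#) c ` leaves (fst c))" for p
    by (cases p) auto
  then show ?thesis using False by auto
qed

lemma finite_leaves [simp]: "finite (leaves T)"
  by (rule finite_subset[of _ "verts T"]) (auto simp: leaves_def)

lemma card_leaves_Node:
  "card (leaves (Node a M)) = (if M = {#} then 1 else (\<Sum>t\<in>#M. card (leaves t)))"
proof (cases "M = {#}")
  case False
  have "card (leaves (Node a M)) = (\<Sum>c\<in>root_children (Node a M). card ((#) c ` leaves (fst c)))"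
    using False unfolding leaves_Node by (simp, intro card_UN_disjoint) auto
  then show ?thesis
    using False sum_root_children[of "\<lambda>t. card (leaves t)" "Node a M"] by (simp add: card_image)
qed (simp add: leaves_Node)

lemma card_leaves_pos: "card (leaves T) > 0"
proof (induction T)
  case (Node a M)
  show ?case
  proof (cases M)
    case (add t N)
    then show ?thesis using Node.IH[of t] by (simp add: card_leaves_Node)
  qed (simp add: card_leaves_Node)
qed

lemma size_le_card_leaves: "size M \<le> (\<Sum>t\<in>#M. card (leaves t))"
proof (induction M)
  case (add t M)
  then show ?case using card_leaves_pos[of t] by simp
qed simp

text \<open>The label of the leaf of the unique branch, for a chain; \<open>0\<close> for all other forests.\<close>
primrec chain_label_tree :: "'a::zero rtree \<Rightarrow> 'a" where
  "chain_label_tree (Node a M) = (if M = {#} then a else if size M = 1 then the_elem (set_mset (image_mset chain_label_tree M)) else 0)"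

definition chain_label :: "'a::zero rtree multiset \<Rightarrow> 'a" where
  "chain_label M = (if size M = 1 then chain_label_tree (the_elem (set_mset M)) else 0)"

lemma chain_label_empty [simp]: "chain_label {#} = 0"
  and chain_label_size: "size M \<noteq> 1 \<Longrightarrow> chain_label M = 0"
  by (simp_all add: chain_label_def)

lemma chain_label_Node [simp]: "chain_label {#Node a M#} = (if M = {#} then a else chain_label M)"
proof (cases "size M = 1")
  case True
  then obtain t where "M = {#t#}" by (metis One_nat_def size_1_singleton_mset)
  then show ?thesis by (simp add: chain_label_def)
qed (auto simp: chain_label_def)

lemma chain_label_eq:
  "chain_label M = (if M \<noteq> {#} \<and> card (leaves (Node a M)) = 1 then leaf_label (Node a M) else 0)"
proof (induction M arbitrary: a rule: forest_induct)
  case (add b M N)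
  show ?case
  proof (cases "N = {#}")
    case True
    have r: "root_children (Node a {#Node b M#}) = {(Node b M, 0)}"
      by (auto simp: root_children_eq split: if_splits)
    have l: "leaves (Node a {#Node b M#}) = (#) (Node b M, 0) ` leaves (Node b M)"
      by (subst leaves_Node) (simp add: r)
    have c: "card (leaves (Node a {#Node b M#})) = card (leaves (Node b M))"
      by (simp add: l card_image)
    have "leaf_label (Node a {#Node b M#}) = leaf_label (Node b M)" if "card (leaves (Node b M)) = 1"
    proof -
      from that obtain p where "leaves (Node b M) = {p}" by (auto simp: card_1_singleton_iff)
      then show ?thesis by (simp add: leaf_label_def l)
    qed
    moreover have "leaf_label (Node b {#}) = b" by (simp add: leaf_label_def leaves_Node)
    moreover have "card (leaves (Node b {#})) = 1" by (simp add: card_leaves_Node)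
    ultimately show ?thesis using True add.IH(1)[of b] c by auto
  next
    case False
    then have "size (add_mset (Node b M) N) \<ge> 2" by (cases N) auto
    then have "card (leaves (Node a (add_mset (Node b M) N))) \<noteq> 1"
      using size_le_card_leaves[of "add_mset (Node b M) N"] by (simp add: card_leaves_Node)
    then show ?thesis using False by (simp add: chain_label_size)
  qed
qed simp

definition child_root :: "'a::zero rtree multiset \<Rightarrow> 'a" where
  "child_root M = (if size M = 1 then root_label (the_elem (set_mset M)) else 0)"

lemma child_root_simps [simp]:
  "child_root {#} = 0"
  "child_root {#Node a M#} = a"
  "size M \<noteq> 1 \<Longrightarrow> child_root M = 0"
  by (simp_all add: child_root_def)

lemma child_label_eq: "child_root M = (if size M = 1 then child_label (Node a M) else 0)"
proof (cases "size M = 1")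
  case True
  then obtain t where M: "M = {#t#}" by (metis One_nat_def size_1_singleton_mset)
  have "root_children (Node a {#t#}) = {(t, 0)}"
    by (auto simp: root_children_eq split: if_splits)
  then show ?thesis by (simp add: M child_root_def child_label_def)
qed simp

declare Poly_Mapping.lookup_sum [simp]

section \<open>The Grossman--Larson algebra in the basis of normalised trees\<close>

text \<open>\<open>gl\<close> also contains trees whose root label is not 0, which
  \<open>gl_coef\<close> does not see; on elements without them the coordinates are
  faithful.\<close>

definition rooted0 :: "'k::rat_algebra gl \<Rightarrow> bool" where
  "rooted0 x \<longleftrightarrow> (\<forall>T. root_label T \<noteq> 0 \<longrightarrow> Poly_Mapping.lookup x T = 0)"

text \<open>The coefficients of \<open>x\<close> with respect to the elements \<open>\<V>\<^sub>T\<close>; the tree \<open>T = B\<^sub>+(M)\<close> is represented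
  by the forest \<open>M\<close>.\<close>
definition gl_coef :: "'k::rat_algebra gl \<Rightarrow> (nat rtree multiset, 'k) conv" where
  "gl_coef x = Conv (\<lambda>M. of_nat (forest_sym M) * Poly_Mapping.lookup x (Node 0 M))"

lemma coef_gl_coef: "coef (gl_coef x) M = of_nat (forest_sym M) * Poly_Mapping.lookup x (Node 0 M)"
  by (simp add: gl_coef_def)

lemma gl_coef_add: "gl_coef (x + y) = gl_coef x + gl_coef y"
  by (rule conv_eqI) (simp add: coef_gl_coef Poly_Mapping.lookup_add distrib_left)

lemma gl_coef_smult: "gl_coef (smult c x) = scal c * gl_coef x"
  by (rule conv_eqI) (simp add: coef_gl_coef mult.left_commute)

lemma gl_coef_0 [simp]: "gl_coef 0 = 0"
  by (rule conv_eqI) (simp add: coef_gl_coef)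

lemma gl_coef_sum: "gl_coef (sum f A) = (\<Sum>i\<in>A. gl_coef (f i))"
  by (induction A rule: infinite_finite_induct) (simp_all add: gl_coef_add)

lemma gl_coef_one [simp]: "gl_coef gl_one = 1"
  by (rule conv_eqI) (auto simp: coef_gl_coef gl_one_def Bplus_def Poly_Mapping.lookup_single when_def)

lemma rooted0_add: "rooted0 x \<Longrightarrow> rooted0 y \<Longrightarrow> rooted0 (x + y)"
  by (simp add: rooted0_def Poly_Mapping.lookup_add)

lemma rooted0_smult: "rooted0 x \<Longrightarrow> rooted0 (smult c x)"
  by (simp add: rooted0_def)

lemma rooted0_sum: "(\<And>i. i \<in> A \<Longrightarrow> rooted0 (f i)) \<Longrightarrow> rooted0 (sum f A)"
  by (simp add: rooted0_def)

lemma rooted0_one [simp]: "rooted0 gl_one"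
  by (auto simp: rooted0_def gl_one_def Bplus_def Poly_Mapping.lookup_single when_def)

lemma gl_coef_inject:
  assumes "rooted0 x" "rooted0 y" "gl_coef x = gl_coef y"
  shows "x = y"
proof (rule poly_mapping_eqI)
  fix T
  show "Poly_Mapping.lookup x T = Poly_Mapping.lookup y T"
  proof (cases "root_label T = 0")
    case True
    have "of_nat (forest_sym (branches T)) * Poly_Mapping.lookup x (Node 0 (branches T)) =
        of_nat (forest_sym (branches T)) * Poly_Mapping.lookup y (Node 0 (branches T))"
      using assms(3) by (metis coef_gl_coef)
    then have "Poly_Mapping.lookup x (Node 0 (branches T)) = Poly_Mapping.lookup y (Node 0 (branches T))"
      by (rule of_nat_cancel[rotated]) simp
    then show ?thesis using True by (metis rtree.collapse)
  qed (use assms in \<open>simp add: rooted0_def\<close>)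
qed

text \<open>Writing coordinates as isomorphism counts is the form to which the adjunction of
  grafting and cutting applies.\<close>

lemma coef_gl_coef_sum_keys:
  assumes "rooted0 x"
  shows "coef (gl_coef x) M =
    (\<Sum>T\<in>Poly_Mapping.keys x. Poly_Mapping.lookup x T * of_nat (fpair (branches T) M))"
proof -
  have "Poly_Mapping.lookup x T * of_nat (fpair (branches T) M) =
      (if T = Node 0 M then of_nat (forest_sym M) * Poly_Mapping.lookup x (Node 0 M) else 0)"
    if "T \<in> Poly_Mapping.keys x" for T
    using assms that by (cases T) (auto simp: fpair_def rooted0_def in_keys_iff mult.commute)
  then have "(\<Sum>T\<in>Poly_Mapping.keys x. Poly_Mapping.lookup x T * of_nat (fpair (branches T) M)) =
      (\<Sum>T\<in>Poly_Mapping.keys x. if T = Node 0 M then of_nat (forest_sym M) * Poly_Mapping.lookup x (Node 0 M) else 0)"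
    by (rule sum.cong[OF refl])
  also have "\<dots> = of_nat (forest_sym M) * Poly_Mapping.lookup x (Node 0 M)"
    by (simp add: in_keys_iff)
  finally show ?thesis by (simp add: coef_gl_coef)
qed

lemma coef_gl_coef_prod_basis:
  "of_nat (forest_sym N) * Poly_Mapping.lookup (gl_prod_basis T S) (Node 0 N) =
    (if root_label S = 0 then of_nat (cut_pairing (branches T) (branches S) N) else (0 :: 'k::rat_algebra))"
proof -
  have "of_nat (forest_sym N) * Poly_Mapping.lookup (gl_prod_basis T S) (Node 0 N) =
      (\<Sum>f\<in>root_children T \<rightarrow>\<^sub>E verts S. of_nat (tpair (graft_tree T (root_children T) S f) (Node 0 N)) :: 'k)"
    by (simp add: gl_prod_basis_def sum_distrib_left Poly_Mapping.lookup_single when_def)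
      (auto intro!: sum.cong simp: graft_eq tpair_def)
  also have "\<dots> = of_nat (\<Sum>f\<in>root_children T \<rightarrow>\<^sub>E verts S. tpair (graft_tree T (root_children T) S f) (Node 0 N))"
    by simp
  also have "\<dots> = (if root_label S = 0 then of_nat (cut_pairing (branches T) (branches S) N) else 0)"
    by (subst sum_graft_tree) (simp_all add: image_mset_root_children)
  finally show ?thesis .
qed

lemma rooted0_prod_basis:
  assumes "root_label S = 0"
  shows "rooted0 (gl_prod_basis T S)"
  unfolding gl_prod_basis_def
proof (rule rooted0_sum)
  fix f assume "f \<in> root_children T \<rightarrow>\<^sub>E verts S"
  then have "root_label (graft T S f) = 0" using assms by (simp add: graft_eq)
  then show "rooted0 (basis (graft T S f))"
    by (auto simp: rooted0_def Poly_Mapping.lookup_single when_def)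
qed

lemma rooted0_keys: "rooted0 x \<Longrightarrow> T \<in> Poly_Mapping.keys x \<Longrightarrow> root_label T = 0"
  by (auto simp: rooted0_def in_keys_iff)

lemma rooted0_mult: "rooted0 y \<Longrightarrow> rooted0 (gl_mult x y)"
  unfolding gl_mult_def by (intro rooted0_sum rooted0_smult rooted0_prod_basis rooted0_keys)

text \<open>A basis tree has an isomorphism count as its coordinate function, so the adjunction
  turns each grafting product into a sum over cuts, with the left factor pruned and the right factor
  kept; bilinearity does the rest.\<close>

lemma gl_coef_mult:
  assumes x: "rooted0 x" and y: "rooted0 y"
  shows "gl_coef (gl_mult x y) = gl_coef x * gl_coef y"
proof (rule conv_eqI)
  fix N
  let ?l = Poly_Mapping.lookup and ?k = Poly_Mapping.keys
  have "coef (gl_coef (gl_mult x y)) N =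
      (\<Sum>T\<in>?k x. \<Sum>S\<in>?k y. ?l x T * ?l y S * (of_nat (forest_sym N) * ?l (gl_prod_basis T S) (Node 0 N)))"
    by (simp add: coef_gl_coef gl_mult_def sum_distrib_left mult.left_commute)
  also have "\<dots> = (\<Sum>T\<in>?k x. \<Sum>S\<in>?k y. ?l x T * ?l y S * of_nat (cut_pairing (branches T) (branches S) N))"
    by (intro sum.cong refl) (simp add: coef_gl_coef_prod_basis rooted0_keys[OF y])
  also have "\<dots> = (\<Sum>T\<in>?k x. \<Sum>S\<in>?k y. \<Sum>p\<in>#cop N.
      (?l x T * of_nat (fpair (branches T) (fst p))) * (?l y S * of_nat (fpair (branches S) (snd p))))"
    by (intro sum.cong refl) (simp add: cut_pairing_def sum_mset_distrib_left sum_mset_image mult_ac)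
  also have "\<dots> = (\<Sum>p\<in>#cop N. (\<Sum>T\<in>?k x. ?l x T * of_nat (fpair (branches T) (fst p))) *
      (\<Sum>S\<in>?k y. ?l y S * of_nat (fpair (branches S) (snd p))))"
    by (simp only: sum_sum_mset_swap sum_product)
  also have "\<dots> = coef (gl_coef x * gl_coef y) N"
    by (simp add: coef_times coef_gl_coef_sum_keys x y)
  finally show "coef (gl_coef (gl_mult x y)) N = coef (gl_coef x * gl_coef y) N" .
qed

text \<open>Inverse of \<open>gl_coef\<close> on functions of finite support; elsewhere the argument
  of \<open>Abs_poly_mapping\<close> is out of range.\<close>

definition to_gl :: "(nat rtree multiset, 'k) conv \<Rightarrow> 'k::rat_algebra gl" where
  "to_gl c = Abs_poly_mapping (\<lambda>T. if root_label T = 0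
     then rat_emb (1 / of_nat (sym_factor T)) * coef c (branches T) else 0)"

definition supp :: "('c, 'k::zero) conv \<Rightarrow> 'c set" where
  "supp c = {x. coef c x \<noteq> 0}"

lemma lookup_to_gl:
  assumes "finite (supp c)"
  shows "Poly_Mapping.lookup (to_gl c) T =
    (if root_label T = 0 then rat_emb (1 / of_nat (sym_factor T)) * coef c (branches T) else 0)"
proof -
  have "{T. (if root_label T = 0 then rat_emb (1 / of_nat (sym_factor T)) * coef c (branches T) else 0) \<noteq> 0}
      \<subseteq> Node 0 ` supp c"
  proof
    fix T assume "T \<in> {T. (if root_label T = 0 then rat_emb (1 / of_nat (sym_factor T)) * coef c (branches T) else 0) \<noteq> 0}"
    then show "T \<in> Node 0 ` supp c" by (cases T) (auto simp: supp_def split: if_splits)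
  qed
  from finite_subset[OF this finite_imageI[OF assms]] show ?thesis
    unfolding to_gl_def by (subst Abs_poly_mapping_inverse) simp_all
qed

lemma rooted0_to_gl [simp]: "finite (supp c) \<Longrightarrow> rooted0 (to_gl c)"
  by (simp add: rooted0_def lookup_to_gl)

lemma gl_coef_to_gl [simp]: "finite (supp c) \<Longrightarrow> gl_coef (to_gl c) = c"
proof (rule conv_eqI)
  fix M assume "finite (supp c)"
  then have "coef (gl_coef (to_gl c)) M = (of_nat (forest_sym M) * rat_emb (1 / of_nat (forest_sym M))) * coef c M"
    by (simp add: coef_gl_coef lookup_to_gl mult.assoc)
  also have "\<dots> = coef c M" by (subst of_nat_inverse) simp_all
  finally show "coef (gl_coef (to_gl c)) M = coef c M" .
qed

lemma finite_supp_gl_coef [simp]: "finite (supp (gl_coef x))"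
proof (rule finite_subset)
  show "supp (gl_coef x) \<subseteq> branches ` Poly_Mapping.keys x"
  proof
    fix M assume "M \<in> supp (gl_coef x)"
    then have "Node 0 M \<in> Poly_Mapping.keys x" by (auto simp: supp_def coef_gl_coef in_keys_iff)
    then show "M \<in> branches ` Poly_Mapping.keys x" by (intro image_eqI[of _ _ "Node 0 M"]) auto
  qed
qed simp

lemma lookup_eq_0_iff_coef:
  "Poly_Mapping.lookup x (Node 0 M) = 0 \<longleftrightarrow> coef (gl_coef x) M = 0"
  using of_nat_cancel[of "forest_sym M" "Poly_Mapping.lookup x (Node 0 M)" 0]
  by (auto simp: coef_gl_coef)

lemma gl_carrier_iff:
  "x \<in> gl_carrier W \<longleftrightarrow> rooted0 x \<and> (\<forall>M\<in>supp (gl_coef x). set_mset (labels M) \<subseteq> W)"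
proof
  assume x: "x \<in> gl_carrier W"
  have "Poly_Mapping.lookup x T = 0" if "root_label T \<noteq> 0" for T
    using x that by (auto simp: gl_carrier_def Tbar_eq in_keys_iff subset_iff)
  moreover have "set_mset (labels M) \<subseteq> W" if "M \<in> supp (gl_coef x)" for M
  proof -
    have "Node 0 M \<in> Poly_Mapping.keys x" using that by (simp add: in_keys_iff lookup_eq_0_iff_coef supp_def)
    then have "Node 0 M \<in> Tbar W" using x unfolding gl_carrier_def by blast
    then show ?thesis by simp
  qed
  ultimately show "rooted0 x \<and> (\<forall>M\<in>supp (gl_coef x). set_mset (labels M) \<subseteq> W)"
    by (simp add: rooted0_def)
next
  assume x: "rooted0 x \<and> (\<forall>M\<in>supp (gl_coef x). set_mset (labels M) \<subseteq> W)"
  show "x \<in> gl_carrier W"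
    unfolding gl_carrier_def
  proof safe
    fix T assume T: "T \<in> Poly_Mapping.keys x"
    obtain M where M: "T = Node 0 M" using rooted0_keys[OF _ T] x by (cases T) auto
    then show "T \<in> Tbar W" using T x by (auto simp: in_keys_iff lookup_eq_0_iff_coef supp_def)
  qed
qed

lemma gl_grade_iff:
  "x \<in> gl_grade W n \<longleftrightarrow> rooted0 x \<and>
    (\<forall>M\<in>supp (gl_coef x). set_mset (labels M) \<subseteq> W \<and> \<Sum>\<^sub># (labels M) = n)"
proof -
  have "(\<forall>T\<in>Poly_Mapping.keys x. weight T = n) \<longleftrightarrow> (\<forall>M\<in>supp (gl_coef x). \<Sum>\<^sub># (labels M) = n)"
    if r: "rooted0 x"
  proof
    assume *: "\<forall>T\<in>Poly_Mapping.keys x. weight T = n"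
    show "\<forall>M\<in>supp (gl_coef x). \<Sum>\<^sub># (labels M) = n"
    proof
      fix M assume "M \<in> supp (gl_coef x)"
      then have "Node 0 M \<in> Poly_Mapping.keys x" by (simp add: in_keys_iff lookup_eq_0_iff_coef supp_def)
      then have "weight (Node 0 M) = n" using * by blast
      then show "\<Sum>\<^sub># (labels M) = n" by (simp only: weight_Node add_0)
    qed
  next
    assume *: "\<forall>M\<in>supp (gl_coef x). \<Sum>\<^sub># (labels M) = n"
    show "\<forall>T\<in>Poly_Mapping.keys x. weight T = n"
    proof
      fix T assume T: "T \<in> Poly_Mapping.keys x"
      obtain M where M: "T = Node 0 M" using rooted0_keys[OF r T] by (cases T) auto
      then show "weight T = n" using T * by (auto simp: in_keys_iff lookup_eq_0_iff_coef supp_def)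
    qed
  qed
  then show ?thesis by (auto simp: gl_grade_def gl_carrier_iff)
qed

text \<open>Coordinates with respect to tensor products of normalised trees; in them the coproduct
  reads \<open>c (M + N)\<close>, without binomial factors.\<close>

definition gl2_coef :: "'k::rat_algebra gl2 \<Rightarrow> nat rtree multiset \<Rightarrow> nat rtree multiset \<Rightarrow> 'k" where
  "gl2_coef z M N = of_nat (forest_sym M * forest_sym N) * Poly_Mapping.lookup z (Node 0 M, Node 0 N)"

definition rooted00 :: "'k::rat_algebra gl2 \<Rightarrow> bool" where
  "rooted00 z \<longleftrightarrow> (\<forall>p. root_label (fst p) \<noteq> 0 \<or> root_label (snd p) \<noteq> 0 \<longrightarrow> Poly_Mapping.lookup z p = 0)"

lemma gl2_coef_inject:
  assumes "rooted00 z" "rooted00 z'" "gl2_coef z = gl2_coef z'"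
  shows "z = z'"
proof (rule poly_mapping_eqI)
  fix p
  show "Poly_Mapping.lookup z p = Poly_Mapping.lookup z' p"
  proof (cases "root_label (fst p) = 0 \<and> root_label (snd p) = 0")
    case True
    define M N where "M = branches (fst p)" and "N = branches (snd p)"
    have p: "p = (Node 0 M, Node 0 N)" using True unfolding M_def N_def by (metis prod.collapse rtree.collapse)
    have "of_nat (forest_sym M * forest_sym N) * Poly_Mapping.lookup z p =
        of_nat (forest_sym M * forest_sym N) * Poly_Mapping.lookup z' p"
      using fun_cong[OF fun_cong[OF assms(3)], of M N] by (simp add: gl2_coef_def p)
    then show ?thesis by (rule of_nat_cancel[rotated]) simp
  next
    case False
    then show ?thesis using assms(1,2) unfolding rooted00_def by metis
  qed
qed

lemma rooted00_sum: "(\<And>i. i \<in> A \<Longrightarrow> rooted00 (f i)) \<Longrightarrow> rooted00 (sum f A)"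
  by (auto simp: rooted00_def intro!: sum.neutral)

lemma rooted00_smult: "rooted00 z \<Longrightarrow> rooted00 (smult c z)"
  by (simp add: rooted00_def)

lemma rooted00_comult: "rooted00 (gl_comult x)"
  unfolding gl_comult_def gl_comult_basis_def
  by (intro rooted00_sum rooted00_smult)
    (auto simp: rooted00_def Bplus_def Poly_Mapping.lookup_single when_def)

lemma gl2_coef_comult_basis:
  "gl2_coef (gl_comult_basis T) M N = of_nat (fpair (branches T) (M + N))"
proof -
  let ?b = "\<lambda>I. image_mset fst (mset_set I)"
  have "gl2_coef (gl_comult_basis T) M N =
      (\<Sum>I\<in>Pow (root_children T). of_nat (fpair (?b I) M * fpair (?b (root_children T - I)) N))"
    unfolding gl2_coef_def gl_comult_basis_def Bplus_def lookup_sum sum_distrib_left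
    by (intro sum.cong refl) (auto simp: Poly_Mapping.lookup_single when_def fpair_def)
  also have "\<dots> = of_nat (\<Sum>I\<in>Pow (root_children T). fpair (?b I) M * fpair (?b (root_children T - I)) N)"
    by (simp only: of_nat_sum)
  finally show ?thesis
    by (simp only: fpair_sum_subsets[OF finite_root_children] image_mset_root_children)
qed

lemma gl2_coef_comult:
  assumes "rooted0 x"
  shows "gl2_coef (gl_comult x) M N = coef (gl_coef x) (M + N)"
proof -
  have "gl2_coef (gl_comult x) M N =
      (\<Sum>T\<in>Poly_Mapping.keys x. Poly_Mapping.lookup x T * gl2_coef (gl_comult_basis T) M N)"
    by (simp add: gl2_coef_def gl_comult_def sum_distrib_left mult.left_commute)
  then show ?thesis by (simp add: gl2_coef_comult_basis coef_gl_coef_sum_keys assms)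
qed

section \<open>Algebra homomorphisms from monoid algebras\<close>

text \<open>The structure map of an algebra over \<open>'k\<close>, kept as an argument because the
  targets vary: the base ring itself, free algebras and their tensor squares, convolution
  rings.\<close>

definition central :: "('k::comm_ring_1 \<Rightarrow> 'r::ring_1) \<Rightarrow> bool" where
  "central s \<longleftrightarrow> s 1 = 1 \<and> (\<forall>a b. s (a + b) = s a + s b) \<and> (\<forall>a b. s (a * b) = s a * s b) \<and>
    (\<forall>a x. s a * x = x * s a)"

definition alg_hom ::
  "('k::comm_ring_1 \<Rightarrow> 'r::ring_1) \<Rightarrow> (('w::monoid_add \<Rightarrow>\<^sub>0 'k) \<Rightarrow> 'r) \<Rightarrow> bool" where
  "alg_hom s \<phi> \<longleftrightarrow> (\<forall>x y. \<phi> (x + y) = \<phi> x + \<phi> y) \<and> (\<forall>c x. \<phi> (smult c x) = s c * \<phi> x) \<and>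
    \<phi> 1 = 1 \<and> (\<forall>x y. \<phi> (x * y) = \<phi> x * \<phi> y)"

lemma central_simps:
  assumes "central s"
  shows "s 1 = 1" "s (a + b) = s a + s b" "s (a * b) = s a * s b" "s 0 = 0" "s (of_nat n) = of_nat n"
proof -
  show *: "s 1 = 1" "s (a + b) = s a + s b" "s (a * b) = s a * s b" for a b
    using assms unfolding central_def by blast+
  show 0: "s 0 = 0" using *(2)[of 0 0] by simp
  show "s (of_nat n) = of_nat n" by (induction n) (simp_all add: * 0)
qed

lemma central_commute: "central s \<Longrightarrow> s a * x = x * s a"
  unfolding central_def by blast

lemma alg_homD:
  assumes "alg_hom s \<phi>"
  shows "\<phi> (x + y) = \<phi> x + \<phi> y" "\<phi> (smult c x) = s c * \<phi> x" "\<phi> 1 = 1" "\<phi> (x * y) = \<phi> x * \<phi> y"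
    "\<phi> 0 = 0" "\<phi> (- x) = - \<phi> x" "\<phi> (x - y) = \<phi> x - \<phi> y" "\<phi> (of_nat n) = of_nat n"
    "\<phi> (x ^ n) = \<phi> x ^ n"
proof -
  show *: "\<phi> (x + y) = \<phi> x + \<phi> y" "\<phi> (smult c x) = s c * \<phi> x" "\<phi> 1 = 1" "\<phi> (x * y) = \<phi> x * \<phi> y" for x y c
    using assms unfolding alg_hom_def by blast+
  show 0: "\<phi> 0 = 0" using *(1)[of 0 0] by simp
  show m: "\<phi> (- x) = - \<phi> x" for x using *(1)[of "- x" x] 0 by (simp add: eq_neg_iff_add_eq_0)
  show "\<phi> (x - y) = \<phi> x - \<phi> y" using *(1)[of x "- y"] m by simp
  show "\<phi> (of_nat n) = of_nat n" by (induction n) (simp_all add: * 0)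
  show "\<phi> (x ^ n) = \<phi> x ^ n" by (induction n) (simp_all add: *)
qed

lemma alg_hom_sum: "alg_hom s \<phi> \<Longrightarrow> \<phi> (sum f A) = (\<Sum>i\<in>A. \<phi> (f i))"
  by (induction A rule: infinite_finite_induct) (simp_all add: alg_homD)

lemma poly_mapping_add_induct [case_names zero add]:
  assumes "P 0" "\<And>k c x. P x \<Longrightarrow> P (Poly_Mapping.single k c + x)"
  shows "P (x :: 'w \<Rightarrow>\<^sub>0 'k::comm_monoid_add)"
proof -
  have "P (\<Sum>k\<in>A. Poly_Mapping.single k (Poly_Mapping.lookup x k))" if "finite A" for A
    using that assms by (induction A rule: finite_induct) auto
  moreover have "(\<Sum>k\<in>Poly_Mapping.keys x. Poly_Mapping.single k (Poly_Mapping.lookup x k)) = x"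
    by (rule poly_mapping_eqI) (simp add: Poly_Mapping.lookup_sum Poly_Mapping.lookup_single when_def in_keys_iff)
  ultimately show ?thesis by (metis finite_keys)
qed

lemma smult_single [simp]: "smult c (Poly_Mapping.single k d) = Poly_Mapping.single k (c * d)"
  by (rule poly_mapping_eqI) (simp add: Poly_Mapping.lookup_single when_def)

lemma smult_add: "smult c (x + y) = smult c x + smult c y"
  by (rule poly_mapping_eqI) (simp add: Poly_Mapping.lookup_add distrib_left)

lemma smult_0 [simp]: "smult c 0 = 0" "smult 0 x = 0"
  by (rule poly_mapping_eqI, simp)+

lemma smult_1 [simp]: "smult 1 x = x"
  by (rule poly_mapping_eqI) simp

lemma smult_smult [simp]: "smult c (smult d x) = smult (c * d) x"
  by (rule poly_mapping_eqI) (simp add: mult.assoc)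

lemma smult_eq_times: "smult c x = Poly_Mapping.single 0 c * (x :: 'w::monoid_add \<Rightarrow>\<^sub>0 'k::comm_ring_1)"
  by (induction x rule: poly_mapping_add_induct) (simp_all add: smult_add distrib_left Poly_Mapping.mult_single)

lemma times_smult: "x * smult c y = smult c (x * y :: 'w::monoid_add \<Rightarrow>\<^sub>0 'k::comm_ring_1)"
proof -
  have "x * Poly_Mapping.single 0 c = Poly_Mapping.single 0 c * x"
    by (induction x rule: poly_mapping_add_induct)
      (simp_all add: distrib_left distrib_right Poly_Mapping.mult_single mult.commute)
  then show ?thesis by (metis mult.assoc smult_eq_times)
qed

lemma smult_times: "smult c x * y = smult c (x * y :: 'w::monoid_add \<Rightarrow>\<^sub>0 'k::comm_ring_1)"
  by (simp add: smult_eq_times mult.assoc)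

lemma of_nat_smult: "of_nat n * x = smult (of_nat n) (x :: 'w::monoid_add \<Rightarrow>\<^sub>0 'k::comm_ring_1)"
  by (induction n) (simp_all add: distrib_right smult_eq_times Poly_Mapping.single_add flip: Poly_Mapping.single_one)

lemma central_single: "central (Poly_Mapping.single 0 :: 'k::comm_ring_1 \<Rightarrow> ('w::monoid_add \<Rightarrow>\<^sub>0 'k))"
proof -
  have "Poly_Mapping.single 0 a * x = x * Poly_Mapping.single 0 a" for a and x :: "'w \<Rightarrow>\<^sub>0 'k"
    using times_smult[of x a 1] by (simp add: smult_eq_times)
  then show ?thesis
    by (auto simp: central_def Poly_Mapping.single_add Poly_Mapping.mult_single)
qed

definition lin_ext :: "('k::comm_ring_1 \<Rightarrow> 'r::ring_1) \<Rightarrow> ('w \<Rightarrow> 'r) \<Rightarrow> ('w \<Rightarrow>\<^sub>0 'k) \<Rightarrow> 'r" where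
  "lin_ext s g x = (\<Sum>w\<in>Poly_Mapping.keys x. s (Poly_Mapping.lookup x w) * g w)"

lemma lin_ext_superset:
  assumes "s 0 = 0" "finite A" "Poly_Mapping.keys x \<subseteq> A"
  shows "lin_ext s g x = (\<Sum>w\<in>A. s (Poly_Mapping.lookup x w) * g w)"
  unfolding lin_ext_def using assms by (intro sum.mono_neutral_left) (auto simp: in_keys_iff)

lemma lin_ext_add:
  assumes "central s"
  shows "lin_ext s g (x + y) = lin_ext s g x + lin_ext s g y"
proof -
  let ?A = "Poly_Mapping.keys x \<union> Poly_Mapping.keys y"
  have "lin_ext s g z = (\<Sum>w\<in>?A. s (Poly_Mapping.lookup z w) * g w)" if "z \<in> {x, y, x + y}" for z
    using that Poly_Mapping.keys_add[of x y] by (intro lin_ext_superset central_simps[OF assms]) auto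
  then show ?thesis
    by (simp add: Poly_Mapping.lookup_add central_simps[OF assms] distrib_right sum.distrib)
qed

lemma lin_ext_single:
  assumes "central s"
  shows "lin_ext s g (Poly_Mapping.single k c) = s c * g k"
  using lin_ext_superset[of s "{k}" "Poly_Mapping.single k c" g] assms by (simp add: central_simps)

lemma lin_ext_0 [simp]: "lin_ext s g 0 = 0"
  by (simp add: lin_ext_def)

lemma alg_hom_lin_ext:
  assumes s: "central s" and g: "g 0 = 1" "\<And>u v. g (u + v) = g u * g v"
  shows "alg_hom s (lin_ext s g)"
  unfolding alg_hom_def
proof (intro conjI allI)
  note c = central_simps[OF s]
  show "lin_ext s g (x + y) = lin_ext s g x + lin_ext s g y" for x y by (rule lin_ext_add[OF s])
  show "lin_ext s g (smult a x) = s a * lin_ext s g x" for a x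
    by (induction x rule: poly_mapping_add_induct)
      (simp_all add: smult_add lin_ext_add[OF s] lin_ext_single[OF s] c distrib_left mult.assoc)
  show "lin_ext s g 1 = 1"
    using lin_ext_single[OF s, of g 0 1] by (simp add: c g)
  show "lin_ext s g (x * y) = lin_ext s g x * lin_ext s g y" for x y
  proof (induction x rule: poly_mapping_add_induct)
    case (add k a x)
    have "lin_ext s g (Poly_Mapping.single k a * y) = lin_ext s g (Poly_Mapping.single k a) * lin_ext s g y"
    proof (induction y rule: poly_mapping_add_induct)
      case (add l b y)
      have "s a * s b * (g k * g l) = s a * g k * (s b * g l)"
        by (metis central_commute[OF s] mult.assoc)
      then show ?case
        using add.IH by (simp add: distrib_left lin_ext_add[OF s] lin_ext_single[OF s] Poly_Mapping.mult_single c(3) g)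
    qed simp
    then show ?case using add.IH by (simp add: distrib_right lin_ext_add[OF s])
  qed simp
qed

section \<open>The universal property of the free algebra\<close>

fun word_eval :: "(nat \<Rightarrow> 'r::ring_1) \<Rightarrow> nat fword \<Rightarrow> 'r" where
  "word_eval l (FWord w) = prod_list (map l w)"

lemma word_eval_hom: "word_eval l 0 = 1" "word_eval l (u + v) = word_eval l u * word_eval l v"
  by (simp add: zero_fword_def) (cases u; cases v; simp)

definition free_hom :: "('k::comm_ring_1 \<Rightarrow> 'r::ring_1) \<Rightarrow> (nat \<Rightarrow> 'r) \<Rightarrow> (nat fword \<Rightarrow>\<^sub>0 'k) \<Rightarrow> 'r" where
  "free_hom s l = lin_ext s (word_eval l)"

lemma alg_hom_free_hom: "central s \<Longrightarrow> alg_hom s (free_hom s l)"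
  unfolding free_hom_def by (rule alg_hom_lin_ext) (simp_all add: word_eval_hom)

lemma free_hom_Lam: "central s \<Longrightarrow> free_hom s l (Lam (Suc n)) = l n"
  by (simp add: free_hom_def Lam_def lin_ext_single central_simps)

lemma Lam_0 [simp]: "Lam 0 = 1"
  by (simp add: Lam_def)

lemma nsym_Lam_induct:
  assumes add: "\<And>x y. P x \<Longrightarrow> P y \<Longrightarrow> P (x + y)" and smult: "\<And>c x. P x \<Longrightarrow> P (smult c x)"
    and one: "P 1" and mult: "\<And>x y. P x \<Longrightarrow> P y \<Longrightarrow> P (x * y)"
    and Lam: "\<And>m. m \<ge> 1 \<Longrightarrow> P (Lam m)"
  shows "P (x :: 'k::rat_algebra nsym)"
proof -
  have w: "P (basis (FWord w))" for w
  proof (induction w)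
    case Nil
    then show ?case using one by (simp add: zero_fword_def[symmetric])
  next
    case (Cons n w)
    have "basis (FWord (n # w)) = Lam (Suc n) * (basis (FWord w) :: 'k nsym)"
      by (simp add: Lam_def Poly_Mapping.mult_single)
    then show ?case using Cons Lam mult by simp
  qed
  show ?thesis
  proof (induction x rule: poly_mapping_add_induct)
    case zero
    then show ?case using smult[OF one, of 0] by simp
  next
    case (add k c x)
    have "Poly_Mapping.single k c = smult c (basis k)" by simp
    then show ?case using add assms(1) smult w by (cases k) metis
  qed
qed

section \<open>Power series over noncommutative rings\<close>

lemma fps_inverse_ex:
  fixes f :: "'r::ring_1 fps"
  assumes "fps_nth f 0 = 1"
  shows "\<exists>g. f * g = 1 \<and> g * f = 1"
  using fps_left_inverse[of 1 f] fps_right_inverse[of f 1] fps_left_inverse_eq_fps_right_inverse[of 1 f 1] assms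
  by auto

lemma inverse_unique_ring:
  fixes f :: "'r::monoid_mult"
  shows "g * f = 1 \<Longrightarrow> f * h = 1 \<Longrightarrow> g = h"
  by (metis mult.assoc mult_1_left mult_1_right)

lemma fps_power_nth_cong:
  fixes F G :: "'r::ring_1 fps"
  assumes "\<And>j. j < n \<Longrightarrow> fps_nth F j = fps_nth G j"
  shows "m < n \<Longrightarrow> fps_nth (F ^ i) m = fps_nth (G ^ i) m"
proof (induction i arbitrary: m)
  case (Suc i)
  then show ?case using assms by (auto simp: fps_mult_nth intro!: sum.cong)
qed simp

text \<open>In a product of at least two series without constant term, the coefficient
  \<open>n\<close> of one factor meets a zero constant term of another. So coefficient
  \<open>n\<close> of a higher power depends on earlier coefficients alone, which makes the
  logarithm recursive.\<close>

lemma fps_power_nth_cong2: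
  fixes F G :: "'r::ring_1 fps"
  assumes "\<And>j. j < n \<Longrightarrow> fps_nth F j = fps_nth G j" "fps_nth F 0 = 0" "fps_nth G 0 = 0" "i \<ge> 2"
  shows "fps_nth (F ^ i) n = fps_nth (G ^ i) n"
proof -
  obtain k where i: "i = Suc (Suc k)" using assms(4) by (metis add_2_eq_Suc le_Suc_ex)
  have "fps_nth F j * fps_nth (F ^ Suc k) (n - j) = fps_nth G j * fps_nth (G ^ Suc k) (n - j)" if jn: "j \<le> n" for j
  proof -
    consider "j = 0" | "j = n" | "0 < j" "j < n" using jn by linarith
    then show ?thesis
    proof cases
      case 3
      then show ?thesis using assms(1) fps_power_nth_cong[OF assms(1), of n "n - j" "Suc k"] by simp
    qed (simp_all add: assms(2,3))
  qed
  then show ?thesis unfolding i power_Suc[of _ "Suc k"] fps_mult_nth by (intro sum.cong) auto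
qed

text \<open>The composition is solved for its linear term; the test \<open>j < n\<close> truncates
  the series so that the recursion terminates.\<close>

fun log_rec :: "(nat \<Rightarrow> 'r::ring_1) \<Rightarrow> 'r fps \<Rightarrow> nat \<Rightarrow> 'r" where
  "log_rec a G n = (if n = 0 then 0 else
     fps_nth G n - (\<Sum>i=2..n. a i * fps_nth (Abs_fps (\<lambda>j. if j < n then log_rec a G j else 0) ^ i) n))"

declare log_rec.simps [simp del]

lemma sum_from_2:
  fixes f :: "nat \<Rightarrow> 'r::comm_monoid_add"
  assumes "n \<ge> 1"
  shows "sum f {0..n} = f 0 + f 1 + sum f {2..n}"
proof -
  have "{0..n} = {0, 1} \<union> {2..n}" using assms by auto
  then show ?thesis by (simp add: sum.union_disjoint add.assoc)
qed

text \<open>As \<open>a 1 = 1\<close>, coefficient \<open>n\<close> of \<open>F\<close> is isolated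
  in coefficient \<open>n\<close> of the composition. With \<open>a n\<close> equal to 1/n! this is
  existence and uniqueness of logarithms over noncommutative coefficients; it is applied both to
  \<Phi>(t) and to its image in the convolution ring.\<close>

lemma fps_compose_unique_root:
  fixes G :: "'r::ring_1 fps"
  assumes a: "a 0 = 1" "a 1 = 1" and G: "fps_nth G 0 = 1"
  shows "\<exists>!F. fps_nth F 0 = 0 \<and> Abs_fps a oo F = G"
proof -
  have nth: "fps_nth (Abs_fps a oo F) n = fps_nth F n + (\<Sum>i=2..n. a i * fps_nth (F ^ i) n)" if "n \<ge> 1" for F n
    using that a by (simp add: fps_compose_nth sum_from_2)
  have nth0: "fps_nth (Abs_fps a oo F) 0 = 1" for F using a by (simp add: fps_compose_nth)
  define F where "F = Abs_fps (log_rec a G)"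
  have F0: "fps_nth F 0 = 0" by (simp add: F_def log_rec.simps)
  have "Abs_fps a oo F = G"
  proof (rule fps_ext)
    fix n
    show "fps_nth (Abs_fps a oo F) n = fps_nth G n"
    proof (cases "n = 0")
      case False
      have "fps_nth (F ^ i) n = fps_nth (Abs_fps (\<lambda>j. if j < n then log_rec a G j else 0) ^ i) n" if "i \<in> {2..n}" for i
        using that False by (intro fps_power_nth_cong2) (auto simp: F_def log_rec.simps)
      then show ?thesis
        using False by (simp add: nth) (simp add: F_def log_rec.simps[of a G n])
    qed (simp add: a G)
  qed
  moreover have "F' = F" if F': "fps_nth F' 0 = 0" "Abs_fps a oo F' = G" for F'
  proof (rule fps_ext)
    fix n
    show "fps_nth F' n = fps_nth F n"
    proof (induction n rule: less_induct)
      case (less n)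
      show ?case
      proof (cases "n = 0")
        case False
        have "(\<Sum>i=2..n. a i * fps_nth (F' ^ i) n) = (\<Sum>i=2..n. a i * fps_nth (F ^ i) n)"
          using less F0 F' by (intro sum.cong refl arg_cong2[where f = times] fps_power_nth_cong2) auto
        moreover have "fps_nth (Abs_fps a oo F') n = fps_nth (Abs_fps a oo F) n"
          using F'(2) \<open>Abs_fps a oo F = G\<close> by simp
        ultimately show ?thesis using False by (simp add: nth)
      qed (use F0 F' in simp)
    qed
  qed
  ultimately show ?thesis using F0 by blast
qed

text \<open>The solution of \<open>S' = S * A\<close> with constant term 1; \<open>d n\<close>
  stands for the inverse of n in the coefficient ring.\<close>

fun ode_rec :: "(nat \<Rightarrow> 'r::ring_1) \<Rightarrow> 'r fps \<Rightarrow> nat \<Rightarrow> 'r" where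
  "ode_rec d A 0 = 1"
| "ode_rec d A (Suc n) = d (Suc n) * (\<Sum>k\<in>{0..n}. ode_rec d A k * fps_nth A (n - k))"

lemma ode_solution:
  fixes A :: "'r::ring_1 fps"
  assumes "\<And>n. n > 0 \<Longrightarrow> of_nat n * d n = 1"
  shows "fps_deriv (Abs_fps (ode_rec d A)) = Abs_fps (ode_rec d A) * A"
proof (rule fps_ext)
  fix n
  have "of_nat (Suc n) * (d (Suc n) * x) = x" for x
    using assms[of "Suc n"] by (simp add: mult.assoc[symmetric] del: of_nat_Suc)
  then show "fps_nth (fps_deriv (Abs_fps (ode_rec d A))) n = fps_nth (Abs_fps (ode_rec d A) * A) n"
    by (simp add: fps_mult_nth del: of_nat_Suc)
qed

lemma ode_unique:
  fixes A :: "'r::ring_1 fps" and d :: "nat \<Rightarrow> 'r"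
  assumes d: "\<And>n. n > 0 \<Longrightarrow> d n * of_nat n = 1"
    and S: "fps_deriv S = S * A" and S': "fps_deriv S' = S' * A" and 0: "fps_nth S 0 = fps_nth S' 0"
  shows "S = S'"
proof (rule fps_ext)
  fix n
  show "fps_nth S n = fps_nth S' n"
  proof (induction n rule: less_induct)
    case (less n)
    show ?case
    proof (cases n)
      case (Suc m)
      have "fps_nth (S * A) m = fps_nth (S' * A) m"
        using less Suc by (auto simp: fps_mult_nth intro!: sum.cong)
      then have "of_nat (Suc m) * fps_nth S (Suc m) = of_nat (Suc m) * fps_nth S' (Suc m)"
        using arg_cong[OF S, of "\<lambda>F. fps_nth F m"] arg_cong[OF S', of "\<lambda>F. fps_nth F m"] by simp
      then have "d (Suc m) * of_nat (Suc m) * fps_nth S (Suc m) = d (Suc m) * of_nat (Suc m) * fps_nth S' (Suc m)"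
        by (simp only: mult.assoc)
      then show ?thesis using d[of "Suc m"] Suc by simp
    qed (simp add: 0)
  qed
qed

lemma coeffwise_nth [simp]: "fps_nth (coeffwise f F) n = f (fps_nth F n)"
  by (simp add: coeffwise_def)

lemma coeffwise_mult:
  assumes "alg_hom s \<phi>"
  shows "coeffwise \<phi> (F * G) = coeffwise \<phi> F * coeffwise \<phi> G"
  by (rule fps_ext) (simp add: fps_mult_nth alg_homD[OF assms] alg_hom_sum[OF assms])

lemma coeffwise_1: "alg_hom s \<phi> \<Longrightarrow> coeffwise \<phi> 1 = 1"
  by (rule fps_ext) (simp add: alg_homD)

lemma coeffwise_power: "alg_hom s \<phi> \<Longrightarrow> coeffwise \<phi> (F ^ n) = coeffwise \<phi> F ^ n"
  by (induction n) (simp_all add: coeffwise_1 coeffwise_mult)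

lemma coeffwise_deriv:
  assumes "alg_hom s \<phi>"
  shows "coeffwise \<phi> (fps_deriv F) = fps_deriv (coeffwise \<phi> F)"
  by (rule fps_ext) (simp add: alg_homD[OF assms] del: of_nat_Suc of_nat_add)

section \<open>Noncommutative symmetric functions\<close>

lemma lam_neg_ser_0 [simp]: "fps_nth lam_neg_ser 0 = 1"
  by (simp add: lam_neg_ser_def lam_ser_def)

lemma sigma_ser: "lam_neg_ser * sigma_ser = (1 :: 'k::rat_algebra nsym fps)"
    "sigma_ser * lam_neg_ser = (1 :: 'k nsym fps)"
proof -
  obtain g where g: "lam_neg_ser * g = (1 :: 'k nsym fps)" "g * lam_neg_ser = 1"
    using fps_inverse_ex[OF lam_neg_ser_0] by blast
  have "sigma_ser = g"
    unfolding sigma_ser_def using g inverse_unique_ring by (intro the_equality) blast+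
  then show "lam_neg_ser * sigma_ser = (1 :: 'k nsym fps)" "sigma_ser * lam_neg_ser = (1 :: 'k nsym fps)"
    using g by simp_all
qed

lemma sigma_ser_0 [simp]: "fps_nth sigma_ser 0 = 1"
  using arg_cong[OF sigma_ser(1), of "\<lambda>F. fps_nth F 0"] by simp

lemma psi_ser_eq: "psi_ser = lam_neg_ser * fps_deriv sigma_ser"
  unfolding psi_ser_def
proof (rule the_equality)
  show "fps_deriv sigma_ser = sigma_ser * (lam_neg_ser * fps_deriv sigma_ser :: 'k::rat_algebra nsym fps)"
    by (simp add: mult.assoc[symmetric] sigma_ser)
next
  fix p :: "'k::rat_algebra nsym fps"
  assume "fps_deriv sigma_ser = sigma_ser * p"
  then show "p = lam_neg_ser * fps_deriv sigma_ser" by (simp add: mult.assoc[symmetric] sigma_ser)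
qed

lemma xi_ser_eq: "xi_ser = fps_deriv sigma_ser * lam_neg_ser"
  unfolding xi_ser_def
proof (rule the_equality)
  show "fps_deriv sigma_ser = fps_deriv sigma_ser * lam_neg_ser * (sigma_ser :: 'k::rat_algebra nsym fps)"
    by (simp add: mult.assoc sigma_ser)
next
  fix p :: "'k::rat_algebra nsym fps"
  assume "fps_deriv sigma_ser = p * sigma_ser"
  then show "p = fps_deriv sigma_ser * lam_neg_ser" by (simp add: mult.assoc sigma_ser)
qed

lemma deriv_sigma: "fps_deriv sigma_ser = sigma_ser * psi_ser"
  by (simp add: psi_ser_eq mult.assoc[symmetric] sigma_ser)

lemma Phi_ser: "fps_nth (Phi_ser :: 'k::rat_algebra nsym fps) 0 = 0" "exp_ser Phi_ser = (sigma_ser :: 'k::rat_algebra nsym fps)"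
proof -
  have "\<exists>!F. fps_nth F 0 = 0 \<and> exp_ser F = (sigma_ser :: 'k nsym fps)"
    unfolding exp_ser_def by (rule fps_compose_unique_root) (simp_all add: rat_emb_1)
  from theI'[OF this] show "fps_nth (Phi_ser :: 'k nsym fps) 0 = 0" "exp_ser Phi_ser = (sigma_ser :: 'k nsym fps)"
    unfolding Phi_ser_def by simp_all
qed

lemma psi_ser_nth: "fps_nth psi_ser n = Psi (Suc n)"
  by (simp add: Psi_def)

lemma smult_of_nat_inverse: "n > 0 \<Longrightarrow> smult (rat_emb (1 / of_nat n)) (of_nat n * x) = (x :: 'k::rat_algebra nsym)"
  by (simp add: of_nat_smult mult.commute[of "rat_emb _"] of_nat_inverse)

lemma lam_neg_nth: "fps_nth lam_neg_ser m = (-1) ^ m * Lam m"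
  by (simp add: lam_neg_ser_def lam_ser_def)

lemma minus_one_power_times: "(-1) ^ m * x = smult ((-1) ^ m) (x :: 'w::monoid_add \<Rightarrow>\<^sub>0 'k::comm_ring_1)"
proof (induction m)
  case (Suc m)
  have "smult (- 1) y = - y" for y :: "'w \<Rightarrow>\<^sub>0 'k" by (rule poly_mapping_eqI) simp
  then have "smult ((-1) ^ Suc m) x = - smult ((-1) ^ m) x"
    by (metis power_Suc smult_smult)
  then show ?case using Suc by simp
qed simp

text \<open>The coefficients of \<sigma>' = \<sigma>\<psi>, which are Newton's identities, express n
  S_n through earlier terms and the \<Psi>'s, and n is invertible. Inverting \<sigma> then reaches
  the \<Lambda>'s, which generate by construction.\<close>

lemma nsym_Psi_induct:
  assumes add: "\<And>x y. P x \<Longrightarrow> P y \<Longrightarrow> P (x + y)" and smult: "\<And>c x. P x \<Longrightarrow> P (smult c x)"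
    and one: "P 1" and mult: "\<And>x y. P x \<Longrightarrow> P y \<Longrightarrow> P (x * y)"
    and Psi: "\<And>m. m \<ge> 1 \<Longrightarrow> P (Psi m)"
  shows "P (x :: 'k::rat_algebra nsym)"
proof -
  have zero: "P 0" using smult[OF one, of 0] by simp
  have sum: "P (sum f A)" if "\<And>i. i \<in> A \<Longrightarrow> P (f i)" for f :: "nat \<Rightarrow> 'k nsym" and A
    using that by (induction A rule: infinite_finite_induct) (auto intro: add zero)
  have sigma: "P (fps_nth sigma_ser n)" for n
  proof (induction n rule: less_induct)
    case (less n)
    show ?case
    proof (cases n)
      case (Suc m)
      have "of_nat (Suc m) * fps_nth sigma_ser (Suc m) = (\<Sum>k=0..m. fps_nth sigma_ser k * (Psi (Suc (m - k)) :: 'k nsym))"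
        using arg_cong[OF deriv_sigma, of "\<lambda>F. fps_nth F m"] by (simp add: fps_mult_nth psi_ser_nth)
      moreover have "P (\<Sum>k=0..m. fps_nth sigma_ser k * (Psi (Suc (m - k)) :: 'k nsym))"
        using less Suc by (intro sum mult Psi) auto
      ultimately have "P (of_nat (Suc m) * fps_nth sigma_ser (Suc m))" by simp
      from smult[OF this, of "rat_emb (1 / of_nat (Suc m))"] show ?thesis
        unfolding Suc smult_of_nat_inverse[OF zero_less_Suc] .
    qed (simp add: one)
  qed
  have lam: "P (fps_nth lam_neg_ser n)" for n
  proof (induction n rule: less_induct)
    case (less n)
    show ?case
    proof (cases "n = 0")
      case False
      have "(\<Sum>k=0..n. fps_nth lam_neg_ser k * fps_nth sigma_ser (n - k)) = (0 :: 'k nsym)"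
        using arg_cong[OF sigma_ser(1), of "\<lambda>F. fps_nth F n"] False by (simp add: fps_mult_nth)
      moreover have "{0..n} = insert n {0..<n}" by auto
      ultimately have "fps_nth lam_neg_ser n = - (\<Sum>k=0..<n. fps_nth lam_neg_ser k * fps_nth sigma_ser (n - k) :: 'k nsym)"
        by (simp add: eq_neg_iff_add_eq_0)
      also have "\<dots> = smult (-1) (\<Sum>k=0..<n. fps_nth lam_neg_ser k * fps_nth sigma_ser (n - k))"
        using minus_one_power_times[of 1] by simp
      also have "P \<dots>" using less sigma by (intro smult sum mult) auto
      finally show ?thesis .
    qed (simp add: one)
  qed
  have "P (Lam m)" for m
  proof -
    have "Lam m = smult ((-1) ^ m) (fps_nth lam_neg_ser m :: 'k nsym)"
      by (simp add: lam_neg_nth minus_one_power_times flip: power_add)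
    then show ?thesis using smult lam by simp
  qed
  from nsym_Lam_induct[of P, OF add smult one mult this] show ?thesis .
qed

lemma alg_hom_Psi_unique:
  assumes "alg_hom s \<phi>" "alg_hom s \<phi>'" "\<And>m. m \<ge> 1 \<Longrightarrow> \<phi> (Psi m) = \<phi>' (Psi m)"
  shows "\<phi> x = \<phi>' x"
  by (induction x rule: nsym_Psi_induct) (simp_all add: alg_homD[OF assms(1)] alg_homD[OF assms(2)] assms(3))

text \<open>Freeness on the \<Psi>'s, although the algebra is built on the \<Lambda>'s: for
  prescribed values \<open>A\<close> the equation \<open>S' = S * A\<close> yields the image of
  \<sigma>, the inverse \<open>L\<close> of \<open>S\<close> that of \<lambda>(-t), and the
  coefficients of \<open>L\<close>, with signs, are admissible values on the free generators
  \<Lambda>.\<close>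

lemma alg_hom_Psi_exists:
  fixes s :: "'k::rat_algebra \<Rightarrow> 'r::ring_1"
  assumes s: "central s"
  shows "\<exists>\<phi>. alg_hom s \<phi> \<and> (\<forall>m\<ge>1. \<phi> (Psi m) = a m)"
proof -
  define d where "d n = s (rat_emb (1 / of_nat n))" for n
  define A where "A = Abs_fps (\<lambda>n. a (Suc n))"
  define S where "S = Abs_fps (ode_rec d A)"
  have "of_nat n * d n = 1" if "n > 0" for n
    unfolding d_def central_simps(5)[OF s, symmetric] central_simps(3)[OF s, symmetric]
    by (simp add: of_nat_inverse[OF that] central_simps[OF s])
  then have S: "fps_deriv S = S * A" unfolding S_def by (rule ode_solution)
  have S0: "fps_nth S 0 = 1" by (simp add: S_def)
  then obtain L where L: "S * L = 1" "L * S = 1" using fps_inverse_ex by blast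
  have L0: "fps_nth L 0 = 1" using arg_cong[OF L(1), of "\<lambda>F. fps_nth F 0"] S0 by simp
  define \<phi> where "\<phi> = free_hom s (\<lambda>n. (-1) ^ Suc n * fps_nth L (Suc n))"
  have \<phi>: "alg_hom s \<phi>" unfolding \<phi>_def by (rule alg_hom_free_hom[OF s])
  have Lam: "\<phi> (Lam m) = (-1) ^ m * fps_nth L m" for m
    using free_hom_Lam[OF s] alg_homD(3)[OF \<phi>] by (cases m) (simp_all add: \<phi>_def L0)
  have l: "coeffwise \<phi> lam_neg_ser = L"
  proof (rule fps_ext)
    fix n
    have "fps_nth (coeffwise \<phi> lam_neg_ser) n = (-1) ^ n * ((-1) ^ n * fps_nth L n)"
      by (simp add: lam_neg_nth alg_homD[OF \<phi>] Lam)
    also have "\<dots> = fps_nth L n" by (simp add: mult.assoc[symmetric] flip: power_add)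
    finally show "fps_nth (coeffwise \<phi> lam_neg_ser) n = fps_nth L n" .
  qed
  have sg: "coeffwise \<phi> sigma_ser = S"
  proof (rule inverse_unique_ring)
    show "coeffwise \<phi> sigma_ser * coeffwise \<phi> lam_neg_ser = 1"
      by (simp add: coeffwise_mult[OF \<phi>, symmetric] sigma_ser coeffwise_1[OF \<phi>])
    show "coeffwise \<phi> lam_neg_ser * S = 1" using l L by simp
  qed
  have "coeffwise \<phi> psi_ser = L * (S * A)"
    unfolding psi_ser_eq coeffwise_mult[OF \<phi>] coeffwise_deriv[OF \<phi>] l sg S ..
  also have "\<dots> = A" unfolding mult.assoc[symmetric] L by simp
  finally have "fps_nth (coeffwise \<phi> psi_ser) n = fps_nth A n" for n by simp
  then have "\<phi> (Psi (Suc n)) = a (Suc n)" for n by (simp add: A_def psi_ser_nth)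
  then have "\<forall>m\<ge>1. \<phi> (Psi m) = a m" by (metis One_nat_def Suc_le_D)
  then show ?thesis using \<phi> by blast
qed

section \<open>Coproduct, counit and antipode of noncommutative symmetric functions\<close>

lemma alg_hom_single_iff:
  "alg_hom (Poly_Mapping.single 0) \<phi> \<longleftrightarrow> (\<forall>x y. \<phi> (x + y) = \<phi> x + \<phi> y) \<and>
    (\<forall>c x. \<phi> (smult c x) = smult c (\<phi> x)) \<and> \<phi> 1 = 1 \<and> (\<forall>x y. \<phi> (x * y) = \<phi> x * \<phi> y)"
  unfolding alg_hom_def smult_eq_times[symmetric] ..

lemma nsym_comult:
  "alg_hom (Poly_Mapping.single 0) (nsym_comult :: 'k::rat_algebra nsym \<Rightarrow> _)"
  "m \<ge> 1 \<Longrightarrow> nsym_comult (Psi m) = tensor (Psi m) 1 + tensor 1 (Psi m :: 'k nsym)"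
proof -
  let ?Q = "\<lambda>D :: 'k nsym \<Rightarrow> 'k nsym2. (\<forall>x y. D (x + y) = D x + D y) \<and> (\<forall>c x. D (smult c x) = smult c (D x)) \<and>
     D 1 = 1 \<and> (\<forall>x y. D (x * y) = D x * D y) \<and> (\<forall>m\<ge>1. D (Psi m) = tensor (Psi m) 1 + tensor 1 (Psi m))"
  obtain D :: "'k nsym \<Rightarrow> 'k nsym2" where
    D: "alg_hom (Poly_Mapping.single 0) D" "\<forall>m\<ge>1. D (Psi m) = tensor (Psi m) 1 + tensor 1 (Psi m)"
    using alg_hom_Psi_exists[OF central_single, of "\<lambda>m. tensor (Psi m) 1 + tensor 1 (Psi m)"] by blast
  have "?Q D" using D unfolding alg_hom_single_iff by blast
  moreover have "E = D" if "?Q E" for E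
  proof (rule ext, rule alg_hom_Psi_unique)
    show "alg_hom (Poly_Mapping.single 0) E" using that unfolding alg_hom_single_iff by blast
    show "E (Psi m) = D (Psi m)" if "m \<ge> 1" for m using \<open>?Q E\<close> D(2) that by metis
  qed (rule D(1))
  ultimately have "nsym_comult = D" unfolding nsym_comult_def by (intro the_equality) blast+
  then show "alg_hom (Poly_Mapping.single 0) (nsym_comult :: 'k nsym \<Rightarrow> _)"
    "m \<ge> 1 \<Longrightarrow> nsym_comult (Psi m) = tensor (Psi m) 1 + tensor 1 (Psi m :: 'k nsym)"
    using D by simp_all
qed

lemma central_id: "central (\<lambda>c. c)"
  by (simp add: central_def mult.commute)

lemma nsym_counit:
  "alg_hom (\<lambda>c. c) (nsym_counit :: 'k::rat_algebra nsym \<Rightarrow> _)"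
  "m \<ge> 1 \<Longrightarrow> nsym_counit (Psi m :: 'k nsym) = 0"
proof -
  let ?Q = "\<lambda>E :: 'k nsym \<Rightarrow> 'k. (\<forall>x y. E (x + y) = E x + E y) \<and> (\<forall>c x. E (smult c x) = c * E x) \<and>
     E 1 = 1 \<and> (\<forall>x y. E (x * y) = E x * E y) \<and> (\<forall>m\<ge>1. E (Psi m) = 0)"
  obtain D :: "'k nsym \<Rightarrow> 'k" where D: "alg_hom (\<lambda>c. c) D" "\<forall>m\<ge>1. D (Psi m) = 0"
    using alg_hom_Psi_exists[OF central_id, of "\<lambda>_. 0"] by blast
  have "?Q D" using D unfolding alg_hom_def by blast
  moreover have "E = D" if "?Q E" for E
  proof (rule ext, rule alg_hom_Psi_unique)
    show "alg_hom (\<lambda>c. c) E" using that unfolding alg_hom_def by blast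
    show "E (Psi m) = D (Psi m)" if "m \<ge> 1" for m using \<open>?Q E\<close> D(2) that by metis
  qed (rule D(1))
  ultimately have "nsym_counit = D" unfolding nsym_counit_def by (intro the_equality) blast+
  then show "alg_hom (\<lambda>c. c) (nsym_counit :: 'k nsym \<Rightarrow> _)" "m \<ge> 1 \<Longrightarrow> nsym_counit (Psi m :: 'k nsym) = 0"
    using D by simp_all
qed

fun rev_word :: "'a fword \<Rightarrow> 'a fword" where
  "rev_word (FWord w) = FWord (rev w)"

lemma rev_word_add: "rev_word (u + v) = rev_word v + rev_word u"
  by (cases u; cases v) simp

text \<open>Reversal of words is an anti-automorphism; composing with it turns the antipode, an
  antihomomorphism, into a homomorphism to which freeness applies.\<close>

definition nsym_rev :: "'k::comm_ring_1 nsym \<Rightarrow> 'k nsym" where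
  "nsym_rev = lin_ext (Poly_Mapping.single 0) (\<lambda>w. basis (rev_word w))"

lemma nsym_rev_add: "nsym_rev (x + y) = nsym_rev x + nsym_rev y"
  by (simp add: nsym_rev_def lin_ext_add[OF central_single])

lemma nsym_rev_single: "nsym_rev (Poly_Mapping.single w c) = Poly_Mapping.single (rev_word w) c"
  by (simp add: nsym_rev_def lin_ext_single[OF central_single] Poly_Mapping.mult_single)

lemma nsym_rev_0 [simp]: "nsym_rev 0 = 0"
  by (simp add: nsym_rev_def)

lemma nsym_rev_1 [simp]: "nsym_rev 1 = 1"
proof -
  have "rev_word 0 = 0" by (simp add: zero_fword_def)
  then show ?thesis by (metis nsym_rev_single Poly_Mapping.single_one)
qed

lemma nsym_rev_smult: "nsym_rev (smult c x) = smult c (nsym_rev x)"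
  by (induction x rule: poly_mapping_add_induct) (simp_all add: smult_add nsym_rev_add nsym_rev_single)

lemma nsym_rev_mult: "nsym_rev (x * y) = nsym_rev y * nsym_rev x"
proof (induction x rule: poly_mapping_add_induct)
  case (add k a x)
  have "nsym_rev (Poly_Mapping.single k a * y) = nsym_rev y * nsym_rev (Poly_Mapping.single k a)"
    by (induction y rule: poly_mapping_add_induct)
      (simp_all add: distrib_left distrib_right nsym_rev_add nsym_rev_single Poly_Mapping.mult_single rev_word_add mult.commute)
  then show ?case using add.IH by (simp add: distrib_left distrib_right nsym_rev_add)
qed simp

lemma nsym_rev_rev [simp]: "nsym_rev (nsym_rev x) = x"
proof (induction x rule: poly_mapping_add_induct)
  case (add k c x)
  have "rev_word (rev_word k) = k" by (cases k) simp
  then show ?case using add by (simp add: nsym_rev_add nsym_rev_single)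
qed simp

lemma nsym_rev_minus: "nsym_rev (- x) = - nsym_rev (x :: 'k::comm_ring_1 nsym)"
proof -
  have "- y = smult (- 1) y" for y :: "'k nsym" by (rule poly_mapping_eqI) simp
  then show ?thesis by (metis nsym_rev_smult)
qed

lemma nsym_antipode:
  fixes x y :: "'k::rat_algebra nsym"
  shows "nsym_antipode (x + y) = nsym_antipode x + nsym_antipode y"
    "nsym_antipode (smult c x) = smult c (nsym_antipode x)"
    "nsym_antipode (1 :: 'k nsym) = 1"
    "nsym_antipode (x * y) = nsym_antipode y * nsym_antipode x"
    "m \<ge> 1 \<Longrightarrow> nsym_antipode (Psi m :: 'k nsym) = - Psi m"
proof -
  let ?Q = "\<lambda>S :: 'k nsym \<Rightarrow> 'k nsym. (\<forall>x y. S (x + y) = S x + S y) \<and> (\<forall>c x. S (smult c x) = smult c (S x)) \<and>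
     S 1 = 1 \<and> (\<forall>x y. S (x * y) = S y * S x) \<and> (\<forall>m\<ge>1. S (Psi m) = - Psi m)"
  obtain \<phi> :: "'k nsym \<Rightarrow> 'k nsym" where
    \<phi>: "alg_hom (Poly_Mapping.single 0) \<phi>" "\<forall>m\<ge>1. \<phi> (Psi m) = - nsym_rev (Psi m)"
    using alg_hom_Psi_exists[OF central_single, of "\<lambda>m. - nsym_rev (Psi m)"] by blast
  define D where "D = (\<lambda>x. nsym_rev (\<phi> x))"
  note h = \<phi>(1)[unfolded alg_hom_single_iff]
  have D: "?Q D"
    using h \<phi>(2) by (simp add: D_def nsym_rev_add nsym_rev_mult nsym_rev_minus nsym_rev_smult)
  moreover have "E = D" if E: "?Q E" for E
  proof
    fix x show "E x = D x"
      by (induction x rule: nsym_Psi_induct) (use E D in auto)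
  qed
  ultimately have e: "nsym_antipode = D" unfolding nsym_antipode_def by (intro the_equality) blast+
  show "nsym_antipode (x + y) = nsym_antipode x + nsym_antipode y"
    "nsym_antipode (smult c x) = smult c (nsym_antipode x)"
    "nsym_antipode (1 :: 'k nsym) = 1"
    "nsym_antipode (x * y) = nsym_antipode y * nsym_antipode x"
    "m \<ge> 1 \<Longrightarrow> nsym_antipode (Psi m :: 'k nsym) = - Psi m"
    using D unfolding e by blast+
qed

section \<open>Tensor products of free modules\<close>

lemma lookup_tensor [simp]: "Poly_Mapping.lookup (tensor x y) (u, v) = Poly_Mapping.lookup x u * Poly_Mapping.lookup y v"
proof -
  let ?l = Poly_Mapping.lookup and ?k = Poly_Mapping.keys
  have "?l (tensor x y) (u, v) = (\<Sum>u'\<in>?k x. \<Sum>v'\<in>?k y. (if u' = u then ?l x u else 0) * (if v' = v then ?l y v else 0))"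
    unfolding tensor_def Poly_Mapping.lookup_sum
    by (intro sum.cong refl) (auto simp: Poly_Mapping.lookup_single when_def)
  also have "\<dots> = (\<Sum>u'\<in>?k x. if u' = u then ?l x u else 0) * (\<Sum>v'\<in>?k y. if v' = v then ?l y v else 0)"
    by (simp only: sum_product)
  also have "\<dots> = ?l x u * ?l y v"
    by (simp add: in_keys_iff)
  finally show ?thesis .
qed

lemma tensor_add_left: "tensor (x + x') y = tensor x y + tensor x' y"
  by (rule poly_mapping_eqI) (simp add: split_paired_all Poly_Mapping.lookup_add distrib_right)

lemma tensor_add_right: "tensor x (y + y') = tensor x y + tensor x y'"
  by (rule poly_mapping_eqI) (simp add: split_paired_all Poly_Mapping.lookup_add distrib_left)

lemma tensor_0 [simp]: "tensor 0 y = 0" "tensor x 0 = 0"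
  by (rule poly_mapping_eqI, simp add: split_paired_all)+

lemma tensor_single: "tensor (Poly_Mapping.single u a) (Poly_Mapping.single v b) = Poly_Mapping.single (u, v) (a * b)"
  by (rule poly_mapping_eqI) (auto simp: split_paired_all Poly_Mapping.lookup_single when_def)

lemma tensor_1 [simp]: "tensor (1 :: 'k::comm_ring_1 nsym) 1 = 1"
  using tensor_single[of 0 1 0 "1 :: 'k"] by (simp add: zero_prod_def[symmetric])

lemma tensor_mult:
  fixes x y x' y' :: "'w::monoid_add \<Rightarrow>\<^sub>0 'k::comm_ring_1"
  shows "tensor x y * tensor x' y' = tensor (x * x') (y * y')"
proof (induction x rule: poly_mapping_add_induct)
  case (add u a x)
  have "tensor (Poly_Mapping.single u a) y * tensor x' y' = tensor (Poly_Mapping.single u a * x') (y * y')"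
  proof (induction y rule: poly_mapping_add_induct)
    case (add v b y)
    have "tensor (Poly_Mapping.single u a) (Poly_Mapping.single v b) * tensor x' y' =
        tensor (Poly_Mapping.single u a * x') (Poly_Mapping.single v b * y')"
    proof (induction x' rule: poly_mapping_add_induct)
      case (add u' a' x')
      have "tensor (Poly_Mapping.single u a) (Poly_Mapping.single v b) * tensor (Poly_Mapping.single u' a') y' =
          tensor (Poly_Mapping.single u a * Poly_Mapping.single u' a') (Poly_Mapping.single v b * y')"
        by (induction y' rule: poly_mapping_add_induct)
          (simp_all add: tensor_add_right distrib_left tensor_single Poly_Mapping.mult_single mult_ac)
      then show ?case using add.IH by (simp add: tensor_add_left distrib_left)
    qed simp
    then show ?case using add.IH by (simp add: tensor_add_right distrib_right)
  qed simp
  then show ?case using add.IH by (simp add: tensor_add_left distrib_right)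
qed simp

section \<open>Primitive functions on forests and the constants \<open>\<theta>\<^sub>T\<close>\<close>

definition prim :: "('a rtree \<Rightarrow> 'k::comm_ring_1) \<Rightarrow> ('a rtree multiset, 'k) conv" where
  "prim f = Conv (\<lambda>M. if size M = 1 then f (the_elem (set_mset M)) else 0)"

lemma coef_prim_single [simp]: "coef (prim f) {#t#} = f t"
  and coef_prim_size: "size M \<noteq> 1 \<Longrightarrow> coef (prim f) M = 0"
  and coef_prim_empty [simp]: "coef (prim f) {#} = 0"
  by (simp_all add: prim_def)

text \<open>Convolving on the left with a function living on single trees keeps only those cuts that
  prune a single tree; these are the cuts of one edge.\<close>

lemma coef_prim_times:
  "coef (prim f * c) F = (\<Sum>p\<in>#cop F. if size (fst p) = 1 then f (the_elem (set_mset (fst p))) * coef c (snd p) else 0)"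
  unfolding coef_times by (rule sum_mset_cong) (simp add: prim_def)

text \<open>A single pruned tree is \<open>Node a M\<close> itself, lies inside \<open>M\<close>, or
  lies inside \<open>N\<close>; in the last two cases the counit law says that the other forest
  stays uncut.\<close>

lemma sum_single_cuts_add:
  fixes \<phi> :: "'a rtree \<Rightarrow> 'a rtree multiset \<Rightarrow> 'e::comm_monoid_add"
  shows "(\<Sum>p\<in>#cop (add_mset (Node a M) N). if size (fst p) = 1 then \<phi> (the_elem (set_mset (fst p))) (snd p) else 0) =
    \<phi> (Node a M) N +
    (\<Sum>p\<in>#cop M. if size (fst p) = 1 then \<phi> (the_elem (set_mset (fst p))) (add_mset (Node a (snd p)) N) else 0) +
    (\<Sum>p\<in>#cop N. if size (fst p) = 1 then \<phi> (the_elem (set_mset (fst p))) (add_mset (Node a M) (snd p)) else 0)"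
proof -
  let ?\<psi> = "\<lambda>A B. if size A = 1 then \<phi> (the_elem (set_mset A)) B else 0"
  have e: "add_mset (Node a M) N = {#Node a M#} + N" by simp
  have "(\<Sum>p\<in>#cop (add_mset (Node a M) N). ?\<psi> (fst p) (snd p)) =
      (\<Sum>q\<in>#cop N. ?\<psi> ({#Node a M#} + fst q) (snd q)) +
      (\<Sum>p\<in>#cop M. \<Sum>q\<in>#cop N. ?\<psi> (fst p + fst q) ({#Node a (snd p)#} + snd q))"
    unfolding e sum_cop_union sum_cop_Node fst_conv snd_conv empty_neutral ..
  also have "(\<Sum>q\<in>#cop N. ?\<psi> ({#Node a M#} + fst q) (snd q)) = (\<Sum>q\<in>#cop N. if eps (fst q) then \<phi> (Node a M) (snd q) else 0)"
    by (rule sum_mset_cong) auto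
  also have "\<dots> = \<phi> (Node a M) N" by (rule counit_left)
  also have "(\<Sum>p\<in>#cop M. \<Sum>q\<in>#cop N. ?\<psi> (fst p + fst q) ({#Node a (snd p)#} + snd q)) =
      (\<Sum>p\<in>#cop M. \<Sum>q\<in>#cop N. if eps (fst q) then ?\<psi> (fst p) (add_mset (Node a (snd p)) (snd q)) else 0) +
      (\<Sum>q\<in>#cop N. \<Sum>p\<in>#cop M. if eps (fst p) then ?\<psi> (fst q) (add_mset (Node a (snd p)) (snd q)) else 0)"
  proof -
    have "(\<Sum>p\<in>#cop M. \<Sum>q\<in>#cop N. ?\<psi> (fst p + fst q) ({#Node a (snd p)#} + snd q)) =
        (\<Sum>p\<in>#cop M. \<Sum>q\<in>#cop N. (if eps (fst q) then ?\<psi> (fst p) (add_mset (Node a (snd p)) (snd q)) else 0) +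
          (if eps (fst p) then ?\<psi> (fst q) (add_mset (Node a (snd p)) (snd q)) else 0))"
    proof (intro sum_mset_cong)
      fix p q :: "'a rtree multiset \<times> 'a rtree multiset"
      show "?\<psi> (fst p + fst q) ({#Node a (snd p)#} + snd q) =
          (if eps (fst q) then ?\<psi> (fst p) (add_mset (Node a (snd p)) (snd q)) else 0) +
          (if eps (fst p) then ?\<psi> (fst q) (add_mset (Node a (snd p)) (snd q)) else 0)"
        by (cases "fst p"; cases "fst q") auto
    qed
    also have "\<dots> = (\<Sum>p\<in>#cop M. \<Sum>q\<in>#cop N. if eps (fst q) then ?\<psi> (fst p) (add_mset (Node a (snd p)) (snd q)) else 0) +
      (\<Sum>p\<in>#cop M. \<Sum>q\<in>#cop N. if eps (fst p) then ?\<psi> (fst q) (add_mset (Node a (snd p)) (snd q)) else 0)"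
      by (simp only: sum_mset.distrib)
    finally show ?thesis by (simp only: sum_mset.swap[of _ "cop N" "cop M"])
  qed
  also have "(\<Sum>p\<in>#cop M. \<Sum>q\<in>#cop N. if eps (fst q) then ?\<psi> (fst p) (add_mset (Node a (snd p)) (snd q)) else 0) =
      (\<Sum>p\<in>#cop M. ?\<psi> (fst p) (add_mset (Node a (snd p)) N))"
    by (intro sum_mset_cong) (rule counit_left)
  also have "(\<Sum>q\<in>#cop N. \<Sum>p\<in>#cop M. if eps (fst p) then ?\<psi> (fst q) (add_mset (Node a (snd p)) (snd q)) else 0) =
      (\<Sum>q\<in>#cop N. ?\<psi> (fst q) (add_mset (Node a M) (snd q)))"
    by (intro sum_mset_cong) (rule counit_left[where g = "\<lambda>B. ?\<psi> (fst _) (add_mset (Node a B) (snd _))"])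
  finally show ?thesis by (simp only: add.assoc)
qed

section \<open>Edges of concrete trees and sequences of cuts\<close>

lemma cut_R_iff: "p \<in> cut_R V e \<longleftrightarrow> p \<in> V \<and> (\<nexists>q. p = e @ q)"
  by (simp add: cut_R_def)

text \<open>Cutting one edge amounts to a cut whose pruned part is a single tree. The edges are
  sorted into the one leading to a chosen child, those in its branch and those elsewhere, in step
  with \<open>sum_single_cuts_add\<close>; \<open>\<phi>\<close> is arbitrary because the trunk of a
  part has to be completed to a trunk of the whole.\<close>

lemma sum_edges:
  fixes \<phi> :: "'a rtree \<Rightarrow> 'a rtree multiset \<Rightarrow> 'e::comm_monoid_add"
  assumes "ctree V"
  shows "(\<Sum>e\<in>tree_edges V. \<phi> (abs_tree (cut_P V e) (\<lambda>q. lab (e @ q))) (branches (abs_tree (cut_R V e) lab))) =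
    (\<Sum>p\<in>#cop (branches (abs_tree V lab)). if size (fst p) = 1 then \<phi> (the_elem (set_mset (fst p))) (snd p) else 0)"
  using assms
proof (induction "card V" arbitrary: V lab \<phi> rule: less_induct)
  case less
  note V = \<open>ctree V\<close>
  show ?case
  proof (cases "\<exists>c. [c] \<in> V")
    case False
    then have V0: "V = {[]}" using ctree_eq_single[OF V] by auto
    then show ?thesis using branches_abs_tree_leaf[OF V V0, of lab] by (simp add: tree_edges_def)
  next
    case True
    then obtain c where c: "[c] \<in> V" by auto
    let ?P = "cut_P V [c]" and ?R = "cut_R V [c]" and ?lab = "\<lambda>q. lab (c # q)"
    have P: "ctree ?P" and R: "ctree ?R" using V c by (simp_all add: ctree_cut_P ctree_cut_R)
    define M where "M = branches (abs_tree ?P ?lab)"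
    define N where "N = branches (abs_tree ?R lab)"
    have TP: "abs_tree ?P ?lab = Node (lab [c]) M"
      unfolding M_def by (metis root_label_abs_tree rtree.collapse)
    have B: "branches (abs_tree V lab) = add_mset (Node (lab [c]) M) N"
      using branches_abs_tree_remove[OF V c, of lab] by (simp add: TP N_def)
    have E: "tree_edges V = insert [c] ((#) c ` tree_edges ?P \<union> tree_edges ?R)"
    proof (intro equalityI subsetI)
      fix e assume e: "e \<in> tree_edges V"
      then obtain d q where e': "e = d # q" by (cases e) (auto simp: tree_edges_def)
      show "e \<in> insert [c] ((#) c ` tree_edges ?P \<union> tree_edges ?R)"
      proof (cases "d = c")
        case True
        then show ?thesis using e e' by (cases "q = []") (auto simp: tree_edges_def)
      qed (use e e' in \<open>auto simp: tree_edges_def in_cut_R_single\<close>)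
    qed (use c in \<open>auto simp: tree_edges_def in_cut_R_single\<close>)
    have fin: "finite (tree_edges ?P)" "finite (tree_edges ?R)"
      using P R by (simp_all add: tree_edges_def)
    let ?f = "\<lambda>e. \<phi> (abs_tree (cut_P V e) (\<lambda>q. lab (e @ q))) (branches (abs_tree (cut_R V e) lab))"
    have "(\<Sum>e\<in>tree_edges V. ?f e) = ?f [c] + (\<Sum>e\<in>(#) c ` tree_edges ?P \<union> tree_edges ?R. ?f e)"
      unfolding E using fin by (intro sum.insert) (auto simp: tree_edges_def in_cut_R_single)
    also have "(\<Sum>e\<in>(#) c ` tree_edges ?P \<union> tree_edges ?R. ?f e) =
        (\<Sum>e\<in>(#) c ` tree_edges ?P. ?f e) + (\<Sum>e\<in>tree_edges ?R. ?f e)"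
      using fin by (intro sum.union_disjoint) (auto simp: tree_edges_def in_cut_R_single)
    also have "(\<Sum>e\<in>(#) c ` tree_edges ?P. ?f e) = (\<Sum>q\<in>tree_edges ?P. ?f (c # q))"
      by (rule sum.reindex[unfolded o_def]) simp
    also have "\<dots> = (\<Sum>q\<in>tree_edges ?P. \<phi> (abs_tree (cut_P ?P q) (\<lambda>r. ?lab (q @ r)))
        (add_mset (Node (lab [c]) (branches (abs_tree (cut_R ?P q) ?lab))) N))"
    proof (intro sum.cong refl)
      fix q assume q: "q \<in> tree_edges ?P"
      have VR: "ctree (cut_R V (c # q))" using V by (simp add: ctree_cut_R)
      have cR: "[c] \<in> cut_R V (c # q)" using c q by (auto simp: cut_R_iff tree_edges_def)
      have 1: "cut_P V (c # q) = cut_P ?P q" by (auto simp: cut_P_def)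
      have 2: "cut_P (cut_R V (c # q)) [c] = cut_R ?P q" by (auto simp: cut_R_iff)
      have 3: "cut_R (cut_R V (c # q)) [c] = ?R" by (auto simp: cut_R_iff)
      have "abs_tree (cut_R ?P q) ?lab = Node (lab [c]) (branches (abs_tree (cut_R ?P q) ?lab))"
        by (metis root_label_abs_tree rtree.collapse)
      then have "branches (abs_tree (cut_R V (c # q)) lab) =
          add_mset (Node (lab [c]) (branches (abs_tree (cut_R ?P q) ?lab))) N"
        using branches_abs_tree_remove[OF VR cR, of lab] unfolding 2 3 N_def by simp
      then show "?f (c # q) = \<phi> (abs_tree (cut_P ?P q) (\<lambda>r. ?lab (q @ r)))
          (add_mset (Node (lab [c]) (branches (abs_tree (cut_R ?P q) ?lab))) N)"
        by (simp add: 1)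
    qed
    also have "\<dots> = (\<Sum>p\<in>#cop M. if size (fst p) = 1 then \<phi> (the_elem (set_mset (fst p))) (add_mset (Node (lab [c]) (snd p)) N) else 0)"
      unfolding M_def using V c
      by (intro less.hyps[where \<phi> = "\<lambda>t B. \<phi> t (add_mset (Node (lab [c]) B) N)"] P card_cut_P_less) auto
    also have "(\<Sum>e\<in>tree_edges ?R. ?f e) = (\<Sum>e\<in>tree_edges ?R. \<phi> (abs_tree (cut_P ?R e) (\<lambda>q. lab (e @ q)))
        (add_mset (Node (lab [c]) M) (branches (abs_tree (cut_R ?R e) lab))))"
    proof (intro sum.cong refl)
      fix e assume e: "e \<in> tree_edges ?R"
      then obtain d q where dq: "e = d # q" and d: "d \<noteq> c" by (cases e) (auto simp: tree_edges_def in_cut_R_single)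
      have VR: "ctree (cut_R V e)" using V dq by (simp add: ctree_cut_R)
      have cR: "[c] \<in> cut_R V e" using c d dq by (auto simp: cut_R_iff)
      have 1: "cut_P V e = cut_P ?R e" using d by (auto simp: cut_R_iff dq)
      have 2: "cut_P (cut_R V e) [c] = ?P" using d by (auto simp: cut_R_iff dq)
      have 3: "cut_R (cut_R V e) [c] = cut_R ?R e" by (auto simp: cut_R_iff)
      have "branches (abs_tree (cut_R V e) lab) = add_mset (Node (lab [c]) M) (branches (abs_tree (cut_R ?R e) lab))"
        using branches_abs_tree_remove[OF VR cR, of lab] unfolding 2 3 TP .
      then show "?f e = \<phi> (abs_tree (cut_P ?R e) (\<lambda>q. lab (e @ q)))
        (add_mset (Node (lab [c]) M) (branches (abs_tree (cut_R ?R e) lab)))"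
        by (simp add: 1)
    qed
    also have "\<dots> = (\<Sum>p\<in>#cop N. if size (fst p) = 1 then \<phi> (the_elem (set_mset (fst p))) (add_mset (Node (lab [c]) M) (snd p)) else 0)"
      unfolding N_def using V c
      by (intro less.hyps[where \<phi> = "\<lambda>t B. \<phi> t (add_mset (Node (lab [c]) M) B)"] R card_cut_R_less) auto
    also have "?f [c] = \<phi> (Node (lab [c]) M) N" using TP by (simp add: N_def)
    finally show ?thesis unfolding B sum_single_cuts_add by (simp only: add.assoc)
  qed
qed

lemma cut_seqs_0: "cut_seqs V 0 = {[]}"
  by (auto simp: cut_seqs_def)

text \<open>To survive the cut at an edge is not to lie at or below it, a condition unaffected by
  earlier cuts. So the pairwise relation on the tail may be read in \<open>V\<close> or in
  \<open>cut_R V e\<close> alike, and sequences are built one cut at a time.\<close>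

lemma cut_seqs_Suc: "cut_seqs V (Suc n) = (\<lambda>(e, es). e # es) ` (SIGMA e:tree_edges V. cut_seqs (cut_R V e) n)"
proof -
  have iff: "e # es \<in> cut_seqs V (Suc n) \<longleftrightarrow> e \<in> tree_edges V \<and> es \<in> cut_seqs (cut_R V e) n" for e es
  proof -
    have sub: "tree_edges (cut_R V e) \<subseteq> tree_edges V" by (auto simp: tree_edges_def cut_R_iff)
    have "sorted_wrt (\<lambda>x y. y \<in> tree_edges (cut_R V x)) es \<longleftrightarrow>
        sorted_wrt (\<lambda>x y. y \<in> tree_edges (cut_R (cut_R V e) x)) es" if "set es \<subseteq> tree_edges (cut_R V e)"
    proof
      assume "sorted_wrt (\<lambda>x y. y \<in> tree_edges (cut_R V x)) es"
      then show "sorted_wrt (\<lambda>x y. y \<in> tree_edges (cut_R (cut_R V e) x)) es"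
        by (rule sorted_wrt_mono_rel[rotated]) (use that in \<open>auto simp: tree_edges_def cut_R_iff\<close>)
    next
      assume "sorted_wrt (\<lambda>x y. y \<in> tree_edges (cut_R (cut_R V e) x)) es"
      then show "sorted_wrt (\<lambda>x y. y \<in> tree_edges (cut_R V x)) es"
        by (rule sorted_wrt_mono_rel[rotated]) (auto simp: tree_edges_def cut_R_iff)
    qed
    then show ?thesis using sub by (auto simp: cut_seqs_def)
  qed
  show ?thesis
  proof (intro equalityI subsetI)
    fix x assume x: "x \<in> cut_seqs V (Suc n)"
    then obtain e es where "x = e # es" by (cases x) (auto simp: cut_seqs_def)
    then show "x \<in> (\<lambda>(e, es). e # es) ` (SIGMA e:tree_edges V. cut_seqs (cut_R V e) n)"
      using x iff by (auto simp: image_iff)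
  qed (use iff in auto)
qed

lemma finite_cut_seqs: "finite V \<Longrightarrow> finite (cut_seqs V n)"
proof (induction n arbitrary: V)
  case (Suc n)
  then show ?case
    unfolding cut_seqs_Suc by (intro finite_imageI finite_SigmaI Suc.IH) (auto simp: tree_edges_def cut_R_def)
qed (simp add: cut_seqs_0)

text \<open>Each cut puts a pruned tree under a new root and so contributes one convolution factor;
  the final trunk is a further factor because \<theta> vanishes unless the root has one child. Hence
  n cuts give the power n + 1.\<close>

lemma sum_cut_seqs:
  fixes \<theta> :: "unit rtree \<Rightarrow> rat"
  assumes zero: "\<And>T. root_degree T \<noteq> 1 \<Longrightarrow> \<theta> T = 0" and "ctree V"
  shows "(\<Sum>es\<in>cut_seqs V n. \<Prod>U\<leftarrow>cut_pieces V es. \<theta> U) =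
    coef (prim (\<lambda>t. \<theta> (Node () {#t#})) ^ Suc n) (branches (abs_tree V (\<lambda>_. ())))"
  using assms(2)
proof (induction n arbitrary: V)
  case 0
  have T: "\<theta> T = coef (prim (\<lambda>t. \<theta> (Node () {#t#}))) (branches T)" for T
  proof (cases "root_degree T = 1")
    case True
    then obtain t where "branches T = {#t#}"
      unfolding root_degree_eq by (metis One_nat_def size_1_singleton_mset)
    then have "T = Node () {#t#}" by (cases T) auto
    then show ?thesis by simp
  qed (simp add: zero coef_prim_size root_degree_eq)
  have "(\<Sum>es\<in>cut_seqs V 0. \<Prod>U\<leftarrow>cut_pieces V es. \<theta> U) = \<theta> (abs_tree V (\<lambda>_. ()))"
    using 0 by (simp add: cut_seqs_0 tree_class_eq)
  also have "\<dots> = coef (prim (\<lambda>t. \<theta> (Node () {#t#}))) (branches (abs_tree V (\<lambda>_. ())))"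
    by (rule T)
  finally show ?case by (simp only: power_Suc power_0 mult_1_right)
next
  case (Suc n)
  let ?f = "\<lambda>t. \<theta> (Node () {#t#})"
  have "(\<Sum>es\<in>cut_seqs V (Suc n). \<Prod>U\<leftarrow>cut_pieces V es. \<theta> U) =
      (\<Sum>x\<in>(SIGMA e:tree_edges V. cut_seqs (cut_R V e) n). \<Prod>U\<leftarrow>cut_pieces V (fst x # snd x). \<theta> U)"
    unfolding cut_seqs_Suc by (subst sum.reindex) (auto simp: inj_on_def split_def)
  also have "\<dots> = (\<Sum>e\<in>tree_edges V. \<Sum>es\<in>cut_seqs (cut_R V e) n. \<Prod>U\<leftarrow>cut_pieces V (e # es). \<theta> U)"
    using sum.Sigma[of "tree_edges V" "\<lambda>e. cut_seqs (cut_R V e) n" "\<lambda>e es. \<Prod>U\<leftarrow>cut_pieces V (e # es). \<theta> U"] Suc.prems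
    by (simp add: finite_cut_seqs tree_edges_def cut_R_def split_def)
  also have "\<dots> = (\<Sum>e\<in>tree_edges V. ?f (abs_tree (cut_P V e) (\<lambda>_. ())) *
      coef (prim ?f ^ Suc n) (branches (abs_tree (cut_R V e) (\<lambda>_. ()))))"
  proof (intro sum.cong refl)
    fix e assume "e \<in> tree_edges V"
    then have e: "e \<in> V" "e \<noteq> []" by (auto simp: tree_edges_def)
    show "(\<Sum>es\<in>cut_seqs (cut_R V e) n. \<Prod>U\<leftarrow>cut_pieces V (e # es). \<theta> U) =
        ?f (abs_tree (cut_P V e) (\<lambda>_. ())) * coef (prim ?f ^ Suc n) (branches (abs_tree (cut_R V e) (\<lambda>_. ())))"
      using Suc.IH[of "cut_R V e"] Suc.prems e
      by (simp add: sum_distrib_left[symmetric] tree_class_eq ctree_cut_P ctree_cut_R)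
  qed
  also have "\<dots> = (\<Sum>p\<in>#cop (branches (abs_tree V (\<lambda>_. ()))). if size (fst p) = 1
      then ?f (the_elem (set_mset (fst p))) * coef (prim ?f ^ Suc n) (snd p) else 0)"
    by (rule sum_edges[OF Suc.prems, where lab = "\<lambda>_. ()"])
  also have "\<dots> = coef (prim ?f * prim ?f ^ Suc n) (branches (abs_tree V (\<lambda>_. ())))"
    by (simp only: coef_prim_times)
  finally show ?case by simp
qed

section \<open>Unique solvability of the recursion for \<theta>\<close>

lemma coef_prim_power_empty: "coef (prim f ^ Suc n) {#} = 0"
  by (simp add: coef_times)

lemma coef_prim_power_cong:
  assumes fg: "\<And>t. size (tree_labels t) < n \<Longrightarrow> f t = g t"
  shows "size (labels F) < n \<Longrightarrow> coef (prim f ^ m) F = coef (prim g ^ m) F"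
proof (induction m arbitrary: F)
  case (Suc m)
  have "coef (prim f * prim f ^ m) F = coef (prim g * prim g ^ m) F"
    unfolding coef_times
  proof (rule sum_mset_cong)
    fix p assume p: "p \<in># cop F"
    have s: "size (labels (fst p)) < n" "size (labels (snd p)) < n"
      using Suc.prems arg_cong[OF labels_cop[OF p], of size] by simp_all
    have "coef (prim f) (fst p) = coef (prim g) (fst p)"
    proof (cases "size (fst p) = 1")
      case True
      then obtain t where "fst p = {#t#}" by (metis One_nat_def size_1_singleton_mset)
      then show ?thesis using s fg by simp
    qed (simp add: coef_prim_size)
    then show "coef (prim f) (fst p) * coef (prim f ^ m) (snd p) = coef (prim g) (fst p) * coef (prim g ^ m) (snd p)"
      using Suc.IH s by simp
  qed
  then show ?case by simp
qed simp

text \<open>With at least two factors, any tree fed to \<open>f\<close> in a nonzero term leaves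
  another nonempty part, so it has fewer vertices than \<open>F\<close>. Here the term whose first
  piece is the whole tree disappears: its trunk is empty and contributes 0.\<close>

lemma coef_prim_power_cong2:
  assumes fg: "\<And>t. size (tree_labels t) < n \<Longrightarrow> f t = g t" and F: "size (labels F) \<le> n" and m: "m \<ge> 2"
  shows "coef (prim f ^ m) F = coef (prim g ^ m) F"
proof -
  obtain k where k: "m = Suc (Suc k)" using m by (metis add_2_eq_Suc le_Suc_ex)
  have "coef (prim f * prim f ^ Suc k) F = coef (prim g * prim g ^ Suc k) F"
    unfolding coef_times
  proof (rule sum_mset_cong)
    fix p assume p: "p \<in># cop F"
    have s: "size (labels (fst p)) + size (labels (snd p)) \<le> n"
      using F arg_cong[OF labels_cop[OF p], of size] by simp
    show "coef (prim f) (fst p) * coef (prim f ^ Suc k) (snd p) = coef (prim g) (fst p) * coef (prim g ^ Suc k) (snd p)"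
    proof (cases "size (fst p) = 1 \<and> snd p \<noteq> {#}")
      case True
      then obtain t where t: "fst p = {#t#}" by (metis One_nat_def size_1_singleton_mset)
      have "size (labels (snd p)) > 0" using True by (metis labels_eq_empty nonempty_has_size)
      moreover have "size (tree_labels t) > 0" by (cases t) simp
      ultimately have "size (tree_labels t) < n" "size (labels (snd p)) < n" using s t by simp_all
      moreover from this(2) have "coef (prim f ^ Suc k) (snd p) = coef (prim g ^ Suc k) (snd p)"
        by (rule coef_prim_power_cong[rotated]) (rule fg)
      ultimately show ?thesis using fg t by (simp only: coef_prim_single)
    next
      case False
      then show ?thesis by (auto simp: coef_prim_size coef_prim_power_empty simp del: power_Suc)
    qed
  qed
  then show ?thesis by (simp add: k)
qed

text \<open>The guard in the recursive call only ensures termination; it is removed in \<open>theta_rec_eq\<close>.\<close>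

function theta_rec :: "unit rtree \<Rightarrow> rat" where
  "theta_rec t = 1 - (\<Sum>m=2..Suc (size (tree_labels t)). 1 / fact m *
     coef (prim (\<lambda>s. if size (tree_labels s) < size (tree_labels t) then theta_rec s else 0) ^ m) {#t#})"
  by auto
termination by (relation "measure (\<lambda>t. size (tree_labels t))") auto

declare theta_rec.simps [simp del]

lemma theta_rec_eq:
  "theta_rec t = 1 - (\<Sum>m=2..Suc (size (tree_labels t)). 1 / fact m * coef (prim theta_rec ^ m) {#t#})"
  by (subst theta_rec.simps)
    (intro arg_cong2[where f = minus] refl sum.cong arg_cong2[where f = times]
      coef_prim_power_cong2[where n = "size (tree_labels t)"], auto)

lemma theta_rec_unique:
  assumes "\<And>t. f t = 1 - (\<Sum>m=2..Suc (size (tree_labels t)). 1 / fact m * coef (prim f ^ m) {#t#})"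
  shows "f t = theta_rec t"
proof (induction "size (tree_labels t)" arbitrary: t rule: less_induct)
  case less
  have "(\<Sum>m=2..Suc (size (tree_labels t)). 1 / fact m * coef (prim f ^ m) {#t#}) =
      (\<Sum>m=2..Suc (size (tree_labels t)). 1 / fact m * coef (prim theta_rec ^ m) {#t#})"
    using less
    by (intro sum.cong refl arg_cong2[where f = times] coef_prim_power_cong2[where n = "size (tree_labels t)"]) auto
  then show ?case using assms[of t] theta_rec_eq[of t] by simp
qed

definition theta_star :: "unit rtree \<Rightarrow> rat" where
  "theta_star T = coef (prim theta_rec) (branches T)"

text \<open>With \<theta> viewed as a function of the branch below the root, the sum over cut
  sequences is a convolution power. The equations then say that the powers divided by m!, for m
  \<ge> 1, add up to 1 on every single tree.\<close>

lemma theta_eqs_iff: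
  "theta_eqs \<theta> \<longleftrightarrow> (\<forall>T. root_degree T \<noteq> 1 \<longrightarrow> \<theta> T = 0) \<and>
    (\<forall>t. \<theta> (Node () {#t#}) = 1 - (\<Sum>m=2..Suc (size (tree_labels t)). 1 / fact m *
      coef (prim (\<lambda>t. \<theta> (Node () {#t#})) ^ m) {#t#}))"
proof -
  let ?f = "\<lambda>t. \<theta> (Node () {#t#})"
  let ?R = "\<lambda>T. if root_degree T \<noteq> 1 then 0
      else if num_verts T = 2 then 1
      else 1 - (\<Sum>m = 2..num_verts T. 1 / fact m *
             (\<Sum>es\<in>cut_seqs (verts T) (m - 1). \<Prod>U\<leftarrow>cut_pieces (verts T) es. \<theta> U))"
  have lab: "label_at T = (\<lambda>_. ())" for T :: "unit rtree" by (simp add: fun_eq_iff)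
  have R: "?R (Node () {#t#}) = 1 - (\<Sum>m=2..Suc (size (tree_labels t)). 1 / fact m * coef (prim ?f ^ m) {#t#})"
    if zero: "\<forall>T. root_degree T \<noteq> 1 \<longrightarrow> \<theta> T = 0" for t
  proof -
    have nv: "num_verts (Node () {#t#}) = Suc (size (tree_labels t))" by (simp add: num_verts_eq)
    have "(\<Sum>m = 2..num_verts (Node () {#t#}). 1 / fact m *
        (\<Sum>es\<in>cut_seqs (verts (Node () {#t#})) (m - 1). \<Prod>U\<leftarrow>cut_pieces (verts (Node () {#t#})) es. \<theta> U)) =
        (\<Sum>m=2..Suc (size (tree_labels t)). 1 / fact m * coef (prim ?f ^ m) {#t#})"
      unfolding nv
    proof (intro sum.cong refl arg_cong2[where f = times])
      fix m assume "m \<in> {2..Suc (size (tree_labels t))}"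
      then have m: "Suc (m - 1) = m" by auto
      have "abs_tree (verts (Node () {#t#})) (\<lambda>_. ()) = Node () {#t#}"
        using abs_tree_verts[of "Node () {#t#}"] by (simp only: lab)
      then show "(\<Sum>es\<in>cut_seqs (verts (Node () {#t#})) (m - 1). \<Prod>U\<leftarrow>cut_pieces (verts (Node () {#t#})) es. \<theta> U) =
          coef (prim ?f ^ m) {#t#}"
        using sum_cut_seqs[of \<theta> "verts (Node () {#t#})" "m - 1"] zero m by simp
    qed
    \<comment> \<open>For two vertices the only summand is m = 2 and it vanishes, so the separate
      clause agrees with the general formula.\<close>
    moreover have "(\<Sum>m=2..Suc (size (tree_labels t)). 1 / fact m * coef (prim ?f ^ m) {#t#}) = 0"
      if two: "num_verts (Node () {#t#}) = 2"
    proof -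
      obtain a M where t: "t = Node a M" by (cases t)
      have "M = {#}" using two[unfolded nv] by (simp add: t)
      then have "coef (prim ?f * prim ?f) {#t#} = 0"
        by (simp add: coef_times t sum_cop_Node)
      then show ?thesis using two[unfolded nv] by (simp add: power2_eq_square)
    qed
    ultimately show ?thesis by (simp add: root_degree_eq)
  qed
  show ?thesis
  proof
    assume eq: "theta_eqs \<theta>"
    then have T: "\<theta> T = ?R T" for T unfolding theta_eqs_def by blast
    then have z: "\<forall>T. root_degree T \<noteq> 1 \<longrightarrow> \<theta> T = 0" by metis
    show "(\<forall>T. root_degree T \<noteq> 1 \<longrightarrow> \<theta> T = 0) \<and>
      (\<forall>t. \<theta> (Node () {#t#}) = 1 - (\<Sum>m=2..Suc (size (tree_labels t)). 1 / fact m * coef (prim ?f ^ m) {#t#}))"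
    proof (intro conjI allI)
      fix t show "\<theta> (Node () {#t#}) = 1 - (\<Sum>m=2..Suc (size (tree_labels t)). 1 / fact m * coef (prim ?f ^ m) {#t#})"
        by (rule trans[OF T[of "Node () {#t#}"] R[OF z, of t]])
    qed (use z in blast)
  next
    assume A: "(\<forall>T. root_degree T \<noteq> 1 \<longrightarrow> \<theta> T = 0) \<and>
      (\<forall>t. \<theta> (Node () {#t#}) = 1 - (\<Sum>m=2..Suc (size (tree_labels t)). 1 / fact m * coef (prim ?f ^ m) {#t#}))"
    have "\<theta> T = ?R T" for T
    proof (cases "root_degree T = 1")
      case True
      then obtain t where "branches T = {#t#}"
        unfolding root_degree_eq by (metis One_nat_def size_1_singleton_mset)
      then have T: "T = Node () {#t#}" by (cases T) auto
      show ?thesis unfolding T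
        by (rule trans[OF conjunct2[OF A, THEN spec, of t] R[OF conjunct1[OF A], of t, symmetric]])
    qed (use A in simp)
    then show "theta_eqs \<theta>" unfolding theta_eqs_def by blast
  qed
qed

lemma theta_unlabeled_eq: "theta_unlabeled = theta_star"
proof -
  have s: "theta_star (Node () {#t#}) = theta_rec t" for t by (simp add: theta_star_def)
  have "theta_eqs theta_star"
    unfolding theta_eqs_iff s
  proof (intro conjI allI impI)
    fix t show "theta_rec t = 1 - (\<Sum>m=2..Suc (size (tree_labels t)). 1 / fact m * coef (prim theta_rec ^ m) {#t#})"
      by (rule theta_rec_eq)
  qed (simp add: theta_star_def coef_prim_size root_degree_eq)
  moreover have "\<theta> = theta_star" if \<theta>: "theta_eqs \<theta>" for \<theta>
  proof
    fix T
    show "\<theta> T = theta_star T"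
    proof (cases "root_degree T = 1")
      case True
      then obtain t where "branches T = {#t#}"
        unfolding root_degree_eq by (metis One_nat_def size_1_singleton_mset)
      then have T: "T = Node () {#t#}" by (cases T) auto
      show ?thesis
        unfolding T s using \<theta> by (intro theta_rec_unique[where f = "\<lambda>t. \<theta> (Node () {#t#})"]) (simp add: theta_eqs_iff)
    qed (use \<theta> in \<open>simp add: theta_eqs_iff theta_star_def coef_prim_size root_degree_eq\<close>)
  qed
  ultimately show ?thesis unfolding theta_unlabeled_def by (rule the_equality)
qed

subsection \<open>The exponential of \<open>\<theta>\<close>\<close>

text \<open>Primitive elements for the coproduct that sends \<open>c\<close> to the function
  \<open>c (M + N)\<close> of two forests.\<close>

definition primitive :: "('a rtree multiset, 'k::comm_ring_1) conv \<Rightarrow> bool" where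
  "primitive c \<longleftrightarrow> (\<forall>M N. coef c (M + N) = (if N = {#} then coef c M else 0) + (if M = {#} then coef c N else 0))"

lemma primitive_empty: "primitive c \<Longrightarrow> coef c {#} = 0"
  unfolding primitive_def by (drule spec[of _ "{#}"], drule spec[of _ "{#}"]) simp

lemma primitiveI:
  assumes "\<And>M. size M \<noteq> 1 \<Longrightarrow> coef c M = 0"
  shows "primitive c"
  unfolding primitive_def
proof (intro allI)
  fix M N
  have e: "coef c {#} = 0" by (rule assms) simp
  show "coef c (M + N) = (if N = {#} then coef c M else 0) + (if M = {#} then coef c N else 0)"
  proof (cases "M = {#} \<or> N = {#}")
    case False
    then have "size (M + N) \<noteq> 1" by (cases M; cases N) auto
    then show ?thesis using False assms by simp
  qed (auto simp: e)
qed

lemma primitive_prim: "primitive (prim f)"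
  by (rule primitiveI) (rule coef_prim_size)

text \<open>A Leibniz rule: the pruned forest must lie entirely in \<open>M\<close> or entirely in
  \<open>N\<close>, so multiplication by a primitive function acts on disjoint unions as a
  derivation.\<close>

lemma coef_primitive_times_union:
  fixes c d :: "('a rtree multiset, 'k::comm_ring_1) conv"
  assumes "primitive c"
  shows "coef (c * d) (M + N) = (\<Sum>p\<in>#cop M. coef c (fst p) * coef d (snd p + N)) +
    (\<Sum>q\<in>#cop N. coef c (fst q) * coef d (M + snd q))"
proof -
  have "coef (c * d) (M + N) = (\<Sum>p\<in>#cop M. \<Sum>q\<in>#cop N.
      ((if fst q = {#} then coef c (fst p) else 0) + (if fst p = {#} then coef c (fst q) else 0)) * coef d (snd p + snd q))"
    unfolding coef_times sum_cop_union using assms by (simp add: primitive_def)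
  also have "\<dots> = (\<Sum>p\<in>#cop M. \<Sum>q\<in>#cop N. if eps (fst q) then coef c (fst p) * coef d (snd p + snd q) else 0) +
      (\<Sum>p\<in>#cop M. \<Sum>q\<in>#cop N. if eps (fst p) then coef c (fst q) * coef d (snd p + snd q) else 0)"
    unfolding sum_mset.distrib[symmetric] by (intro sum_mset_cong) (auto simp: distrib_right)
  also have "(\<Sum>p\<in>#cop M. \<Sum>q\<in>#cop N. if eps (fst q) then coef c (fst p) * coef d (snd p + snd q) else 0) =
      (\<Sum>p\<in>#cop M. coef c (fst p) * coef d (snd p + N))"
    by (intro sum_mset_cong) (rule counit_left)
  also have "(\<Sum>p\<in>#cop M. \<Sum>q\<in>#cop N. if eps (fst p) then coef c (fst q) * coef d (snd p + snd q) else 0) =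
      (\<Sum>q\<in>#cop N. \<Sum>p\<in>#cop M. if eps (fst p) then coef c (fst q) * coef d (snd p + snd q) else 0)"
    by (rule sum_mset.swap)
  also have "\<dots> = (\<Sum>q\<in>#cop N. coef c (fst q) * coef d (M + snd q))"
    by (intro sum_mset_cong) (rule counit_left[where g = "\<lambda>x. coef c _ * coef d (x + _)"])
  finally show ?thesis .
qed

text \<open>The value at \<open>M\<close> of exp(xc) as a series in an auxiliary variable x,
  unrelated to the grading, which is introduced in order to differentiate.\<close>

definition exp_fps :: "('a rtree multiset, rat) conv \<Rightarrow> 'a rtree multiset \<Rightarrow> rat fps" where
  "exp_fps c M = Abs_fps (\<lambda>n. coef (c ^ n) M / fact n)"

lemma fps_sum_mset_nth: "fps_nth (\<Sum>x\<in>#A. f x) n = (\<Sum>x\<in>#A. fps_nth (f x) n)"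
  by (induction A) auto

lemma deriv_exp_fps: "fps_deriv (exp_fps c M) = (\<Sum>p\<in>#cop M. fps_const (coef c (fst p)) * exp_fps c (snd p))"
proof (rule fps_ext)
  fix n
  have "fps_nth (fps_deriv (exp_fps c M)) n = coef (c * c ^ n) M / fact n"
    by (simp add: exp_fps_def field_simps del: of_nat_Suc)
  also have "\<dots> = (\<Sum>p\<in>#cop M. coef c (fst p) * (coef (c ^ n) (snd p) / fact n))"
    unfolding coef_times by (simp add: divide_inverse sum_mset_distrib_right mult.assoc)
  finally show "fps_nth (fps_deriv (exp_fps c M)) n =
      fps_nth (\<Sum>p\<in>#cop M. fps_const (coef c (fst p)) * exp_fps c (snd p)) n"
    by (simp add: fps_sum_mset_nth exp_fps_def)
qed

text \<open>The Leibniz rule gives both sides the same recursion for their coefficients. This is the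
  fact that the exponential of a primitive element is group-like.\<close>

lemma exp_fps_union:
  assumes "primitive c"
  shows "exp_fps c (M + N) = exp_fps c M * exp_fps c N"
proof (rule fps_ext)
  fix n
  show "fps_nth (exp_fps c (M + N)) n = fps_nth (exp_fps c M * exp_fps c N) n"
  proof (induction n arbitrary: M N)
    case 0
    show ?case by (auto simp: exp_fps_def)
  next
    case (Suc n)
    have "of_nat (Suc n) * fps_nth (exp_fps c (M + N)) (Suc n) = coef (c * c ^ n) (M + N) / fact n"
      by (simp add: exp_fps_def field_simps del: of_nat_Suc)
    also have "\<dots> = (\<Sum>p\<in>#cop M. coef c (fst p) * fps_nth (exp_fps c (snd p + N)) n) +
        (\<Sum>q\<in>#cop N. coef c (fst q) * fps_nth (exp_fps c (M + snd q)) n)"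
      unfolding coef_primitive_times_union[OF assms]
      by (simp add: exp_fps_def divide_inverse sum_mset_distrib_right mult.assoc distrib_right)
    also have "\<dots> = fps_nth (fps_deriv (exp_fps c M) * exp_fps c N + exp_fps c M * fps_deriv (exp_fps c N)) n"
      by (simp add: Suc.IH deriv_exp_fps sum_mset_distrib_right sum_mset_distrib_left fps_sum_mset_nth
          mult.assoc mult.left_commute[of "exp_fps c M"] del: fps_mult_nth)
    also have "\<dots> = fps_nth (fps_deriv (exp_fps c M * exp_fps c N)) n"
      by (simp add: add.commute)
    also have "\<dots> = of_nat (Suc n) * fps_nth (exp_fps c M * exp_fps c N) (Suc n)"
      by (simp only: fps_deriv_nth Suc_eq_plus1)
    finally show ?case by (simp del: of_nat_Suc)
  qed
qed

lemma power_coef_eq_0: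
  assumes c: "coef c {#} = 0"
  shows "size (labels M) < n \<Longrightarrow> coef (c ^ n) M = (0 :: 'k::comm_ring_1)"
proof (induction n arbitrary: M)
  case (Suc n)
  have "coef (c * c ^ n) M = (\<Sum>p\<in>#cop M. 0)"
    unfolding coef_times
  proof (rule sum_mset_cong)
    fix p assume p: "p \<in># cop M"
    have s: "size (labels (fst p)) + size (labels (snd p)) = size (labels M)"
      using arg_cong[OF labels_cop[OF p], of size] by simp
    show "coef c (fst p) * coef (c ^ n) (snd p) = 0"
    proof (cases "fst p = {#}")
      case False
      then have "size (labels (fst p)) > 0" by (metis labels_eq_empty nonempty_has_size)
      then show ?thesis using Suc s by simp
    qed (simp add: c)
  qed
  then show ?case by simp
qed simp

text \<open>The exponential is multiplicative over unions and 1 on single trees by the recursion,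
  hence 1 on all forests. Setting the auxiliary variable to 1 is legitimate because powers beyond
  the number of vertices vanish.\<close>

lemma exp_theta_rec:
  fixes M :: "unit rtree multiset"
  assumes "n \<ge> size (labels M)"
  shows "(\<Sum>i=0..n. coef (prim theta_rec ^ i) M / fact i) = 1"
proof -
  let ?d = "prim theta_rec"
  have z: "coef (?d ^ i) M / fact i = 0" if "i > size (labels M)" for i and M :: "unit rtree multiset"
    using power_coef_eq_0[of ?d M i] that by simp
  have ext: "(\<Sum>i=0..n. coef (?d ^ i) M / fact i) = (\<Sum>i=0..m. coef (?d ^ i) M / fact i)"
    if "size (labels M) \<le> m" "m \<le> n" for m n and M :: "unit rtree multiset"
    using that z by (intro sum.mono_neutral_right) auto
  have E: "(\<Sum>i=0..size (labels M). coef (?d ^ i) M / fact i) = 1" for M :: "unit rtree multiset"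
  proof (induction M)
    case (add t M)
    let ?a = "size (tree_labels t)" and ?b = "size (labels M)"
    have t: "(\<Sum>i=0..?a. coef (?d ^ i) {#t#} / fact i) = 1"
    proof -
      have "(\<Sum>i=0..?a. coef (?d ^ i) {#t#} / fact i) = (\<Sum>i=0..Suc ?a. coef (?d ^ i) {#t#} / fact i)"
        using ext[of "{#t#}" ?a "Suc ?a"] by simp
      \<comment> \<open>Exponent 0 contributes nothing on a nonempty forest, exponent 1 is \<theta>
        itself, and the rest is the sum in the recursion.\<close>
      also have "\<dots> = 1"
        using theta_rec_eq[of t] by (simp add: sum_from_2 del: sum.cl_ivl_Suc)
      finally show ?thesis .
    qed
    have "(\<Sum>i=0..?a + ?b. coef (?d ^ i) ({#t#} + M) / fact i) =
        (\<Sum>i=0..?a + ?b. fps_nth (exp_fps ?d {#t#} * exp_fps ?d M) i)"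
      by (simp only: exp_fps_union[OF primitive_prim, symmetric]) (simp add: exp_fps_def)
    also have "\<dots> = (\<Sum>i=0..?a + ?b. \<Sum>j=0..i. (coef (?d ^ j) {#t#} / fact j) * (coef (?d ^ (i - j)) M / fact (i - j)))"
      by (simp add: fps_mult_nth exp_fps_def)
    also have "\<dots> = (\<Sum>(j, k)\<in>{(j, k). j + k \<le> ?a + ?b}. (coef (?d ^ j) {#t#} / fact j) * (coef (?d ^ k) M / fact k))"
      by (subst sum.triangle_reindex_eq) (simp add: atMost_atLeast0)
    \<comment> \<open>Outside the rectangle one power exceeds the number of vertices available to
      it, so the triangle of the Cauchy product may be replaced by a product of two sums.\<close>
    also have "\<dots> = (\<Sum>(j, k)\<in>{0..?a} \<times> {0..?b}. (coef (?d ^ j) {#t#} / fact j) * (coef (?d ^ k) M / fact k))"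
    proof (rule sum.mono_neutral_right)
      show "finite {(j, k). j + k \<le> ?a + ?b}"
        by (rule finite_subset[of _ "{..?a + ?b} \<times> {..?a + ?b}"]) auto
      show "{0..?a} \<times> {0..?b} \<subseteq> {(j, k). j + k \<le> ?a + ?b}" by auto
      show "\<forall>x\<in>{(j, k). j + k \<le> ?a + ?b} - {0..?a} \<times> {0..?b}.
          (case x of (j, k) \<Rightarrow> (coef (?d ^ j) {#t#} / fact j) * (coef (?d ^ k) M / fact k)) = 0"
      proof
        fix x assume x: "x \<in> {(j, k). j + k \<le> ?a + ?b} - {0..?a} \<times> {0..?b}"
        then obtain j k where jk: "x = (j, k)" "j > ?a \<or> k > ?b" by (cases x) auto
        then have "coef (?d ^ j) {#t#} / fact j = 0 \<or> coef (?d ^ k) M / fact k = 0"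
          using z[of "{#t#}" j] z[of M k] by (auto simp del: divide_eq_0_iff)
        then show "(case x of (j, k) \<Rightarrow> (coef (?d ^ j) {#t#} / fact j) * (coef (?d ^ k) M / fact k)) = 0"
          unfolding jk prod.case mult_eq_0_iff .
      qed
    qed
    also have "\<dots> = (\<Sum>j=0..?a. coef (?d ^ j) {#t#} / fact j) * (\<Sum>k=0..?b. coef (?d ^ k) M / fact k)"
      by (simp add: sum_product sum.cartesian_product)
    also have "\<dots> = 1" using t add.IH by simp
    finally show ?case by simp
  qed simp
  show ?thesis using ext[OF order_refl assms] E by simp
qed

text \<open>Cuts do not look at labels. This transfers the exponential identity from unlabelled
  trees, where \<theta> is defined, to labelled ones.\<close>

lemma cop_map:
  "cop (image_mset (map_rtree h) M) =
    image_mset (\<lambda>p. (image_mset (map_rtree h) (fst p), image_mset (map_rtree h) (snd p))) (cop M)"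
proof (induction M rule: forest_induct)
  case (add a M N)
  have m: "image_mset f (mconv A B) = mconv (image_mset f A) (image_mset f B)"
    if "\<And>x y. f (x + y) = f x + f y" for A B and f :: "('b rtree multiset \<times> 'b rtree multiset) \<Rightarrow> ('c rtree multiset \<times> 'c rtree multiset)"
    by (rule mset_eqI_sum) (simp add: sum_mset_image sum_mconv that)
  let ?f = "\<lambda>p. (image_mset (map_rtree h) (fst p), image_mset (map_rtree h) (snd p))"
  have single: "cop {#map_rtree h (Node a M)#} = image_mset ?f (cop {#Node a M#})"
    using add.IH(1) by (simp add: cop_singleton bcuts_Node image_mset.compositionality o_def)
  have 1: "image_mset (map_rtree h) (add_mset (Node a M) N) = {#map_rtree h (Node a M)#} + image_mset (map_rtree h) N"
    by simp
  have "cop (image_mset (map_rtree h) (add_mset (Node a M) N)) =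
      mconv (cop {#map_rtree h (Node a M)#}) (cop (image_mset (map_rtree h) N))"
    unfolding 1 by (simp add: cop_multiset_def)
  also have "\<dots> = mconv (image_mset ?f (cop {#Node a M#})) (image_mset ?f (cop N))"
    unfolding single add.IH(2) ..
  also have "\<dots> = image_mset ?f (mconv (cop {#Node a M#}) (cop N))"
    by (rule m[symmetric]) simp
  also have "mconv (cop {#Node a M#}) (cop N) = cop (add_mset (Node a M) N)"
    by (simp add: cop_multiset_def)
  finally show ?case .
qed simp

definition theta_conv :: "('a rtree multiset, 'k::rat_algebra) conv" where
  "theta_conv = Conv (\<lambda>M. rat_emb (coef (prim theta_rec) (image_mset (map_rtree (\<lambda>_. ())) M)))"

lemma theta_Node: "theta (Node a M) = coef (prim theta_rec) (image_mset (map_rtree (\<lambda>_. ())) M)"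
  by (simp add: theta_def theta_unlabeled_eq theta_star_def)

lemma coef_theta_conv: "coef theta_conv M = rat_emb (theta (Node a M))"
  by (simp add: theta_conv_def theta_Node)

lemma primitive_theta_conv: "primitive theta_conv"
  by (rule primitiveI) (simp add: theta_conv_def coef_prim_size)

lemma coef_theta_conv_power:
  "coef (theta_conv ^ n) M = rat_emb (coef (prim theta_rec ^ n) (image_mset (map_rtree (\<lambda>_. ())) M))"
proof (induction n arbitrary: M)
  case (Suc n)
  then show ?case
    by (simp add: coef_times cop_map sum_mset_image rat_emb_sum_mset rat_emb_mult)
      (simp add: theta_conv_def)
qed (simp add: rat_emb_1)

lemma size_labels_map: "size (labels (image_mset (map_rtree h) M)) = size (labels M)"
  by (induction M rule: forest_induct) auto

lemma exp_theta_conv: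
  assumes "n \<ge> size (labels M)"
  shows "(\<Sum>i=0..n. rat_emb (1 / fact i) * coef (theta_conv ^ i) M) = (1 :: 'k::rat_algebra)"
proof -
  have "(\<Sum>i=0..n. rat_emb (1 / fact i) * coef (theta_conv ^ i) M) =
      (rat_emb (\<Sum>i=0..n. coef (prim theta_rec ^ i) (image_mset (map_rtree (\<lambda>_. ())) M) / fact i) :: 'k)"
    by (simp add: rat_emb_sum coef_theta_conv_power flip: rat_emb_mult)
  also have "\<dots> = 1" using assms by (simp add: exp_theta_rec size_labels_map rat_emb_1)
  finally show ?thesis .
qed

section \<open>The series in the convolution algebra\<close>

definition all_conv :: "('a rtree multiset, 'k::comm_ring_1) conv" where
  "all_conv = Conv (\<lambda>_. 1)"

text \<open>This function and \<open>child_conv\<close> represent t h(t) and t m(t), so that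
  everything is graded by the weight; the shift by one degree is undone in the comparison of
  series.\<close>

definition chain_conv :: "(nat rtree multiset, 'k::comm_ring_1) conv" where
  "chain_conv = Conv (\<lambda>M. of_nat (chain_label M))"

definition child_conv :: "(nat rtree multiset, 'k::comm_ring_1) conv" where
  "child_conv = Conv (\<lambda>M. of_nat (child_root M))"

text \<open>The coordinates of f(-t): the substitution cancels the sign (-1)^|T| and leaves the one
  given by the number of children.\<close>

definition star_conv :: "(nat rtree multiset, 'k::comm_ring_1) conv" where
  "star_conv = Conv (\<lambda>M. if \<forall>t\<in>#M. branches t = {#} then (- 1) ^ size M else 0)"

lemma coef_all [simp]: "coef all_conv M = 1" by (simp add: all_conv_def)

lemma primitive_chain: "primitive chain_conv"
  by (rule primitiveI) (simp add: chain_conv_def chain_label_size)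

lemma primitive_child: "primitive child_conv"
  by (rule primitiveI) (simp add: child_conv_def)

text \<open>A trunk seen by a primitive function lies in one of the two forests; the other forest is
  then pruned entirely, which happens in exactly one way.\<close>

lemma coef_all_times_union:
  fixes c :: "('a rtree multiset, 'k::comm_ring_1) conv"
  assumes "primitive c"
  shows "coef (all_conv * c) (M + N) = coef (all_conv * c) M + coef (all_conv * c) N"
proof -
  have one: "(\<Sum>q\<in>#cop N. if eps (snd q) then x else 0) = x" for N :: "'a rtree multiset" and x :: 'k
    by (rule counit_right[where g = "\<lambda>_. x"])
  have "coef (all_conv * c) (M + N) = (\<Sum>p\<in>#cop M. \<Sum>q\<in>#cop N. (if eps (snd q) then coef c (snd p) else 0)) +
      (\<Sum>p\<in>#cop M. \<Sum>q\<in>#cop N. if eps (snd p) then coef c (snd q) else 0)"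
    unfolding coef_times sum_cop_union sum_mset.distrib[symmetric] using assms by (simp add: primitive_def)
  also have "(\<Sum>p\<in>#cop M. \<Sum>q\<in>#cop N. if eps (snd p) then coef c (snd q) else 0) =
      (\<Sum>q\<in>#cop N. \<Sum>p\<in>#cop M. if eps (snd p) then coef c (snd q) else 0)"
    by (rule sum_mset.swap)
  finally show ?thesis by (simp only: one coef_times coef_all mult_1)
qed

text \<open>Each vertex is the end of exactly one chain that can remain as trunk, namely the path to
  it from the root of its tree, and its label is the leaf label of that chain.\<close>

lemma coef_all_times_chain: "coef (all_conv * chain_conv) M = (of_nat (\<Sum>\<^sub># (labels M)) :: 'k::comm_ring_1)"
proof (induction M rule: forest_induct)
  case (add a M N)
  have 0: "(\<Sum>p\<in>#cop M. if eps (snd p) then x else 0) = x" for x :: 'k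
    by (rule counit_right[where g = "\<lambda>_. x"])
  have "coef (all_conv * chain_conv) {#Node a M#} =
      (\<Sum>p\<in>#cop M. (if eps (snd p) then of_nat a else 0) + coef chain_conv (snd p) :: 'k)"
    by (simp add: coef_times sum_cop_Node chain_conv_def) (rule sum_mset_cong, auto)
  also have "\<dots> = of_nat a + coef (all_conv * chain_conv) M"
    by (simp only: sum_mset.distrib 0) (simp add: coef_times)
  finally have "coef (all_conv * chain_conv) {#Node a M#} = (of_nat a + of_nat (\<Sum>\<^sub># (labels M)) :: 'k)"
    using add.IH by simp
  moreover have "coef (all_conv * chain_conv) ({#Node a M#} + N) =
      coef (all_conv * chain_conv) {#Node a M#} + (coef (all_conv * chain_conv) N :: 'k)"
    by (rule coef_all_times_union[OF primitive_chain])
  ultimately show ?case using add.IH by simp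
qed (simp add: coef_times chain_conv_def)

text \<open>Each vertex is the root of exactly one single tree that can be pruned, so every label is
  counted once.\<close>

lemma coef_child_times_all: "coef (child_conv * all_conv) M = (of_nat (\<Sum>\<^sub># (labels M)) :: 'k::comm_ring_1)"
proof (induction M rule: forest_induct)
  case (add a M N)
  have "coef (child_conv * all_conv) {#Node a M#} = (of_nat a + coef (child_conv * all_conv) M :: 'k)"
    by (simp add: coef_times sum_cop_Node child_conv_def)
  moreover have "coef (child_conv * all_conv) ({#Node a M#} + N) =
      coef (child_conv * all_conv) {#Node a M#} + (coef (child_conv * all_conv) N :: 'k)"
    unfolding coef_primitive_times_union[OF primitive_child] by (simp add: coef_times)
  ultimately show ?case using add.IH by simp
qed (simp add: coef_times child_conv_def)

lemma coef_star_union: "coef star_conv (M + N) = coef star_conv M * (coef star_conv N :: 'k::comm_ring_1)"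
  by (auto simp: star_conv_def power_add)

text \<open>The product is multiplicative over unions. On one tree, either it is a single vertex and
  pruning it cancels the empty cut, or the root has to stay and the claim passes to the
  branches.\<close>

lemma star_times_all: "star_conv * all_conv = (1 :: (nat rtree multiset, 'k::comm_ring_1) conv)"
proof (rule conv_eqI)
  fix M
  show "coef (star_conv * all_conv) M = coef (1 :: (nat rtree multiset, 'k) conv) M"
  proof (induction M rule: forest_induct)
    case (add a M N)
    have "coef (star_conv * all_conv) {#Node a M#} = (if M = {#} then - 1 else 0) + (coef (star_conv * all_conv) M :: 'k)"
      by (simp add: coef_times sum_cop_Node) (simp add: star_conv_def)
    also have "\<dots> = 0" using add.IH(1) by simp
    finally have "coef (star_conv * all_conv) {#Node a M#} = (0 :: 'k)" .
    moreover have "coef (star_conv * all_conv) ({#Node a M#} + N) =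
        coef (star_conv * all_conv) {#Node a M#} * (coef (star_conv * all_conv) N :: 'k)"
      unfolding coef_times sum_cop_union fst_conv coef_star_union coef_all mult_1_right
      by (simp only: sum_mset_distrib_left[symmetric] sum_mset_distrib_right[symmetric])
    ultimately show ?case by simp
  qed (simp add: coef_times, simp add: star_conv_def)
qed

section \<open>Grading by weight and restriction to labels in \<open>W\<close>\<close>

definition graded_ser :: "nat set \<Rightarrow> (nat rtree multiset, 'k) conv \<Rightarrow> (nat rtree multiset, 'k::comm_ring_1) conv fps" where
  "graded_ser W c = Abs_fps (\<lambda>n. Conv (\<lambda>M. if set_mset (labels M) \<subseteq> W \<and> \<Sum>\<^sub># (labels M) = n then coef c M else 0))"

lemma coef_graded_ser: "coef (fps_nth (graded_ser W c) n) M =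
    (if set_mset (labels M) \<subseteq> W \<and> \<Sum>\<^sub># (labels M) = n then coef c M else 0)"
  by (simp add: graded_ser_def)

lemma sum_mset_if_const: "(\<Sum>x\<in>#A. if P then f x else 0) = (if P then \<Sum>x\<in>#A. f x else 0)"
  by simp

text \<open>A cut distributes the labels, so weights add up, and a forest has its labels in
  \<open>W\<close> exactly when both parts do. Identities of functions thereby become identities of
  power series.\<close>

lemma graded_ser_mult: "graded_ser W (c * d) = graded_ser W c * graded_ser W (d :: (nat rtree multiset, 'k::comm_ring_1) conv)"
proof (rule fps_ext, rule conv_eqI)
  fix n M
  have "coef (fps_nth (graded_ser W c * graded_ser W d) n) M =
      (\<Sum>i=0..n. \<Sum>p\<in>#cop M. coef (fps_nth (graded_ser W c) i) (fst p) * coef (fps_nth (graded_ser W d) (n - i)) (snd p))"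
    by (simp add: fps_mult_nth coef_times)
  also have "\<dots> = (\<Sum>p\<in>#cop M. \<Sum>i=0..n. coef (fps_nth (graded_ser W c) i) (fst p) * coef (fps_nth (graded_ser W d) (n - i)) (snd p))"
    by (rule sum_sum_mset_swap)
  also have "\<dots> = (\<Sum>p\<in>#cop M. if set_mset (labels M) \<subseteq> W \<and> \<Sum>\<^sub># (labels M) = n then coef c (fst p) * coef d (snd p) else 0)"
  proof (rule sum_mset_cong)
    fix p assume p: "p \<in># cop M"
    let ?w = "\<lambda>M. \<Sum>\<^sub># (labels M)"
    have l: "labels M = labels (fst p) + labels (snd p)" using labels_cop[OF p] by simp
    have "(\<Sum>i=0..n. coef (fps_nth (graded_ser W c) i) (fst p) * coef (fps_nth (graded_ser W d) (n - i)) (snd p)) =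
        (\<Sum>i=0..n. if i = ?w (fst p) then (if set_mset (labels M) \<subseteq> W \<and> ?w M = n then coef c (fst p) * coef d (snd p) else 0) else 0)"
      by (rule sum.cong[OF refl]) (auto simp: coef_graded_ser l)
    also have "\<dots> = (if set_mset (labels M) \<subseteq> W \<and> ?w M = n then coef c (fst p) * coef d (snd p) else 0)"
      by (auto simp: l)
    finally show "(\<Sum>i=0..n. coef (fps_nth (graded_ser W c) i) (fst p) * coef (fps_nth (graded_ser W d) (n - i)) (snd p)) =
        (if set_mset (labels M) \<subseteq> W \<and> ?w M = n then coef c (fst p) * coef d (snd p) else 0)" .
  qed
  also have "\<dots> = coef (fps_nth (graded_ser W (c * d)) n) M"
    by (simp only: coef_graded_ser coef_times sum_mset_if_const)
  finally show "coef (fps_nth (graded_ser W (c * d)) n) M = coef (fps_nth (graded_ser W c * graded_ser W d) n) M" by simp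
qed

lemma graded_ser_1: "graded_ser W 1 = 1"
  by (rule fps_ext, rule conv_eqI) (auto simp: coef_graded_ser)

lemma graded_ser_power: "graded_ser W (c ^ n) = graded_ser W c ^ n"
  by (induction n) (simp_all add: graded_ser_1 graded_ser_mult)

lemma graded_ser_0:
  assumes "0 \<notin> W"
  shows "fps_nth (graded_ser W c) 0 = scal (coef c {#})"
proof (rule conv_eqI)
  fix M
  have "M = {#}" if "set_mset (labels M) \<subseteq> W" "\<Sum>\<^sub># (labels M) = 0"
  proof -
    have "size (labels M) \<le> 0" using size_le_sum_mset[of "labels M"] that assms by auto
    then show ?thesis by simp
  qed
  then show "coef (fps_nth (graded_ser W c) 0) M = coef (scal (coef c {#})) M"
    by (auto simp: coef_graded_ser coef_scal)
qed

section \<open>The antipode of the Grossman--Larson algebra\<close>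

text \<open>The coproduct of the Grossman--Larson algebra in the basis \<open>\<V>\<^sub>T\<close>.\<close>
instantiation rtree :: (type) coalg
begin
text \<open>A set, not a multiset: with respect to normalised trees every splitting occurs in the
  coproduct with coefficient 1.\<close>

definition splits :: "'b multiset \<Rightarrow> ('b multiset \<times> 'b multiset) set" where
  "splits M = {p. fst p + snd p = M}"
definition cop_rtree :: "'a rtree \<Rightarrow> ('a rtree \<times> 'a rtree) multiset" where
  "cop_rtree T = image_mset (\<lambda>p. (Node (root_label T) (fst p), Node (root_label T) (snd p))) (mset_set (splits (branches T)))"
definition eps_rtree :: "'a rtree \<Rightarrow> bool" where
  "eps_rtree T \<longleftrightarrow> branches T = {#}"

lemma finite_splits [simp]: "finite (splits M)"
proof (induction M)
  case (add x M)
  let ?S = "(\<lambda>p. (add_mset x (fst p), snd p)) ` splits M \<union> (\<lambda>p. (fst p, add_mset x (snd p))) ` splits M"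
  have "splits (add_mset x M) \<subseteq> ?S"
  proof
    fix p assume p: "p \<in> splits (add_mset x M)"
    obtain A B where AB: "p = (A, B)" by (cases p)
    then have e: "A + B = add_mset x M" using p by (simp add: splits_def)
    then have "x \<in># A \<or> x \<in># B" by (metis union_iff union_single_eq_member)
    then show "p \<in> ?S"
    proof
      assume "x \<in># A"
      then obtain A' where A': "A = add_mset x A'" by (meson multi_member_split)
      then have "(A', B) \<in> splits M" using e by (simp add: splits_def)
      then show ?thesis using AB A' by (intro UnI1 image_eqI[of _ _ "(A', B)"]) auto
    next
      assume "x \<in># B"
      then obtain B' where B': "B = add_mset x B'" by (meson multi_member_split)
      then have "(A, B') \<in> splits M" using e by (simp add: splits_def)
      then show ?thesis using AB B' by (intro UnI2 image_eqI[of _ _ "(A, B')"]) auto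
    qed
  qed
  then show ?case by (rule finite_subset) (use add in auto)
next
  case empty
  have "splits ({#} :: 'b multiset) = {({#}, {#})}" by (auto simp: splits_def)
  then show ?case by simp
qed

lemma sum_cop_rtree:
  "(\<Sum>p\<in>#cop (Node a M :: 'a rtree). \<phi> p) = (\<Sum>p\<in>splits M. \<phi> (Node a (fst p), Node a (snd p)))"
  by (simp add: cop_rtree_def sum_unfold_sum_mset sum_mset_image image_mset.compositionality o_def)

lemma sum_splits_assoc:
  fixes \<phi> :: "'b multiset \<Rightarrow> 'b multiset \<Rightarrow> 'b multiset \<Rightarrow> 'e::comm_monoid_add"
  shows "(\<Sum>p\<in>splits M. \<Sum>q\<in>splits (fst p). \<phi> (fst q) (snd q) (snd p)) =
    (\<Sum>p\<in>splits M. \<Sum>q\<in>splits (snd p). \<phi> (fst p) (fst q) (snd q))"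
proof -
  have "(\<Sum>p\<in>splits M. \<Sum>q\<in>splits (fst p). \<phi> (fst q) (snd q) (snd p)) =
      (\<Sum>(p, q)\<in>(SIGMA p:splits M. splits (fst p)). \<phi> (fst q) (snd q) (snd p))"
    by (rule sum.Sigma) auto
  also have "\<dots> = (\<Sum>(p, q)\<in>(SIGMA p:splits M. splits (snd p)). \<phi> (fst p) (fst q) (snd q))"
    by (rule sum.reindex_bij_witness[where
          i = "\<lambda>(p, q). ((fst p + fst q, snd q), (fst p, fst q))" and
          j = "\<lambda>(p, q). ((fst q, snd q + snd p), (snd q, snd p))"])
      (auto simp: splits_def add.assoc)
  also have "\<dots> = (\<Sum>p\<in>splits M. \<Sum>q\<in>splits (snd p). \<phi> (fst p) (fst q) (snd q))"
    by (rule sum.Sigma[symmetric]) auto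
  finally show ?thesis .
qed

instance
proof
  fix T :: "'a rtree"
  obtain a M where T: "T = Node a M" by (cases T)
  show "(\<Sum>p\<in>#cop T. image_mset (\<lambda>q. (fst q, snd q, snd p)) (cop (fst p))) =
      (\<Sum>p\<in>#cop T. image_mset (\<lambda>q. (fst p, fst q, snd q)) (cop (snd p)))"
  proof (rule mset_eqI_sum)
    fix \<phi> :: "'a rtree \<times> 'a rtree \<times> 'a rtree \<Rightarrow> ('a rtree \<times> 'a rtree \<times> 'a rtree) multiset"
    show "(\<Sum>y\<in>#(\<Sum>p\<in>#cop T. image_mset (\<lambda>q. (fst q, snd q, snd p)) (cop (fst p))). \<phi> y) =
        (\<Sum>y\<in>#(\<Sum>p\<in>#cop T. image_mset (\<lambda>q. (fst p, fst q, snd q)) (cop (snd p))). \<phi> y)"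
      unfolding T sum_mset_UNION sum_mset_image unfolding sum_cop_rtree fst_conv snd_conv
      by (rule sum_splits_assoc[where \<phi> = "\<lambda>A B C. \<phi> (Node a A, Node a B, Node a C)"])
  qed
  have l: "{p \<in> splits M. fst p = {#}} = {({#}, M)}" by (auto simp: splits_def)
  have r: "{p \<in> splits M. snd p = {#}} = {(M, {#})}" by (auto simp: splits_def)
  show "image_mset snd (filter_mset (\<lambda>p. eps (fst p)) (cop T)) = {#T#}"
    by (simp add: cop_rtree_def T eps_rtree_def filter_mset_image_mset o_def filter_mset_mset_set l)
  show "image_mset fst (filter_mset (\<lambda>p. eps (snd p)) (cop T)) = {#T#}"
    by (simp add: cop_rtree_def T eps_rtree_def filter_mset_image_mset o_def filter_mset_mset_set r)
qed
end

lemma eps_rtree_simps [simp]: "eps (T :: 'a rtree) \<longleftrightarrow> branches T = {#}"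
  by (simp add: eps_rtree_def)

lemma in_cop_rtree: "p \<in># cop (T :: 'a rtree) \<Longrightarrow> branches (fst p) + branches (snd p) = branches T"
proof -
  assume "p \<in># cop T"
  then obtain q where "q \<in> splits (branches T)" "p = (Node (root_label T) (fst q), Node (root_label T) (snd q))"
    by (auto simp: cop_rtree_def)
  then show ?thesis by (auto simp: splits_def)
qed

section \<open>The convolution inverse of the identity\<close>

definition delta :: "'a rtree multiset \<Rightarrow> ('a rtree multiset, 'k::comm_ring_1) conv" where
  "delta M = Conv (\<lambda>F. if F = M then 1 else 0)"

lemma delta_empty [simp]: "delta {#} = 1"
  by (rule conv_eqI) (simp add: delta_def)

text \<open>The identity map, given on normalised trees by its coordinates. It is an element of the
  convolution ring of maps from the coalgebra of trees to the algebra of functions on forests; its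
  inverse there is the antipode.\<close>

definition delta_conv :: "('a rtree, ('a rtree multiset, 'k::comm_ring_1) conv) conv" where
  "delta_conv = Conv (\<lambda>T. delta (branches T))"

text \<open>The inverse as a geometric series: \<^term>\<open>1 - delta_conv\<close> is locally nilpotent, as it vanishes on the
  single vertex.\<close>

definition delta_inv :: "('a rtree, ('a rtree multiset, 'k::comm_ring_1) conv) conv" where
  "delta_inv = Conv (\<lambda>T. \<Sum>i\<in>{..size (branches T)}. coef ((1 - delta_conv) ^ i) T)"

lemma power_one_minus_delta_0:
  "size (branches T) < n \<Longrightarrow> coef ((1 - delta_conv) ^ n) T = (0 :: ('a rtree multiset, 'k::comm_ring_1) conv)"
proof (induction n arbitrary: T)
  case (Suc n)
  let ?N = "1 - delta_conv :: ('a rtree, ('a rtree multiset, 'k) conv) conv"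
  have "coef (?N * ?N ^ n) T = (\<Sum>p\<in>#cop T. 0)"
    unfolding coef_times
  proof (rule sum_mset_cong)
    fix p assume p: "p \<in># cop T"
    have s: "size (branches (fst p)) + size (branches (snd p)) = size (branches T)"
      using arg_cong[OF in_cop_rtree[OF p], of size] by simp
    show "coef ?N (fst p) * coef (?N ^ n) (snd p) = 0"
    proof (cases "branches (fst p) = {#}")
      case True
      then show ?thesis by (simp add: delta_conv_def)
    next
      case False
      then have "size (branches (fst p)) > 0" by (simp add: nonempty_has_size)
      then have "size (branches (snd p)) < n" using Suc.prems s by linarith
      then show ?thesis by (simp add: Suc.IH)
    qed
  qed
  then show ?case by simp
qed simp

text \<open>The number of terms may be raised to a common bound, so that one finite geometric sum
  serves all parts of a tree at once.\<close>

lemma coef_delta_inv: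
  assumes "size (branches T) \<le> m"
  shows "coef delta_inv T = coef (\<Sum>i\<in>{..m}. (1 - delta_conv) ^ i) (T :: 'a rtree)"
  unfolding delta_inv_def conv.sel coef_sum
  using assms by (intro sum.mono_neutral_left) (auto simp: power_one_minus_delta_0)

lemma geometric_sum_ring:
  fixes x :: "'r::ring_1"
  shows "(1 - x) * (\<Sum>i\<in>{..m}. x ^ i) = 1 - x ^ Suc m" "(\<Sum>i\<in>{..m}. x ^ i) * (1 - x) = 1 - x ^ Suc m"
proof -
  show "(1 - x) * (\<Sum>i\<in>{..m}. x ^ i) = 1 - x ^ Suc m"
  proof (induction m)
    case (Suc m)
    have "(1 - x) * (\<Sum>i\<in>{..Suc m}. x ^ i) = (1 - x) * (\<Sum>i\<in>{..m}. x ^ i) + (1 - x) * x ^ Suc m"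
      by (simp add: distrib_left)
    also have "\<dots> = 1 - x ^ Suc (Suc m)" unfolding Suc by (simp add: left_diff_distrib)
    finally show ?case .
  qed simp
  show "(\<Sum>i\<in>{..m}. x ^ i) * (1 - x) = 1 - x ^ Suc m"
  proof (induction m)
    case (Suc m)
    have "(\<Sum>i\<in>{..Suc m}. x ^ i) * (1 - x) = (\<Sum>i\<in>{..m}. x ^ i) * (1 - x) + x ^ Suc m * (1 - x)"
      by (simp add: distrib_right)
    also have "\<dots> = 1 - x ^ Suc (Suc m)"
      unfolding Suc by (simp add: right_diff_distrib power_commutes mult.assoc)
    finally show ?case .
  qed simp
qed

lemma delta_inv:
  "delta_conv * delta_inv = (1 :: ('a rtree, ('a rtree multiset, 'k::comm_ring_1) conv) conv)"
  "delta_inv * delta_conv = (1 :: ('a rtree, ('a rtree multiset, 'k::comm_ring_1) conv) conv)"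
proof -
  let ?N = "1 - delta_conv :: ('a rtree, ('a rtree multiset, 'k) conv) conv"
  have U: "delta_conv = 1 - ?N" by simp
  show "delta_conv * delta_inv = (1 :: ('a rtree, ('a rtree multiset, 'k) conv) conv)"
  proof (rule conv_eqI)
    fix T :: "'a rtree"
    let ?m = "size (branches T)"
    have "coef (delta_conv * delta_inv) T = coef ((1 - ?N) * (\<Sum>i\<in>{..?m}. ?N ^ i)) T"
      unfolding coef_times U[symmetric]
    proof (rule sum_mset_cong)
      fix p assume p: "p \<in># cop T"
      have "size (branches (snd p)) \<le> ?m" using arg_cong[OF in_cop_rtree[OF p], of size] by simp
      then show "coef delta_conv (fst p) * coef delta_inv (snd p) =
          coef delta_conv (fst p) * coef (\<Sum>i\<in>{..?m}. ?N ^ i) (snd p)"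
        by (simp only: coef_delta_inv)
    qed
    also have "\<dots> = coef 1 T"
      unfolding geometric_sum_ring coef_simps(4) power_one_minus_delta_0[OF lessI] by simp
    finally show "coef (delta_conv * delta_inv) T = coef (1 :: ('a rtree, ('a rtree multiset, 'k) conv) conv) T" .
  qed
  show "delta_inv * delta_conv = (1 :: ('a rtree, ('a rtree multiset, 'k) conv) conv)"
  proof (rule conv_eqI)
    fix T :: "'a rtree"
    let ?m = "size (branches T)"
    have "coef (delta_inv * delta_conv) T = coef ((\<Sum>i\<in>{..?m}. ?N ^ i) * (1 - ?N)) T"
      unfolding coef_times U[symmetric]
    proof (rule sum_mset_cong)
      fix p assume p: "p \<in># cop T"
      have "size (branches (fst p)) \<le> ?m" using arg_cong[OF in_cop_rtree[OF p], of size] by simp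
      then show "coef delta_inv (fst p) * coef delta_conv (snd p) =
          coef (\<Sum>i\<in>{..?m}. ?N ^ i) (fst p) * coef delta_conv (snd p)"
        by (simp only: coef_delta_inv)
    qed
    also have "\<dots> = coef 1 T"
      unfolding geometric_sum_ring coef_simps(4) power_one_minus_delta_0[OF lessI] by simp
    finally show "coef (delta_inv * delta_conv) T = coef (1 :: ('a rtree, ('a rtree multiset, 'k) conv) conv) T" .
  qed
qed

text \<open>Invariance of the labels makes the values of the antipode finitely supported and keeps
  them inside the carrier for every \<open>W\<close>.\<close>

definition label_preserving :: "('a rtree, ('a rtree multiset, 'k::comm_ring_1) conv) conv \<Rightarrow> bool" where
  "label_preserving c \<longleftrightarrow> (\<forall>T F. coef (coef c T) F \<noteq> 0 \<longrightarrow> labels F = labels (branches T))"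

lemma sum_mset_not_0E:
  assumes "(\<Sum>x\<in>#A. f x) \<noteq> 0"
  obtains x where "x \<in># A" "f x \<noteq> 0"
proof -
  have "\<exists>x\<in>#A. f x \<noteq> 0"
  proof (rule ccontr)
    assume "\<not> (\<exists>x\<in>#A. f x \<noteq> 0)"
    then have "(\<Sum>x\<in>#A. f x) = (\<Sum>x\<in>#A. 0)" by (intro sum_mset_cong) auto
    then show False using assms by simp
  qed
  then show thesis using that by blast
qed

lemma coef_sum_mset: "coef (\<Sum>x\<in>#A. f x) y = (\<Sum>x\<in>#A. coef (f x) y)"
  by (induction A) auto

lemma label_preserving_mult:
  assumes "label_preserving c" "label_preserving d"
  shows "label_preserving (c * d)"
  unfolding label_preserving_def
proof (intro allI impI)
  fix T F assume "coef (coef (c * d) T) F \<noteq> 0"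
  then have "(\<Sum>p\<in>#cop T. coef (coef c (fst p) * coef d (snd p)) F) \<noteq> 0"
    by (simp add: coef_times[of c d] coef_sum_mset)
  then obtain p where p: "p \<in># cop T" "coef (coef c (fst p) * coef d (snd p)) F \<noteq> 0"
    by (rule sum_mset_not_0E)
  from p(2) have "(\<Sum>q\<in>#cop F. coef (coef c (fst p)) (fst q) * coef (coef d (snd p)) (snd q)) \<noteq> 0"
    by (simp add: coef_times)
  then obtain q where q: "q \<in># cop F" "coef (coef c (fst p)) (fst q) * coef (coef d (snd p)) (snd q) \<noteq> 0"
    by (rule sum_mset_not_0E)
  have "labels (fst q) = labels (branches (fst p))" "labels (snd q) = labels (branches (snd p))"
    using assms q(2) unfolding label_preserving_def by (metis mult_zero_left, metis mult_zero_right)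
  then show "labels F = labels (branches T)"
    using labels_cop[OF q(1)] arg_cong[OF in_cop_rtree[OF p(1)], of labels] by simp
qed

lemma label_preserving_delta_inv:
  "label_preserving (delta_inv :: ('a rtree, ('a rtree multiset, 'k::comm_ring_1) conv) conv)"
proof -
  let ?N = "1 - delta_conv :: ('a rtree, ('a rtree multiset, 'k) conv) conv"
  have 1: "label_preserving (1 :: ('a rtree, ('a rtree multiset, 'k) conv) conv)"
    by (auto simp: label_preserving_def)
  have N: "label_preserving ?N"
    by (auto simp: label_preserving_def delta_conv_def delta_def)
  have P: "label_preserving (?N ^ n)" for n
    by (induction n) (simp_all add: 1 label_preserving_mult[OF N])
  show ?thesis
    unfolding label_preserving_def
  proof (intro allI impI)
    fix T and F :: "'a rtree multiset" assume "coef (coef (delta_inv :: ('a rtree, ('a rtree multiset, 'k) conv) conv) T) F \<noteq> 0"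
    then have "(\<Sum>i\<in>{..size (branches T)}. coef (coef (?N ^ i) T) F) \<noteq> 0"
      by (simp add: delta_inv_def)
    then obtain i where "coef (coef (?N ^ i) T) F \<noteq> 0" by (meson sum.neutral)
    then show "labels F = labels (branches T)" using P unfolding label_preserving_def by blast
  qed
qed

section \<open>Linear maps in coordinates and their convolution\<close>

lemma central_scal: "central (scal :: 'k::comm_ring_1 \<Rightarrow> ('c::coalg, 'k) conv)"
  unfolding central_def
proof (intro conjI allI)
  show "scal 1 = (1 :: ('c, 'k) conv)" by (rule conv_eqI) (simp add: coef_scal)
  show "scal (a + b) = (scal a + scal b :: ('c, 'k) conv)" for a b by (rule conv_eqI) (simp add: coef_scal)
  show "scal (a * b) = (scal a * scal b :: ('c, 'k) conv)" for a b by (rule conv_eqI) (simp add: coef_scal)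
  show "scal a * x = (x * scal a :: ('c, 'k) conv)" for a x by (rule conv_eqI) (simp add: mult.commute)
qed

lemmas scal_simps = central_simps[OF central_scal]

lemma gl_coef_smult_basis: "gl_coef (smult c (basis (Node 0 M))) = scal (c * of_nat (forest_sym M)) * delta M"
  by (rule conv_eqI) (auto simp: coef_gl_coef delta_def Poly_Mapping.lookup_single when_def mult.commute)

lemma gl_coef_basis: "gl_coef (basis (Node 0 M)) = scal (of_nat (forest_sym M)) * delta M"
  using gl_coef_smult_basis[of 1 M] by simp

definition gl_apply :: "('a \<Rightarrow> ('c::coalg, 'k) conv) \<Rightarrow> ('a, 'k) conv \<Rightarrow> ('c, 'k::comm_ring_1) conv" where
  "gl_apply J c = (\<Sum>M\<in>supp c. scal (coef c M) * J M)"

lemma gl_apply_superset: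
  assumes "finite A" "supp c \<subseteq> A"
  shows "gl_apply J c = (\<Sum>M\<in>A. scal (coef c M) * J M)"
  unfolding gl_apply_def using assms by (intro sum.mono_neutral_left) (auto simp: supp_def scal_simps)

lemma gl_apply_add:
  assumes "finite (supp c)" "finite (supp d)"
  shows "gl_apply J (c + d) = gl_apply J c + (gl_apply J d)"
proof -
  have "gl_apply J e = (\<Sum>M\<in>supp c \<union> supp d. scal (coef e M) * J M)" if "e \<in> {c, d, c + d}" for e
    using that assms by (intro gl_apply_superset) (auto simp: supp_def)
  then show ?thesis by (simp add: scal_simps distrib_right sum.distrib)
qed

lemma gl_apply_scal:
  assumes "finite (supp c)"
  shows "gl_apply J (scal a * c) = scal a * gl_apply J c"
proof -
  have "gl_apply J (scal a * c) = (\<Sum>M\<in>supp c. scal (coef (scal a * c) M) * J M)"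
    using assms by (intro gl_apply_superset) (auto simp: supp_def)
  then show ?thesis by (simp add: gl_apply_def sum_distrib_left scal_simps mult.assoc)
qed

text \<open>The forest \<open>L\<close> is recovered from a splitting as the union of its parts, so
  nothing collides or cancels: the support of the coproduct consists of the splittings of the
  forests in the support of \<open>x\<close>.\<close>

lemma sum_keys_comult:
  fixes g :: "nat rtree multiset \<Rightarrow> nat rtree multiset \<Rightarrow> 'e::ring_1"
  assumes x: "rooted0 x" and s: "s 0 = 0"
  shows "(\<Sum>p\<in>Poly_Mapping.keys (gl_comult x). s (gl2_coef (gl_comult x) (branches (fst p)) (branches (snd p))) *
      g (branches (fst p)) (branches (snd p))) =
    (\<Sum>L\<in>supp (gl_coef x). s (coef (gl_coef x) L) * (\<Sum>p\<in>splits L. g (fst p) (snd p)))"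
proof -
  let ?c = "coef (gl_coef x)"
  let ?P = "SIGMA L:supp (gl_coef x). splits L"
  have k: "Poly_Mapping.keys (gl_comult x) = (\<lambda>(L, p). (Node 0 (fst p), Node 0 (snd p))) ` ?P"
  proof (intro equalityI subsetI)
    fix p assume p: "p \<in> Poly_Mapping.keys (gl_comult x)"
    then have r: "root_label (fst p) = 0 \<and> root_label (snd p) = 0"
      using rooted00_comult[of x] unfolding rooted00_def by (metis in_keys_iff)
    define M N where "M = branches (fst p)" and "N = branches (snd p)"
    have e: "p = (Node 0 M, Node 0 N)" using r unfolding M_def N_def by (metis prod.collapse rtree.collapse)
    have "?c (M + N) \<noteq> 0"
    proof
      assume "?c (M + N) = 0"
      then have "of_nat (forest_sym M * forest_sym N) * Poly_Mapping.lookup (gl_comult x) (Node 0 M, Node 0 N) =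
          of_nat (forest_sym M * forest_sym N) * 0"
        using gl2_coef_comult[OF x, of M N] by (simp add: gl2_coef_def)
      then have "Poly_Mapping.lookup (gl_comult x) (Node 0 M, Node 0 N) = 0"
        by (rule of_nat_cancel[rotated]) simp
      then show False using p e by (simp add: in_keys_iff)
    qed
    then have "(M + N, (M, N)) \<in> ?P" by (simp add: supp_def splits_def)
    then show "p \<in> (\<lambda>(L, p). (Node 0 (fst p), Node 0 (snd p))) ` ?P" using e by force
  next
    fix p assume "p \<in> (\<lambda>(L, p). (Node 0 (fst p), Node 0 (snd p))) ` ?P"
    then obtain M N where e: "p = (Node 0 M, Node 0 N)" and "M + N \<in> supp (gl_coef x)"
      by (auto simp: splits_def)
    then have "gl2_coef (gl_comult x) M N \<noteq> 0" by (simp add: gl2_coef_comult[OF x] supp_def)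
    then show "p \<in> Poly_Mapping.keys (gl_comult x)" by (auto simp: gl2_coef_def e in_keys_iff)
  qed
  have inj: "inj_on (\<lambda>(L, p). (Node 0 (fst p), Node 0 (snd p) :: nat rtree)) ?P"
    by (auto simp: inj_on_def splits_def prod_eq_iff)
  have "(\<Sum>p\<in>Poly_Mapping.keys (gl_comult x). s (gl2_coef (gl_comult x) (branches (fst p)) (branches (snd p))) *
      g (branches (fst p)) (branches (snd p))) =
      (\<Sum>(L, p)\<in>?P. s (?c L) * g (fst p) (snd p))"
    unfolding k sum.reindex[OF inj] by (intro sum.cong) (auto simp: gl2_coef_comult[OF x] splits_def)
  also have "\<dots> = (\<Sum>L\<in>supp (gl_coef x). \<Sum>p\<in>splits L. s (?c L) * g (fst p) (snd p))"
    by (rule sum.Sigma[symmetric]) auto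
  finally show ?thesis by (simp add: sum_distrib_left)
qed

lemma finite_labels: "finite {F :: 'a rtree multiset. labels F = L}"
  by (rule finite_subset[OF _ finite_forests[of "set_mset L" "size L"]]) auto

lemma supp_sum: "supp (\<Sum>i\<in>A. f i) \<subseteq> (\<Union>i\<in>A. supp (f i))"
  by (auto simp: supp_def intro: ccontr sum.neutral)

lemma supp_scal_times: "supp (scal a * c) \<subseteq> supp c"
  by (auto simp: supp_def)

lemma central_shuffle:
  assumes "central s"
  shows "s l * ((s m * a) * (s n * b)) = s (m * n * l) * (a * b)"
proof -
  have "a * (s n * b) = s n * (a * b)" by (metis central_commute[OF assms] mult.assoc)
  then have "s l * ((s m * a) * (s n * b)) = s l * (s m * (s n * (a * b)))" by (simp add: mult.assoc)
  also have "\<dots> = s (l * (m * n)) * (a * b)" by (simp add: central_simps(3)[OF assms] mult.assoc)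
  also have "l * (m * n) = m * n * l" by (rule mult.commute)
  finally show ?thesis .
qed

text \<open>The symmetry factors carried by the values of \<open>f\<close> and \<open>g\<close> on
  basis trees combine with the coefficient of the coproduct to its normalised coordinate; what
  remains is a sum over splittings.\<close>

lemma gl_coef_convolution:
  assumes x: "rooted0 x"
    and f: "\<And>M. rooted0 (f (basis (Node 0 M)))" "\<And>M. gl_coef (f (basis (Node 0 M))) = scal (of_nat (forest_sym M)) * a M"
    and g: "\<And>M. rooted0 (g (basis (Node 0 M)))" "\<And>M. gl_coef (g (basis (Node 0 M))) = scal (of_nat (forest_sym M)) * b M"
  shows "gl_coef (gl_convolution f g x) = gl_apply (\<lambda>L. \<Sum>p\<in>splits L. a (fst p) * b (snd p)) (gl_coef x)"
proof -
  let ?l = "Poly_Mapping.lookup (gl_comult x)" and ?k = "Poly_Mapping.keys (gl_comult x)"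
  have "gl_coef (gl_convolution f g x) =
      (\<Sum>p\<in>?k. scal (?l p) * gl_coef (gl_mult (f (basis (fst p))) (g (basis (snd p)))))"
    by (simp add: gl_convolution_def gl_coef_sum gl_coef_smult split_def)
  also have "\<dots> = (\<Sum>p\<in>?k. scal (gl2_coef (gl_comult x) (branches (fst p)) (branches (snd p))) *
      (a (branches (fst p)) * b (branches (snd p))))"
  proof (rule sum.cong[OF refl])
    fix p assume p: "p \<in> ?k"
    then have r: "root_label (fst p) = 0 \<and> root_label (snd p) = 0"
      using rooted00_comult[of x] unfolding rooted00_def by (metis in_keys_iff)
    define M N where "M = branches (fst p)" and "N = branches (snd p)"
    have e: "p = (Node 0 M, Node 0 N)" using r unfolding M_def N_def by (metis prod.collapse rtree.collapse)
    have "scal (?l p) * gl_coef (gl_mult (f (basis (fst p))) (g (basis (snd p)))) =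
        scal (?l p) * ((scal (of_nat (forest_sym M)) * a M) * (scal (of_nat (forest_sym N)) * b N))"
      unfolding e fst_conv snd_conv by (subst gl_coef_mult) (simp_all add: f g)
    also have "\<dots> = scal (of_nat (forest_sym M * forest_sym N) * ?l p) * (a M * b N)"
      unfolding of_nat_mult by (rule central_shuffle[OF central_scal])
    finally show "scal (?l p) * gl_coef (gl_mult (f (basis (fst p))) (g (basis (snd p)))) =
        scal (gl2_coef (gl_comult x) (branches (fst p)) (branches (snd p))) * (a (branches (fst p)) * b (branches (snd p)))"
      by (simp add: e gl2_coef_def)
  qed
  also have "\<dots> = gl_apply (\<lambda>L. \<Sum>p\<in>splits L. a (fst p) * b (snd p)) (gl_coef x)"
    unfolding gl_apply_def by (rule sum_keys_comult[OF x]) (simp add: scal_simps)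
  finally show ?thesis .
qed

lemma rooted0_basis [simp]: "rooted0 (basis (Node 0 M))"
  by (auto simp: rooted0_def Poly_Mapping.lookup_single when_def)

lemma rooted0_convolution:
  assumes "\<And>M. rooted0 (g (basis (Node 0 M)))" 
  shows "rooted0 (gl_convolution f g x)"
  unfolding gl_convolution_def split_def
proof (intro rooted0_sum rooted0_smult rooted0_mult)
  fix p assume "p \<in> Poly_Mapping.keys (gl_comult x)"
  then have "root_label (snd p) = 0"
    using rooted00_comult[of x] unfolding rooted00_def by (metis in_keys_iff)
  then have "snd p = Node 0 (branches (snd p))" by (metis rtree.collapse)
  then show "rooted0 (g (basis (snd p)))" using assms by metis
qed

definition antipode_spec :: "nat set \<Rightarrow> ('k::rat_algebra gl \<Rightarrow> 'k gl) \<Rightarrow> bool" where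
  "antipode_spec W A \<longleftrightarrow>
     (\<forall>x\<in>gl_carrier W. A x \<in> gl_carrier W) \<and>
     (\<forall>x\<in>gl_carrier W. \<forall>y\<in>gl_carrier W. A (x + y) = A x + A y) \<and>
     (\<forall>c. \<forall>x\<in>gl_carrier W. A (smult c x) = smult c (A x)) \<and>
     (\<forall>x\<in>gl_carrier W.
        gl_convolution A id x = smult (gl_counit x) gl_one \<and>
        gl_convolution id A x = smult (gl_counit x) gl_one)"

lemma gl_counit_eq: "gl_counit x = coef (gl_coef x) {#}"
  by (simp add: gl_counit_def Bplus_def coef_gl_coef)

text \<open>\<open>gl_antipode\<close> is a choice, so its properties are available only once they
  are satisfiable. The witness applies \<open>delta_inv\<close> to normalised trees and is the same
  for every \<open>W\<close>.\<close>

lemma antipode_exists: "antipode_spec W (gl_antipode W :: 'k::rat_algebra gl \<Rightarrow> 'k gl)"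
proof -
  define J where "J = (\<lambda>M. coef (delta_inv :: (nat rtree, (nat rtree multiset, 'k) conv) conv) (Node 0 M))"
  have Jl: "labels F = labels M" if "F \<in> supp (J M)" for F M
    using label_preserving_delta_inv that unfolding label_preserving_def J_def supp_def by fastforce
  have Jf: "finite (supp (J M))" for M
    by (rule finite_subset[OF _ finite_labels[of "labels M"]]) (use Jl in auto)
  define A :: "'k gl \<Rightarrow> 'k gl" where "A x = to_gl (gl_apply J (gl_coef x))" for x
  have fin: "finite (supp (gl_apply J (gl_coef x)))" for x :: "'k gl"
    unfolding gl_apply_def
    by (rule finite_subset[OF supp_sum]) (intro finite_UN_I finite_supp_gl_coef finite_subset[OF supp_scal_times Jf])
  have Ac: "gl_coef (A x) = gl_apply J (gl_coef x)" and Ar: "rooted0 (A x)" for x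
    using fin by (simp_all add: A_def)
  have J1: "(\<Sum>p\<in>splits L. delta (fst p) * J (snd p)) = (if L = {#} then 1 else 0)" for L
    using arg_cong[OF delta_inv(1), of "\<lambda>c. coef c (Node 0 L)"]
    by (simp add: coef_times sum_cop_rtree J_def delta_conv_def)
  have J2: "(\<Sum>p\<in>splits L. J (fst p) * delta (snd p)) = (if L = {#} then 1 else 0)" for L
    using arg_cong[OF delta_inv(2), of "\<lambda>c. coef c (Node 0 L)"]
    by (simp add: coef_times sum_cop_rtree J_def delta_conv_def)
  have ap1: "gl_apply (\<lambda>L. if L = {#} then 1 else 0) (gl_coef x) = gl_coef (smult (gl_counit x) gl_one)" for x :: "'k gl"
  proof -
    have "gl_apply (\<lambda>L. if L = {#} then 1 else 0) (gl_coef x) =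
        (\<Sum>M\<in>insert {#} (supp (gl_coef x)). scal (coef (gl_coef x) M) * (if M = {#} then 1 else 0))"
      by (rule gl_apply_superset) auto
    then show ?thesis
      by (simp add: gl_coef_smult gl_counit_eq if_distrib[where f = "\<lambda>z. _ * z"] cong: if_cong)
  qed
  have Ab: "gl_coef (A (basis (Node 0 M))) = scal (of_nat (forest_sym M)) * J M" for M
    unfolding Ac by (subst gl_apply_superset[of "{M}"])
      (auto simp: supp_def gl_coef_basis delta_def)
  have "antipode_spec W A"
    unfolding antipode_spec_def
  proof (intro conjI ballI allI)
    fix x :: "'k gl" assume x: "x \<in> gl_carrier W"
    then have xr: "rooted0 x" and xl: "\<And>M. M \<in> supp (gl_coef x) \<Longrightarrow> set_mset (labels M) \<subseteq> W"
      by (simp_all add: gl_carrier_iff)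
    have "set_mset (labels F) \<subseteq> W" if F: "F \<in> supp (gl_apply J (gl_coef x))" for F
    proof -
      obtain M where "M \<in> supp (gl_coef x)" "F \<in> supp (J M)"
        using F supp_sum supp_scal_times unfolding gl_apply_def by blast
      then show ?thesis using xl Jl by metis
    qed
    then show "A x \<in> gl_carrier W" by (simp add: gl_carrier_iff Ac Ar)
    show "gl_convolution A id x = smult (gl_counit x) gl_one"
    proof (rule gl_coef_inject)
      show "rooted0 (gl_convolution A id x)" by (rule rooted0_convolution) simp
      show "rooted0 (smult (gl_counit x) gl_one)" by (simp add: rooted0_smult)
      have "gl_coef (gl_convolution A id x) = gl_apply (\<lambda>L. \<Sum>p\<in>splits L. J (fst p) * delta (snd p)) (gl_coef x)"
        by (rule gl_coef_convolution[OF xr]) (simp_all add: Ar Ab gl_coef_basis)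
      then show "gl_coef (gl_convolution A id x) = gl_coef (smult (gl_counit x) gl_one)"
        by (simp only: J2 ap1)
    qed
    show "gl_convolution id A x = smult (gl_counit x) gl_one"
    proof (rule gl_coef_inject)
      show "rooted0 (gl_convolution id A x)" by (rule rooted0_convolution) (rule Ar)
      show "rooted0 (smult (gl_counit x) gl_one)" by (simp add: rooted0_smult)
      have "gl_coef (gl_convolution id A x) = gl_apply (\<lambda>L. \<Sum>p\<in>splits L. delta (fst p) * J (snd p)) (gl_coef x)"
        by (rule gl_coef_convolution[OF xr]) (simp_all add: Ar Ab gl_coef_basis)
      then show "gl_coef (gl_convolution id A x) = gl_coef (smult (gl_counit x) gl_one)"
        by (simp only: J1 ap1)
    qed
    show "A (smult c x) = smult c (A x)" for c
      by (rule gl_coef_inject) (simp_all add: Ac Ar rooted0_smult gl_coef_smult gl_apply_scal)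
    fix y
    show "A (x + y) = A x + A y"
      by (rule gl_coef_inject) (simp_all add: Ac Ar rooted0_add gl_coef_add gl_apply_add)
  qed
  then have "antipode_spec W (SOME A :: 'k gl \<Rightarrow> 'k gl. antipode_spec W A)" by (rule someI[where P = "antipode_spec W"])
  then show ?thesis unfolding gl_antipode_def antipode_spec_def .
qed

section \<open>The homomorphism\<close>

text \<open>The homomorphism in coordinates, with values in the ring of all functions; finiteness of
  support is settled afterwards.\<close>

definition tau :: "nat set \<Rightarrow> 'k::rat_algebra nsym \<Rightarrow> (nat rtree multiset, 'k) conv" where
  "tau W = (SOME \<phi>. alg_hom scal \<phi> \<and> (\<forall>m\<ge>1. \<phi> (Psi m) = fps_nth (graded_ser W chain_conv) m))"

lemma tau: "alg_hom scal (tau W :: 'k::rat_algebra nsym \<Rightarrow> _)"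
  and tau_Psi: "m \<ge> 1 \<Longrightarrow> tau W (Psi m :: 'k nsym) = fps_nth (graded_ser W chain_conv) m"
proof -
  have "alg_hom scal (tau W :: 'k nsym \<Rightarrow> _) \<and> (\<forall>m\<ge>1. tau W (Psi m :: 'k nsym) = fps_nth (graded_ser W chain_conv) m)"
    unfolding tau_def
    by (rule someI_ex[OF alg_hom_Psi_exists[OF central_scal, of "fps_nth (graded_ser W chain_conv)"]])
  then show "alg_hom scal (tau W :: 'k nsym \<Rightarrow> _)"
    "m \<ge> 1 \<Longrightarrow> tau W (Psi m :: 'k nsym) = fps_nth (graded_ser W chain_conv) m" by blast+
qed

lemmas tau_simps = alg_homD[OF tau]

lemma deriv_graded_all:
  assumes W: "0 \<notin> W"
  shows "fps_deriv (graded_ser W all_conv) = (graded_ser W all_conv :: (nat rtree multiset, 'k::comm_ring_1) conv fps) *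
      Abs_fps (\<lambda>n. fps_nth (graded_ser W chain_conv) (Suc n))"
    "fps_deriv (graded_ser W all_conv) = Abs_fps (\<lambda>n. fps_nth (graded_ser W child_conv) (Suc n)) * (graded_ser W all_conv :: (nat rtree multiset, 'k::comm_ring_1) conv fps)"
proof -
  let ?G = "graded_ser W all_conv :: (nat rtree multiset, 'k) conv fps"
  \<comment> \<open>Differentiation multiplies the part of weight n by n, so any function whose
    value is the total of the labels represents the derivative, up to a shift.\<close>
  have l: "fps_nth (fps_deriv ?G) n = fps_nth (graded_ser W c) (Suc n)"
    if "\<And>M. coef c M = of_nat (\<Sum>\<^sub># (labels M))" for n and c :: "(nat rtree multiset, 'k) conv"
  proof (rule conv_eqI)
    fix M
    have s: "of_nat k = (scal (of_nat k) :: (nat rtree multiset, 'k) conv)" for k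
      by (simp add: scal_simps)
    show "coef (fps_nth (fps_deriv ?G) n) M = coef (fps_nth (graded_ser W c) (Suc n)) M"
      unfolding fps_deriv_nth s coef_scal_times by (simp only: coef_graded_ser coef_all that Suc_eq_plus1) simp
  qed
  have 0: "fps_nth (graded_ser W c) 0 = 0" if "coef c {#} = 0" for c :: "(nat rtree multiset, 'k) conv"
    using that by (simp add: graded_ser_0[OF W] scal_simps)
  show "fps_deriv ?G = ?G * Abs_fps (\<lambda>n. fps_nth (graded_ser W chain_conv) (Suc n))"
  proof (rule fps_ext)
    fix n
    have "fps_nth (fps_deriv ?G) n = fps_nth (?G * graded_ser W chain_conv) (Suc n)"
      by (simp only: l[OF coef_all_times_chain] graded_ser_mult[symmetric])
    also have "\<dots> = (\<Sum>i=0..n. fps_nth ?G i * fps_nth (graded_ser W chain_conv) (Suc n - i))"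
      unfolding fps_mult_nth sum.atLeast0_atMost_Suc diff_self_eq_0 0[OF primitive_empty[OF primitive_chain]] by simp
    also have "\<dots> = fps_nth (?G * Abs_fps (\<lambda>n. fps_nth (graded_ser W chain_conv) (Suc n))) n"
      unfolding fps_mult_nth by (rule sum.cong) (auto simp: Suc_diff_le)
    finally show "fps_nth (fps_deriv ?G) n = fps_nth (?G * Abs_fps (\<lambda>n. fps_nth (graded_ser W chain_conv) (Suc n))) n" .
  qed
  show "fps_deriv ?G = Abs_fps (\<lambda>n. fps_nth (graded_ser W child_conv) (Suc n)) * ?G"
  proof (rule fps_ext)
    fix n
    have "fps_nth (fps_deriv ?G) n = fps_nth (graded_ser W child_conv * ?G) (Suc n)"
      by (simp only: l[OF coef_child_times_all] graded_ser_mult[symmetric])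
    also have "\<dots> = (\<Sum>i=0..n. fps_nth (graded_ser W child_conv) (Suc i) * fps_nth ?G (n - i))"
      unfolding fps_mult_nth sum.atLeast0_atMost_Suc_shift 0[OF primitive_empty[OF primitive_child]] by simp
    finally show "fps_nth (fps_deriv ?G) n = fps_nth (Abs_fps (\<lambda>n. fps_nth (graded_ser W child_conv) (Suc n)) * ?G) n"
      by (simp add: fps_mult_nth)
  qed
qed

lemma scal_of_nat_inverse:
  "n > 0 \<Longrightarrow> scal (rat_emb (1 / of_nat n)) * of_nat n = (1 :: ('c::coalg, 'k::rat_algebra) conv)"
  unfolding scal_simps(5)[symmetric] scal_simps(3)[symmetric]
  by (simp add: mult.commute of_nat_inverse scal_simps)

context
  fixes W :: "nat set"
  assumes W: "0 \<notin> W"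
begin

lemma graded_all_0: "fps_nth (graded_ser W all_conv) 0 = (1 :: (nat rtree multiset, 'k::comm_ring_1) conv)"
  by (simp add: graded_ser_0[OF W] scal_simps)

lemma tau_psi_ser: "coeffwise (tau W) (psi_ser :: 'k::rat_algebra nsym fps) = Abs_fps (\<lambda>n. fps_nth (graded_ser W chain_conv) (Suc n))"
  by (rule fps_ext) (simp add: psi_ser_nth tau_Psi)

lemma tau_sigma_ser: "coeffwise (tau W) (sigma_ser :: 'k::rat_algebra nsym fps) = graded_ser W all_conv"
proof (rule ode_unique)
  show "scal (rat_emb (1 / of_nat n)) * of_nat n = (1 :: (nat rtree multiset, 'k) conv)" if "n > 0" for n
    using that by (rule scal_of_nat_inverse)
  show "fps_deriv (coeffwise (tau W) (sigma_ser :: 'k nsym fps)) =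
      coeffwise (tau W) sigma_ser * Abs_fps (\<lambda>n. fps_nth (graded_ser W chain_conv) (Suc n))"
    unfolding coeffwise_deriv[OF tau, symmetric] deriv_sigma coeffwise_mult[OF tau] tau_psi_ser ..
  show "fps_deriv (graded_ser W all_conv :: (nat rtree multiset, 'k) conv fps) =
      graded_ser W all_conv * Abs_fps (\<lambda>n. fps_nth (graded_ser W chain_conv) (Suc n))"
    by (rule deriv_graded_all(1)[OF W])
  show "fps_nth (coeffwise (tau W) (sigma_ser :: 'k nsym fps)) 0 = fps_nth (graded_ser W all_conv) 0"
    by (simp add: graded_all_0 tau_simps)
qed

lemma tau_lam_neg_ser: "coeffwise (tau W) (lam_neg_ser :: 'k::rat_algebra nsym fps) = graded_ser W star_conv"
proof (rule inverse_unique_ring[symmetric])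
  show "graded_ser W star_conv * graded_ser W all_conv = (1 :: (nat rtree multiset, 'k) conv fps)"
    by (simp add: graded_ser_mult[symmetric] star_times_all graded_ser_1)
  show "graded_ser W all_conv * coeffwise (tau W) (lam_neg_ser :: 'k nsym fps) = 1"
    unfolding tau_sigma_ser[symmetric] coeffwise_mult[OF tau, symmetric] sigma_ser coeffwise_1[OF tau] ..
qed

lemma tau_xi_ser: "coeffwise (tau W) (xi_ser :: 'k::rat_algebra nsym fps) = Abs_fps (\<lambda>n. fps_nth (graded_ser W child_conv) (Suc n))"
proof -
  have "coeffwise (tau W) (xi_ser :: 'k nsym fps) = fps_deriv (graded_ser W all_conv) * coeffwise (tau W) lam_neg_ser"
    unfolding xi_ser_eq coeffwise_mult[OF tau] coeffwise_deriv[OF tau] tau_sigma_ser ..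
  also have "\<dots> = Abs_fps (\<lambda>n. fps_nth (graded_ser W child_conv) (Suc n)) *
      (coeffwise (tau W) (sigma_ser :: 'k nsym fps) * coeffwise (tau W) lam_neg_ser)"
    unfolding deriv_graded_all(2)[OF W] tau_sigma_ser mult.assoc ..
  also have "coeffwise (tau W) (sigma_ser :: 'k nsym fps) * coeffwise (tau W) lam_neg_ser = 1"
    unfolding coeffwise_mult[OF tau, symmetric] sigma_ser coeffwise_1[OF tau] ..
  finally show ?thesis by simp
qed

lemma tau_Phi_ser: "coeffwise (tau W) (Phi_ser :: 'k::rat_algebra nsym fps) = graded_ser W theta_conv"
proof -
  let ?a = "\<lambda>n. scal (rat_emb (1 / fact n)) :: (nat rtree multiset, 'k) conv"
  let ?G = "graded_ser W all_conv :: (nat rtree multiset, 'k) conv fps"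
  have "\<exists>!F. fps_nth F 0 = 0 \<and> Abs_fps ?a oo F = ?G"
    by (rule fps_compose_unique_root) (simp_all add: rat_emb_1 scal_simps graded_all_0)
  moreover have "fps_nth (coeffwise (tau W) (Phi_ser :: 'k nsym fps)) 0 = 0"
    by (simp add: Phi_ser tau_simps)
  moreover have "Abs_fps ?a oo coeffwise (tau W) (Phi_ser :: 'k nsym fps) = ?G"
  proof (rule fps_ext)
    fix n
    have "fps_nth (Abs_fps ?a oo coeffwise (tau W) (Phi_ser :: 'k nsym fps)) n =
        tau W (fps_nth (exp_ser (Phi_ser :: 'k nsym fps)) n)"
      by (simp add: exp_ser_def fps_compose_nth alg_hom_sum[OF tau] tau_simps coeffwise_power[OF tau, symmetric])
    also have "\<dots> = fps_nth (coeffwise (tau W) (sigma_ser :: 'k nsym fps)) n" by (simp add: Phi_ser)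
    finally show "fps_nth (Abs_fps ?a oo coeffwise (tau W) (Phi_ser :: 'k nsym fps)) n = fps_nth ?G n"
      by (simp only: tau_sigma_ser)
  qed
  moreover have "fps_nth (graded_ser W theta_conv) 0 = (0 :: (nat rtree multiset, 'k) conv)"
    by (simp add: graded_ser_0[OF W] primitive_empty[OF primitive_theta_conv] scal_simps)
  moreover have "Abs_fps ?a oo graded_ser W theta_conv = ?G"
  proof (rule fps_ext, rule conv_eqI)
    fix n and M :: "nat rtree multiset"
    have "coef (fps_nth (Abs_fps ?a oo graded_ser W theta_conv) n) M =
        (\<Sum>i=0..n. rat_emb (1 / fact i) * coef (fps_nth (graded_ser W (theta_conv ^ i)) n) M)"
      by (simp add: fps_compose_nth graded_ser_power)
    also have "\<dots> = coef (fps_nth ?G n) M"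
    proof (cases "set_mset (labels M) \<subseteq> W \<and> \<Sum>\<^sub># (labels M) = n")
      case True
      \<comment> \<open>Positive labels bound the number of vertices by the weight \<open>n\<close>,
        so the exponential sum up to \<open>n\<close> is already complete on
        \<open>M\<close>.\<close>
      then have "0 \<notin># labels M" using W by blast
      then have "size (labels M) \<le> n" using True size_le_sum_mset by blast
      then show ?thesis using True by (simp add: coef_graded_ser exp_theta_conv)
    next
      case False
      then show ?thesis by (simp only: coef_graded_ser if_False mult_zero_right sum.neutral_const)
    qed
    finally show "coef (fps_nth (Abs_fps ?a oo graded_ser W theta_conv) n) M = coef (fps_nth ?G n) M" .
  qed
  ultimately show ?thesis by blast
qed

section \<open>Homogeneity and finite support of the images\<close>

definition homog :: "nat \<Rightarrow> (nat rtree multiset, 'k::zero) conv \<Rightarrow> bool" where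
  "homog n c \<longleftrightarrow> (\<forall>M\<in>supp c. set_mset (labels M) \<subseteq> W \<and> \<Sum>\<^sub># (labels M) = n)"

lemma homog_graded_ser: "homog n (fps_nth (graded_ser W c) n)"
  by (auto simp: homog_def supp_def coef_graded_ser)

lemma homog_mult:
  assumes "homog m c" "homog n (d :: (nat rtree multiset, 'k::comm_ring_1) conv)"
  shows "homog (m + n) (c * d)"
  unfolding homog_def
proof
  fix M assume "M \<in> supp (c * d)"
  then have "(\<Sum>p\<in>#cop M. coef c (fst p) * coef d (snd p)) \<noteq> 0" by (simp add: supp_def coef_times)
  then obtain p where p: "p \<in># cop M" "coef c (fst p) * coef d (snd p) \<noteq> 0" by (rule sum_mset_not_0E)
  then have "fst p \<in> supp c" "snd p \<in> supp d" by (auto simp: supp_def)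
  then have "set_mset (labels (fst p)) \<subseteq> W \<and> \<Sum>\<^sub># (labels (fst p)) = m"
    "set_mset (labels (snd p)) \<subseteq> W \<and> \<Sum>\<^sub># (labels (snd p)) = n"
    using assms unfolding homog_def by blast+
  then show "set_mset (labels M) \<subseteq> W \<and> \<Sum>\<^sub># (labels M) = m + n"
    using labels_cop[OF p(1), symmetric] by simp
qed

lemma homog_finite: "homog n c \<Longrightarrow> finite (supp c)"
  by (rule finite_subset[OF _ finite_forests_weight[OF W, of n]]) (auto simp: homog_def)

lemma tau_Lam: "tau W (Lam m :: 'k::rat_algebra nsym) = scal ((-1) ^ m) * fps_nth (graded_ser W star_conv) m"
proof -
  have "Lam m = smult ((-1) ^ m) (fps_nth lam_neg_ser m :: 'k nsym)"
    by (simp add: lam_neg_nth minus_one_power_times flip: power_add)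
  then have "tau W (Lam m :: 'k nsym) = scal ((-1) ^ m) * fps_nth (coeffwise (tau W) (lam_neg_ser :: 'k nsym fps)) m"
    by (simp add: tau_simps)
  then show ?thesis by (simp only: tau_lam_neg_ser)
qed

text \<open>Homogeneity is what brings the values back into \<open>gl\<close>: only finitely many
  forests have labels in \<open>W\<close> and a given weight.\<close>

lemma homog_tau_word: "homog (word_weight w) (tau W (basis w :: 'k::rat_algebra nsym))"
proof -
  have "homog (word_weight (FWord l)) (tau W (basis (FWord l) :: 'k nsym))" for l
  proof (induction l)
    case Nil
    have "basis (FWord []) = (1 :: 'k nsym)" by (simp add: zero_fword_def[symmetric])
    then show ?case by (auto simp: tau_simps homog_def supp_def)
  next
    case (Cons n l)
    have e: "basis (FWord (n # l)) = Lam (Suc n) * (basis (FWord l) :: 'k nsym)"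
      by (simp add: Lam_def Poly_Mapping.mult_single)
    have "homog (Suc n) (tau W (Lam (Suc n) :: 'k nsym))"
      unfolding tau_Lam using homog_graded_ser supp_scal_times unfolding homog_def by blast
    from homog_mult[OF this Cons.IH] show ?case by (simp add: e tau_simps)
  qed
  then show ?thesis by (cases w) auto
qed

lemma tau_sum_words:
  "tau W (x :: 'k::rat_algebra nsym) = (\<Sum>w\<in>Poly_Mapping.keys x. scal (Poly_Mapping.lookup x w) * tau W (basis w))"
proof -
  have "x = (\<Sum>w\<in>Poly_Mapping.keys x. smult (Poly_Mapping.lookup x w) (basis w))"
    by (rule poly_mapping_eqI) (simp add: Poly_Mapping.lookup_single when_def in_keys_iff)
  then have "tau W x = tau W (\<Sum>w\<in>Poly_Mapping.keys x. smult (Poly_Mapping.lookup x w) (basis w))"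
    by (rule arg_cong)
  then show ?thesis by (simp only: alg_hom_sum[OF tau] tau_simps)
qed

lemma supp_tau: "M \<in> supp (tau W (x :: 'k::rat_algebra nsym)) \<Longrightarrow>
    \<exists>w\<in>Poly_Mapping.keys x. set_mset (labels M) \<subseteq> W \<and> \<Sum>\<^sub># (labels M) = word_weight w"
proof -
  assume "M \<in> supp (tau W x)"
  then have "M \<in> supp (\<Sum>w\<in>Poly_Mapping.keys x. scal (Poly_Mapping.lookup x w) * tau W (basis w))"
    by (subst (asm) tau_sum_words)
  from subsetD[OF supp_sum this] obtain w where w: "w \<in> Poly_Mapping.keys x"
    "M \<in> supp (scal (Poly_Mapping.lookup x w) * tau W (basis w))" by blast
  then have "M \<in> supp (tau W (basis w :: 'k nsym))" using supp_scal_times by blast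
  then show ?thesis using homog_tau_word[of w, where 'k = 'k] w(1) unfolding homog_def by blast
qed

lemma finite_supp_tau [simp]: "finite (supp (tau W (x :: 'k::rat_algebra nsym)))"
  by (subst tau_sum_words, rule finite_subset[OF supp_sum])
    (intro finite_UN_I finite_keys finite_subset[OF supp_scal_times homog_finite[OF homog_tau_word]])

definition TW_hom :: "'k::rat_algebra nsym \<Rightarrow> 'k gl" where
  "TW_hom x = to_gl (tau W x)"

lemma gl_coef_TW [simp]: "gl_coef (TW_hom x) = tau W x"
  and rooted0_TW [simp]: "rooted0 (TW_hom x)"
  by (simp_all add: TW_hom_def)

lemma TW_carrier: "TW_hom x \<in> gl_carrier W"
  using supp_tau unfolding gl_carrier_iff gl_coef_TW by fastforce

subsection \<open>Compatibility with the coproduct, the counit and the antipode\<close>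

definition conv_tensor :: "('a, 'k) conv \<Rightarrow> ('b, 'k) conv \<Rightarrow> ('a \<times> 'b, 'k::comm_ring_1) conv" where
  "conv_tensor c d = Conv (\<lambda>p. coef c (fst p) * coef d (snd p))"

definition conv_merge :: "('a rtree multiset, 'k) conv \<Rightarrow> ('a rtree multiset \<times> 'a rtree multiset, 'k::comm_ring_1) conv" where
  "conv_merge c = Conv (\<lambda>p. coef c (fst p + snd p))"

lemma conv_tensor_mult: "conv_tensor (c * c') (d * d') = conv_tensor c d * conv_tensor c' d'"
  by (rule conv_eqI)
    (simp add: conv_tensor_def coef_times sum_cop_prod sum_mset_distrib_right, simp add: sum_mset_distrib_left mult_ac)

lemma conv_tensor_1 [simp]: "conv_tensor 1 1 = 1"
  by (rule conv_eqI) (simp add: conv_tensor_def eps_prod_def)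

lemma conv_tensor_add: "conv_tensor (c + c') d = conv_tensor c d + conv_tensor c' d"
  "conv_tensor c (d + d') = conv_tensor c d + conv_tensor c d'"
  by (rule conv_eqI, simp add: conv_tensor_def algebra_simps)+

lemma conv_tensor_scal: "conv_tensor (scal a * c) (scal b * d) = scal (a * b) * conv_tensor c d"
  by (rule conv_eqI) (simp add: conv_tensor_def mult_ac)

lemma conv_tensor_0: "conv_tensor 0 d = 0" "conv_tensor c 0 = 0"
  by (rule conv_eqI, simp add: conv_tensor_def)+

definition tau2 :: "'k::rat_algebra nsym2 \<Rightarrow> (nat rtree multiset \<times> nat rtree multiset, 'k) conv" where
  "tau2 = lin_ext scal (\<lambda>(u, v). conv_tensor (tau W (basis u)) (tau W (basis v)))"

lemma tau_basis_add: "tau W (basis (u + v) :: 'k::rat_algebra nsym) = tau W (basis u) * tau W (basis v)"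
  using tau_simps(4)[of W "basis u :: 'k nsym" "basis v"] by (simp add: Poly_Mapping.mult_single)

lemma alg_hom_tau2: "alg_hom scal (tau2 :: 'k::rat_algebra nsym2 \<Rightarrow> _)"
  unfolding tau2_def
  by (rule alg_hom_lin_ext[OF central_scal])
    (simp_all add: zero_prod_def tau_simps split_def tau_basis_add conv_tensor_mult)

lemma tau_single: "tau W (Poly_Mapping.single u a :: 'k::rat_algebra nsym) = scal a * tau W (basis u)"
  using tau_simps(2)[of W a "basis u :: 'k nsym"] by simp

lemma tau2_tensor: "tau2 (tensor x y :: 'k::rat_algebra nsym2) = conv_tensor (tau W x) (tau W y)"
proof (induction x rule: poly_mapping_add_induct)
  case (add u a x)
  have "tau2 (tensor (Poly_Mapping.single u a) y) = conv_tensor (tau W (Poly_Mapping.single u a)) (tau W y)"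
  proof (induction y rule: poly_mapping_add_induct)
    case (add v b y)
    have "tau2 (Poly_Mapping.single (u, v) (a * b)) =
        conv_tensor (tau W (Poly_Mapping.single u a)) (tau W (Poly_Mapping.single v b))"
      unfolding tau2_def lin_ext_single[OF central_scal] prod.case
      by (subst (3 4) tau_single) (rule conv_tensor_scal[symmetric])
    then show ?case
      using add.IH by (simp add: tensor_add_right tensor_single alg_homD[OF alg_hom_tau2] tau_simps conv_tensor_add)
  qed (simp add: tau_simps conv_tensor_0 alg_homD[OF alg_hom_tau2])
  then show ?case
    using add.IH by (simp add: tensor_add_left alg_homD[OF alg_hom_tau2] tau_simps conv_tensor_add)
qed (simp add: tau_simps conv_tensor_0 alg_homD[OF alg_hom_tau2])

lemma primitive_graded:
  assumes "primitive c"
  shows "primitive (fps_nth (graded_ser W c) n)"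
  using assms unfolding primitive_def coef_graded_ser by auto

lemma conv_merge_primitive:
  assumes "primitive c"
  shows "conv_merge c = conv_tensor c 1 + conv_tensor 1 c"
  by (rule conv_eqI) (use assms in \<open>auto simp: conv_merge_def conv_tensor_def primitive_def\<close>)

text \<open>Multiplicativity is the bialgebra axiom of the tree algebra in coordinates; it holds
  because a cut of a disjoint union is a pair of cuts.\<close>

lemma alg_hom_merge: "alg_hom scal (\<lambda>x. conv_merge (tau W (x :: 'k::rat_algebra nsym)))"
  unfolding alg_hom_def tau_simps
proof (intro conjI allI)
  show "conv_merge (c + d) = conv_merge c + conv_merge (d :: (nat rtree multiset, 'k) conv)" for c d
    by (rule conv_eqI) (simp add: conv_merge_def)
  show "conv_merge (scal a * c) = scal a * conv_merge (c :: (nat rtree multiset, 'k) conv)" for a c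
    by (rule conv_eqI) (simp add: conv_merge_def)
  show "conv_merge 1 = (1 :: (nat rtree multiset \<times> nat rtree multiset, 'k) conv)"
    by (rule conv_eqI) (simp add: conv_merge_def eps_prod_def)
  show "conv_merge (c * d) = conv_merge c * conv_merge (d :: (nat rtree multiset, 'k) conv)" for c d
    by (rule conv_eqI) (simp add: conv_merge_def coef_times sum_cop_prod sum_cop_union)
qed

text \<open>Both sides are algebra homomorphisms, so they need only be compared on the \<Psi>'s,
  which are primitive on either side since the chain function lives on single trees.\<close>

lemma merge_tau: "conv_merge (tau W (x :: 'k::rat_algebra nsym)) = tau2 (nsym_comult x)"
proof (rule alg_hom_Psi_unique[OF alg_hom_merge])
  note D = nsym_comult(1)[where 'k = 'k, unfolded alg_hom_single_iff]
  show "alg_hom scal (\<lambda>x :: 'k nsym. tau2 (nsym_comult x))"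
    unfolding alg_hom_def using D by (simp add: alg_homD[OF alg_hom_tau2])
  show "conv_merge (tau W (Psi m :: 'k nsym)) = tau2 (nsym_comult (Psi m))" if "m \<ge> 1" for m
    using that by (simp add: nsym_comult(2) alg_homD[OF alg_hom_tau2] tau2_tensor tau_simps tau_Psi
        conv_merge_primitive[OF primitive_graded[OF primitive_chain]])
qed

lemma coef_lin_ext: "coef (lin_ext scal g z) y = (\<Sum>k\<in>Poly_Mapping.keys z. Poly_Mapping.lookup z k * coef (g k) y)"
  by (simp add: lin_ext_def)

lemma rooted00_tensor:
  assumes "rooted0 x" "rooted0 y"
  shows "rooted00 (tensor x y)"
  unfolding rooted00_def
proof (intro allI impI)
  fix p :: "nat rtree \<times> nat rtree" assume p: "root_label (fst p) \<noteq> 0 \<or> root_label (snd p) \<noteq> 0"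
  obtain T S where "p = (T, S)" by (cases p)
  moreover from this have "Poly_Mapping.lookup x T = 0 \<or> Poly_Mapping.lookup y S = 0"
    using assms p unfolding rooted0_def by auto
  ultimately show "Poly_Mapping.lookup (tensor x y) p = 0" by auto
qed

lemma TW_comult: "gl_comult (TW_hom x) = tensor_map TW_hom TW_hom (nsym_comult (x :: 'k::rat_algebra nsym))"
proof (rule gl2_coef_inject)
  let ?z = "nsym_comult x"
  show "rooted00 (gl_comult (TW_hom x))" by (rule rooted00_comult)
  show "rooted00 (tensor_map TW_hom TW_hom ?z)"
    unfolding tensor_map_def split_def
    by (intro rooted00_sum rooted00_smult rooted00_tensor rooted0_TW)
  show "gl2_coef (gl_comult (TW_hom x)) = gl2_coef (tensor_map TW_hom TW_hom ?z)"
  proof (intro ext)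
    fix M N
    have "gl2_coef (gl_comult (TW_hom x)) M N = coef (conv_merge (tau W x)) (M, N)"
      by (simp add: gl2_coef_comult conv_merge_def)
    also have "\<dots> = (\<Sum>k\<in>Poly_Mapping.keys ?z. Poly_Mapping.lookup ?z k *
        (coef (tau W (basis (fst k))) M * coef (tau W (basis (snd k))) N))"
      by (simp add: merge_tau tau2_def coef_lin_ext split_def conv_tensor_def)
    also have "\<dots> = gl2_coef (tensor_map TW_hom TW_hom ?z) M N"
      by (simp add: gl2_coef_def tensor_map_def split_def sum_distrib_left coef_gl_coef mult_ac
          flip: gl_coef_TW)
    finally show "gl2_coef (gl_comult (TW_hom x)) M N = gl2_coef (tensor_map TW_hom TW_hom ?z) M N" .
  qed
qed

lemma coef_tau_empty: "coef (tau W x) {#} = nsym_counit (x :: 'k::rat_algebra nsym)"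
proof (rule alg_hom_Psi_unique)
  show "alg_hom (\<lambda>c. c) (\<lambda>x. coef (tau W (x :: 'k nsym)) {#})"
    unfolding alg_hom_def tau_simps
  proof (intro conjI allI)
    show "coef (c * d) {#} = coef c {#} * coef (d :: (nat rtree multiset, 'k) conv) {#}" for c d
      by (simp add: coef_times)
  qed simp_all
  show "alg_hom (\<lambda>c. c) (nsym_counit :: 'k nsym \<Rightarrow> 'k)" by (rule nsym_counit)
  show "coef (tau W (Psi m :: 'k nsym)) {#} = nsym_counit (Psi m :: 'k nsym)" if "m \<ge> 1" for m
    using that by (simp add: nsym_counit tau_Psi primitive_empty[OF primitive_graded[OF primitive_chain]])
qed

lemma TW_counit: "gl_counit (TW_hom x) = nsym_counit x"
  by (simp add: gl_counit_eq coef_tau_empty)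

subsubsection \<open>The antipode\<close>

text \<open>The word is multiplied out in reverse order: a new letter stands on the right, where it
  becomes adjacent to its antipode and can cancel against it.\<close>

primrec Psi_word :: "nat list \<Rightarrow> 'k::rat_algebra nsym" where
  "Psi_word [] = 1"
| "Psi_word (m # w) = Psi_word w * Psi m"

text \<open>The splittings of a word into complementary subwords, as in the coproduct of a product
  of primitive elements. The order of the list puts the splitting with empty first part at the
  head.\<close>

primrec unshuffles :: "'a list \<Rightarrow> ('a list \<times> 'a list) list" where
  "unshuffles [] = [([], [])]"
| "unshuffles (m # w) = map (\<lambda>p. (fst p, m # snd p)) (unshuffles w) @ map (\<lambda>p. (m # fst p, snd p)) (unshuffles w)"

lemma unshuffles_Cons: "\<exists>ps. unshuffles w = ([], w) # ps \<and> (\<forall>p\<in>set ps. length (snd p) < length w)"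
proof (induction w)
  case (Cons m w)
  then obtain ps where "unshuffles w = ([], w) # ps" "\<forall>p\<in>set ps. length (snd p) < length w" by blast
  then show ?case by (intro exI[of _ "map (\<lambda>p. (fst p, m # snd p)) ps @ map (\<lambda>p. (m # fst p, snd p)) (([], w) # ps)"]) auto
qed simp

lemma comult_Psi_word:
  assumes "\<forall>m\<in>set w. m \<ge> 1"
  shows "nsym_comult (Psi_word w :: 'k::rat_algebra nsym) =
    (\<Sum>p\<leftarrow>unshuffles w. tensor (Psi_word (fst p)) (Psi_word (snd p)))"
  using assms
proof (induction w)
  case Nil
  show ?case using alg_homD(3)[OF nsym_comult(1)[where 'k = 'k]] by simp
next
  case (Cons m w)
  have "nsym_comult (Psi_word (m # w) :: 'k nsym) =
      (\<Sum>p\<leftarrow>unshuffles w. tensor (Psi_word (fst p)) (Psi_word (snd p))) * (tensor (Psi m) 1 + tensor 1 (Psi m))"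
    using Cons by (simp add: alg_homD[OF nsym_comult(1)] nsym_comult(2))
  also have "\<dots> = (\<Sum>p\<leftarrow>unshuffles w. tensor (Psi_word (m # fst p)) (Psi_word (snd p)) + tensor (Psi_word (fst p)) (Psi_word (m # snd p)))"
    by (simp add: sum_list_mult_const[symmetric] distrib_left tensor_mult sum_list_addf)
  finally show ?case by (simp add: sum_list_addf o_def add.commute)
qed

lemma counit_Psi_word:
  "w \<noteq> [] \<Longrightarrow> \<forall>m\<in>set w. m \<ge> 1 \<Longrightarrow> nsym_counit (Psi_word w :: 'k::rat_algebra nsym) = 0"
  by (cases w) (simp_all add: alg_homD[OF nsym_counit(1)] nsym_counit(2))

text \<open>The antipode of \<open>gl\<close> is available only as a linear convolution inverse, so
  compatibility is checked on a linear spanning set and not on algebra generators.\<close>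

inductive Psi_span :: "'k::rat_algebra nsym \<Rightarrow> bool" where
  zero: "Psi_span 0"
| add: "Psi_span x \<Longrightarrow> \<forall>m\<in>set w. m \<ge> 1 \<Longrightarrow> Psi_span (smult c (Psi_word w) + x)"

lemma Psi_span_add: "Psi_span x \<Longrightarrow> Psi_span y \<Longrightarrow> Psi_span (x + y)"
  by (induction rule: Psi_span.induct) (simp_all add: add.assoc Psi_span.add)

lemma Psi_span_smult: "Psi_span x \<Longrightarrow> Psi_span (smult c x)"
  by (induction rule: Psi_span.induct) (simp_all add: smult_add Psi_span.zero Psi_span.add)

lemma Psi_span_word: "\<forall>m\<in>set w. m \<ge> 1 \<Longrightarrow> Psi_span (Psi_word w)"
  using Psi_span.add[OF Psi_span.zero, of w 1] by simp

lemma Psi_word_append: "Psi_word (v @ w) = Psi_word w * Psi_word v"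
  by (induction v) (simp_all add: mult.assoc)

lemma Psi_span_mult: "Psi_span x \<Longrightarrow> Psi_span y \<Longrightarrow> Psi_span (x * y)"
proof (induction arbitrary: y rule: Psi_span.induct)
  case (add x w c)
  from add.prems have "Psi_span (Psi_word w * y)"
  proof (induction rule: Psi_span.induct)
    case (add z v d)
    have "Psi_span (smult d (Psi_word (v @ w)))"
      using add.hyps \<open>\<forall>m\<in>set w. m \<ge> 1\<close> by (intro Psi_span_smult Psi_span_word) auto
    then show ?case using add.IH by (simp add: distrib_left times_smult Psi_word_append Psi_span_add)
  qed (simp add: Psi_span.zero)
  then show ?case
    using add by (simp add: distrib_right smult_times Psi_span_add Psi_span_smult)
qed (simp add: Psi_span.zero)

lemma Psi_span_all: "Psi_span x"
proof (induction x rule: nsym_Psi_induct)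
  show "Psi_span 1" using Psi_span_word[of "[]"] by simp
  show "Psi_span (Psi m)" if "m \<ge> 1" for m using Psi_span_word[of "[m]"] that by simp
qed (simp_all add: Psi_span_add Psi_span_smult Psi_span_mult)

section \<open>Comparison of the two antipodes\<close>

definition antipode_coef :: "'k::rat_algebra nsym \<Rightarrow> (nat rtree multiset, 'k) conv" where
  "antipode_coef x = gl_coef (gl_antipode W (TW_hom x))"

lemma TW_add: "TW_hom (x + y) = TW_hom x + TW_hom y"
  by (rule gl_coef_inject) (simp_all add: rooted0_add gl_coef_add tau_simps)

lemma TW_smult: "TW_hom (smult c x) = smult c (TW_hom x)"
  by (rule gl_coef_inject) (simp_all add: rooted0_smult gl_coef_smult tau_simps)

lemma TW_one: "TW_hom 1 = gl_one"
  by (rule gl_coef_inject) (simp_all add: tau_simps)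

lemma TW_mult: "TW_hom (x * y) = gl_mult (TW_hom x) (TW_hom y)"
  by (rule gl_coef_inject) (simp_all add: rooted0_mult gl_coef_mult tau_simps)

lemmas antipode_props = antipode_exists[of W, unfolded antipode_spec_def]

lemma antipode_coef_linear:
  "antipode_coef (x + y) = antipode_coef x + (antipode_coef y :: (nat rtree multiset, 'k::rat_algebra) conv)"
  "antipode_coef (smult c x) = scal c * (antipode_coef x :: (nat rtree multiset, 'k) conv)"
proof -
  note P = antipode_props[where 'k = 'k] and C = TW_carrier[of "_ :: 'k nsym"]
  have "gl_antipode W (TW_hom x + TW_hom y) = gl_antipode W (TW_hom x) + gl_antipode W (TW_hom y :: 'k gl)"
    using P C by blast
  then show "antipode_coef (x + y) = antipode_coef x + (antipode_coef y :: (nat rtree multiset, 'k) conv)"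
    by (simp add: antipode_coef_def TW_add gl_coef_add)
  have "gl_antipode W (smult c (TW_hom x)) = smult c (gl_antipode W (TW_hom x :: 'k gl))"
    using P C by blast
  then show "antipode_coef (smult c x) = scal c * (antipode_coef x :: (nat rtree multiset, 'k) conv)"
    by (simp add: antipode_coef_def TW_smult gl_coef_smult)
qed

lemma antipode_coef_0: "antipode_coef (0 :: 'k::rat_algebra nsym) = 0"
  using antipode_coef_linear(1)[of 0 "0 :: 'k nsym"] by simp

text \<open>Multiplication after \<open>id \<otimes> S\<close>, in coordinates, with
  \<open>S\<close> the antipode of the tree algebra.\<close>

definition conv_antipode :: "'k::rat_algebra gl2 \<Rightarrow> (nat rtree multiset, 'k) conv" where
  "conv_antipode = lin_ext scal (\<lambda>(T, S). gl_coef (basis T) * gl_coef (gl_antipode W (basis S)))"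

lemma basis_carrier: "T \<in> Tbar W \<Longrightarrow> basis T \<in> gl_carrier W"
  by (simp add: gl_carrier_def)

lemma gl_carrier_0 [simp]: "0 \<in> gl_carrier W"
  by (simp add: gl_carrier_def)

lemma gl_carrier_closed:
  "x \<in> gl_carrier W \<Longrightarrow> y \<in> gl_carrier W \<Longrightarrow> x + y \<in> gl_carrier W"
  "x \<in> gl_carrier W \<Longrightarrow> smult c x \<in> gl_carrier W"
  unfolding gl_carrier_def using Poly_Mapping.keys_add[of x y] keys_smult[of c x] by blast+

text \<open>\<open>gl_antipode\<close> is known to be linear only on the carrier, so every step of
  the expansion in basis trees records membership there.\<close>

lemma gl_carrier_expand:
  assumes x: "x \<in> (gl_carrier W :: 'k::rat_algebra gl set)"
    and add: "\<And>x y. x \<in> gl_carrier W \<Longrightarrow> y \<in> gl_carrier W \<Longrightarrow> P x \<Longrightarrow> P y \<Longrightarrow> P (x + y)"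
    and smult: "\<And>c x. x \<in> gl_carrier W \<Longrightarrow> P x \<Longrightarrow> P (smult c x)"
    and zero: "P 0" and basis: "\<And>T. T \<in> Tbar W \<Longrightarrow> P (basis T)"
  shows "P x"
proof -
  have "P (\<Sum>T\<in>A. smult (Poly_Mapping.lookup x T) (basis T)) \<and>
      (\<Sum>T\<in>A. smult (Poly_Mapping.lookup x T) (basis T)) \<in> gl_carrier W" if "finite A" "A \<subseteq> Tbar W" for A
    using that
  proof (induction A rule: finite_induct)
    case (insert T A)
    then have T: "T \<in> Tbar W" by simp
    have 1: "smult (Poly_Mapping.lookup x T) (basis T) \<in> gl_carrier W" "P (smult (Poly_Mapping.lookup x T) (basis T))"
      using gl_carrier_closed(2)[OF basis_carrier[OF T]] smult[OF basis_carrier[OF T] basis[OF T]] by blast+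
    have 2: "P (\<Sum>T\<in>A. smult (Poly_Mapping.lookup x T) (basis T))"
        "(\<Sum>T\<in>A. smult (Poly_Mapping.lookup x T) (basis T)) \<in> gl_carrier W"
      using insert.IH insert.prems by auto
    show ?case
      unfolding sum.insert[OF insert.hyps]
      using add[OF 1(1) 2(2) 1(2) 2(1)] gl_carrier_closed(1)[OF 1(1) 2(2)] by blast
  qed (simp add: zero)
  moreover have "(\<Sum>T\<in>Poly_Mapping.keys x. smult (Poly_Mapping.lookup x T) (basis T)) = x"
    by (rule poly_mapping_eqI) (simp add: Poly_Mapping.lookup_single when_def in_keys_iff)
  ultimately show ?thesis using x unfolding gl_carrier_def by (metis (no_types, lifting) finite_keys mem_Collect_eq)
qed

lemma lin_ext_smult:
  assumes "central s"
  shows "lin_ext s g (smult a x) = s a * lin_ext s g x"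
  by (induction x rule: poly_mapping_add_induct)
    (simp_all add: smult_add lin_ext_add[OF assms] lin_ext_single[OF assms] central_simps[OF assms] distrib_left mult.assoc)

lemma tensor_smult: "tensor (smult c x) y = smult c (tensor x y)" "tensor x (smult c y) = smult c (tensor x y)"
  by (rule poly_mapping_eqI, simp add: split_paired_all mult_ac)+

lemma conv_antipode_tensor:
  assumes x: "x \<in> gl_carrier W" and y: "y \<in> (gl_carrier W :: 'k::rat_algebra gl set)"
  shows "conv_antipode (tensor x y) = gl_coef x * gl_coef (gl_antipode W y)"
  using x
proof (rule gl_carrier_expand)
  note L = lin_ext_add[OF central_scal] lin_ext_smult[OF central_scal]
  note P = antipode_props[where 'k = 'k]
  show "conv_antipode (tensor (x + x') y) = gl_coef (x + x') * gl_coef (gl_antipode W y)"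
    if "conv_antipode (tensor x y) = gl_coef x * gl_coef (gl_antipode W y)"
      "conv_antipode (tensor x' y) = gl_coef x' * gl_coef (gl_antipode W y)" for x x' :: "'k gl"
    using that by (simp add: conv_antipode_def tensor_add_left L gl_coef_add distrib_right)
  show "conv_antipode (tensor (smult c x) y) = gl_coef (smult c x) * gl_coef (gl_antipode W y)"
    if "conv_antipode (tensor x y) = gl_coef x * gl_coef (gl_antipode W y)" for c and x :: "'k gl"
    using that by (simp add: conv_antipode_def tensor_smult L gl_coef_smult mult.assoc)
  show "conv_antipode (tensor 0 y) = gl_coef 0 * gl_coef (gl_antipode W y)"
    by (simp add: conv_antipode_def)
  fix T assume T: "T \<in> Tbar W"
  show "conv_antipode (tensor (basis T) y) = gl_coef (basis T) * gl_coef (gl_antipode W y)"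
    using y
  proof (rule gl_carrier_expand)
    show "conv_antipode (tensor (basis T) (y + y')) = gl_coef (basis T) * gl_coef (gl_antipode W (y + y'))"
      if "y \<in> gl_carrier W" "y' \<in> gl_carrier W"
        "conv_antipode (tensor (basis T) y) = gl_coef (basis T) * gl_coef (gl_antipode W y)"
        "conv_antipode (tensor (basis T) y') = gl_coef (basis T) * gl_coef (gl_antipode W y')" for y y' :: "'k gl"
      using that P by (simp add: conv_antipode_def tensor_add_right L gl_coef_add distrib_left)
    show "conv_antipode (tensor (basis T) (smult c y)) = gl_coef (basis T) * gl_coef (gl_antipode W (smult c y))"
      if "y \<in> gl_carrier W" "conv_antipode (tensor (basis T) y) = gl_coef (basis T) * gl_coef (gl_antipode W y)"
      for c and y :: "'k gl"
    proof -
      have "gl_antipode W (smult c y) = smult c (gl_antipode W y)" using that P by blast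
      moreover have "gl_coef (basis T) * (scal c * gl_coef (gl_antipode W y)) =
          scal c * (gl_coef (basis T) * gl_coef (gl_antipode W y))"
        by (metis central_commute[OF central_scal] mult.assoc)
      ultimately show ?thesis using that by (simp add: conv_antipode_def tensor_smult L gl_coef_smult)
    qed
    have "gl_antipode W (smult 0 0) = smult 0 (gl_antipode W (0 :: 'k gl))" using P gl_carrier_0 by blast
    then show "conv_antipode (tensor (basis T) 0) = gl_coef (basis T) * gl_coef (gl_antipode W (0 :: 'k gl))"
      by (simp add: conv_antipode_def)
    show "conv_antipode (tensor (basis T) (basis S)) = gl_coef (basis T) * gl_coef (gl_antipode W (basis S :: 'k gl))" for S
      by (simp add: conv_antipode_def tensor_single lin_ext_single[OF central_scal] scal_simps)
  qed
qed

lemma conv_antipode_tensor_map: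
  "conv_antipode (tensor_map TW_hom TW_hom z) =
    lin_ext scal (\<lambda>(u, v). tau W (basis u) * antipode_coef (basis v)) (z :: 'k::rat_algebra nsym2)"
proof -
  have sum: "conv_antipode (sum f A) = (\<Sum>i\<in>A. conv_antipode (f i))" for f :: "nat fword \<times> nat fword \<Rightarrow> 'k gl2" and A
    by (induction A rule: infinite_finite_induct) (simp_all add: conv_antipode_def lin_ext_add[OF central_scal])
  have sm: "conv_antipode (smult c y) = scal c * conv_antipode y" for c and y :: "'k gl2"
    by (simp add: conv_antipode_def lin_ext_smult[OF central_scal])
  show ?thesis
    by (simp add: tensor_map_def split_def sum sm conv_antipode_tensor[OF TW_carrier TW_carrier] lin_ext_def antipode_coef_def)
qed

lemma lin_ext_tensor_antipode:
  fixes Y :: "'k::rat_algebra nsym \<Rightarrow> (nat rtree multiset, 'k) conv"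
  assumes Y: "\<And>x y. Y (x + y) = Y x + Y y" "\<And>c x. Y (smult c x) = scal c * Y x"
  shows "lin_ext scal (\<lambda>(u, v). tau W (basis u) * Y (basis v)) (tensor x y) = tau W x * Y y"
proof (induction x rule: poly_mapping_add_induct)
  case zero
  show ?case by (simp add: tau_simps)
next
  case (add u a x)
  note L = lin_ext_add[OF central_scal]
  have Y0: "Y 0 = 0" using Y(1)[of 0 0] by simp
  have "lin_ext scal (\<lambda>(u, v). tau W (basis u) * Y (basis v)) (tensor (Poly_Mapping.single u a) y) =
      tau W (Poly_Mapping.single u a) * Y y"
  proof (induction y rule: poly_mapping_add_induct)
    case (add v b y)
    have Yv: "Y (Poly_Mapping.single v b) = scal b * Y (basis v)" using Y(2)[of b "basis v"] by simp
    have "scal (a * b) * (tau W (basis u) * Y (basis v)) = (scal a * tau W (basis u)) * (scal b * Y (basis v))"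
      using central_shuffle[OF central_scal, of 1 a "tau W (basis u)" b "Y (basis v)"] by (simp add: scal_simps)
    then show ?case
      using add.IH by (simp add: tensor_add_right L tensor_single lin_ext_single[OF central_scal] Y(1) distrib_left
          tau_single[of u a] Yv)
  qed (simp add: Y0)
  then show ?case using add.IH by (simp add: tensor_add_left L tau_simps distrib_right)
qed

text \<open>Uniqueness of convolution inverses, carried out on words. Whether the antipode is
  applied before or after the homomorphism, summing \<open>tau\<close> of the first part times the
  candidate at the second part over all splittings of \<open>w\<close> gives the counit. The
  splitting with empty first part isolates the value at \<open>w\<close>; all others have a shorter
  second part.\<close>

lemma antipode_coef_Psi_word:
  assumes "\<forall>m\<in>set w. m \<ge> 1"
  shows "antipode_coef (Psi_word w :: 'k::rat_algebra nsym) = tau W (nsym_antipode (Psi_word w))"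
  using assms
proof (induction "length w" arbitrary: w rule: less_induct)
  case less
  let ?Y = "antipode_coef :: 'k nsym \<Rightarrow> _" and ?Z = "\<lambda>x :: 'k nsym. tau W (nsym_antipode x)"
  let ?P = "Psi_word :: nat list \<Rightarrow> 'k nsym"
  let ?c = "scal (nsym_counit (?P w)) :: (nat rtree multiset, 'k) conv"
  have Z: "?Z (x + y) = ?Z x + ?Z y" "?Z (smult c x) = scal c * ?Z x" for x y c
    by (simp_all add: nsym_antipode tau_simps)
  have sumL: "lin_ext scal g (\<Sum>p\<leftarrow>ps. f p) = (\<Sum>p\<leftarrow>ps. lin_ext scal g (f p))"
    for g :: "nat fword \<times> nat fword \<Rightarrow> (nat rtree multiset, 'k) conv" and f :: "nat list \<times> nat list \<Rightarrow> 'k nsym2" and ps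
    by (induction ps) (simp_all add: lin_ext_add[OF central_scal])
  have "(\<Sum>p\<leftarrow>unshuffles w. tau W (?P (fst p)) * ?Y (?P (snd p))) =
      lin_ext scal (\<lambda>(u, v). tau W (basis u) * ?Y (basis v)) (nsym_comult (?P w))"
    unfolding comult_Psi_word[OF less.prems] sumL lin_ext_tensor_antipode[of ?Y, OF antipode_coef_linear] ..
  also have "\<dots> = conv_antipode (gl_comult (TW_hom (?P w)))"
    by (simp only: TW_comult conv_antipode_tensor_map)
  also have "\<dots> = gl_coef (gl_convolution id (gl_antipode W) (TW_hom (?P w)))"
  proof -
    have "gl_coef (smult (Poly_Mapping.lookup (gl_comult (TW_hom (?P w))) p)
          (gl_mult (id (basis (fst p))) (gl_antipode W (basis (snd p))))) =
        scal (Poly_Mapping.lookup (gl_comult (TW_hom (?P w))) p) *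
          (gl_coef (basis (fst p)) * gl_coef (gl_antipode W (basis (snd p))))"
      if p: "p \<in> Poly_Mapping.keys (gl_comult (TW_hom (?P w)))" for p
    proof -
      have "Poly_Mapping.lookup (gl_comult (TW_hom (?P w))) p \<noteq> 0" using p by (simp add: in_keys_iff)
      \<comment> \<open>Lying in the support of the coproduct places both components in
        \<open>Tbar W\<close>. Membership is required because the properties of
        \<open>gl_antipode W\<close>, among them the root labels needed for
        \<open>gl_coef_mult\<close>, are known on the carrier.\<close>
      then have "\<exists>L\<in>supp (gl_coef (TW_hom (?P w))). L = branches (fst p) + branches (snd p) \<and>
          root_label (fst p) = 0 \<and> root_label (snd p) = 0"
      proof -
        assume nz: "Poly_Mapping.lookup (gl_comult (TW_hom (?P w))) p \<noteq> 0"
        then have r: "root_label (fst p) = 0 \<and> root_label (snd p) = 0"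
          using rooted00_comult[of "TW_hom (?P w)"] unfolding rooted00_def by metis
        then have e: "(Node 0 (branches (fst p)), Node 0 (branches (snd p))) = p"
          by (metis prod.collapse rtree.collapse)
        have "coef (gl_coef (TW_hom (?P w))) (branches (fst p) + branches (snd p)) \<noteq> 0"
        proof
          assume "coef (gl_coef (TW_hom (?P w))) (branches (fst p) + branches (snd p)) = 0"
          then have "of_nat (forest_sym (branches (fst p)) * forest_sym (branches (snd p))) *
              Poly_Mapping.lookup (gl_comult (TW_hom (?P w))) p =
              of_nat (forest_sym (branches (fst p)) * forest_sym (branches (snd p))) * 0"
            using gl2_coef_comult[of "TW_hom (?P w)" "branches (fst p)" "branches (snd p)"]
            unfolding gl2_coef_def e by simp
          then have "Poly_Mapping.lookup (gl_comult (TW_hom (?P w))) p = 0"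
            by (rule of_nat_cancel[rotated]) simp
          then show False using nz by simp
        qed
        then show ?thesis using r by (auto simp: supp_def)
      qed
      then have S: "snd p \<in> Tbar W" and T: "fst p \<in> Tbar W"
        using TW_carrier[of "?P w"] unfolding gl_carrier_iff Tbar_eq by fastforce+
      have "rooted0 (gl_antipode W (basis (snd p) :: 'k gl))" "rooted0 (basis (fst p) :: 'k gl)"
        using antipode_props[where 'k = 'k] basis_carrier[OF S] basis_carrier[OF T] gl_carrier_iff by blast+
      then show ?thesis by (simp add: gl_coef_smult gl_coef_mult)
    qed
    then show ?thesis
      by (simp add: conv_antipode_def lin_ext_def gl_convolution_def split_def gl_coef_sum)
  qed
  also have "\<dots> = ?c"
    using antipode_props[where 'k = 'k] TW_carrier[of "?P w"]
    by (simp add: gl_coef_smult TW_counit)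
  finally have YP: "(\<Sum>p\<leftarrow>unshuffles w. tau W (?P (fst p)) * ?Y (?P (snd p))) = ?c" .
  have ZP: "(\<Sum>p\<leftarrow>unshuffles w. tau W (?P (fst p)) * ?Z (?P (snd p))) = ?c"
  proof (cases w)
    case Nil
    then show ?thesis by (simp add: tau_simps nsym_antipode alg_homD[OF nsym_counit(1)] scal_simps)
  next
    case (Cons m v)
    then have m: "m \<ge> 1" using less.prems by simp
    have "(\<Sum>p\<leftarrow>unshuffles w. tau W (?P (fst p)) * ?Z (?P (snd p))) =
        (\<Sum>p\<leftarrow>unshuffles v. tau W (?P (fst p)) * ?Z (?P (snd p) * Psi m) + tau W (?P (fst p) * Psi m) * ?Z (?P (snd p)))"
      by (simp add: Cons sum_list_addf o_def)
    \<comment> \<open>The letter \<open>m\<close> goes to the second or to the first part. In the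
      former case the antipode moves it, with a minus sign, to the front of its factor, which is
      exactly where it stands in the latter case; the two terms cancel.\<close>
    also have "\<dots> = (\<Sum>p\<leftarrow>unshuffles v. 0)"
      by (intro arg_cong[where f = sum_list] map_cong refl)
        (simp add: nsym_antipode(4) nsym_antipode(5)[OF m] tau_simps mult.assoc)
    also have "\<dots> = ?c" using counit_Psi_word[of w, where 'k = 'k] Cons less.prems by (simp add: scal_simps)
    finally show ?thesis .
  qed
  obtain ps where ps: "unshuffles w = ([], w) # ps" "\<forall>p\<in>set ps. length (snd p) < length w"
    using unshuffles_Cons by blast
  have sub: "set (fst p) \<union> set (snd p) \<subseteq> set u" if "p \<in> set (unshuffles u)" for p and u :: "nat list"
    using that by (induction u arbitrary: p) fastforce+
  have E: "(\<Sum>p\<leftarrow>ps. tau W (?P (fst p)) * ?Y (?P (snd p))) = (\<Sum>p\<leftarrow>ps. tau W (?P (fst p)) * ?Z (?P (snd p)))"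
  proof (intro arg_cong[where f = sum_list] map_cong refl)
    fix p assume p: "p \<in> set ps"
    then have "\<forall>m\<in>set (snd p). m \<ge> 1" using sub[of p w] ps(1) less.prems by auto
    then show "tau W (?P (fst p)) * ?Y (?P (snd p)) = tau W (?P (fst p)) * ?Z (?P (snd p))"
      using less.hyps[of "snd p"] ps(2) p by simp
  qed
  have "?Y (?P w) + (\<Sum>p\<leftarrow>ps. tau W (?P (fst p)) * ?Z (?P (snd p))) = ?c"
    using YP by (simp only: ps(1) list.map sum_list.Cons fst_conv snd_conv Psi_word.simps tau_simps(3) mult_1_left E)
  moreover have "?Z (?P w) + (\<Sum>p\<leftarrow>ps. tau W (?P (fst p)) * ?Z (?P (snd p))) = ?c"
    using ZP by (simp only: ps(1) list.map sum_list.Cons fst_conv snd_conv Psi_word.simps tau_simps(3) mult_1_left)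
  ultimately have "?Y (?P w) + (\<Sum>p\<leftarrow>ps. tau W (?P (fst p)) * ?Z (?P (snd p))) =
      ?Z (?P w) + (\<Sum>p\<leftarrow>ps. tau W (?P (fst p)) * ?Z (?P (snd p)))" by (rule trans[OF _ sym])
  then show ?case by (rule add_right_imp_eq)
qed

lemma TW_antipode: "TW_hom (nsym_antipode x) = gl_antipode W (TW_hom (x :: 'k::rat_algebra nsym))"
proof (rule gl_coef_inject)
  show "rooted0 (gl_antipode W (TW_hom x))"
    using antipode_props[where 'k = 'k] TW_carrier[of x] gl_carrier_iff by blast
  have "antipode_coef x = tau W (nsym_antipode x)"
    using Psi_span_all[of x]
  proof (induction rule: Psi_span.induct)
    case zero
    have "nsym_antipode (0 :: 'k nsym) = 0" using nsym_antipode(1)[of 0 "0 :: 'k nsym"] by simp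
    then show ?case by (simp add: antipode_coef_0 tau_simps)
  next
    case (add x w c)
    then show ?case
      by (simp add: antipode_coef_linear nsym_antipode tau_simps antipode_coef_Psi_word)
  qed
  then show "gl_coef (TW_hom (nsym_antipode x)) = gl_coef (gl_antipode W (TW_hom x))"
    by (simp add: antipode_coef_def)
qed simp

lemma TW_grade: "x \<in> nsym_grade n \<Longrightarrow> TW_hom x \<in> gl_grade W n"
  unfolding gl_grade_iff gl_coef_TW
proof (intro conjI ballI rooted0_TW)
  fix M assume x: "x \<in> nsym_grade n" and M: "M \<in> supp (tau W x)"
  then obtain w where "w \<in> Poly_Mapping.keys x" "set_mset (labels M) \<subseteq> W \<and> \<Sum>\<^sub># (labels M) = word_weight w"
    using supp_tau by blast
  then show "set_mset (labels M) \<subseteq> W" "\<Sum>\<^sub># (labels M) = n"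
    using x unfolding nsym_grade_def by auto
qed

lemma TW_graded_hopf_hom: "graded_hopf_hom W (TW_hom :: 'k::rat_algebra nsym \<Rightarrow> _)"
  unfolding graded_hopf_hom_def
  using TW_carrier TW_add TW_smult TW_one TW_mult TW_comult TW_counit TW_antipode TW_grade by blast

subsection \<open>The tuple \<open>\<Omega>\<close>\<close>

text \<open>In coordinates the symmetry factors cancel and only \<open>c\<close> remains. Finiteness
  enters because a sum over an infinite set is 0 by convention.\<close>

lemma tree_series_nth:
  assumes A: "A \<subseteq> Tbar W" and fin: "finite {T \<in> A. d T = n}" and x: "rooted0 x"
    and c: "\<And>M. coef (gl_coef x) M = (if Node 0 M \<in> A \<and> d (Node 0 M) = n then c (Node 0 M) else 0)"
  shows "x = fps_nth (tree_series A d c) n"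
proof (rule gl_coef_inject[OF x])
  have r: "rooted0 (smult a (VT T) :: 'a gl)" if "T \<in> A" for T a
  proof -
    have "root_label T = 0" using that A by (auto simp: Tbar_eq)
    then show ?thesis by (auto simp: VT_def rooted0_def Poly_Mapping.lookup_single when_def)
  qed
  show "rooted0 (fps_nth (tree_series A d c) n)"
    unfolding tree_series_def fps_nth_Abs_fps by (rule rooted0_sum) (use r in auto)
  show "gl_coef x = gl_coef (fps_nth (tree_series A d c) n)"
  proof (rule conv_eqI)
    fix M
    have "coef (gl_coef (fps_nth (tree_series A d c) n)) M =
        (\<Sum>T\<in>{T \<in> A. d T = n}. if T = Node 0 M then c (Node 0 M) else 0)"
      unfolding tree_series_def fps_nth_Abs_fps gl_coef_sum coef_sum
    proof (rule sum.cong)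
      fix T
      have "of_nat (forest_sym M) * (a * rat_emb (1 / of_nat (forest_sym M))) = a" for a :: 'a
        using of_nat_inverse[of "forest_sym M", where 'k = 'a] by (simp add: mult.left_commute)
      then show "coef (gl_coef (smult (c T) (VT T))) M = (if T = Node 0 M then c (Node 0 M) else 0)"
        by (auto simp: VT_def coef_gl_coef num_auts_eq Poly_Mapping.lookup_single when_def)
    qed simp
    also have "\<dots> = (if Node 0 M \<in> A \<and> d (Node 0 M) = n then c (Node 0 M) else 0)"
      using fin by simp
    finally show "coef (gl_coef x) M = coef (gl_coef (fps_nth (tree_series A d c) n)) M" by (simp add: c)
  qed
qed

lemma Node_in_Sbar: "Node 0 M \<in> Sbar W \<longleftrightarrow> set_mset (labels M) \<subseteq> W \<and> (\<forall>t\<in>#M. branches t = {#})"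
proof -
  have "(\<forall>p\<in>verts (Node 0 M). length p \<le> 1) \<longleftrightarrow> (\<forall>t\<in>#M. branches t = {#})"
  proof
    assume L: "\<forall>p\<in>verts (Node 0 M). length p \<le> 1"
    show "\<forall>t\<in>#M. branches t = {#}"
    proof (intro ballI, rule ccontr)
      fix t assume t: "t \<in># M" "branches t \<noteq> {#}"
      then obtain s where "s \<in># branches t" by blast
      then have "[(t, 0), (s, 0)] \<in> verts (Node 0 M)" using t by (simp add: Cons_in_verts)
      then show False using L by fastforce
    qed
  next
    assume B: "\<forall>t\<in>#M. branches t = {#}"
    show "\<forall>p\<in>verts (Node 0 M). length p \<le> 1"
    proof
      fix p assume p: "p \<in> verts (Node 0 M)"
      show "length p \<le> 1"
      proof (cases p)
        case (Cons c q)
        then have c: "snd c < count M (fst c)" "q \<in> verts (fst c)" using p by (simp_all add: Cons_in_verts)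
        then have "branches (fst c) = {#}" using B by (metis count_inI less_nat_zero_code)
        then have "q = []" using c(2) by (cases q) (simp_all add: Cons_in_verts)
        then show ?thesis using Cons by simp
      qed simp
    qed
  qed
  then show ?thesis by (simp add: Sbar_def)
qed

lemma Node_in_Hbar: "Node 0 M \<in> Hbar W \<longleftrightarrow> set_mset (labels M) \<subseteq> W \<and> M \<noteq> {#} \<and> card (leaves (Node 0 M)) = 1"
  by (auto simp: Hbar_def Bplus_def)

lemma Node_in_Pbar: "Node 0 M \<in> Pbar W \<longleftrightarrow> set_mset (labels M) \<subseteq> W \<and> size M = 1"
  by (simp add: Pbar_def root_degree_eq)

text \<open>Excludes weight 0, at which the truncated subtraction in the exponents of t would go
  wrong.\<close>

lemma pos_weight: "set_mset (labels M) \<subseteq> W \<Longrightarrow> M \<noteq> {#} \<Longrightarrow> \<Sum>\<^sub># (labels M) \<ge> 1"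
proof -
  assume "set_mset (labels M) \<subseteq> W" "M \<noteq> {#}"
  then have "0 \<notin># labels M" "labels M \<noteq> {#}" using W by auto
  then show ?thesis using size_le_sum_mset[of "labels M"] by (metis One_nat_def Suc_leI le_trans nonempty_has_size)
qed

lemma finite_weight_subset: "A \<subseteq> Tbar W \<Longrightarrow> (\<And>T. T \<in> A \<Longrightarrow> P T \<Longrightarrow> weight T \<le> n) \<Longrightarrow> finite {T \<in> A. P T}"
  by (rule finite_subset[OF _ finite_Tbar_weight[OF W, of n]]) auto

lemma finite_weight_eq: "A \<subseteq> Tbar W \<Longrightarrow> finite {T \<in> A. weight T = n}"
  by (rule finite_weight_subset[where n = n]) auto

lemma sub_Tbar: "Sbar W \<subseteq> Tbar W" "Hbar W \<subseteq> Tbar W" "Pbar W \<subseteq> Tbar W"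
  by (auto simp: Sbar_def Hbar_def Pbar_def)

lemma TW_Omega: "coeffwise5 TW_hom (Pi_sys :: 'k::rat_algebra nsym series5) = Omega W"
proof -
  have lam: "coeffwise TW_hom (lam_ser :: 'k nsym fps) = tree_series (Sbar W) weight (\<lambda>T. (-1) ^ (root_degree T + weight T))"
  proof (rule fps_ext)
    fix n
    show "fps_nth (coeffwise TW_hom (lam_ser :: 'k nsym fps)) n =
        fps_nth (tree_series (Sbar W) weight (\<lambda>T. (-1) ^ (root_degree T + weight T))) n"
      unfolding coeffwise_nth
    proof (rule tree_series_nth)
      fix M
      show "coef (gl_coef (TW_hom (fps_nth lam_ser n :: 'k nsym))) M =
          (if Node 0 M \<in> Sbar W \<and> weight (Node 0 M) = n then (- 1) ^ (root_degree (Node 0 M) + weight (Node 0 M)) else 0)"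
        by (auto simp: lam_ser_def tau_Lam coef_graded_ser Node_in_Sbar star_conv_def root_degree_eq power_add mult.commute)
    qed (simp_all add: finite_weight_eq sub_Tbar)
  qed
  have sigma: "coeffwise TW_hom (sigma_ser :: 'k nsym fps) = tree_series (Tbar W) weight (\<lambda>T. 1)"
  proof (rule fps_ext)
    fix n
    have t: "tau W (fps_nth (sigma_ser :: 'k nsym fps) n) = fps_nth (graded_ser W all_conv) n"
      by (simp only: tau_sigma_ser[symmetric] coeffwise_nth)
    show "fps_nth (coeffwise TW_hom (sigma_ser :: 'k nsym fps)) n = fps_nth (tree_series (Tbar W) weight (\<lambda>T. 1)) n"
      unfolding coeffwise_nth
      by (rule tree_series_nth) (auto simp: finite_weight_eq t coef_graded_ser)
  qed
  have Phi: "coeffwise TW_hom (Phi_ser :: 'k nsym fps) = tree_series (Pbar W) weight (\<lambda>T. rat_emb (theta T))"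
  proof (rule fps_ext)
    fix n
    have t: "tau W (fps_nth (Phi_ser :: 'k nsym fps) n) = fps_nth (graded_ser W theta_conv) n"
      by (simp only: tau_Phi_ser[symmetric] coeffwise_nth)
    have z: "rat_emb (theta (Node 0 M)) = (0 :: 'k)" if "size M \<noteq> 1" for M :: "nat rtree multiset"
      using that by (simp add: theta_Node coef_prim_size)
    show "fps_nth (coeffwise TW_hom (Phi_ser :: 'k nsym fps)) n =
        fps_nth (tree_series (Pbar W) weight (\<lambda>T. rat_emb (theta T))) n"
      unfolding coeffwise_nth
    proof (rule tree_series_nth)
      fix M
      show "coef (gl_coef (TW_hom (fps_nth Phi_ser n :: 'k nsym))) M =
          (if Node 0 M \<in> Pbar W \<and> weight (Node 0 M) = n then rat_emb (theta (Node 0 M)) else 0)"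
        using z[of M] by (auto simp: t coef_graded_ser Node_in_Pbar coef_theta_conv[where a = 0])
    qed (simp_all add: finite_weight_eq sub_Tbar)
  qed
  have psi: "coeffwise TW_hom (psi_ser :: 'k nsym fps) = tree_series (Hbar W) (\<lambda>T. weight T - 1) (\<lambda>T. of_nat (leaf_label T))"
  proof (rule fps_ext)
    fix n
    have t: "tau W (fps_nth (psi_ser :: 'k nsym fps) n) = fps_nth (graded_ser W chain_conv) (Suc n)"
      by (simp add: psi_ser_nth tau_Psi)
    show "fps_nth (coeffwise TW_hom (psi_ser :: 'k nsym fps)) n =
        fps_nth (tree_series (Hbar W) (\<lambda>T. weight T - 1) (\<lambda>T. of_nat (leaf_label T))) n"
      unfolding coeffwise_nth
    proof (rule tree_series_nth)
      show "finite {T \<in> Hbar W. weight T - 1 = n}" by (rule finite_weight_subset[where n = "Suc n"]) (simp_all add: sub_Tbar)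
      fix M
      have "\<Sum>\<^sub># (labels M) = Suc n \<longleftrightarrow> \<Sum>\<^sub># (labels M) - 1 = n" if "set_mset (labels M) \<subseteq> W" "M \<noteq> {#}"
        using pos_weight[OF that] by linarith
      then show "coef (gl_coef (TW_hom (fps_nth psi_ser n :: 'k nsym))) M =
          (if Node 0 M \<in> Hbar W \<and> weight (Node 0 M) - 1 = n then of_nat (leaf_label (Node 0 M)) else 0)"
        by (auto simp: t coef_graded_ser Node_in_Hbar chain_conv_def chain_label_eq[where a = 0])
    qed (simp_all add: sub_Tbar)
  qed
  have xi: "coeffwise TW_hom (xi_ser :: 'k nsym fps) = tree_series (Pbar W) (\<lambda>T. weight T - 1) (\<lambda>T. of_nat (child_label T))"
  proof (rule fps_ext)
    fix n
    have t: "tau W (fps_nth (xi_ser :: 'k nsym fps) n) = fps_nth (graded_ser W child_conv) (Suc n)"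
      using arg_cong[OF tau_xi_ser[where 'k = 'k], of "\<lambda>F. fps_nth F n"] by simp
    show "fps_nth (coeffwise TW_hom (xi_ser :: 'k nsym fps)) n =
        fps_nth (tree_series (Pbar W) (\<lambda>T. weight T - 1) (\<lambda>T. of_nat (child_label T))) n"
      unfolding coeffwise_nth
    proof (rule tree_series_nth)
      show "finite {T \<in> Pbar W. weight T - 1 = n}" by (rule finite_weight_subset[where n = "Suc n"]) (simp_all add: sub_Tbar)
      fix M
      have "\<Sum>\<^sub># (labels M) = Suc n \<longleftrightarrow> \<Sum>\<^sub># (labels M) - 1 = n" if "set_mset (labels M) \<subseteq> W" "size M = 1"
      proof -
        have "M \<noteq> {#}" using that(2) by auto
        then show ?thesis using pos_weight[OF that(1)] by linarith
      qed
      then show "coef (gl_coef (TW_hom (fps_nth xi_ser n :: 'k nsym))) M =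
          (if Node 0 M \<in> Pbar W \<and> weight (Node 0 M) - 1 = n then of_nat (child_label (Node 0 M)) else 0)"
        by (auto simp: t coef_graded_ser Node_in_Pbar child_conv_def child_label_eq[where a = 0])
    qed (simp_all add: sub_Tbar)
  qed
  show ?thesis
    by (simp add: coeffwise5_def Pi_sys_def Omega_def lam sigma Phi psi xi)
qed

end

theorem theorem4p6:
  fixes W :: "nat set"
  assumes "W \<noteq> {}" and "0 \<notin> W"
  shows "(\<exists>!\<T> :: 'k::rat_algebra nsym \<Rightarrow> 'k gl.
            graded_hopf_hom W \<T> \<and> coeffwise5 \<T> Pi_sys = Omega W) \<and>
         (\<forall>\<T> :: 'k nsym \<Rightarrow> 'k gl.
            graded_hopf_hom W \<T> \<and> coeffwise5 \<T> Pi_sys = Omega W \<longrightarrow>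
            (\<forall>m\<ge>1.
               \<T> (Lam m) = (\<Sum>T | T \<in> Sbar W \<and> weight T = m.
                              smult ((-1) ^ (root_degree T + weight T)) (VT T)) \<and>
               \<T> (Sfun m) = (\<Sum>T | T \<in> Tbar W \<and> weight T = m. VT T) \<and>
               \<T> (Psi m) = (\<Sum>T | T \<in> Hbar W \<and> weight T = m.
                              smult (of_nat (leaf_label T)) (VT T)) \<and>
               \<T> (Phi m) = smult (of_nat m) (\<Sum>T | T \<in> Pbar W \<and> weight T = m.
                              smult (rat_emb (theta T)) (VT T)) \<and>
               \<T> (Xi m) = (\<Sum>T | T \<in> Pbar W \<and> weight T = m.
                              smult (of_nat (child_label T)) (VT T))))"
proof (intro conjI allI impI)
  note W = \<open>0 \<notin> W\<close>
  have lam: "\<T> (Lam m) = fps_nth (tree_series (Sbar W) weight (\<lambda>T. (-1) ^ (root_degree T + weight T))) m"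
    if "coeffwise5 \<T> (Pi_sys :: 'k nsym series5) = Omega W" for \<T> :: "'k nsym \<Rightarrow> 'k gl" and m
  proof -
    have "coeffwise \<T> (lam_ser :: 'k nsym fps) = tree_series (Sbar W) weight (\<lambda>T. (-1) ^ (root_degree T + weight T))"
      using that by (simp add: coeffwise5_def Pi_sys_def Omega_def)
    from arg_cong[OF this, of "\<lambda>F. fps_nth F m"] show ?thesis by (simp add: lam_ser_def)
  qed
  show "\<exists>!\<T> :: 'k nsym \<Rightarrow> 'k gl. graded_hopf_hom W \<T> \<and> coeffwise5 \<T> Pi_sys = Omega W"
  proof (rule ex1I)
    show "graded_hopf_hom W (TW_hom W :: 'k nsym \<Rightarrow> 'k gl) \<and> coeffwise5 (TW_hom W) (Pi_sys :: 'k nsym series5) = Omega W"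
      using TW_graded_hopf_hom[OF W] TW_Omega[OF W] by blast
    fix \<T> :: "'k nsym \<Rightarrow> 'k gl"
    assume T: "graded_hopf_hom W \<T> \<and> coeffwise5 \<T> Pi_sys = Omega W"
    show "\<T> = TW_hom W"
    proof
      fix x
      note h1 = T[THEN conjunct1, unfolded graded_hopf_hom_def]
      note h2 = TW_graded_hopf_hom[OF W, where 'k = 'k, unfolded graded_hopf_hom_def]
      \<comment> \<open>The first component of the tuple prescribes the images of the \<Lambda>'s,
        which generate the algebra.\<close>
      show "\<T> x = TW_hom W x"
      proof (induction x rule: nsym_Lam_induct)
        fix m show "\<T> (Lam m) = TW_hom W (Lam m)"
          using lam[of \<T> m] lam[of "TW_hom W" m] T TW_Omega[OF W, where 'k = 'k] by simp
      qed (use h1 h2 in simp_all)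
    qed
  qed
  fix \<T> :: "'k nsym \<Rightarrow> 'k gl" and m :: nat
  assume T: "graded_hopf_hom W \<T> \<and> coeffwise5 \<T> Pi_sys = Omega W" and m: "1 \<le> m"
  note h = T[THEN conjunct1, unfolded graded_hopf_hom_def]
  have O: "coeffwise \<T> (sigma_ser :: 'k nsym fps) = tree_series (Tbar W) weight (\<lambda>T. 1)"
    "coeffwise \<T> (Phi_ser :: 'k nsym fps) = tree_series (Pbar W) weight (\<lambda>T. rat_emb (theta T))"
    "coeffwise \<T> (psi_ser :: 'k nsym fps) = tree_series (Hbar W) (\<lambda>T. weight T - 1) (\<lambda>T. of_nat (leaf_label T))"
    "coeffwise \<T> (xi_ser :: 'k nsym fps) = tree_series (Pbar W) (\<lambda>T. weight T - 1) (\<lambda>T. of_nat (child_label T))"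
    using T by (simp_all add: coeffwise5_def Pi_sys_def Omega_def)
  have pos: "weight T \<ge> 1" if "T \<in> Hbar W \<union> Pbar W" for T
  proof -
    have TT: "T \<in> Tbar W" using that sub_Tbar[OF W] by blast
    obtain a M where aM: "T = Node a M" by (cases T)
    then have a: "a = 0" "set_mset (labels M) \<subseteq> W" using TT by simp_all
    have "M \<noteq> {#}" using that by (auto simp: aM a(1) Node_in_Hbar[OF W] Node_in_Pbar[OF W])
    then show ?thesis using pos_weight[OF W a(2)] by (simp add: aM a(1))
  qed
  \<comment> \<open>Truncated subtraction identifies the weights 0 and 1; \<open>pos\<close> and
    \<open>m\<close> excludes the former on both sides of the equation.\<close>
  have e: "{T. T \<in> A \<and> weight T - 1 = m - 1} = {T. T \<in> A \<and> weight T = m}" if "A \<subseteq> Hbar W \<union> Pbar W" for A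
    using that pos m by fastforce
  show "\<T> (Lam m) = (\<Sum>T | T \<in> Sbar W \<and> weight T = m. smult ((-1) ^ (root_degree T + weight T)) (VT T))"
    using lam[of \<T> m] T by (simp add: tree_series_def)
  show "\<T> (Sfun m) = (\<Sum>T | T \<in> Tbar W \<and> weight T = m. VT T)"
    using arg_cong[OF O(1), of "\<lambda>F. fps_nth F m"] by (simp add: tree_series_def Sfun_def)
  show "\<T> (Psi m) = (\<Sum>T | T \<in> Hbar W \<and> weight T = m. smult (of_nat (leaf_label T)) (VT T))"
    using arg_cong[OF O(3), of "\<lambda>F. fps_nth F (m - 1)"] e[of "Hbar W"] by (simp add: tree_series_def Psi_def)
  \<comment> \<open>The factor \<open>m\<close> comes from the normalisation of \<Phi>(t), whose
    coefficient is \<Phi>_m / m.\<close>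
  show "\<T> (Phi m) = smult (of_nat m) (\<Sum>T | T \<in> Pbar W \<and> weight T = m. smult (rat_emb (theta T)) (VT T))"
    using arg_cong[OF O(2), of "\<lambda>F. fps_nth F m"] h by (simp add: tree_series_def Phi_def of_nat_smult)
  show "\<T> (Xi m) = (\<Sum>T | T \<in> Pbar W \<and> weight T = m. smult (of_nat (child_label T)) (VT T))"
    using arg_cong[OF O(4), of "\<lambda>F. fps_nth F (m - 1)"] e[of "Pbar W"] by (simp add: tree_series_def Xi_def)
qed

end
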